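(* Let $B=A[[t;\sigma,\delta]]$ be a skew power series ring over the pseudocompact ring $A$. For any pseudocompact $B$-module $M$, there exists an exact sequence of pseudocompact $B$-modules $$0\to B^\sigma\hat{\otimes}_A M\xrightarrow{\kappa} B\hat{\otimes}_A M\xrightarrow{\mu} M\to 0$$ with $$\kappa(b\hat{\otimes} m)=bt\hat{\otimes} m-b\hat{\otimes} tm,\qquad \mu(b\hat{\otimes} m)=bm.$$
   Context: Rings are associative with identity; $R^{\mathrm{op}}$ is the opposite ring; modules are left unitary. Let $A$ be a topological ring. A topological $A$-module is pro-discrete if it is the limit of a filtered (inverse) system of discrete $A$-modules, and pseudocompact if these discrete modules can moreover be taken of finite length. A topological $A$-$B$-bimodule is pseudocompact if it is pseudocompact both as $A$-module and as $B^{\mathrm{op}}$-module. A topological ring $A$ is left pseudocompact if it is pseudocompact as a left $A$-module, and pseudocompact if it is pseudocompact as an $A$-$A$-bimodule. For a topological module $M$, $\mathcal{U}_M$ is the directed set of open submodules. For a pro-discrete $A^{\mathrm{op}}$-module $M$ and a pro-discrete $A$-module $N$ the completed tensor product is $$M\hat{\otimes}_A N=\varprojlim_{U\in\mathcal{U}_M}\varprojlim_{V\in\mathcal{U}_N}M/U\otimes_A N/V,$$ where each $M/U\otimes_A N/V$ is discrete; $m\hat\otimes n$ is the image of $(m,n)$. Skew power series rings. Let $A$ be a pseudocompact ring with a continuous ring automorphism $\sigma$ and a topologically nilpotent $\sigma$-derivation $\delta$, i.e. a continuous map $\delta\colon A\to A$ with $\delta(ab)=\sigma(a)\delta(b)+\delta(a)b$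 for all $a,b\in A$ and such that for each open ideal $I$ of $A$ there is a positive integer $n$ with $\delta^n(A)\subset I$. A (left) skew power series ring $B=A[[t;\sigma,\delta]]$ over $A$ is a left pseudocompact ring $B$ with an element $t\in B$ such that: (i) $B$ contains $A$ as a closed subring; (ii) $B$ is pseudocompact as $A^{\mathrm{op}}$-module; (iii) as topological $A$-module, $B$ is topologically freely generated by the powers of $t$: $B=\prod_{n=0}^\infty At^n$; (iv) $ta=\sigma(a)t+\delta(a)$ for all $a\in A$. $B^\sigma$ denotes the pseudocompact $B$-$A$-bimodule which is $B$ as left $B$-module, with $A^{\mathrm{op}}$-structure $a\cdot b=b\sigma(a)$ for $a\in A^{\mathrm{op}}$, $b\in B$. *)

theory Defs
  imports
    "HOL-Analysis.Analysis"
    "HOL-Algebra.Algebra"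
begin

section \<open>Rings, modules and bimodules\<close>

definition op_ring :: "('r, 'z) ring_scheme \<Rightarrow> ('r, 'z) ring_scheme" where
  "op_ring R = R\<lparr>mult := \<lambda>x y. y \<otimes>\<^bsub>R\<^esub> x\<rparr>"

text \<open>The library locale \<^locale>\<open>module\<close> is restricted to commutative rings, whereas
  \<^locale>\<open>submodule\<close> is not. The components \<^const>\<open>mult\<close> and \<^const>\<open>one\<close> of a module record
  are irrelevant. A right \<open>R\<close>-module is a left module over \<^term>\<open>op_ring R\<close>.\<close>

locale left_module = R?: ring R + M?: abelian_group M
  for R :: "('r, 'z) ring_scheme" (structure) and M :: "('r, 'm, 'y) module_scheme" (structure) +
  assumes lsmult_closed: "a \<in> carrier R \<Longrightarrow> x \<in> carrier M \<Longrightarrow> a \<odot>\<^bsub>M\<^esub> x \<in> carrier M"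
    and lsmult_l_distr: "a \<in> carrier R \<Longrightarrow> b \<in> carrier R \<Longrightarrow> x \<in> carrier M \<Longrightarrow>
      (a \<oplus>\<^bsub>R\<^esub> b) \<odot>\<^bsub>M\<^esub> x = a \<odot>\<^bsub>M\<^esub> x \<oplus>\<^bsub>M\<^esub> b \<odot>\<^bsub>M\<^esub> x"
    and lsmult_r_distr: "a \<in> carrier R \<Longrightarrow> x \<in> carrier M \<Longrightarrow> y \<in> carrier M \<Longrightarrow>
      a \<odot>\<^bsub>M\<^esub> (x \<oplus>\<^bsub>M\<^esub> y) = a \<odot>\<^bsub>M\<^esub> x \<oplus>\<^bsub>M\<^esub> a \<odot>\<^bsub>M\<^esub> y"
    and lsmult_assoc: "a \<in> carrier R \<Longrightarrow> b \<in> carrier R \<Longrightarrow> x \<in> carrier M \<Longrightarrow>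
      (a \<otimes>\<^bsub>R\<^esub> b) \<odot>\<^bsub>M\<^esub> x = a \<odot>\<^bsub>M\<^esub> (b \<odot>\<^bsub>M\<^esub> x)"
    and lsmult_one: "x \<in> carrier M \<Longrightarrow> \<one>\<^bsub>R\<^esub> \<odot>\<^bsub>M\<^esub> x = x"

definition module_homs ::
  "('r, 'z) ring_scheme \<Rightarrow> ('r, 'm, 'y) module_scheme \<Rightarrow> ('r, 'n, 'w) module_scheme \<Rightarrow> ('m \<Rightarrow> 'n) set"
where
  "module_homs R M N = {f \<in> hom (add_monoid M) (add_monoid N).
     \<forall>r\<in>carrier R. \<forall>x\<in>carrier M. f (r \<odot>\<^bsub>M\<^esub> x) = r \<odot>\<^bsub>N\<^esub> f x}"

text \<open>For additive \<open>f\<close> with \<open>f(U') \<subseteq> U\<close> and a coset \<open>C = U' + x\<close> this is the coset \<open>U + f x\<close> in \<open>M\<close>,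
  i.e. the value at \<open>C\<close> of the map induced by \<open>f\<close> on quotients.\<close>

definition coset_map :: "('m, 'z) ring_scheme \<Rightarrow> 'm set \<Rightarrow> ('k \<Rightarrow> 'm) \<Rightarrow> 'k set \<Rightarrow> 'm set" where
  "coset_map M U f C = (\<Union>x\<in>C. U +>\<^bsub>M\<^esub> f x)"

definition quot_module :: "('r, 'm, 'y) module_scheme \<Rightarrow> 'm set \<Rightarrow> ('r, 'm set) module" where
  "quot_module M U =
    \<lparr>carrier = a_rcosets\<^bsub>M\<^esub> U, mult = undefined, one = undefined,
     ring.zero = U, add = set_add M,
     smult = \<lambda>r. coset_map M U (\<lambda>x. r \<odot>\<^bsub>M\<^esub> x)\<rparr>"

definition finite_length :: "('r, 'z) ring_scheme \<Rightarrow> ('r, 'm, 'y) module_scheme \<Rightarrow> bool" where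
  "finite_length R M \<longleftrightarrow>
    (\<exists>(C :: nat \<Rightarrow> 'm set) n. C 0 = {\<zero>\<^bsub>M\<^esub>} \<and> C n = carrier M \<and>
       (\<forall>i\<le>n. submodule (C i) R M) \<and>
       (\<forall>i<n. C i \<subset> C (Suc i) \<and> \<not> (\<exists>K. submodule K R M \<and> C i \<subset> K \<and> K \<subset> C (Suc i))))"

record ('r, 's, 'm) bimodule = "('r, 'm) module" +
  rsmult :: "'m \<Rightarrow> 's \<Rightarrow> 'm"

definition right_module :: "('r, 's, 'm, 'y) bimodule_scheme \<Rightarrow> ('s, 'm) module" where
  "right_module P =
    \<lparr>carrier = carrier P, mult = mult P, one = one P, ring.zero = ring.zero P, add = add P,
     smult = \<lambda>s x. rsmult P x s\<rparr>"

text \<open>The ring \<open>B\<close> as a left module over itself, with right action \<open>b \<cdot> a = b \<rho>(a)\<close>.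
  The regular bimodule is the case \<open>\<rho> = id\<close>.\<close>

definition twisted_bimodule :: "('b, 'z) ring_scheme \<Rightarrow> ('s \<Rightarrow> 'b) \<Rightarrow> ('b, 's, 'b) bimodule" where
  "twisted_bimodule B \<rho> =
    \<lparr>carrier = carrier B, mult = mult B, one = one B, ring.zero = ring.zero B, add = add B,
     smult = mult B, rsmult = \<lambda>b s. b \<otimes>\<^bsub>B\<^esub> \<rho> s\<rparr>"

abbreviation regular_bimodule :: "('b, 'z) ring_scheme \<Rightarrow> ('b, 'b, 'b) bimodule" where
  "regular_bimodule B \<equiv> twisted_bimodule B (\<lambda>b. b)"


section \<open>Topological rings and modules\<close>

definition topological_abelian_group :: "('m, 'z) ring_scheme \<Rightarrow> 'm topology \<Rightarrow> bool" where
  "topological_abelian_group G T \<longleftrightarrow>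
     abelian_group G \<and> topspace T = carrier G \<and>
     continuous_map (prod_topology T T) T (\<lambda>(x, y). x \<oplus>\<^bsub>G\<^esub> y) \<and>
     continuous_map T T (\<lambda>x. \<ominus>\<^bsub>G\<^esub> x)"

definition topological_ring :: "('r, 'z) ring_scheme \<Rightarrow> 'r topology \<Rightarrow> bool" where
  "topological_ring R T \<longleftrightarrow>
     ring R \<and> topological_abelian_group R T \<and>
     continuous_map (prod_topology T T) T (\<lambda>(x, y). x \<otimes>\<^bsub>R\<^esub> y)"

definition topological_module ::
  "('r, 'z) ring_scheme \<Rightarrow> 'r topology \<Rightarrow> ('r, 'm, 'y) module_scheme \<Rightarrow> 'm topology \<Rightarrow> bool"
where
  "topological_module R TR M TM \<longleftrightarrow>
     topological_ring R TR \<and> left_module R M \<and> topological_abelian_group M TM \<and>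
     continuous_map (prod_topology TR TM) TM (\<lambda>(r, x). r \<odot>\<^bsub>M\<^esub> x)"

definition open_submodules ::
  "('r, 'z) ring_scheme \<Rightarrow> ('r, 'm, 'y) module_scheme \<Rightarrow> 'm topology \<Rightarrow> 'm set set"
where
  "open_submodules R M TM = {U. submodule U R M \<and> openin TM U}"


section \<open>Inverse limits, pro-discrete and pseudocompact modules\<close>

text \<open>If \<open>leq i j\<close> then \<open>f i j\<close> is the transition map from the \<open>j\<close>-th to the \<open>i\<close>-th object.\<close>

definition inv_lim ::
  "'i set \<Rightarrow> ('i \<Rightarrow> 'i \<Rightarrow> bool) \<Rightarrow> ('i \<Rightarrow> 'x topology) \<Rightarrow> ('i \<Rightarrow> 'i \<Rightarrow> 'x \<Rightarrow> 'x) \<Rightarrow> ('i \<Rightarrow> 'x) topology"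
where
  "inv_lim I leq T f =
     subtopology (product_topology T I) {x. \<forall>i\<in>I. \<forall>j\<in>I. leq i j \<longrightarrow> f i j (x j) = x i}"

definition directed_on :: "'i set \<Rightarrow> ('i \<Rightarrow> 'i \<Rightarrow> bool) \<Rightarrow> bool" where
  "directed_on I leq \<longleftrightarrow>
     I \<noteq> {} \<and> (\<forall>i\<in>I. leq i i) \<and>
     (\<forall>i\<in>I. \<forall>j\<in>I. \<forall>k\<in>I. leq i j \<longrightarrow> leq j k \<longrightarrow> leq i k) \<and>
     (\<forall>i\<in>I. \<forall>j\<in>I. \<exists>k\<in>I. leq i k \<and> leq j k)"

definition discrete_system ::
  "('r, 'z) ring_scheme \<Rightarrow> 'r topology \<Rightarrow> 'i set \<Rightarrow> ('i \<Rightarrow> 'i \<Rightarrow> bool) \<Rightarrow>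
   ('i \<Rightarrow> ('r, 'x, 'y) module_scheme) \<Rightarrow> ('i \<Rightarrow> 'i \<Rightarrow> 'x \<Rightarrow> 'x) \<Rightarrow> bool"
where
  "discrete_system R TR I leq N f \<longleftrightarrow>
     directed_on I leq \<and>
     (\<forall>i\<in>I. topological_module R TR (N i) (discrete_topology (carrier (N i)))) \<and>
     (\<forall>i\<in>I. \<forall>j\<in>I. leq i j \<longrightarrow> f i j \<in> module_homs R (N j) (N i)) \<and>
     (\<forall>i\<in>I. \<forall>x\<in>carrier (N i). f i i x = x) \<and>
     (\<forall>i\<in>I. \<forall>j\<in>I. \<forall>k\<in>I. leq i j \<longrightarrow> leq j k \<longrightarrow>
        (\<forall>x\<in>carrier (N k). f i j (f j k x) = f i k x))"

definition is_discrete_limit ::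
  "('r, 'z) ring_scheme \<Rightarrow> ('r, 'm, 'w) module_scheme \<Rightarrow> 'm topology \<Rightarrow>
   'i set \<Rightarrow> ('i \<Rightarrow> 'i \<Rightarrow> bool) \<Rightarrow> ('i \<Rightarrow> ('r, 'x, 'y) module_scheme) \<Rightarrow> ('i \<Rightarrow> 'i \<Rightarrow> 'x \<Rightarrow> 'x) \<Rightarrow>
   ('i \<Rightarrow> 'm \<Rightarrow> 'x) \<Rightarrow> bool"
where
  "is_discrete_limit R M TM I leq N f p \<longleftrightarrow>
     (\<forall>i\<in>I. p i \<in> module_homs R M (N i)) \<and>
     homeomorphic_map TM (inv_lim I leq (\<lambda>i. discrete_topology (carrier (N i))) f)
       (\<lambda>x. \<lambda>i\<in>I. p i x)"

text \<open>HOL cannot quantify over the types carrying the index set and the modules of the system.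
  The types chosen here lose nothing: a limit of any discrete system is the limit of its own
  quotients by open submodules, which live in type \<^typ>\<open>'m set\<close>; see \<open>pro_discreteI\<close>
  and \<open>pseudocompactI\<close> below.\<close>

definition pro_discrete ::
  "('r, 'z) ring_scheme \<Rightarrow> 'r topology \<Rightarrow> ('r, 'm, 'y) module_scheme \<Rightarrow> 'm topology \<Rightarrow> bool"
where
  "pro_discrete R TR M TM \<longleftrightarrow>
     topological_module R TR M TM \<and>
     (\<exists>(I :: 'm set set) leq (N :: 'm set \<Rightarrow> ('r, 'm set) module) f p.
        discrete_system R TR I leq N f \<and> is_discrete_limit R M TM I leq N f p)"

definition pseudocompact ::
  "('r, 'z) ring_scheme \<Rightarrow> 'r topology \<Rightarrow> ('r, 'm, 'y) module_scheme \<Rightarrow> 'm topology \<Rightarrow> bool"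
where
  "pseudocompact R TR M TM \<longleftrightarrow>
     topological_module R TR M TM \<and>
     (\<exists>(I :: 'm set set) leq (N :: 'm set \<Rightarrow> ('r, 'm set) module) f p.
        discrete_system R TR I leq N f \<and> (\<forall>i\<in>I. finite_length R (N i)) \<and>
        is_discrete_limit R M TM I leq N f p)"

definition pseudocompact_bimodule ::
  "('r, 'z) ring_scheme \<Rightarrow> 'r topology \<Rightarrow> ('s, 'w) ring_scheme \<Rightarrow> 's topology \<Rightarrow>
   ('r, 's, 'm, 'y) bimodule_scheme \<Rightarrow> 'm topology \<Rightarrow> bool"
where
  "pseudocompact_bimodule R TR S TS P TP \<longleftrightarrow>
     (\<forall>r\<in>carrier R. \<forall>s\<in>carrier S. \<forall>x\<in>carrier P.
        rsmult P (r \<odot>\<^bsub>P\<^esub> x) s = r \<odot>\<^bsub>P\<^esub> rsmult P x s) \<and>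
     pseudocompact R TR P TP \<and>
     pseudocompact (op_ring S) TS (right_module P) TP"

definition left_pseudocompact_ring :: "('r, 'z) ring_scheme \<Rightarrow> 'r topology \<Rightarrow> bool" where
  "left_pseudocompact_ring R TR \<longleftrightarrow>
     topological_ring R TR \<and> pseudocompact R TR (regular_bimodule R) TR"

definition pseudocompact_ring :: "('r, 'z) ring_scheme \<Rightarrow> 'r topology \<Rightarrow> bool" where
  "pseudocompact_ring R TR \<longleftrightarrow>
     topological_ring R TR \<and> pseudocompact_bimodule R TR R TR (regular_bimodule R) TR"


section \<open>Tensor products and completed tensor products\<close>

text \<open>Here \<open>M\<close> is a module over \<^term>\<open>op_ring A\<close>, so \<open>a \<odot>\<^bsub>M\<^esub> m\<close> stands for \<open>m a\<close>.\<close>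

definition tensor_rel ::
  "('a, 'z) ring_scheme \<Rightarrow> ('a, 'm, 'y) module_scheme \<Rightarrow> ('a, 'n, 'w) module_scheme \<Rightarrow>
   (('m \<times> 'n) \<Rightarrow>\<^sub>0 int) set"
where
  "tensor_rel A M N =
     generate (free_Abelian_group (carrier M \<times> carrier N))
       ({frag_of (m \<oplus>\<^bsub>M\<^esub> m', n) - frag_of (m, n) - frag_of (m', n) | m m' n.
           m \<in> carrier M \<and> m' \<in> carrier M \<and> n \<in> carrier N} \<union>
        {frag_of (m, n \<oplus>\<^bsub>N\<^esub> n') - frag_of (m, n) - frag_of (m, n') | m n n'.
           m \<in> carrier M \<and> n \<in> carrier N \<and> n' \<in> carrier N} \<union>
        {frag_of (a \<odot>\<^bsub>M\<^esub> m, n) - frag_of (m, a \<odot>\<^bsub>N\<^esub> n) | a m n.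
           a \<in> carrier A \<and> m \<in> carrier M \<and> n \<in> carrier N})"

definition tensor ::
  "('a, 'z) ring_scheme \<Rightarrow> ('a, 'm, 'y) module_scheme \<Rightarrow> ('a, 'n, 'w) module_scheme \<Rightarrow>
   (('m \<times> 'n) \<Rightarrow>\<^sub>0 int) set monoid"
where
  "tensor A M N = free_Abelian_group (carrier M \<times> carrier N) Mod tensor_rel A M N"

definition tensor_elem ::
  "('a, 'z) ring_scheme \<Rightarrow> ('a, 'm, 'y) module_scheme \<Rightarrow> ('a, 'n, 'w) module_scheme \<Rightarrow>
   'm \<Rightarrow> 'n \<Rightarrow> (('m \<times> 'n) \<Rightarrow>\<^sub>0 int) set"
where
  "tensor_elem A M N m n =
     tensor_rel A M N #>\<^bsub>free_Abelian_group (carrier M \<times> carrier N)\<^esub> frag_of (m, n)"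

text \<open>The map \<open>f \<otimes> g\<close> with values in \<^term>\<open>tensor A M N\<close>.\<close>

definition tensor_map ::
  "('a, 'z) ring_scheme \<Rightarrow> ('a, 'm, 'y) module_scheme \<Rightarrow> ('a, 'n, 'w) module_scheme \<Rightarrow>
   ('k \<Rightarrow> 'm) \<Rightarrow> ('l \<Rightarrow> 'n) \<Rightarrow> (('k \<times> 'l) \<Rightarrow>\<^sub>0 int) set \<Rightarrow> (('m \<times> 'n) \<Rightarrow>\<^sub>0 int) set"
where
  "tensor_map A M N f g C =
     (\<Union>c\<in>C. tensor_rel A M N #>\<^bsub>free_Abelian_group (carrier M \<times> carrier N)\<^esub>
        frag_extend (\<lambda>(k, l). frag_of (f k, g l)) c)"

text \<open>The iterated limit over open submodules \<open>U\<close> of \<open>M\<close> and \<open>V\<close> of \<open>N\<close>, both ordered by reverse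
  inclusion, of the discrete groups \<open>M/U \<otimes>\<^sub>A N/V\<close>.\<close>

definition ctensor_top ::
  "('a, 'z) ring_scheme \<Rightarrow> ('a, 'm, 'y) module_scheme \<Rightarrow> 'm topology \<Rightarrow>
   ('a, 'n, 'w) module_scheme \<Rightarrow> 'n topology \<Rightarrow>
   ('m set \<Rightarrow> 'n set \<Rightarrow> (('m set \<times> 'n set) \<Rightarrow>\<^sub>0 int) set) topology"
where
  "ctensor_top A M TM N TN =
     inv_lim (open_submodules (op_ring A) M TM) (\<lambda>U U'. U' \<subseteq> U)
       (\<lambda>U. inv_lim (open_submodules A N TN) (\<lambda>V V'. V' \<subseteq> V)
          (\<lambda>V. discrete_topology (carrier (tensor A (quot_module M U) (quot_module N V))))
          (\<lambda>V V'. tensor_map A (quot_module M U) (quot_module N V)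
             (\<lambda>C. C) (coset_map N V (\<lambda>y. y))))
       (\<lambda>U U' x. \<lambda>V\<in>open_submodules A N TN.
          tensor_map A (quot_module M U) (quot_module N V) (coset_map M U (\<lambda>y. y)) (\<lambda>C. C) (x V))"

definition ctensor_elem ::
  "('a, 'z) ring_scheme \<Rightarrow> ('a, 'm, 'y) module_scheme \<Rightarrow> 'm topology \<Rightarrow>
   ('a, 'n, 'w) module_scheme \<Rightarrow> 'n topology \<Rightarrow> 'm \<Rightarrow> 'n \<Rightarrow>
   'm set \<Rightarrow> 'n set \<Rightarrow> (('m set \<times> 'n set) \<Rightarrow>\<^sub>0 int) set"
where
  "ctensor_elem A M TM N TN m n =
     (\<lambda>U\<in>open_submodules (op_ring A) M TM. \<lambda>V\<in>open_submodules A N TN.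
        tensor_elem A (quot_module M U) (quot_module N V) (U +>\<^bsub>M\<^esub> m) (V +>\<^bsub>N\<^esub> n))"

text \<open>For a bimodule \<open>P\<close>, left multiplication by \<open>b\<close> is a continuous endomorphism \<open>\<lambda>\<^sub>b\<close> of the right
  module \<open>P\<close>, and \<open>b\<close> acts on the completed tensor product by functoriality: the component of
  \<open>b \<cdot> x\<close> at \<open>(U, V)\<close> is the image of the component of \<open>x\<close> at \<open>(\<lambda>\<^sub>b\<^sup>-\<^sup>1(U), V)\<close>.
  Thus \<open>b \<cdot> (p \<otimes> n) = b p \<otimes> n\<close>.\<close>

definition ctensor ::
  "('a, 'z) ring_scheme \<Rightarrow> ('b, 'a, 'm, 'y) bimodule_scheme \<Rightarrow> 'm topology \<Rightarrow>
   ('a, 'n, 'w) module_scheme \<Rightarrow> 'n topology \<Rightarrow>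
   ('b, 'm set \<Rightarrow> 'n set \<Rightarrow> (('m set \<times> 'n set) \<Rightarrow>\<^sub>0 int) set) module"
where
  "ctensor A P TP N TN =
     (let M = right_module P;
          \<U> = open_submodules (op_ring A) M TP;
          \<V> = open_submodules A N TN;
          T = (\<lambda>U V. tensor A (quot_module M U) (quot_module N V))
      in \<lparr>carrier = topspace (ctensor_top A M TP N TN),
          mult = undefined, one = undefined,
          ring.zero = (\<lambda>U\<in>\<U>. \<lambda>V\<in>\<V>. \<one>\<^bsub>T U V\<^esub>),
          add = (\<lambda>x y. \<lambda>U\<in>\<U>. \<lambda>V\<in>\<V>. x U V \<otimes>\<^bsub>T U V\<^esub> y U V),
          smult = (\<lambda>b x. \<lambda>U\<in>\<U>. \<lambda>V\<in>\<V>.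
             tensor_map A (quot_module M U) (quot_module N V)
               (coset_map M U (\<lambda>p. b \<odot>\<^bsub>P\<^esub> p)) (\<lambda>C. C)
               (x {p \<in> carrier P. b \<odot>\<^bsub>P\<^esub> p \<in> U} V))\<rparr>)"


section \<open>Skew power series rings\<close>

definition top_nilpotent_derivation ::
  "('a, 'z) ring_scheme \<Rightarrow> 'a topology \<Rightarrow> ('a \<Rightarrow> 'a) \<Rightarrow> ('a \<Rightarrow> 'a) \<Rightarrow> bool"
where
  "top_nilpotent_derivation A TA \<sigma> \<delta> \<longleftrightarrow>
     \<delta> \<in> hom (add_monoid A) (add_monoid A) \<and> continuous_map TA TA \<delta> \<and>
     (\<forall>a\<in>carrier A. \<forall>b\<in>carrier A.
        \<delta> (a \<otimes>\<^bsub>A\<^esub> b) = \<sigma> a \<otimes>\<^bsub>A\<^esub> \<delta> b \<oplus>\<^bsub>A\<^esub> \<delta> a \<otimes>\<^bsub>A\<^esub> b) \<and>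
     (\<forall>I. ideal I A \<and> openin TA I \<longrightarrow> (\<exists>n>0. (\<delta> ^^ n) ` carrier A \<subseteq> I))"

text \<open>The ring \<open>A\<close> is literally contained in \<open>B\<close>. In the last condition \<open>\<Phi>\<close> is the map
  \<open>(a\<^sub>n) \<mapsto> \<Sum> a\<^sub>n t\<^sup>n\<close>; as a pointwise limit of \<open>A\<close>-linear maps it is automatically \<open>A\<close>-linear, so being a
  homeomorphism it is an isomorphism of topological \<open>A\<close>-modules.\<close>

definition skew_power_series_ring ::
  "('b, 'z) ring_scheme \<Rightarrow> 'b topology \<Rightarrow> ('b \<Rightarrow> 'b) \<Rightarrow> ('b \<Rightarrow> 'b) \<Rightarrow>
   ('b, 'w) ring_scheme \<Rightarrow> 'b topology \<Rightarrow> 'b \<Rightarrow> bool"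
where
  "skew_power_series_ring A TA \<sigma> \<delta> B TB t \<longleftrightarrow>
     pseudocompact_ring A TA \<and>
     \<sigma> \<in> ring_iso A A \<and> continuous_map TA TA \<sigma> \<and>
     top_nilpotent_derivation A TA \<sigma> \<delta> \<and>
     left_pseudocompact_ring B TB \<and> t \<in> carrier B \<and>
     (\<lambda>a. a) \<in> ring_hom A B \<and> closedin TB (carrier A) \<and> TA = subtopology TB (carrier A) \<and>
     pseudocompact (op_ring A) TA (right_module (regular_bimodule B)) TB \<and>
     (\<exists>\<Phi>. homeomorphic_map (product_topology (\<lambda>_::nat. TA) UNIV) TB \<Phi> \<and>
        (\<forall>a \<in> UNIV \<rightarrow> carrier A.
           limitin TB (\<lambda>n. \<Oplus>\<^bsub>B\<^esub>k\<in>{..<n}. a k \<otimes>\<^bsub>B\<^esub> t [^]\<^bsub>B\<^esub> k) (\<Phi> a) sequentially)) \<and>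
     (\<forall>a\<in>carrier A. t \<otimes>\<^bsub>B\<^esub> a = \<sigma> a \<otimes>\<^bsub>B\<^esub> t \<oplus>\<^bsub>B\<^esub> \<delta> a)"


section \<open>Exact sequences of pseudocompact modules\<close>

definition pseudocompact_short_exact ::
  "('r, 'z) ring_scheme \<Rightarrow> 'r topology \<Rightarrow>
   ('r, 'l, 'u) module_scheme \<Rightarrow> 'l topology \<Rightarrow> ('l \<Rightarrow> 'm) \<Rightarrow>
   ('r, 'm, 'v) module_scheme \<Rightarrow> 'm topology \<Rightarrow> ('m \<Rightarrow> 'n) \<Rightarrow>
   ('r, 'n, 'w) module_scheme \<Rightarrow> 'n topology \<Rightarrow> bool"
where
  "pseudocompact_short_exact R TR L TL f M TM g N TN \<longleftrightarrow>
     pseudocompact R TR L TL \<and> pseudocompact R TR M TM \<and> pseudocompact R TR N TN \<and>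
     f \<in> module_homs R L M \<and> continuous_map TL TM f \<and>
     g \<in> module_homs R M N \<and> continuous_map TM TN g \<and>
     inj_on f (carrier L) \<and> f ` carrier L = a_kernel M N g \<and> g ` carrier M = carrier N"


section \<open>Limits of arbitrary discrete systems\<close>

lemma mem_a_r_coset: "y \<in> U +>\<^bsub>M\<^esub> x \<longleftrightarrow> (\<exists>u\<in>U. y = u \<oplus>\<^bsub>M\<^esub> x)"
  unfolding a_r_coset_def r_coset_def by auto

lemma coset_map_coset:
  assumes "abelian_subgroup V K" "abelian_subgroup U M"
    and f: "f \<in> hom (add_monoid K) (add_monoid M)" "f ` V \<subseteq> U" and x: "x \<in> carrier K"
  shows "coset_map M U f (V +>\<^bsub>K\<^esub> x) = U +>\<^bsub>M\<^esub> f x"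
proof -
  interpret K: abelian_subgroup V K by fact
  interpret M: abelian_subgroup U M by fact
  have fx: "f x \<in> carrier M" using f(1) x by (auto simp: hom_def)
  have "U +>\<^bsub>M\<^esub> f y = U +>\<^bsub>M\<^esub> f x" if yV: "y \<in> V +>\<^bsub>K\<^esub> x" for y
  proof -
    obtain v where v: "v \<in> V" "y = v \<oplus>\<^bsub>K\<^esub> x" using yV unfolding mem_a_r_coset by blast
    have vK: "v \<in> carrier K" using v(1) K.a_subset by blast
    have "f y = f v \<oplus>\<^bsub>M\<^esub> f x" using hom_mult[OF f(1), of v x] vK x unfolding v(2) by simp
    moreover have "f v \<in> U" using f(2) v by auto
    ultimately have "f y \<in> U +>\<^bsub>M\<^esub> f x" by (auto simp: mem_a_r_coset)
    then show ?thesis using M.a_repr_independence fx M.a_subgroup by metis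
  qed
  moreover have "x \<in> V +>\<^bsub>K\<^esub> x" using K.a_rcos_self x by simp
  ultimately show ?thesis unfolding coset_map_def by blast
qed

lemma (in left_module) submodule_abelian_subgroup:
  "submodule U R M \<Longrightarrow> abelian_subgroup U M"
  by (simp add: M.a_comm_group abelian_subgroupI2 submodule_def)

lemma (in left_module) smult_hom: "r \<in> carrier R \<Longrightarrow> (\<lambda>x. r \<odot>\<^bsub>M\<^esub> x) \<in> hom (add_monoid M) (add_monoid M)"
  by (auto simp: hom_def lsmult_closed lsmult_r_distr)

lemma (in left_module) quot_module_facts:
  assumes U: "submodule U R M"
  shows "left_module R (quot_module M U)"
    and "carrier (quot_module M U) = (\<lambda>x. U +>\<^bsub>M\<^esub> x) ` carrier M"
    and "\<And>x y. x \<in> carrier M \<Longrightarrow> y \<in> carrier M \<Longrightarrow>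
      (U +>\<^bsub>M\<^esub> x) \<oplus>\<^bsub>quot_module M U\<^esub> (U +>\<^bsub>M\<^esub> y) = U +>\<^bsub>M\<^esub> (x \<oplus>\<^bsub>M\<^esub> y)"
    and "\<And>r x. r \<in> carrier R \<Longrightarrow> x \<in> carrier M \<Longrightarrow>
      r \<odot>\<^bsub>quot_module M U\<^esub> (U +>\<^bsub>M\<^esub> x) = U +>\<^bsub>M\<^esub> (r \<odot>\<^bsub>M\<^esub> x)"
    and "\<zero>\<^bsub>quot_module M U\<^esub> = U"
proof -
  interpret U: abelian_subgroup U M using submodule_abelian_subgroup[OF U] .
  let ?Q = "quot_module M U"
  show car: "carrier ?Q = (\<lambda>x. U +>\<^bsub>M\<^esub> x) ` carrier M"
    by (auto simp: quot_module_def A_RCOSETS_def RCOSETS_def a_r_coset_def)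
  show z: "\<zero>\<^bsub>?Q\<^esub> = U" by (simp add: quot_module_def)
  show add: "(U +>\<^bsub>M\<^esub> x) \<oplus>\<^bsub>?Q\<^esub> (U +>\<^bsub>M\<^esub> y) = U +>\<^bsub>M\<^esub> (x \<oplus>\<^bsub>M\<^esub> y)"
    if "x \<in> carrier M" "y \<in> carrier M" for x y
    using that by (simp add: quot_module_def U.a_rcos_sum)
  show sm: "r \<odot>\<^bsub>?Q\<^esub> (U +>\<^bsub>M\<^esub> x) = U +>\<^bsub>M\<^esub> (r \<odot>\<^bsub>M\<^esub> x)"
    if "r \<in> carrier R" "x \<in> carrier M" for r x
    using coset_map_coset[OF U.is_abelian_subgroup U.is_abelian_subgroup smult_hom[OF that(1)] _ that(2)]
      submodule.smult_closed[OF U that(1)] by (auto simp: quot_module_def)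
  have "abelian_group ?Q"
  proof (rule abelian_groupI)
    show "\<zero>\<^bsub>?Q\<^esub> \<in> carrier ?Q" by (simp add: quot_module_def U.a_subgroup_in_rcosets)
    fix x assume x: "x \<in> carrier ?Q"
    then obtain x' where x': "x' \<in> carrier M" "x = U +>\<^bsub>M\<^esub> x'" by (auto simp: car)
    have U0: "U = U +>\<^bsub>M\<^esub> \<zero>\<^bsub>M\<^esub>" by (simp add: U.a_subset)
    show "\<zero>\<^bsub>?Q\<^esub> \<oplus>\<^bsub>?Q\<^esub> x = x"
      using add[of "\<zero>\<^bsub>M\<^esub>" x'] x' by (simp add: z U0[symmetric])
    have "(U +>\<^bsub>M\<^esub> (\<ominus>\<^bsub>M\<^esub> x')) \<oplus>\<^bsub>?Q\<^esub> x = \<zero>\<^bsub>?Q\<^esub>"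
      using add[of "\<ominus>\<^bsub>M\<^esub> x'" x'] x' by (simp add: z U0[symmetric] M.l_neg)
    then show "\<exists>y\<in>carrier ?Q. y \<oplus>\<^bsub>?Q\<^esub> x = \<zero>\<^bsub>?Q\<^esub>" using x' car by blast
    fix y assume "y \<in> carrier ?Q"
    then obtain y' where y': "y' \<in> carrier M" "y = U +>\<^bsub>M\<^esub> y'" by (auto simp: car)
    show "x \<oplus>\<^bsub>?Q\<^esub> y \<in> carrier ?Q" using x' y' by (auto simp: car add)
    show "x \<oplus>\<^bsub>?Q\<^esub> y = y \<oplus>\<^bsub>?Q\<^esub> x" using x' y' by (simp add: add M.a_comm)
    fix z assume "z \<in> carrier ?Q"
    then obtain z' where z': "z' \<in> carrier M" "z = U +>\<^bsub>M\<^esub> z'" by (auto simp: car)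
    show "x \<oplus>\<^bsub>?Q\<^esub> y \<oplus>\<^bsub>?Q\<^esub> z = x \<oplus>\<^bsub>?Q\<^esub> (y \<oplus>\<^bsub>?Q\<^esub> z)" using x' y' z' by (simp add: add M.a_assoc)
  qed
  then interpret Q: abelian_group ?Q .
  show "left_module R ?Q"
  proof (intro left_module.intro left_module_axioms.intro)
    show "ring R" by (rule R.ring_axioms)
    show "abelian_group ?Q" by (rule Q.abelian_group_axioms)
    fix x assume "x \<in> carrier ?Q"
    then obtain x' where x': "x' \<in> carrier M" "x = U +>\<^bsub>M\<^esub> x'" unfolding car by blast
    show "\<one>\<^bsub>R\<^esub> \<odot>\<^bsub>?Q\<^esub> x = x" using x' by (simp add: sm lsmult_one)
    fix a assume a: "a \<in> carrier R"
    show "a \<odot>\<^bsub>?Q\<^esub> x \<in> carrier ?Q" unfolding x'(2) sm[OF a x'(1)] car using lsmult_closed[OF a x'(1)] by blast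
    { fix y assume "y \<in> carrier ?Q"
      then obtain y' where y': "y' \<in> carrier M" "y = U +>\<^bsub>M\<^esub> y'" unfolding car by blast
      show "a \<odot>\<^bsub>?Q\<^esub> (x \<oplus>\<^bsub>?Q\<^esub> y) = a \<odot>\<^bsub>?Q\<^esub> x \<oplus>\<^bsub>?Q\<^esub> a \<odot>\<^bsub>?Q\<^esub> y"
        using a x' y' by (simp add: sm add lsmult_closed lsmult_r_distr) }
    fix b assume b: "b \<in> carrier R"
    show "(a \<oplus>\<^bsub>R\<^esub> b) \<odot>\<^bsub>?Q\<^esub> x = a \<odot>\<^bsub>?Q\<^esub> x \<oplus>\<^bsub>?Q\<^esub> b \<odot>\<^bsub>?Q\<^esub> x"
      using a b x' by (simp add: sm add lsmult_closed lsmult_l_distr)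
    show "(a \<otimes>\<^bsub>R\<^esub> b) \<odot>\<^bsub>?Q\<^esub> x = a \<odot>\<^bsub>?Q\<^esub> (b \<odot>\<^bsub>?Q\<^esub> x)"
      using a b x' by (simp add: sm lsmult_closed lsmult_assoc)
  qed
qed

lemma (in left_module) kernel_submodule:
  assumes "left_module R N" and p: "p \<in> module_homs R M N"
  shows "submodule (a_kernel M N p) R M"
proof -
  interpret N: left_module R N by fact
  have h: "p \<in> hom (add_monoid M) (add_monoid N)" using p by (simp add: module_homs_def)
  then interpret h: group_hom "add_monoid M" "add_monoid N" p
    by (simp add: M.a_group N.M.a_group group_hom_axioms_def group_hom_def)
  have "\<And>a. a \<in> carrier R \<Longrightarrow> a \<odot>\<^bsub>N\<^esub> \<zero>\<^bsub>N\<^esub> = \<zero>\<^bsub>N\<^esub>"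
    by (metis N.lsmult_r_distr N.lsmult_closed N.M.zero_closed N.M.r_zero N.M.add.l_cancel)
  then show ?thesis
    unfolding submodule_def submodule_axioms_def
    using h.subgroup_kernel p
    by (auto simp: a_kernel_def kernel_def module_homs_def lsmult_closed)
qed

lemma (in left_module) coset_eq_kernel_iff:
  assumes "left_module R N" and p: "p \<in> module_homs R M N"
    and x: "x \<in> carrier M" and y: "y \<in> carrier M"
  shows "a_kernel M N p +>\<^bsub>M\<^esub> x = a_kernel M N p +>\<^bsub>M\<^esub> y \<longleftrightarrow> p x = p y"
    and "y \<in> a_kernel M N p +>\<^bsub>M\<^esub> x \<longleftrightarrow> p x = p y"
proof -
  interpret N: left_module R N by fact
  let ?K = "a_kernel M N p"
  interpret K: abelian_subgroup ?K M
    using submodule_abelian_subgroup[OF kernel_submodule[OF assms(1,2)]] .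
  have h: "p \<in> hom (add_monoid M) (add_monoid N)" using p by (simp add: module_homs_def)
  show 2: "y \<in> ?K +>\<^bsub>M\<^esub> x \<longleftrightarrow> p x = p y"
  proof
    assume "y \<in> ?K +>\<^bsub>M\<^esub> x"
    then obtain k where k: "k \<in> ?K" "y = k \<oplus>\<^bsub>M\<^esub> x" by (auto simp: mem_a_r_coset)
    have kk: "k \<in> carrier M" "p k = \<zero>\<^bsub>N\<^esub>" using k(1) unfolding a_kernel_def kernel_def by auto
    have "p y = p k \<oplus>\<^bsub>N\<^esub> p x" using hom_mult[OF h, of k x] kk(1) x unfolding k(2) by simp
    then show "p x = p y" using kk(2) N.M.l_zero hom_in_carrier[OF h, of x] x by simp
  next
    assume e: "p x = p y"
    have d: "y = (y \<ominus>\<^bsub>M\<^esub> x) \<oplus>\<^bsub>M\<^esub> x" "y \<ominus>\<^bsub>M\<^esub> x \<in> carrier M"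
      using x y by (simp_all add: a_minus_def M.a_assoc M.l_neg)
    have c: "p (y \<ominus>\<^bsub>M\<^esub> x) \<in> carrier N" "p x \<in> carrier N" using hom_in_carrier[OF h] d(2) x by simp_all
    have "p y = p (y \<ominus>\<^bsub>M\<^esub> x) \<oplus>\<^bsub>N\<^esub> p x"
      using hom_mult[OF h, of "y \<ominus>\<^bsub>M\<^esub> x" x] d x by simp
    then have "p (y \<ominus>\<^bsub>M\<^esub> x) \<oplus>\<^bsub>N\<^esub> p x = p x" using e by simp
    then have "p (y \<ominus>\<^bsub>M\<^esub> x) = \<zero>\<^bsub>N\<^esub>" using c by simp
    with d(2) have "y \<ominus>\<^bsub>M\<^esub> x \<in> ?K" unfolding a_kernel_def kernel_def by simp
    moreover note d(1)
    ultimately show "y \<in> ?K +>\<^bsub>M\<^esub> x" by (auto simp: mem_a_r_coset)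
  qed
  show "?K +>\<^bsub>M\<^esub> x = ?K +>\<^bsub>M\<^esub> y \<longleftrightarrow> p x = p y"
    using 2 K.a_rcos_self[OF y] M.a_repr_independence[OF _ x K.a_subgroup] by metis
qed


lemma (in left_module) lsmult_zero: "a \<in> carrier R \<Longrightarrow> a \<odot>\<^bsub>M\<^esub> \<zero>\<^bsub>M\<^esub> = \<zero>\<^bsub>M\<^esub>"
  by (metis lsmult_r_distr lsmult_closed M.zero_closed M.r_zero M.add.l_cancel)

lemma (in left_module) lsmult_minus_one:
  assumes x: "x \<in> carrier M" shows "(\<ominus>\<^bsub>R\<^esub> \<one>\<^bsub>R\<^esub>) \<odot>\<^bsub>M\<^esub> x = \<ominus>\<^bsub>M\<^esub> x"
proof -
  have z: "\<zero>\<^bsub>R\<^esub> \<odot>\<^bsub>M\<^esub> x = \<zero>\<^bsub>M\<^esub>"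
    by (metis R.zero_closed R.r_zero lsmult_l_distr lsmult_closed M.r_zero M.add.l_cancel x M.zero_closed)
  have "(\<ominus>\<^bsub>R\<^esub> \<one>\<^bsub>R\<^esub>) \<odot>\<^bsub>M\<^esub> x \<oplus>\<^bsub>M\<^esub> x = (\<ominus>\<^bsub>R\<^esub> \<one>\<^bsub>R\<^esub> \<oplus>\<^bsub>R\<^esub> \<one>\<^bsub>R\<^esub>) \<odot>\<^bsub>M\<^esub> x"
    using lsmult_l_distr[of "\<ominus>\<^bsub>R\<^esub> \<one>\<^bsub>R\<^esub>" "\<one>\<^bsub>R\<^esub>" x] x by (simp add: lsmult_one)
  also have "\<dots> = \<zero>\<^bsub>M\<^esub>" using z by (simp add: R.l_neg)
  finally show ?thesis using x by (simp add: M.minus_equality lsmult_closed)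
qed

lemma (in left_module) submoduleI_left:
  assumes "H \<subseteq> carrier M" "\<zero>\<^bsub>M\<^esub> \<in> H"
    and "\<And>x y. x \<in> H \<Longrightarrow> y \<in> H \<Longrightarrow> x \<oplus>\<^bsub>M\<^esub> y \<in> H"
    and s: "\<And>a x. a \<in> carrier R \<Longrightarrow> x \<in> H \<Longrightarrow> a \<odot>\<^bsub>M\<^esub> x \<in> H"
  shows "submodule H R M"
proof -
  have "\<ominus>\<^bsub>M\<^esub> x \<in> H" if "x \<in> H" for x
    using s[of "\<ominus>\<^bsub>R\<^esub> \<one>\<^bsub>R\<^esub>" x] that assms(1) lsmult_minus_one by auto
  then show ?thesis using assms
    by (auto simp: submodule_def submodule_axioms_def subgroup_def a_inv_def)
qed

lemma (in left_module) submoduleD_left: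
  assumes "submodule H R M"
  shows "H \<subseteq> carrier M" "\<zero>\<^bsub>M\<^esub> \<in> H"
    and "\<And>x y. x \<in> H \<Longrightarrow> y \<in> H \<Longrightarrow> x \<oplus>\<^bsub>M\<^esub> y \<in> H"
    and "\<And>a x. a \<in> carrier R \<Longrightarrow> x \<in> H \<Longrightarrow> a \<odot>\<^bsub>M\<^esub> x \<in> H"
    and "\<And>x. x \<in> H \<Longrightarrow> \<ominus>\<^bsub>M\<^esub> x \<in> H"
  using assms by (auto simp: submodule_def submodule_axioms_def subgroup_def a_inv_def)

lemma (in left_module) homD:
  assumes "f \<in> module_homs R M N"
  shows "\<And>x. x \<in> carrier M \<Longrightarrow> f x \<in> carrier N"
    and "\<And>x y. x \<in> carrier M \<Longrightarrow> y \<in> carrier M \<Longrightarrow> f (x \<oplus>\<^bsub>M\<^esub> y) = f x \<oplus>\<^bsub>N\<^esub> f y"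
    and "\<And>a x. a \<in> carrier R \<Longrightarrow> x \<in> carrier M \<Longrightarrow> f (a \<odot>\<^bsub>M\<^esub> x) = a \<odot>\<^bsub>N\<^esub> f x"
  using assms by (auto simp: module_homs_def hom_def)

lemma (in left_module) hom_zero:
  assumes "left_module R N" "f \<in> module_homs R M N"
  shows "f \<zero>\<^bsub>M\<^esub> = \<zero>\<^bsub>N\<^esub>"
proof -
  interpret N: left_module R N by fact
  have "f \<zero>\<^bsub>M\<^esub> \<oplus>\<^bsub>N\<^esub> f \<zero>\<^bsub>M\<^esub> = f \<zero>\<^bsub>M\<^esub>"
    using homD(2)[OF assms(2), of "\<zero>\<^bsub>M\<^esub>" "\<zero>\<^bsub>M\<^esub>"] by simp
  then show ?thesis using homD(1)[OF assms(2), of "\<zero>\<^bsub>M\<^esub>"] by simp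
qed

lemma finite_length_weak:
  fixes C :: "nat \<Rightarrow> 'm set"
  assumes "C 0 = {\<zero>\<^bsub>M\<^esub>}" "\<And>i. i \<le> n \<Longrightarrow> submodule (C i) R M"
    and "\<And>i. i < n \<Longrightarrow> C i \<subseteq> C (Suc i)"
    and "\<And>i K. i < n \<Longrightarrow> submodule K R M \<Longrightarrow> C i \<subset> K \<Longrightarrow> K \<subset> C (Suc i) \<Longrightarrow> False"
  shows "\<exists>(D :: nat \<Rightarrow> 'm set) m. D 0 = {\<zero>\<^bsub>M\<^esub>} \<and> D m = C n \<and> (\<forall>i\<le>m. submodule (D i) R M) \<and>
    (\<forall>i<m. D i \<subset> D (Suc i) \<and> \<not> (\<exists>K. submodule K R M \<and> D i \<subset> K \<and> K \<subset> D (Suc i)))"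
  using assms
proof (induction n)
  case 0
  then show ?case by (intro exI[of _ C] exI[of _ 0]) auto
next
  case (Suc n)
  have "\<exists>(D :: nat \<Rightarrow> 'm set) m. D 0 = {\<zero>\<^bsub>M\<^esub>} \<and> D m = C n \<and> (\<forall>i\<le>m. submodule (D i) R M) \<and>
    (\<forall>i<m. D i \<subset> D (Suc i) \<and> \<not> (\<exists>K. submodule K R M \<and> D i \<subset> K \<and> K \<subset> D (Suc i)))"
  proof (rule Suc.IH)
    show "C 0 = {\<zero>\<^bsub>M\<^esub>}" by (rule Suc.prems)
    show "\<And>i. i \<le> n \<Longrightarrow> submodule (C i) R M" using Suc.prems(2) by simp
    show "\<And>i. i < n \<Longrightarrow> C i \<subseteq> C (Suc i)" using Suc.prems(3) by simp
    show "\<And>i K. i < n \<Longrightarrow> submodule K R M \<Longrightarrow> C i \<subset> K \<Longrightarrow> K \<subset> C (Suc i) \<Longrightarrow> False"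
      using Suc.prems(4) less_SucI by blast
  qed
  then obtain D m where Dm: "D 0 = {\<zero>\<^bsub>M\<^esub>} \<and> D m = C n \<and> (\<forall>i\<le>m. submodule (D i) R M) \<and>
    (\<forall>i<m. D i \<subset> D (Suc i) \<and> \<not> (\<exists>K. submodule K R M \<and> D i \<subset> K \<and> K \<subset> D (Suc i)))"
    by (elim exE) (rule that)
  note D = conjunct1[OF Dm] conjunct1[OF conjunct2[OF Dm]]
    conjunct1[OF conjunct2[OF conjunct2[OF Dm]]] conjunct2[OF conjunct2[OF conjunct2[OF Dm]]]
  show ?case
  proof (cases "C n = C (Suc n)")
    case True
    then show ?thesis using Dm by (intro exI[of _ D] exI[of _ m]) simp
  next
    case False
    define E where "E = D(Suc m := C (Suc n))"
    have "\<not> (\<exists>K. submodule K R M \<and> C n \<subset> K \<and> K \<subset> C (Suc n))" using Suc.prems(4)[of n] by blast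
    moreover have "C n \<subset> C (Suc n)" using False Suc.prems(3)[of n] by blast
    moreover have "submodule (C (Suc n)) R M" using Suc.prems(2)[of "Suc n"] by simp
    moreover have E: "E (Suc m) = C (Suc n)" "\<And>i. i \<le> m \<Longrightarrow> E i = D i"
      by (simp_all add: E_def)
    moreover have "submodule (E i) R M" if "i \<le> Suc m" for i
      using that E D(3) \<open>submodule (C (Suc n)) R M\<close> by (metis le_Suc_eq)
    moreover have "E i \<subset> E (Suc i) \<and> \<not> (\<exists>K. submodule K R M \<and> E i \<subset> K \<and> K \<subset> E (Suc i))"
      if "i < Suc m" for i
    proof (cases "i = m")
      case True
      then show ?thesis
        using E D(2) \<open>C n \<subset> C (Suc n)\<close>
          \<open>\<not> (\<exists>K. submodule K R M \<and> C n \<subset> K \<and> K \<subset> C (Suc n))\<close> by simp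
    next
      case False
      then have "i < m" "E i = D i" "E (Suc i) = D (Suc i)" using that E(2) by simp_all
      then show ?thesis using D(4) by simp
    qed
    moreover have "E 0 = {\<zero>\<^bsub>M\<^esub>}" using E(2)[of 0] D(1) by simp
    ultimately show ?thesis by (intro exI[of _ E] exI[of _ "Suc m"]) simp
  qed
qed

lemma (in left_module) finite_length_pullback:
  assumes "left_module R N" and f: "f \<in> module_homs R M N"
    and inj: "\<And>x. x \<in> carrier M \<Longrightarrow> f x = \<zero>\<^bsub>N\<^esub> \<Longrightarrow> x = \<zero>\<^bsub>M\<^esub>"
    and "finite_length R N"
  shows "finite_length R M"
proof -
  interpret N: left_module R N by fact
  obtain C n where C: "C 0 = {\<zero>\<^bsub>N\<^esub>}" "C n = carrier N" "\<And>i. i \<le> n \<Longrightarrow> submodule (C i) R N"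
    "\<And>i. i < n \<Longrightarrow> C i \<subset> C (Suc i)"
    "\<And>i K. i < n \<Longrightarrow> submodule K R N \<Longrightarrow> C i \<subset> K \<Longrightarrow> K \<subset> C (Suc i) \<Longrightarrow> False"
    using assms(4) unfolding finite_length_def by metis
  define D where "D i = {x \<in> carrier M. f x \<in> C i}" for i
  have D0: "D 0 = {\<zero>\<^bsub>M\<^esub>}"
    using inj hom_zero[OF assms(1) f] by (auto simp: D_def C(1))
  have Dn: "D n = carrier M" using homD(1)[OF f] by (auto simp: D_def C(2))
  have Ds: "submodule (D i) R M" if "i \<le> n" for i
  proof (rule submoduleI_left)
    note s = N.submoduleD_left[OF C(3)[OF that]]
    show "\<zero>\<^bsub>M\<^esub> \<in> D i" using s(2) hom_zero[OF assms(1) f] by (simp add: D_def)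
  qed (auto simp: D_def homD[OF f] lsmult_closed N.submoduleD_left(3,4)[OF C(3)[OF that]])
  have Dm: "D i \<subseteq> D (Suc i)" if "i < n" for i using C(4)[OF that] by (auto simp: D_def)
  have Db: False if i: "i < n" and K: "submodule K R M" "D i \<subset> K" "K \<subset> D (Suc i)" for i K
  proof -
    note Ki = submoduleD_left[OF K(1)]
    have in': "i \<le> n" "Suc i \<le> n" using i by auto
    note s = N.submoduleD_left[OF C(3)[OF in'(1)]]
    note s' = N.submoduleD_left[OF C(3)[OF in'(2)]]
    define L where "L = {f k \<oplus>\<^bsub>N\<^esub> c | k c. k \<in> K \<and> c \<in> C i}"
    have LI: "f k \<oplus>\<^bsub>N\<^esub> c \<in> L" if "k \<in> K" "c \<in> C i" for k c using that by (auto simp: L_def)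
    have fK: "f k \<in> carrier N" if "k \<in> K" for k using homD(1)[OF f] Ki(1) that by blast
    have cN: "c \<in> carrier N" if "c \<in> C i" for c using s(1) that by blast
    have "submodule L R N"
    proof (rule N.submoduleI_left)
      show "L \<subseteq> carrier N" using fK cN by (auto simp: L_def)
      show "\<zero>\<^bsub>N\<^esub> \<in> L" using LI[OF Ki(2) s(2)] hom_zero[OF assms(1) f] by simp
      fix x assume "x \<in> L"
      then obtain k c where x: "k \<in> K" "c \<in> C i" "x = f k \<oplus>\<^bsub>N\<^esub> c" by (auto simp: L_def)
      { fix y assume "y \<in> L"
        then obtain k' c' where y: "k' \<in> K" "c' \<in> C i" "y = f k' \<oplus>\<^bsub>N\<^esub> c'" by (auto simp: L_def)
        have "x \<oplus>\<^bsub>N\<^esub> y = (f k \<oplus>\<^bsub>N\<^esub> f k') \<oplus>\<^bsub>N\<^esub> (c \<oplus>\<^bsub>N\<^esub> c')"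
          using x y fK cN by (simp add: N.M.a_ac)
        also have "f k \<oplus>\<^bsub>N\<^esub> f k' = f (k \<oplus>\<^bsub>M\<^esub> k')" using homD(2)[OF f] Ki(1) x y by (metis subsetD)
        finally show "x \<oplus>\<^bsub>N\<^esub> y \<in> L" using LI[OF Ki(3)[OF x(1) y(1)] s(3)[OF x(2) y(2)]] by simp }
      fix a assume a: "a \<in> carrier R"
      have "a \<odot>\<^bsub>N\<^esub> x = f (a \<odot>\<^bsub>M\<^esub> k) \<oplus>\<^bsub>N\<^esub> a \<odot>\<^bsub>N\<^esub> c"
        using a x fK cN homD(3)[OF f a] Ki(1) by (auto simp: N.lsmult_r_distr)
      then show "a \<odot>\<^bsub>N\<^esub> x \<in> L" using LI[OF Ki(4)[OF a x(1)] s(4)[OF a x(2)]] by simp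
    qed
    moreover have "C i \<subseteq> L"
    proof
      fix c assume c: "c \<in> C i"
      then show "c \<in> L" using LI[OF Ki(2) c] hom_zero[OF assms(1) f] cN by simp
    qed
    moreover have "L \<subseteq> C (Suc i)"
    proof
      fix x assume "x \<in> L"
      then obtain k c where x: "k \<in> K" "c \<in> C i" "x = f k \<oplus>\<^bsub>N\<^esub> c" by (auto simp: L_def)
      have "f k \<in> C (Suc i)" "c \<in> C (Suc i)" using x K(3) C(4)[OF i] by (auto simp: D_def)
      then show "x \<in> C (Suc i)" using s'(3) x(3) by simp
    qed
    ultimately consider "L = C i" | "L = C (Suc i)" using C(5)[OF i, of L] by blast
    then show False
    proof cases
      case 1
      have "K \<subseteq> D i"
      proof
        fix k assume k: "k \<in> K"
        then show "k \<in> D i" using LI[OF k s(2)] fK[OF k] Ki(1) 1 by (auto simp: D_def)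
      qed
      then show False using K(2) by blast
    next
      case 2
      have "D (Suc i) \<subseteq> K"
      proof
        fix z assume z: "z \<in> D (Suc i)"
        then have zM: "z \<in> carrier M" and "f z \<in> L" using 2 by (auto simp: D_def)
        then obtain k c where x: "k \<in> K" "c \<in> C i" "f z = f k \<oplus>\<^bsub>N\<^esub> c" by (auto simp: L_def)
        have kM: "k \<in> carrier M" using Ki(1) x(1) by blast
        define d where "d = \<ominus>\<^bsub>M\<^esub> k \<oplus>\<^bsub>M\<^esub> z"
        have dM: "d \<in> carrier M" using kM zM by (simp add: d_def)
        have zd: "z = k \<oplus>\<^bsub>M\<^esub> d" using kM zM by (simp add: d_def M.r_neg1 M.r_neg2)
        have "f k \<oplus>\<^bsub>N\<^esub> f d = f k \<oplus>\<^bsub>N\<^esub> c" using homD(2)[OF f kM dM] x(3) zd by simp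
        then have "f d = c" using fK[OF x(1)] homD(1)[OF f dM] cN[OF x(2)] by simp
        then have "d \<in> D i" using dM x(2) by (simp add: D_def)
        then show "z \<in> K" using K(2) Ki(3) x(1) zd by blast
      qed
      then show False using K(3) by blast
    qed
  qed
  from finite_length_weak[of D M n R, OF D0 Ds Dm Db]
  show ?thesis unfolding finite_length_def Dn .
qed


lemma topological_module_left_module: "topological_module R TR M TM \<Longrightarrow> left_module R M"
  by (simp add: topological_module_def)

lemma (in left_module) coset_closed:
  assumes "abelian_subgroup U M" "x \<in> carrier M" "y \<in> U +>\<^bsub>M\<^esub> x"
  shows "y \<in> carrier M"
proof -
  interpret U: abelian_subgroup U M by fact
  show ?thesis using M.a_r_coset_subset_G[OF U.a_subset assms(2)] assms(3) by blast
qed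

lemma coset_open:
  assumes T: "topological_abelian_group M TM" and U: "abelian_subgroup U M" "openin TM U"
    and x: "x \<in> carrier M"
  shows "openin TM (U +>\<^bsub>M\<^esub> x)"
proof -
  interpret U: abelian_subgroup U M by fact
  have tM: "topspace TM = carrier M" and
    cont: "continuous_map (prod_topology TM TM) TM (\<lambda>(x, y). x \<oplus>\<^bsub>M\<^esub> y)"
    using T by (auto simp: topological_abelian_group_def)
  have "continuous_map TM (prod_topology TM TM) (\<lambda>y. (y, \<ominus>\<^bsub>M\<^esub> x))"
    using x tM by (intro continuous_map_pairedI) auto
  from continuous_map_compose[OF this cont]
  have "continuous_map TM TM (\<lambda>y. y \<oplus>\<^bsub>M\<^esub> \<ominus>\<^bsub>M\<^esub> x)" by (simp add: o_def)
  from openin_continuous_map_preimage[OF this U(2)]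
  have "openin TM {y \<in> carrier M. y \<oplus>\<^bsub>M\<^esub> \<ominus>\<^bsub>M\<^esub> x \<in> U}" by (simp add: tM)
  also have "{y \<in> carrier M. y \<oplus>\<^bsub>M\<^esub> \<ominus>\<^bsub>M\<^esub> x \<in> U} = U +>\<^bsub>M\<^esub> x"
  proof (intro Set.set_eqI iffI)
    fix y assume y: "y \<in> {y \<in> carrier M. y \<oplus>\<^bsub>M\<^esub> \<ominus>\<^bsub>M\<^esub> x \<in> U}"
    then have "y = (y \<oplus>\<^bsub>M\<^esub> \<ominus>\<^bsub>M\<^esub> x) \<oplus>\<^bsub>M\<^esub> x" using x by (simp add: U.a_assoc U.l_neg)
    then show "y \<in> U +>\<^bsub>M\<^esub> x" using y unfolding mem_a_r_coset by blast
  next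
    fix y assume "y \<in> U +>\<^bsub>M\<^esub> x"
    then obtain u where u: "u \<in> U" "y = u \<oplus>\<^bsub>M\<^esub> x" unfolding mem_a_r_coset by blast
    have uM: "u \<in> carrier M" using u(1) U.a_subset by blast
    then have "y \<oplus>\<^bsub>M\<^esub> \<ominus>\<^bsub>M\<^esub> x = u" using x u(2) by (simp add: U.a_assoc U.r_neg)
    then show "y \<in> {y \<in> carrier M. y \<oplus>\<^bsub>M\<^esub> \<ominus>\<^bsub>M\<^esub> x \<in> U}" using u uM x by simp
  qed
  finally show ?thesis .
qed

lemma quot_discrete:
  assumes tm: "topological_module R TR M TM" and U: "submodule U R M" "openin TM U"
  shows "topological_module R TR (quot_module M U) (discrete_topology (carrier (quot_module M U)))"
proof -
  interpret left_module R M using tm by (rule topological_module_left_module)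
  interpret U: abelian_subgroup U M using submodule_abelian_subgroup[OF U(1)] .
  let ?Q = "quot_module M U"
  note q = quot_module_facts[OF U(1)]
  interpret Q: left_module R ?Q by (rule q(1))
  have T: "topological_ring R TR" "topological_abelian_group M TM"
    "continuous_map (prod_topology TR TM) TM (\<lambda>(r, x). r \<odot>\<^bsub>M\<^esub> x)"
    using tm by (auto simp: topological_module_def)
  have tR: "topspace TR = carrier R" and tM: "topspace TM = carrier M"
    using T by (auto simp: topological_ring_def topological_abelian_group_def)
  have "continuous_map (prod_topology TR (discrete_topology (carrier ?Q))) (discrete_topology (carrier ?Q))
    (\<lambda>(r, x). r \<odot>\<^bsub>?Q\<^esub> x)"
    unfolding continuous_map_def
  proof (intro conjI allI impI)
    show "(\<lambda>(r, x). r \<odot>\<^bsub>?Q\<^esub> x) \<in> topspace (prod_topology TR (discrete_topology (carrier ?Q))) \<rightarrow>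
        topspace (discrete_topology (carrier ?Q))"
      by (auto simp: tR Q.lsmult_closed)
    fix S assume "openin (discrete_topology (carrier ?Q)) S"
    then have S: "S \<subseteq> carrier ?Q" by simp
    have oS: "openin TM (\<Union>S)"
      using S coset_open[OF T(2) U.is_abelian_subgroup U(2)] unfolding q(2) by blast
    have o1: "openin TR {r \<in> carrier R. r \<odot>\<^bsub>?Q\<^esub> c \<in> S}" if c: "c \<in> carrier ?Q" for c
    proof -
      obtain x where x: "x \<in> carrier M" "c = U +>\<^bsub>M\<^esub> x" using c unfolding q(2) by blast
      have "continuous_map TR (prod_topology TR TM) (\<lambda>r. (r, x))"
        using x tM by (intro continuous_map_pairedI) auto
      from continuous_map_compose[OF this T(3)]
      have "continuous_map TR TM (\<lambda>r. r \<odot>\<^bsub>M\<^esub> x)" by (simp add: o_def)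
      from openin_continuous_map_preimage[OF this oS]
      have "openin TR {r \<in> carrier R. r \<odot>\<^bsub>M\<^esub> x \<in> \<Union>S}" by (simp add: tR)
      moreover have "r \<odot>\<^bsub>M\<^esub> x \<in> \<Union>S \<longleftrightarrow> r \<odot>\<^bsub>?Q\<^esub> c \<in> S" if r: "r \<in> carrier R" for r
      proof
        have rx: "r \<odot>\<^bsub>M\<^esub> x \<in> carrier M" using r x lsmult_closed by blast
        { assume "r \<odot>\<^bsub>?Q\<^esub> c \<in> S"
          then show "r \<odot>\<^bsub>M\<^esub> x \<in> \<Union>S" using q(4)[OF r x(1)] x(2) U.a_rcos_self[OF rx] by auto }
        assume "r \<odot>\<^bsub>M\<^esub> x \<in> \<Union>S"
        then obtain y where y: "y \<in> carrier M" "U +>\<^bsub>M\<^esub> y \<in> S" "r \<odot>\<^bsub>M\<^esub> x \<in> U +>\<^bsub>M\<^esub> y"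
          using S unfolding q(2) by blast
        then have "U +>\<^bsub>M\<^esub> y = U +>\<^bsub>M\<^esub> (r \<odot>\<^bsub>M\<^esub> x)"
          using M.a_repr_independence[OF _ y(1) U.a_subgroup] by blast
        then show "r \<odot>\<^bsub>?Q\<^esub> c \<in> S" using q(4)[OF r x(1)] x(2) y(2) by simp
      qed
      ultimately show ?thesis by (metis (mono_tags, lifting) Collect_cong)
    qed
    have "{z \<in> topspace (prod_topology TR (discrete_topology (carrier ?Q))).
        (case z of (r, x) \<Rightarrow> r \<odot>\<^bsub>?Q\<^esub> x) \<in> S} =
        (\<Union>c\<in>carrier ?Q. {r \<in> carrier R. r \<odot>\<^bsub>?Q\<^esub> c \<in> S} \<times> {c})"
      by (auto simp: tR)
    moreover have "openin (prod_topology TR (discrete_topology (carrier ?Q)))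
        (\<Union>c\<in>carrier ?Q. {r \<in> carrier R. r \<odot>\<^bsub>?Q\<^esub> c \<in> S} \<times> {c})"
      using o1 by (intro openin_Union) (auto simp: openin_prod_Times_iff)
    ultimately show "openin (prod_topology TR (discrete_topology (carrier ?Q)))
      {z \<in> topspace (prod_topology TR (discrete_topology (carrier ?Q))).
        (case z of (r, x) \<Rightarrow> r \<odot>\<^bsub>?Q\<^esub> x) \<in> S}" by simp
  qed
  moreover have "topological_abelian_group ?Q (discrete_topology (carrier ?Q))"
    by (auto simp: topological_abelian_group_def Q.M.abelian_group_axioms
        prod_topology_discrete_topology[symmetric])
  ultimately show ?thesis using T(1) q(1) by (simp add: topological_module_def)
qed

lemma inv_lim_iff:
  "x \<in> topspace (inv_lim I leq T f) \<longleftrightarrow>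
    x \<in> (\<Pi>\<^sub>E i\<in>I. topspace (T i)) \<and> (\<forall>i\<in>I. \<forall>j\<in>I. leq i j \<longrightarrow> f i j (x j) = x i)"
  by (auto simp: inv_lim_def topspace_subtopology)

lemma inv_lim_proj:
  "i \<in> I \<Longrightarrow> continuous_map (inv_lim I leq T f) (T i) (\<lambda>x. x i)"
  unfolding inv_lim_def by (intro continuous_map_from_subtopology continuous_map_product_projection)

lemma continuous_map_inv_limI:
  assumes "\<And>i. i \<in> I \<Longrightarrow> continuous_map S (T i) (\<lambda>z. g z i)"
    and "\<And>z. z \<in> topspace S \<Longrightarrow> g z \<in> extensional I"
    and "\<And>z i j. z \<in> topspace S \<Longrightarrow> i \<in> I \<Longrightarrow> j \<in> I \<Longrightarrow> leq i j \<Longrightarrow> f i j (g z j) = g z i"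
  shows "continuous_map S (inv_lim I leq T f) g"
  unfolding inv_lim_def
  by (intro continuous_map_into_subtopology) (use assms in \<open>auto simp: continuous_map_componentwise\<close>)

lemma discrete_limit_canonical:
  fixes f :: "'i \<Rightarrow> 'i \<Rightarrow> 'x \<Rightarrow> 'x"
  assumes tm: "topological_module R TR M TM"
    and sys: "discrete_system R TR I leq N f"
    and lim: "is_discrete_limit R M TM I leq N f p"
  defines "J \<equiv> (\<lambda>i. a_kernel M (N i) (p i)) ` I"
  shows "J \<subseteq> open_submodules R M TM"
    and "discrete_system R TR J (\<lambda>U V. V \<subseteq> U) (quot_module M) (\<lambda>U V. coset_map M U (\<lambda>x. x))"
    and "is_discrete_limit R M TM J (\<lambda>U V. V \<subseteq> U) (quot_module M) (\<lambda>U V. coset_map M U (\<lambda>x. x))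
           (\<lambda>U x. U +>\<^bsub>M\<^esub> x)"
proof -
  interpret left_module R M using tm by (rule topological_module_left_module)
  define K where "K i = a_kernel M (N i) (p i)" for i
  let ?L = "inv_lim I leq (\<lambda>i. discrete_topology (carrier (N i))) f"
  let ?P = "\<lambda>x. \<lambda>i\<in>I. p i x"
  have tM: "topspace TM = carrier M" and tag: "topological_abelian_group M TM"
    using tm by (auto simp: topological_module_def topological_abelian_group_def)
  have dir: "directed_on I leq" using sys by (simp add: discrete_system_def)
  have lN: "left_module R (N i)" if "i \<in> I" for i
    using sys that by (auto simp: discrete_system_def topological_module_def)
  have hp: "p i \<in> module_homs R M (N i)" if "i \<in> I" for i
    using lim that by (simp add: is_discrete_limit_def)
  have hom: "homeomorphic_map TM ?L ?P" using lim by (simp add: is_discrete_limit_def)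
  have contp: "continuous_map TM (discrete_topology (carrier (N i))) (p i)" if "i \<in> I" for i
    using continuous_map_compose[OF homeomorphic_imp_continuous_map[OF hom] inv_lim_proj[OF that]] that
    by (simp add: o_def)
  have compat: "f i j (p j x) = p i x" if "i \<in> I" "j \<in> I" "leq i j" "x \<in> carrier M" for i j x
  proof -
    have "?P x \<in> topspace ?L"
      using homeomorphic_imp_surjective_map[OF hom] that(4) tM by blast
    then have "f i j (?P x j) = ?P x i" using that unfolding inv_lim_iff by blast
    then show ?thesis using that by simp
  qed
  have Ks: "submodule (K i) R M" if "i \<in> I" for i
    unfolding K_def by (rule kernel_submodule[OF lN[OF that] hp[OF that]])
  have Ka: "abelian_subgroup (K i) M" if "i \<in> I" for i
    using submodule_abelian_subgroup[OF Ks[OF that]] .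
  have Ko: "openin TM (K i)" if i: "i \<in> I" for i
  proof -
    interpret Ni: left_module R "N i" by (rule lN[OF i])
    have "openin TM {x \<in> topspace TM. p i x \<in> {\<zero>\<^bsub>N i\<^esub>}}"
      by (rule openin_continuous_map_preimage[OF contp[OF i]]) simp
    then show ?thesis by (simp add: K_def a_kernel_def kernel_def tM)
  qed
  have eq: "K i +>\<^bsub>M\<^esub> x = K i +>\<^bsub>M\<^esub> y \<longleftrightarrow> p i x = p i y" "y \<in> K i +>\<^bsub>M\<^esub> x \<longleftrightarrow> p i x = p i y"
    if "i \<in> I" "x \<in> carrier M" "y \<in> carrier M" for i x y
    using coset_eq_kernel_iff[OF lN[OF that(1)] hp[OF that(1)] that(2,3)] by (simp_all add: K_def)
  have Kmono: "K j \<subseteq> K i" if "i \<in> I" "j \<in> I" "leq i j" for i j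
  proof
    fix x assume x: "x \<in> K j"
    interpret Nj: left_module R "N j" by (rule lN[OF that(2)])
    have fh: "f i j \<in> module_homs R (N j) (N i)" using sys that by (auto simp: discrete_system_def)
    have "x \<in> carrier M" "p j x = \<zero>\<^bsub>N j\<^esub>" using x by (auto simp: K_def a_kernel_def kernel_def)
    then show "x \<in> K i" using compat[OF that] Nj.hom_zero[OF lN[OF that(1)] fh]
      by (metis (mono_tags, lifting) K_def a_kernel_def kernel_def mem_Collect_eq
          partial_object.select_convs(1) monoid.select_convs(2))
  qed
  have J: "J = K ` I" by (simp add: J_def K_def)
  show Jo: "J \<subseteq> open_submodules R M TM" using Ks Ko by (auto simp: J open_submodules_def)
  have Js: "submodule U R M" "openin TM U" if "U \<in> J" for U
    using Jo that by (auto simp: open_submodules_def)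
  have Ja: "abelian_subgroup U M" if "U \<in> J" for U
    using submodule_abelian_subgroup[OF Js(1)[OF that]] .
  have idh: "(\<lambda>x. x) \<in> hom (add_monoid M) (add_monoid M)" by (auto simp: hom_def)
  have cm: "coset_map M U (\<lambda>x. x) (V +>\<^bsub>M\<^esub> x) = U +>\<^bsub>M\<^esub> x"
    if "U \<in> J" "V \<in> J" "V \<subseteq> U" "x \<in> carrier M" for U V x
    using coset_map_coset[OF Ja[OF that(2)] Ja[OF that(1)] idh _ that(4)] that(3) by simp
  note q = quot_module_facts[OF Js(1)]
  show "discrete_system R TR J (\<lambda>U V. V \<subseteq> U) (quot_module M) (\<lambda>U V. coset_map M U (\<lambda>x. x))"
    unfolding discrete_system_def
  proof (intro conjI ballI impI)
    show "directed_on J (\<lambda>U V. V \<subseteq> U)"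
      unfolding directed_on_def
    proof (intro conjI ballI impI)
      show "J \<noteq> {}" using dir by (auto simp: J directed_on_def)
      fix U V assume "U \<in> J" "V \<in> J"
      then obtain i j where ij: "i \<in> I" "j \<in> I" "U = K i" "V = K j" by (auto simp: J)
      then obtain k where "k \<in> I" "leq i k" "leq j k" using dir unfolding directed_on_def by blast
      then show "\<exists>W\<in>J. W \<subseteq> U \<and> W \<subseteq> V" using Kmono ij by (auto simp: J)
    qed auto
    fix U assume U: "U \<in> J"
    show "topological_module R TR (quot_module M U) (discrete_topology (carrier (quot_module M U)))"
      by (rule quot_discrete[OF tm Js[OF U]])
    { fix c assume "c \<in> carrier (quot_module M U)"
      then show "coset_map M U (\<lambda>x. x) c = c" using cm[OF U U] unfolding q(2)[OF U] by auto }
    fix V assume V: "V \<in> J"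
    { assume VU: "V \<subseteq> U"
      show "coset_map M U (\<lambda>x. x) \<in> module_homs R (quot_module M V) (quot_module M U)"
        unfolding module_homs_def hom_def
        using cm[OF U V VU] q(3,4)[OF U] q(3,4)[OF V]
        by (auto simp: q(2)[OF U] q(2)[OF V] lsmult_closed) }
    fix W c assume W: "W \<in> J" and le: "V \<subseteq> U" "W \<subseteq> V" and c: "c \<in> carrier (quot_module M W)"
    then obtain x where x: "x \<in> carrier M" "c = W +>\<^bsub>M\<^esub> x" unfolding q(2)[OF W] by blast
    have WU: "W \<subseteq> U" using le by blast
    show "coset_map M U (\<lambda>x. x) (coset_map M V (\<lambda>x. x) c) = coset_map M U (\<lambda>x. x) c"
      unfolding x(2) cm[OF V W le(2) x(1)] cm[OF U V le(1) x(1)] cm[OF U W WU x(1)] ..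
  qed
  let ?L' = "inv_lim J (\<lambda>U V. V \<subseteq> U) (\<lambda>U. discrete_topology (carrier (quot_module M U)))
    (\<lambda>U V. coset_map M U (\<lambda>x. x))"
  let ?P' = "\<lambda>x. \<lambda>U\<in>J. U +>\<^bsub>M\<^esub> x"
  obtain h where h: "homeomorphic_maps TM ?L ?P h" using hom homeomorphic_map_maps by blast
  have rep: "\<exists>y. y \<in> carrier M \<and> y \<in> z (K i) \<and> z (K i) = K i +>\<^bsub>M\<^esub> y"
    if z: "z \<in> topspace ?L'" and i: "i \<in> I" for z i
  proof -
    have "z (K i) \<in> carrier (quot_module M (K i))" using z i by (auto simp: inv_lim_iff J)
    then obtain y where "y \<in> carrier M" "z (K i) = K i +>\<^bsub>M\<^esub> y" using q(2) i by (auto simp: J)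
    then show ?thesis using abelian_subgroup.a_rcos_self[OF Ka[OF i]] by blast
  qed
  define g where "g z = (\<lambda>i\<in>I. p i (SOME y. y \<in> z (K i)))" for z
  have g: "g z i = p i y"
    if "z \<in> topspace ?L'" "i \<in> I" "y \<in> carrier M" "z (K i) = K i +>\<^bsub>M\<^esub> y" for z i y
  proof -
    let ?s = "SOME y. y \<in> z (K i)"
    have s: "?s \<in> z (K i)" using rep[OF that(1,2)] by (metis someI)
    then have "?s \<in> carrier M"
      using that coset_closed[OF Ka[OF that(2)] that(3)] by simp
    then show ?thesis using eq(2)[OF that(2,3)] s that by (simp add: g_def)
  qed
  have cg: "continuous_map ?L' ?L g"
  proof (rule continuous_map_inv_limI)
    fix i assume i: "i \<in> I"
    have KJ: "K i \<in> J" using i by (simp add: J)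
    have "continuous_map (discrete_topology (carrier (quot_module M (K i))))
        (discrete_topology (carrier (N i))) (\<lambda>c. p i (SOME y. y \<in> c))"
    proof (subst continuous_map_from_discrete_topology, rule Pi_I)
      fix c assume "c \<in> carrier (quot_module M (K i))"
      then obtain y where y: "y \<in> carrier M" "c = K i +>\<^bsub>M\<^esub> y" unfolding q(2)[OF KJ] by blast
      have "(SOME y. y \<in> c) \<in> c"
        using abelian_subgroup.a_rcos_self[OF Ka[OF i] y(1)] y(2) by (metis someI)
      then have "(SOME y. y \<in> c) \<in> carrier M"
        using coset_closed[OF Ka[OF i] y(1)] y(2) by simp
      then show "p i (SOME y. y \<in> c) \<in> topspace (discrete_topology (carrier (N i)))"
        using homD(1)[OF hp[OF i]] by simp
    qed
    moreover have "continuous_map ?L' (discrete_topology (carrier (quot_module M (K i)))) (\<lambda>z. z (K i))"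
      by (rule inv_lim_proj[OF KJ])
    ultimately have "continuous_map ?L' (discrete_topology (carrier (N i)))
        ((\<lambda>c. p i (SOME y. y \<in> c)) \<circ> (\<lambda>z. z (K i)))"
      by (rule continuous_map_compose[rotated])
    then show "continuous_map ?L' (discrete_topology (carrier (N i))) (\<lambda>z. g z i)"
      using i by (simp add: o_def g_def)
  next
    fix z assume z: "z \<in> topspace ?L'"
    show "g z \<in> extensional I" by (simp add: g_def)
    fix i j assume ij: "i \<in> I" "j \<in> I" "leq i j"
    then obtain y where y: "y \<in> carrier M" "z (K j) = K j +>\<^bsub>M\<^esub> y" using rep[OF z] by blast
    have KJ: "K i \<in> J" "K j \<in> J" using ij by (auto simp: J)
    have "z (K i) = coset_map M (K i) (\<lambda>x. x) (z (K j))"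
      using z KJ Kmono[OF ij] unfolding inv_lim_iff by metis
    then have "z (K i) = K i +>\<^bsub>M\<^esub> y" using cm[OF KJ Kmono[OF ij] y(1)] y(2) by simp
    then show "f i j (g z j) = g z i" using g[OF z] ij y compat by simp
  qed
  have cP: "continuous_map TM ?L' ?P'"
  proof (rule continuous_map_inv_limI)
    fix U assume U: "U \<in> J"
    have "continuous_map TM (discrete_topology (carrier (quot_module M U))) (\<lambda>x. U +>\<^bsub>M\<^esub> x)"
      unfolding continuous_map_def
    proof (intro conjI allI impI)
      show "(\<lambda>x. U +>\<^bsub>M\<^esub> x) \<in> topspace TM \<rightarrow> topspace (discrete_topology (carrier (quot_module M U)))"
        by (auto simp: tM q(2)[OF U])
      fix S assume "openin (discrete_topology (carrier (quot_module M U))) S"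
      then have S: "S \<subseteq> carrier (quot_module M U)" by simp
      have "openin TM (\<Union>S)"
        using S coset_open[OF tag Ja[OF U] Js(2)[OF U]] unfolding q(2)[OF U] by blast
      moreover have "{x \<in> topspace TM. U +>\<^bsub>M\<^esub> x \<in> S} = \<Union>S"
      proof (intro Set.set_eqI iffI)
        fix x assume "x \<in> {x \<in> topspace TM. U +>\<^bsub>M\<^esub> x \<in> S}"
        then show "x \<in> \<Union>S" using abelian_subgroup.a_rcos_self[OF Ja[OF U]] tM by auto
      next
        fix x assume "x \<in> \<Union>S"
        then obtain y where y: "y \<in> carrier M" "U +>\<^bsub>M\<^esub> y \<in> S" "x \<in> U +>\<^bsub>M\<^esub> y"
          using S unfolding q(2)[OF U] by blast
        have "x \<in> carrier M"
          using coset_closed[OF Ja[OF U] y(1,3)] .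
        moreover have "U +>\<^bsub>M\<^esub> y = U +>\<^bsub>M\<^esub> x"
          using M.a_repr_independence[OF y(3,1)] submodule.axioms(1)[OF Js(1)[OF U]] by blast
        ultimately show "x \<in> {x \<in> topspace TM. U +>\<^bsub>M\<^esub> x \<in> S}" using y tM by simp
      qed
      ultimately show "openin TM {x \<in> topspace TM. U +>\<^bsub>M\<^esub> x \<in> S}" by simp
    qed
    then show "continuous_map TM (discrete_topology (carrier (quot_module M U))) (\<lambda>x. ?P' x U)"
      using U by simp
  qed (auto simp: cm tM)
  have hL: "h w \<in> carrier M" if "w \<in> topspace ?L" for w
    using h that tM by (auto simp: homeomorphic_maps_def continuous_map_def)
  have gP: "g (?P' x) = ?P x" if "x \<in> carrier M" for x
  proof -
    have m: "?P' x \<in> topspace ?L'" using cP that tM unfolding continuous_map_def by blast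
    have "g (?P' x) i = ?P x i" for i
      using g[OF m _ that, of i] by (cases "i \<in> I") (auto simp: J g_def)
    then show ?thesis by blast
  qed
  have Pg: "?P' (h (g z)) = z" if z: "z \<in> topspace ?L'" for z
  proof -
    have gz: "g z \<in> topspace ?L" using cg z unfolding continuous_map_def by blast
    have "?P (h (g z)) = g z" using h gz by (simp add: homeomorphic_maps_def)
    then have pe: "p i (h (g z)) = g z i" if "i \<in> I" for i using that by (metis restrict_apply')
    have "?P' (h (g z)) U = z U" for U
    proof (cases "U \<in> J")
      case True
      then obtain i where i: "i \<in> I" "U = K i" by (auto simp: J)
      obtain y where y: "y \<in> carrier M" "z (K i) = K i +>\<^bsub>M\<^esub> y" using rep[OF z i(1)] by blast
      have "p i (h (g z)) = p i y" using pe[OF i(1)] g[OF z i(1) y] by simp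
      then show ?thesis using eq(1)[OF i(1) hL[OF gz] y(1)] y(2) i True by simp
    next
      case False
      then show ?thesis using z by (auto simp: inv_lim_iff PiE_def extensional_def)
    qed
    then show ?thesis by blast
  qed
  have "homeomorphic_maps TM ?L' ?P' (\<lambda>z. h (g z))"
    unfolding homeomorphic_maps_def
  proof (intro conjI ballI)
    show "continuous_map TM ?L' ?P'" by (rule cP)
    have "continuous_map ?L TM h" using h by (simp add: homeomorphic_maps_def)
    from continuous_map_compose[OF cg this] show "continuous_map ?L' TM (\<lambda>z. h (g z))" by (simp add: o_def)
    show "h (g (?P' x)) = x" if "x \<in> topspace TM" for x
      using gP[of x] that tM h by (simp add: homeomorphic_maps_def)
  qed (rule Pg)
  then have "homeomorphic_map TM ?L' ?P'" using homeomorphic_map_maps by blast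
  moreover have "(\<lambda>x. U +>\<^bsub>M\<^esub> x) \<in> module_homs R M (quot_module M U)" if U: "U \<in> J" for U
    unfolding module_homs_def hom_def using q(3,4)[OF U] by (auto simp: q(2)[OF U])
  ultimately show "is_discrete_limit R M TM J (\<lambda>U V. V \<subseteq> U) (quot_module M)
    (\<lambda>U V. coset_map M U (\<lambda>x. x)) (\<lambda>U x. U +>\<^bsub>M\<^esub> x)"
    by (simp add: is_discrete_limit_def)
qed

lemma pro_discreteI:
  assumes "topological_module R TR M TM"
    and "discrete_system R TR I leq N f" and "is_discrete_limit R M TM I leq N f p"
  shows "pro_discrete R TR M TM"
  using assms(1) discrete_limit_canonical(2,3)[OF assms] unfolding pro_discrete_def by blast

lemma pseudocompactI:
  assumes "topological_module R TR M TM"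
    and "discrete_system R TR I leq N f" and "\<And>i. i \<in> I \<Longrightarrow> finite_length R (N i)"
    and "is_discrete_limit R M TM I leq N f p"
  shows "pseudocompact R TR M TM"
proof -
  interpret left_module R M using assms(1) by (rule topological_module_left_module)
  have "finite_length R (quot_module M (a_kernel M (N i) (p i)))" if i: "i \<in> I" for i
  proof -
    let ?K = "a_kernel M (N i) (p i)"
    let ?Q = "quot_module M ?K"
    have lN: "left_module R (N i)"
      using assms(2) i by (auto simp: discrete_system_def topological_module_def)
    have hp: "p i \<in> module_homs R M (N i)" using assms(4) i by (simp add: is_discrete_limit_def)
    have Ks: "submodule ?K R M" by (rule kernel_submodule[OF lN hp])
    note q = quot_module_facts[OF Ks]
    interpret Q: left_module R ?Q by (rule q(1))
    interpret K: abelian_subgroup ?K M using submodule_abelian_subgroup[OF Ks] .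
    define g where "g c = p i (SOME y. y \<in> c)" for c
    have g: "g (?K +>\<^bsub>M\<^esub> x) = p i x" if x: "x \<in> carrier M" for x
    proof -
      let ?s = "SOME y. y \<in> ?K +>\<^bsub>M\<^esub> x"
      have s: "?s \<in> ?K +>\<^bsub>M\<^esub> x" using K.a_rcos_self[OF x] by (rule someI)
      then have "?s \<in> carrier M" using M.a_r_coset_subset_G[OF K.a_subset x] by blast
      then show ?thesis using coset_eq_kernel_iff(2)[OF lN hp x] s by (simp add: g_def)
    qed
    show ?thesis
    proof (rule Q.finite_length_pullback[OF lN _ _ assms(3)[OF i]])
      show "g \<in> module_homs R ?Q (N i)"
        unfolding module_homs_def hom_def
        using homD[OF hp] by (auto simp: q(2,3,4) g lsmult_closed)
      fix c assume "c \<in> carrier ?Q" and z: "g c = \<zero>\<^bsub>N i\<^esub>"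
      then obtain x where x: "x \<in> carrier M" "c = ?K +>\<^bsub>M\<^esub> x" unfolding q(2) by blast
      have "p i x = p i \<zero>\<^bsub>M\<^esub>" using z g[OF x(1)] x(2) hom_zero[OF lN hp] by simp
      then have "c = ?K +>\<^bsub>M\<^esub> \<zero>\<^bsub>M\<^esub>"
        using coset_eq_kernel_iff(1)[OF lN hp x(1) M.zero_closed] x(2) by simp
      then show "c = \<zero>\<^bsub>?Q\<^esub>" using K.a_subset by (simp add: q(5))
    qed
  qed
  then show ?thesis
    using assms(1) discrete_limit_canonical(2,3)[OF assms(1,2,4)] unfolding pseudocompact_def
    by (intro conjI) (blast intro: exI)+
qed

end

theory Submission
  imports Defs
begin

text \<open>The sequence is split exact as a sequence of topological abelian groups. A section of \<open>\<mu>\<close> is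
  \<open>m \<mapsto> 1 \<otimes> m\<close>, and a retraction \<open>s\<close> of \<open>\<kappa>\<close> comes from the derivation \<open>D\<close> from \<open>B\<close> to the completed
  tensor product of \<open>B\<^sup>\<sigma>\<close> and \<open>B\<close> over \<open>A\<close> that vanishes on \<open>A\<close> and sends \<open>t\<close> to \<open>1 \<otimes> 1\<close>. Such a
  derivation is compatible with the relation \<open>t a = \<sigma>(a) t + \<delta>(a)\<close> precisely because of the twist:
  \<open>D(t a) = 1 \<otimes> a = \<sigma>(a) \<otimes> 1 = D(\<sigma>(a) t + \<delta>(a))\<close>. Explicitly, \<open>D(a t\<^sup>n)\<close> is \<open>a\<close> times the sum of the
  \<open>t\<^sup>i \<otimes> t\<^sup>j\<close> with \<open>i + j = n - 1\<close>, and \<open>s (b \<otimes> m) = D(b) m\<close>. Leibniz' rule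
  \<open>D(b t) = D(b) t + b \<otimes> 1\<close> (\<open>D_mult_t\<close>) says that \<open>s \<kappa> = id\<close>. Clearly \<open>\<mu> \<kappa> = 0\<close>. Finally
  \<open>\<kappa> (s x) + 1 \<otimes> \<mu> x = x\<close>: for \<open>x = a t\<^sup>n \<otimes> m\<close> the sum \<open>\<kappa> (s x)\<close> telescopes to
  \<open>a t\<^sup>n \<otimes> m - a \<otimes> t\<^sup>n m\<close>. Exactness follows formally from these three identities (\<open>short_exact\<close>).

  The maps live on completed objects, so they are constructed and compared on topological
  generators. For maps out of \<open>B\<close> these are the monomials \<open>a t\<^sup>n\<close> (\<open>power_series_extension\<close>,
  \<open>monomials_generate\<close>), for maps out of a completed tensor product the elements \<open>p \<otimes> n\<close>
  (\<open>ctensor_universal\<close>, \<open>ce_generates\<close>). That \<open>D\<close> extends from monomials to power series rests on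
  \<open>t\<^sup>n \<rightarrow> 0\<close>: if \<open>i + j\<close> is large, then one factor of \<open>t\<^sup>i \<otimes> t\<^sup>j m\<close> is small (\<open>qsum_null\<close>).

  Two finiteness statements make everything pseudocompact and continuous. First, every
  neighbourhood of zero in \<open>B\<close> contains an open subbimodule \<open>W\<close> such that \<open>B/W\<close> has finite length
  over \<open>B\<close> (\<open>small_subbimodule\<close>). Hence the iterated limit over open right submodules that defines
  the completed tensor product is also a limit of the \<open>B\<close>-modules \<open>B/W \<otimes> M/V\<close>
  (\<open>ctensor_homeomorphic\<close>). Second, the discrete quotients \<open>M/V\<close> are finitely generated over \<open>A\<close>
  (\<open>M_finitely_generated\<close>). So \<open>B/W \<otimes> M/V\<close> is a quotient of a finite power of \<open>B/W\<close> and has finite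
  length. Moreover, if a balanced map is small for \<open>m\<close> in \<open>V\<close>, then it is small in \<open>b\<close> uniformly in all
  \<open>m\<close> as soon as it is small in \<open>b\<close> for each of finitely many generators of \<open>M/V\<close>, which is the continuity that the universal property requires of
  \<open>(b, m) \<mapsto> b m\<close> and of \<open>(b, m) \<mapsto> D(b) m\<close>.\<close>

section \<open>Tensor products over a noncommutative ring\<close>

lemma op_ring_simps [simp]:
  "carrier (op_ring R) = carrier R" "\<zero>\<^bsub>op_ring R\<^esub> = \<zero>\<^bsub>R\<^esub>" "\<one>\<^bsub>op_ring R\<^esub> = \<one>\<^bsub>R\<^esub>"
  "a \<oplus>\<^bsub>op_ring R\<^esub> b = a \<oplus>\<^bsub>R\<^esub> b" "a \<otimes>\<^bsub>op_ring R\<^esub> b = b \<otimes>\<^bsub>R\<^esub> a"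
  by (simp_all add: op_ring_def)

lemma (in comm_group) div_eq_one_iff:
  assumes "x \<in> carrier G" "y \<in> carrier G"
  shows "x \<otimes> inv y = \<one> \<longleftrightarrow> x = y"
proof
  assume "x \<otimes> inv y = \<one>"
  then have "x \<otimes> inv y \<otimes> y = y" using assms by simp
  then show "x = y" using assms by (simp add: m_assoc)
qed (use assms in simp)

lemma (in comm_group) div_div_eq_one_iff:
  assumes "x \<in> carrier G" "y \<in> carrier G" "z \<in> carrier G"
  shows "x \<otimes> inv y \<otimes> inv z = \<one> \<longleftrightarrow> x = y \<otimes> z"
proof -
  have "x \<otimes> inv y \<otimes> inv z = x \<otimes> inv (y \<otimes> z)"
    using assms by (simp add: inv_mult m_assoc)
  then show ?thesis using div_eq_one_iff[of x "y \<otimes> z"] assms by simp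
qed

locale tensor_factors =
  M: left_module "op_ring A" M + N: left_module A N
  for A :: "('a, 'z) ring_scheme" and M :: "('a, 'm, 'y) module_scheme"
    and N :: "('a, 'n, 'w) module_scheme"
begin

abbreviation "FG \<equiv> free_Abelian_group (carrier M \<times> carrier N)"
abbreviation "TG \<equiv> tensor A M N"
abbreviation "proj c \<equiv> tensor_rel A M N #>\<^bsub>FG\<^esub> c"
abbreviation "tens \<equiv> tensor_elem A M N"

lemma tensor_rel_subgroup: "subgroup (tensor_rel A M N) FG"
  unfolding tensor_rel_def
proof (rule group.generate_is_subgroup[OF group_free_Abelian_group])
  show "{frag_of (m \<oplus>\<^bsub>M\<^esub> m', n) - frag_of (m, n) - frag_of (m', n) | m m' n.
           m \<in> carrier M \<and> m' \<in> carrier M \<and> n \<in> carrier N} \<union>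
        {frag_of (m, n \<oplus>\<^bsub>N\<^esub> n') - frag_of (m, n) - frag_of (m, n') | m n n'.
           m \<in> carrier M \<and> n \<in> carrier N \<and> n' \<in> carrier N} \<union>
        {frag_of (a \<odot>\<^bsub>M\<^esub> m, n) - frag_of (m, a \<odot>\<^bsub>N\<^esub> n) | a m n.
           a \<in> carrier A \<and> m \<in> carrier M \<and> n \<in> carrier N} \<subseteq> carrier FG"
    by (intro Un_least subsetI) (auto dest!: subsetD[OF keys_diff] simp: M.lsmult_closed N.lsmult_closed)
qed

lemma tensor_rel_normal: "tensor_rel A M N \<lhd> FG"
  by (rule comm_group.subgroup_imp_normal[OF abelian_free_Abelian_group tensor_rel_subgroup])

lemma tensor_comm_group: "comm_group TG"
  unfolding tensor_def by (rule comm_group.abelian_FactGroup[OF abelian_free_Abelian_group tensor_rel_subgroup])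

lemma proj_hom: "proj \<in> hom FG TG"
  unfolding tensor_def by (rule normal.r_coset_hom_Mod[OF tensor_rel_normal])

sublocale T: comm_group TG by (rule tensor_comm_group)

lemma proj_diff:
  assumes "x \<in> carrier FG" "y \<in> carrier FG"
  shows "proj (x - y) = proj x \<otimes>\<^bsub>TG\<^esub> inv\<^bsub>TG\<^esub> proj y"
proof -
  interpret h: group_hom FG TG proj
    by (simp add: group_hom_def group_hom_axioms_def proj_hom T.is_group)
  have "proj (x \<otimes>\<^bsub>FG\<^esub> inv\<^bsub>FG\<^esub> y) = proj x \<otimes>\<^bsub>TG\<^esub> inv\<^bsub>TG\<^esub> proj y"
    using assms by (simp only: h.hom_mult h.hom_inv h.G.inv_closed)
  then show ?thesis using assms by simp
qed

lemma proj_rel: "c \<in> tensor_rel A M N \<Longrightarrow> proj c = \<one>\<^bsub>TG\<^esub>"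
  using group.coset_join2[OF group_free_Abelian_group _ tensor_rel_subgroup]
    subgroup.subset[OF tensor_rel_subgroup]
  by (metis (no_types, lifting) tensor_def one_FactGroup subsetD)

lemma carrier_tensor: "carrier TG = proj ` carrier FG"
  by (auto simp: tensor_def FactGroup_def RCOSETS_def)

lemma elem_closed [simp]: "m \<in> carrier M \<Longrightarrow> n \<in> carrier N \<Longrightarrow> tens m n \<in> carrier TG"
  unfolding carrier_tensor tensor_elem_def by simp

lemma elem_relation:
  assumes "frag_of (m1, n1) - frag_of (m2, n2) \<in> tensor_rel A M N"
    "m1 \<in> carrier M" "n1 \<in> carrier N" "m2 \<in> carrier M" "n2 \<in> carrier N"
  shows "tens m1 n1 = tens m2 n2"
proof -
  have "tens m1 n1 \<otimes>\<^bsub>TG\<^esub> inv\<^bsub>TG\<^esub> tens m2 n2 = \<one>\<^bsub>TG\<^esub>"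
    using proj_rel[OF assms(1)] proj_diff[of "frag_of (m1, n1)" "frag_of (m2, n2)"] assms(2-)
    by (simp add: tensor_elem_def)
  then show ?thesis using assms(2-) elem_closed by (metis T.inv_solve_right' T.one_closed T.l_one)
qed

lemma elem_relation3:
  assumes "frag_of (m1, n1) - frag_of (m2, n2) - frag_of (m3, n3) \<in> tensor_rel A M N"
    "m1 \<in> carrier M" "n1 \<in> carrier N" "m2 \<in> carrier M" "n2 \<in> carrier N" "m3 \<in> carrier M" "n3 \<in> carrier N"
  shows "tens m1 n1 = tens m2 n2 \<otimes>\<^bsub>TG\<^esub> tens m3 n3"
proof -
  have k: "Poly_Mapping.keys (frag_of (m1, n1) - frag_of (m2, n2)) \<subseteq> carrier M \<times> carrier N"
    using keys_diff[of "frag_of (m1, n1)" "frag_of (m2, n2)"] assms(2-) by auto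
  have "(tens m1 n1 \<otimes>\<^bsub>TG\<^esub> inv\<^bsub>TG\<^esub> tens m2 n2) \<otimes>\<^bsub>TG\<^esub> inv\<^bsub>TG\<^esub> tens m3 n3 = \<one>\<^bsub>TG\<^esub>"
    using proj_rel[OF assms(1)] proj_diff[of "frag_of (m1, n1) - frag_of (m2, n2)" "frag_of (m3, n3)"]
      proj_diff[of "frag_of (m1, n1)" "frag_of (m2, n2)"] assms(2-) k
    by (simp add: tensor_elem_def)
  then show ?thesis using assms(2-) by (simp add: T.div_div_eq_one_iff)
qed

lemma elem_add_left:
  assumes "m \<in> carrier M" "m' \<in> carrier M" "n \<in> carrier N"
  shows "tens (m \<oplus>\<^bsub>M\<^esub> m') n = tens m n \<otimes>\<^bsub>TG\<^esub> tens m' n"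
proof (rule elem_relation3)
  show "frag_of (m \<oplus>\<^bsub>M\<^esub> m', n) - frag_of (m, n) - frag_of (m', n) \<in> tensor_rel A M N"
    unfolding tensor_rel_def by (rule generate.incl) (use assms in blast)
qed (use assms in auto)

lemma elem_add_right:
  assumes "m \<in> carrier M" "n \<in> carrier N" "n' \<in> carrier N"
  shows "tens m (n \<oplus>\<^bsub>N\<^esub> n') = tens m n \<otimes>\<^bsub>TG\<^esub> tens m n'"
proof (rule elem_relation3)
  show "frag_of (m, n \<oplus>\<^bsub>N\<^esub> n') - frag_of (m, n) - frag_of (m, n') \<in> tensor_rel A M N"
    unfolding tensor_rel_def by (rule generate.incl) (use assms in blast)
qed (use assms in auto)

lemma elem_balanced:
  assumes "a \<in> carrier A" "m \<in> carrier M" "n \<in> carrier N"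
  shows "tens (a \<odot>\<^bsub>M\<^esub> m) n = tens m (a \<odot>\<^bsub>N\<^esub> n)"
proof (rule elem_relation)
  show "frag_of (a \<odot>\<^bsub>M\<^esub> m, n) - frag_of (m, a \<odot>\<^bsub>N\<^esub> n) \<in> tensor_rel A M N"
    unfolding tensor_rel_def by (rule generate.incl) (use assms in blast)
qed (use assms in \<open>auto simp: M.lsmult_closed N.lsmult_closed\<close>)

lemma tensor_induct [consumes 1, case_names tens one diff]:
  assumes "x \<in> carrier TG"
    and "\<And>m n. m \<in> carrier M \<Longrightarrow> n \<in> carrier N \<Longrightarrow> Q (tens m n)"
    and "Q \<one>\<^bsub>TG\<^esub>"
    and "\<And>x y. x \<in> carrier TG \<Longrightarrow> y \<in> carrier TG \<Longrightarrow> Q x \<Longrightarrow> Q y \<Longrightarrow> Q (x \<otimes>\<^bsub>TG\<^esub> inv\<^bsub>TG\<^esub> y)"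
  shows "Q x"
proof -
  have "Q (proj c)" if "Poly_Mapping.keys c \<subseteq> carrier M \<times> carrier N" for c
    using that
  proof (induction c rule: free_Abelian_group_induct[consumes 1, case_names zero diff frag])
    case zero
    then show ?case
      using proj_rel[of 0] assms(3) subgroup.one_closed[OF tensor_rel_subgroup] by simp
  next
    case (diff x y)
    then show ?case using proj_diff[of x y] assms(4)[of "proj x" "proj y"] carrier_tensor by auto
  next
    case (frag a)
    then show ?case using assms(2) unfolding tensor_elem_def by auto
  qed
  then show ?thesis using assms(1) unfolding carrier_tensor by auto
qed

lemma tensor_universal:
  assumes H: "comm_group H"
    and cl: "\<And>m n. m \<in> carrier M \<Longrightarrow> n \<in> carrier N \<Longrightarrow> \<phi> m n \<in> carrier H"
    and l: "\<And>m m' n. m \<in> carrier M \<Longrightarrow> m' \<in> carrier M \<Longrightarrow> n \<in> carrier N \<Longrightarrow>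
      \<phi> (m \<oplus>\<^bsub>M\<^esub> m') n = \<phi> m n \<otimes>\<^bsub>H\<^esub> \<phi> m' n"
    and r: "\<And>m n n'. m \<in> carrier M \<Longrightarrow> n \<in> carrier N \<Longrightarrow> n' \<in> carrier N \<Longrightarrow>
      \<phi> m (n \<oplus>\<^bsub>N\<^esub> n') = \<phi> m n \<otimes>\<^bsub>H\<^esub> \<phi> m n'"
    and b: "\<And>a m n. a \<in> carrier A \<Longrightarrow> m \<in> carrier M \<Longrightarrow> n \<in> carrier N \<Longrightarrow>
      \<phi> (a \<odot>\<^bsub>M\<^esub> m) n = \<phi> m (a \<odot>\<^bsub>N\<^esub> n)"
  obtains h where "h \<in> hom TG H" "\<And>m n. m \<in> carrier M \<Longrightarrow> n \<in> carrier N \<Longrightarrow> h (tens m n) = \<phi> m n"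
proof -
  interpret H: comm_group H by (rule H)
  obtain g where g: "g \<in> hom FG H" "\<And>x. x \<in> carrier M \<times> carrier N \<Longrightarrow> g (frag_of x) = case_prod \<phi> x"
  proof (rule H.free_Abelian_group_universal[of "case_prod \<phi>" "carrier M \<times> carrier N"])
    show "case_prod \<phi> ` (carrier M \<times> carrier N) \<subseteq> carrier H" using cl by auto
  qed (rule that)
  interpret g: group_hom FG H g
    by (simp add: group_hom_def group_hom_axioms_def g(1) H.is_group)
  have gd: "g (x - y) = g x \<otimes>\<^bsub>H\<^esub> inv\<^bsub>H\<^esub> g y" "x - y \<in> carrier FG"
    if "x \<in> carrier FG" "y \<in> carrier FG" for x y
  proof -
    have e: "x - y = x \<otimes>\<^bsub>FG\<^esub> inv\<^bsub>FG\<^esub> y" using that(2) by simp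
    show "g (x - y) = g x \<otimes>\<^bsub>H\<^esub> inv\<^bsub>H\<^esub> g y" "x - y \<in> carrier FG"
      unfolding e by (simp_all only: that g.hom_mult g.hom_inv g.G.inv_closed g.G.m_closed)
  qed
  have "tensor_rel A M N \<subseteq> kernel FG H g"
    unfolding tensor_rel_def
  proof (rule g.G.generate_subgroup_incl[OF _ g.subgroup_kernel], intro Un_least subsetI)
    have fr: "frag_of (m, n) \<in> carrier FG" "g (frag_of (m, n)) = \<phi> m n" "\<phi> m n \<in> carrier H"
      if "m \<in> carrier M" "n \<in> carrier N" for m n
      using that g(2) cl by auto
    have k3: "frag_of (m1, n1) - frag_of (m2, n2) - frag_of (m3, n3) \<in> kernel FG H g"
      if "\<phi> m1 n1 = \<phi> m2 n2 \<otimes>\<^bsub>H\<^esub> \<phi> m3 n3"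
        "m1 \<in> carrier M" "n1 \<in> carrier N" "m2 \<in> carrier M" "n2 \<in> carrier N" "m3 \<in> carrier M" "n3 \<in> carrier N"
      for m1 n1 m2 n2 m3 n3
    proof -
      note f = fr[OF that(2,3)] fr[OF that(4,5)] fr[OF that(6,7)]
      let ?d = "frag_of (m1, n1) - frag_of (m2, n2)"
      have d: "?d \<in> carrier FG" by (rule gd(2)[OF f(1) f(4)])
      have "g (?d - frag_of (m3, n3)) = \<phi> m1 n1 \<otimes>\<^bsub>H\<^esub> inv\<^bsub>H\<^esub> \<phi> m2 n2 \<otimes>\<^bsub>H\<^esub> inv\<^bsub>H\<^esub> \<phi> m3 n3"
        unfolding gd(1)[OF d f(7)] gd(1)[OF f(1) f(4)] f(2,5,8) ..
      also have "\<dots> = \<one>\<^bsub>H\<^esub>" using H.div_div_eq_one_iff[OF f(3,6,9)] that(1) by (rule iffD2)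
      finally show ?thesis using gd(2)[OF d f(7)] unfolding kernel_def by blast
    qed
    {
      fix x assume "x \<in> {frag_of (m \<oplus>\<^bsub>M\<^esub> m', n) - frag_of (m, n) - frag_of (m', n) | m m' n.
           m \<in> carrier M \<and> m' \<in> carrier M \<and> n \<in> carrier N}"
      then obtain m m' n where x: "x = frag_of (m \<oplus>\<^bsub>M\<^esub> m', n) - frag_of (m, n) - frag_of (m', n)"
        "m \<in> carrier M" "m' \<in> carrier M" "n \<in> carrier N" by blast
      show "x \<in> kernel FG H g" unfolding x(1) by (rule k3[OF l[OF x(2-4)]]) (use x in auto)
    next
      fix x assume "x \<in> {frag_of (m, n \<oplus>\<^bsub>N\<^esub> n') - frag_of (m, n) - frag_of (m, n') | m n n'.
           m \<in> carrier M \<and> n \<in> carrier N \<and> n' \<in> carrier N}"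
      then obtain m n n' where x: "x = frag_of (m, n \<oplus>\<^bsub>N\<^esub> n') - frag_of (m, n) - frag_of (m, n')"
        "m \<in> carrier M" "n \<in> carrier N" "n' \<in> carrier N" by blast
      show "x \<in> kernel FG H g" unfolding x(1) by (rule k3[OF r[OF x(2-4)]]) (use x in auto)
    next
      fix x assume "x \<in> {frag_of (a \<odot>\<^bsub>M\<^esub> m, n) - frag_of (m, a \<odot>\<^bsub>N\<^esub> n) | a m n.
           a \<in> carrier A \<and> m \<in> carrier M \<and> n \<in> carrier N}"
      then obtain a m n where x: "x = frag_of (a \<odot>\<^bsub>M\<^esub> m, n) - frag_of (m, a \<odot>\<^bsub>N\<^esub> n)"
        "a \<in> carrier A" "m \<in> carrier M" "n \<in> carrier N" by blast
      have c: "a \<odot>\<^bsub>M\<^esub> m \<in> carrier M" "a \<odot>\<^bsub>N\<^esub> n \<in> carrier N"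
        using x by (auto simp: M.lsmult_closed N.lsmult_closed)
      note f = fr[OF c(1) x(4)] fr[OF x(3) c(2)]
      have "g x = \<one>\<^bsub>H\<^esub>"
        unfolding x(1) gd(1)[OF f(1) f(4)] f(2,5) b[OF x(2-4)] using f(6) by (rule H.r_inv)
      then show "x \<in> kernel FG H g" using gd(2)[OF f(1) f(4)] unfolding x(1) kernel_def by blast
    }
  qed
  then have ker: "tensor_rel A M N \<subseteq> kernel FG H g" .
  obtain h where h: "h \<in> hom (FG Mod tensor_rel A M N) H" "\<And>x. x \<in> carrier FG \<Longrightarrow> h (proj x) = g x"
    by (rule g.FactGroup_universal_kernel[OF tensor_rel_normal ker]) (rule that)
  show ?thesis
  proof (rule that)
    show "h \<in> hom TG H" using h(1) by (simp add: tensor_def)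
    show "h (tens m n) = \<phi> m n" if "m \<in> carrier M" "n \<in> carrier N" for m n
      using h(2)[of "frag_of (m, n)"] g(2)[of "(m, n)"] that by (simp add: tensor_elem_def)
  qed
qed

end

text \<open>The set-theoretic value of \<^const>\<open>tensor_map\<close> at a coset is a union over representatives; all
  of them contribute the same coset because \<open>f\<close> and \<open>g\<close> respect the tensor relations.\<close>

lemma tensor_map_hom:
  assumes "tensor_factors A K L" "tensor_factors A M N"
    and f: "f \<in> module_homs (op_ring A) K M" and g: "g \<in> module_homs A L N"
  shows "tensor_map A M N f g \<in> hom (tensor A K L) (tensor A M N)"
    and "k \<in> carrier K \<Longrightarrow> l \<in> carrier L \<Longrightarrow>
      tensor_map A M N f g (tensor_elem A K L k l) = tensor_elem A M N (f k) (g l)"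
proof -
  interpret S: tensor_factors A K L by fact
  interpret T: tensor_factors A M N by fact
  note F = S.M.homD[OF f] and G = S.N.homD[OF g]
  let ?e = "\<lambda>(k, l). frag_of (f k, g l)"
  obtain h where h: "h \<in> hom S.TG T.TG"
    "\<And>k l. k \<in> carrier K \<Longrightarrow> l \<in> carrier L \<Longrightarrow> h (S.tens k l) = T.tens (f k) (g l)"
    by (rule S.tensor_universal[OF T.tensor_comm_group, of "\<lambda>k l. T.tens (f k) (g l)"])
      (use F G in \<open>auto simp: T.elem_add_left T.elem_add_right T.elem_balanced\<close>)
  have key: "T.proj (frag_extend ?e c) = h (S.proj c) \<and> frag_extend ?e c \<in> carrier T.FG"
    if "Poly_Mapping.keys c \<subseteq> carrier K \<times> carrier L" for c
    using that
  proof (induction c rule: free_Abelian_group_induct[consumes 1, case_names zero diff frag])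
    case zero
    interpret h: group_hom S.TG T.TG h
      by (simp add: group_hom_def group_hom_axioms_def h(1) S.T.is_group T.T.is_group)
    have "S.proj 0 = \<one>\<^bsub>S.TG\<^esub>" "T.proj 0 = \<one>\<^bsub>T.TG\<^esub>"
      using S.proj_rel[of 0] T.proj_rel[of 0] subgroup.one_closed[OF S.tensor_rel_subgroup]
        subgroup.one_closed[OF T.tensor_rel_subgroup] by simp_all
    then show ?case by simp
  next
    case (diff x y)
    interpret h: group_hom S.TG T.TG h
      by (simp add: group_hom_def group_hom_axioms_def h(1) S.T.is_group T.T.is_group)
    have c: "S.proj x \<in> carrier S.TG" "S.proj y \<in> carrier S.TG"
      using diff S.carrier_tensor by auto
    have "Poly_Mapping.keys (frag_extend ?e x - frag_extend ?e y) \<subseteq> carrier M \<times> carrier N"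
      using diff keys_diff[of "frag_extend ?e x" "frag_extend ?e y"] by auto
    moreover have "h (S.proj (x - y)) = h (S.proj x) \<otimes>\<^bsub>T.TG\<^esub> inv\<^bsub>T.TG\<^esub> h (S.proj y)"
      using S.proj_diff[of x y] diff c by simp
    ultimately show ?case using diff T.proj_diff[of "frag_extend ?e x" "frag_extend ?e y"]
      by (simp add: frag_extend_diff)
  next
    case (frag a)
    then show ?case using h(2) F(1) G(1) by (auto simp: tensor_elem_def split: prod.splits)
  qed
  have eq: "tensor_map A M N f g x = h x" if x: "x \<in> carrier S.TG" for x
  proof -
    obtain c where c: "c \<in> carrier S.FG" "x = S.proj c" using x unfolding S.carrier_tensor by blast
    have "S.proj d = x \<and> d \<in> carrier S.FG" if "d \<in> x" for d
    proof -
      have "d \<in> carrier S.FG"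
        using monoid.r_coset_subset_G[OF group.is_monoid[OF group_free_Abelian_group]
            subgroup.subset[OF S.tensor_rel_subgroup] c(1)] that unfolding c(2) by blast
      moreover have "S.proj c = S.proj d"
        by (rule group.repr_independence[OF group_free_Abelian_group]) (use that c S.tensor_rel_subgroup in auto)
      ultimately show ?thesis using c by simp
    qed
    then have "\<And>d. d \<in> x \<Longrightarrow> T.proj (frag_extend ?e d) = h x" using key by auto
    moreover have "c \<in> x"
      unfolding c(2) by (rule group.rcos_self[OF group_free_Abelian_group c(1) S.tensor_rel_subgroup]) 
    ultimately show ?thesis unfolding tensor_map_def by blast
  qed
  show "tensor_map A M N f g \<in> hom S.TG T.TG"
  proof (rule homI)
    fix x y assume xy: "x \<in> carrier S.TG" "y \<in> carrier S.TG"
    show "tensor_map A M N f g x \<in> carrier T.TG" using eq h(1) xy by (metis hom_in_carrier)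
    show "tensor_map A M N f g (x \<otimes>\<^bsub>S.TG\<^esub> y) = tensor_map A M N f g x \<otimes>\<^bsub>T.TG\<^esub> tensor_map A M N f g y"
      using eq xy hom_mult[OF h(1) xy] by simp
  qed
  show "tensor_map A M N f g (S.tens k l) = T.tens (f k) (g l)" if "k \<in> carrier K" "l \<in> carrier L"
    using eq h(2) that by simp
qed

section \<open>Topological abelian groups\<close>

lemma additive_homD:
  assumes "f \<in> hom (add_monoid E) (add_monoid Y)"
  shows "\<And>x. x \<in> carrier E \<Longrightarrow> f x \<in> carrier Y"
    and "\<And>x y. x \<in> carrier E \<Longrightarrow> y \<in> carrier E \<Longrightarrow> f (x \<oplus>\<^bsub>E\<^esub> y) = f x \<oplus>\<^bsub>Y\<^esub> f y"
  using assms by (auto simp: hom_def)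

lemma additive_hom_diff:
  assumes "abelian_group E" "abelian_group Y" "f \<in> hom (add_monoid E) (add_monoid Y)"
  shows "f \<zero>\<^bsub>E\<^esub> = \<zero>\<^bsub>Y\<^esub>"
    and "x \<in> carrier E \<Longrightarrow> f (\<ominus>\<^bsub>E\<^esub> x) = \<ominus>\<^bsub>Y\<^esub> f x"
    and "x \<in> carrier E \<Longrightarrow> y \<in> carrier E \<Longrightarrow> f (x \<ominus>\<^bsub>E\<^esub> y) = f x \<ominus>\<^bsub>Y\<^esub> f y"
proof -
  interpret E: abelian_group E by fact
  interpret Y: abelian_group Y by fact
  interpret f: group_hom "add_monoid E" "add_monoid Y" f
    using assms by (simp add: group_hom_def group_hom_axioms_def E.a_group Y.a_group)
  show "f \<zero>\<^bsub>E\<^esub> = \<zero>\<^bsub>Y\<^esub>" using f.hom_one by simp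
  show m: "f (\<ominus>\<^bsub>E\<^esub> x) = \<ominus>\<^bsub>Y\<^esub> f x" if "x \<in> carrier E" for x
    using f.hom_inv[of x] that by (simp add: a_inv_def)
  show "f (x \<ominus>\<^bsub>E\<^esub> y) = f x \<ominus>\<^bsub>Y\<^esub> f y" if "x \<in> carrier E" "y \<in> carrier E"
    using that m additive_homD[OF assms(3)] by (simp add: a_minus_def)
qed

lemma hom_add_maps:
  assumes "abelian_group G" "abelian_group H" "f \<in> hom (add_monoid G) (add_monoid H)" "g \<in> hom (add_monoid G) (add_monoid H)"
  shows "(\<lambda>x. f x \<oplus>\<^bsub>H\<^esub> g x) \<in> hom (add_monoid G) (add_monoid H)"
proof -
  interpret H: abelian_group H by fact
  note F = additive_homD[OF assms(3)] and G = additive_homD[OF assms(4)]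
  show ?thesis by (rule homI) (simp_all add: F G H.a_ac)
qed

lemma (in abelian_group) diff_zero [simp]: "x \<in> carrier G \<Longrightarrow> x \<ominus> \<zero> = x"
  using r_neg[OF zero_closed] by (simp add: a_minus_def)

lemma topological_abelian_groupD:
  assumes "topological_abelian_group G T"
  shows "abelian_group G" "topspace T = carrier G"
    and "continuous_map S T f \<Longrightarrow> continuous_map S T g \<Longrightarrow> continuous_map S T (\<lambda>x. f x \<oplus>\<^bsub>G\<^esub> g x)"
    and "continuous_map S T f \<Longrightarrow> continuous_map S T (\<lambda>x. \<ominus>\<^bsub>G\<^esub> f x)"
    and "continuous_map S T f \<Longrightarrow> continuous_map S T g \<Longrightarrow> continuous_map S T (\<lambda>x. f x \<ominus>\<^bsub>G\<^esub> g x)"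
proof -
  have c: "continuous_map (prod_topology T T) T (\<lambda>(x, y). x \<oplus>\<^bsub>G\<^esub> y)" "continuous_map T T (\<lambda>x. \<ominus>\<^bsub>G\<^esub> x)"
    using assms by (auto simp: topological_abelian_group_def)
  show "abelian_group G" "topspace T = carrier G"
    using assms by (auto simp: topological_abelian_group_def)
  show add: "continuous_map S T (\<lambda>x. f x \<oplus>\<^bsub>G\<^esub> g x)"
    if "continuous_map S T f" "continuous_map S T g" for f g
    using continuous_map_compose[OF continuous_map_pairedI[OF that] c(1)] by (simp add: o_def)
  show neg: "continuous_map S T (\<lambda>x. \<ominus>\<^bsub>G\<^esub> f x)" if "continuous_map S T f" for f
    using continuous_map_compose[OF that c(2)] by (simp add: o_def)
  show "continuous_map S T (\<lambda>x. f x \<ominus>\<^bsub>G\<^esub> g x)" if "continuous_map S T f" "continuous_map S T g"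
    unfolding a_minus_def by (rule add[OF that(1) neg[OF that(2)]])
qed

definition open_subgroup :: "('m, 'z) ring_scheme \<Rightarrow> 'm topology \<Rightarrow> 'm set \<Rightarrow> bool" where
  "open_subgroup G T H \<longleftrightarrow> subgroup H (add_monoid G) \<and> openin T H"

lemma add_subgroupD:
  assumes "subgroup H (add_monoid G)"
  shows "H \<subseteq> carrier G" "\<zero>\<^bsub>G\<^esub> \<in> H" "\<And>x y. x \<in> H \<Longrightarrow> y \<in> H \<Longrightarrow> x \<oplus>\<^bsub>G\<^esub> y \<in> H"
    "\<And>x. x \<in> H \<Longrightarrow> \<ominus>\<^bsub>G\<^esub> x \<in> H" "\<And>x y. x \<in> H \<Longrightarrow> y \<in> H \<Longrightarrow> x \<ominus>\<^bsub>G\<^esub> y \<in> H"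
  using assms by (auto simp: subgroup_def a_inv_def a_minus_def)

lemma (in abelian_group) add_subgroupI:
  assumes "H \<subseteq> carrier G" "\<zero> \<in> H" "\<And>x y. x \<in> H \<Longrightarrow> y \<in> H \<Longrightarrow> x \<ominus> y \<in> H"
  shows "subgroup H (add_monoid G)"
proof -
  have n: "\<ominus> x \<in> H" if "x \<in> H" for x
    using assms(3)[OF assms(2) that] assms(1) that by (auto simp: a_minus_def)
  have "x \<oplus> y \<in> H" if "x \<in> H" "y \<in> H" for x y
    using assms(3)[OF that(1) n[OF that(2)]] assms(1) that by (auto simp: a_minus_def)
  then show ?thesis using assms n by (auto simp: subgroup_def a_inv_def)
qed

lemma openin_translate:
  assumes T: "topological_abelian_group G T" and O: "openin T O'" and x: "x \<in> carrier G"
  shows "openin T {y \<in> carrier G. y \<oplus>\<^bsub>G\<^esub> x \<in> O'}" "openin T {y \<in> carrier G. y \<ominus>\<^bsub>G\<^esub> x \<in> O'}"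
proof -
  note t = topological_abelian_groupD[OF T]
  have c: "continuous_map T T (\<lambda>_. x)" using x t(2) by simp
  show "openin T {y \<in> carrier G. y \<oplus>\<^bsub>G\<^esub> x \<in> O'}"
    using openin_continuous_map_preimage[OF t(3)[OF continuous_map_id c] O] t(2) by simp
  show "openin T {y \<in> carrier G. y \<ominus>\<^bsub>G\<^esub> x \<in> O'}"
    using openin_continuous_map_preimage[OF t(5)[OF continuous_map_id c] O] t(2) by simp
qed

text \<open>The complement of an open subgroup is a union of cosets.\<close>

lemma open_subgroup_closed:
  assumes T: "topological_abelian_group G T" and H: "open_subgroup G T H"
  shows "closedin T H"
proof -
  note t = topological_abelian_groupD[OF T]
  interpret abelian_group G by (rule t(1))
  have Hs: "subgroup H (add_monoid G)" "openin T H" using H by (auto simp: open_subgroup_def)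
  note h = add_subgroupD[OF Hs(1)]
  have "openin T (carrier G - H)"
  proof (subst openin_subopen, intro ballI exI conjI)
    fix x assume x: "x \<in> carrier G - H"
    let ?T = "{y \<in> carrier G. y \<ominus>\<^bsub>G\<^esub> x \<in> H}"
    show "openin T ?T" using openin_translate(2)[OF T Hs(2)] x by blast
    show "x \<in> ?T" using x h(2) by (simp add: a_minus_def r_neg)
    show "?T \<subseteq> carrier G - H"
    proof
      fix y assume y: "y \<in> ?T"
      have "x \<in> H" if "y \<in> H"
      proof -
        have "y \<ominus>\<^bsub>G\<^esub> (y \<ominus>\<^bsub>G\<^esub> x) \<in> H" using h(5) y that by blast
        moreover have "y \<ominus>\<^bsub>G\<^esub> (y \<ominus>\<^bsub>G\<^esub> x) = x"
          using x y by (simp add: a_minus_def minus_add r_neg1 r_neg2)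
        ultimately show ?thesis by simp
      qed
      then show "y \<in> carrier G - H" using x y by blast
    qed
  qed
  then show ?thesis using h(1) t(2) by (simp add: closedin_def)
qed

lemma additive_continuousI:
  assumes E: "topological_abelian_group E TE" and Y: "topological_abelian_group Y TY"
    and f: "f \<in> hom (add_monoid E) (add_monoid Y)"
    and 0: "\<And>V. openin TY V \<Longrightarrow> \<zero>\<^bsub>Y\<^esub> \<in> V \<Longrightarrow> \<exists>U. openin TE U \<and> \<zero>\<^bsub>E\<^esub> \<in> U \<and> f ` U \<subseteq> V"
  shows "continuous_map TE TY f"
  unfolding continuous_map_def
proof (intro conjI allI impI)
  note tE = topological_abelian_groupD[OF E] and tY = topological_abelian_groupD[OF Y]
  interpret E: abelian_group E by (rule tE(1))
  interpret Y: abelian_group Y by (rule tY(1))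
  note F = additive_homD[OF f]
  show "f \<in> topspace TE \<rightarrow> topspace TY" using F tE(2) tY(2) by auto
  fix V assume V: "openin TY V"
  show "openin TE {x \<in> topspace TE. f x \<in> V}"
  proof (subst openin_subopen, intro ballI)
    fix x assume "x \<in> {x \<in> topspace TE. f x \<in> V}"
    then have x: "x \<in> carrier E" "f x \<in> V" using tE(2) by auto
    have "openin TY {y \<in> carrier Y. y \<oplus>\<^bsub>Y\<^esub> f x \<in> V}"
      by (rule openin_translate(1)[OF Y V F(1)[OF x(1)]])
    from 0[OF this] obtain U where U: "openin TE U" "\<zero>\<^bsub>E\<^esub> \<in> U"
      "f ` U \<subseteq> {y \<in> carrier Y. y \<oplus>\<^bsub>Y\<^esub> f x \<in> V}" using x F by auto
    let ?T = "{y \<in> carrier E. y \<ominus>\<^bsub>E\<^esub> x \<in> U}"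
    have "f y \<in> V" if "y \<in> ?T" for y
    proof -
      have "f y = f (y \<ominus>\<^bsub>E\<^esub> x) \<oplus>\<^bsub>Y\<^esub> f x"
        using F(2)[of "y \<ominus>\<^bsub>E\<^esub> x" x] that x by (simp add: a_minus_def E.a_assoc E.l_neg)
      then show ?thesis using U(3) that by auto
    qed
    then show "\<exists>T. openin TE T \<and> x \<in> T \<and> T \<subseteq> {x \<in> topspace TE. f x \<in> V}"
      using openin_translate(2)[OF E U(1) x(1)] x U(2) tE(2)
      by (intro exI[of _ ?T]) (auto simp: a_minus_def E.r_neg)
  qed
qed

definition topologically_generates :: "('m, 'z) ring_scheme \<Rightarrow> 'm topology \<Rightarrow> 'm set \<Rightarrow> bool" where
  "topologically_generates E TE S \<longleftrightarrow> S \<subseteq> carrier E \<and>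
     (\<forall>C. subgroup C (add_monoid E) \<and> closedin TE C \<and> S \<subseteq> C \<longrightarrow> C = carrier E)"

text \<open>The equalizer of two continuous additive maps into a Hausdorff group is a closed subgroup. All
  identities between maps out of completed objects are checked on topological generators in this
  way.\<close>

lemma continuous_additive_eqI:
  assumes E: "topological_abelian_group E TE" "topologically_generates E TE S"
    and Y: "topological_abelian_group Y TY" "Hausdorff_space TY"
    and f: "f \<in> hom (add_monoid E) (add_monoid Y)" "continuous_map TE TY f"
    and g: "g \<in> hom (add_monoid E) (add_monoid Y)" "continuous_map TE TY g"
    and eq: "\<And>x. x \<in> S \<Longrightarrow> f x = g x" and x: "x \<in> carrier E"
  shows "f x = g x"
proof -
  note tE = topological_abelian_groupD[OF E(1)] and tY = topological_abelian_groupD[OF Y(1)]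
  interpret E: abelian_group E by (rule tE(1))
  let ?C = "{x \<in> topspace TE. f x = g x}"
  have "closedin TE ?C" by (rule closedin_continuous_maps_eq[OF Y(2) f(2) g(2)])
  moreover have "subgroup ?C (add_monoid E)"
    using additive_hom_diff[OF tE(1) tY(1) f(1)] additive_hom_diff[OF tE(1) tY(1) g(1)] tE(2)
    by (intro E.add_subgroupI) auto
  moreover have "S \<subseteq> ?C" using E(2) eq tE(2) by (auto simp: topologically_generates_def)
  ultimately show ?thesis using E(2) x unfolding topologically_generates_def by blast
qed

text \<open>Open subgroups are closed, so their preimages are closed subgroups.\<close>

lemma continuous_additive_mem_open_subgroup:
  assumes E: "topological_abelian_group E TE" "topologically_generates E TE S"
    and Y: "topological_abelian_group Y TY" "open_subgroup Y TY H"
    and f: "f \<in> hom (add_monoid E) (add_monoid Y)" "continuous_map TE TY f"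
    and eq: "\<And>x. x \<in> S \<Longrightarrow> f x \<in> H" and x: "x \<in> carrier E"
  shows "f x \<in> H"
proof -
  note tE = topological_abelian_groupD[OF E(1)] and tY = topological_abelian_groupD[OF Y(1)]
  interpret E: abelian_group E by (rule tE(1))
  let ?C = "{x \<in> topspace TE. f x \<in> H}"
  have H: "subgroup H (add_monoid Y)" using Y(2) by (simp add: open_subgroup_def)
  have "closedin TE ?C"
    by (rule closedin_continuous_map_preimage[OF f(2) open_subgroup_closed[OF Y]])
  moreover have "subgroup ?C (add_monoid E)"
    using additive_hom_diff[OF tE(1) tY(1) f(1)] add_subgroupD[OF H] tE(2)
    by (intro E.add_subgroupI) auto
  moreover have "S \<subseteq> ?C" using E(2) eq tE(2) by (auto simp: topologically_generates_def)
  ultimately show ?thesis using E(2) x unfolding topologically_generates_def by blast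
qed

section \<open>Limits of discrete systems\<close>

text \<open>By directedness, finitely many coordinates of a compatible family are controlled by one.\<close>

lemma inv_lim_discrete_nbhd:
  assumes dir: "directed_on I leq"
    and S: "openin (inv_lim I leq (\<lambda>i. discrete_topology (D i)) f) S" "z \<in> S"
  obtains i where "i \<in> I"
    "\<And>z'. z' \<in> topspace (inv_lim I leq (\<lambda>i. discrete_topology (D i)) f) \<Longrightarrow> z' i = z i \<Longrightarrow> z' \<in> S"
proof -
  let ?L = "inv_lim I leq (\<lambda>i. discrete_topology (D i)) f"
  have dirD: "I \<noteq> {}" "\<And>i. i \<in> I \<Longrightarrow> leq i i"
    "\<And>i j k. i \<in> I \<Longrightarrow> j \<in> I \<Longrightarrow> k \<in> I \<Longrightarrow> leq i j \<Longrightarrow> leq j k \<Longrightarrow> leq i k"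
    "\<And>i j. i \<in> I \<Longrightarrow> j \<in> I \<Longrightarrow> \<exists>k\<in>I. leq i k \<and> leq j k"
    using dir unfolding directed_on_def by blast+
  have zL: "z \<in> topspace ?L" using openin_subset[OF S(1)] S(2) by blast
  obtain S' where S': "openin (product_topology (\<lambda>i. discrete_topology (D i)) I) S'"
    "S = S' \<inter> {x. \<forall>i\<in>I. \<forall>j\<in>I. leq i j \<longrightarrow> f i j (x j) = x i}"
    using S(1) unfolding inv_lim_def openin_subtopology by blast
  then have "z \<in> S'" using S(2) by blast
  then obtain E where E: "finite {i \<in> I. E i \<noteq> topspace (discrete_topology (D i))}"
    "z \<in> Pi\<^sub>E I E" "Pi\<^sub>E I E \<subseteq> S'"
    using S'(1) unfolding openin_product_topology_alt by meson
  let ?F = "{i \<in> I. E i \<noteq> topspace (discrete_topology (D i))}"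
  have "\<exists>k\<in>I. \<forall>i\<in>F. leq i k" if "finite F" "F \<subseteq> I" for F
    using that
  proof (induction F)
    case empty
    then show ?case using dirD(1) by blast
  next
    case (insert a F)
    then obtain k where k: "k \<in> I" "\<forall>i\<in>F. leq i k" by auto
    obtain l where "l \<in> I" "leq a l" "leq k l" using dirD(4)[of a k] k insert by auto
    then show ?case using k dirD(3) insert by (metis insert_iff subsetD)
  qed
  from this[OF E(1)] obtain k where k: "k \<in> I" "\<And>i. i \<in> ?F \<Longrightarrow> leq i k" by auto
  show thesis
  proof (rule that[OF k(1)])
    fix z' assume z': "z' \<in> topspace ?L" "z' k = z k"
    have "z' i \<in> E i" if i: "i \<in> I" for i
    proof (cases "i \<in> ?F")
      case True
      then have "z' i = z i" using z' zL k i unfolding inv_lim_iff by metis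
      then show ?thesis using E(2) i by auto
    next
      case False
      then show ?thesis using z'(1) i by (auto simp: inv_lim_iff)
    qed
    then have "z' \<in> S'" using E(3) z'(1) by (auto simp: inv_lim_iff PiE_def)
    then show "z' \<in> S" using z'(1) S'(2) by (auto simp: inv_lim_iff)
  qed
qed

lemma Hausdorff_inv_lim_discrete:
  "Hausdorff_space (inv_lim I leq (\<lambda>i. discrete_topology (D i)) f)"
  unfolding inv_lim_def
  by (intro Hausdorff_space_subtopology) (simp add: Hausdorff_space_product_topology)

lemma homeomorphic_map_imp_Hausdorff:
  "homeomorphic_map T T' f \<Longrightarrow> Hausdorff_space T' \<Longrightarrow> Hausdorff_space T"
  using homeomorphic_Hausdorff_space homeomorphic_map_imp_homeomorphic_space by blast

text \<open>The three properties of a pro-discrete module: a base of open submodules, separatedness and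
  completeness. In the last clause the values \<open>c K\<close> represent a compatible family of cosets.\<close>

definition complete_base :: "('r, 'z) ring_scheme \<Rightarrow> ('r, 'm, 'y) module_scheme \<Rightarrow> 'm topology \<Rightarrow> 'm set set \<Rightarrow> bool"
where
  "complete_base R M TM J \<longleftrightarrow> J \<subseteq> open_submodules R M TM \<and>
     (\<forall>V. openin TM V \<and> \<zero>\<^bsub>M\<^esub> \<in> V \<longrightarrow> (\<exists>K\<in>J. K \<subseteq> V)) \<and>
     (\<forall>y\<in>carrier M. (\<forall>K\<in>J. y \<in> K) \<longrightarrow> y = \<zero>\<^bsub>M\<^esub>) \<and>
     (\<forall>c. (\<forall>K\<in>J. c K \<in> carrier M) \<and> (\<forall>K\<in>J. \<forall>L\<in>J. L \<subseteq> K \<longrightarrow> c L \<ominus>\<^bsub>M\<^esub> c K \<in> K) \<longrightarrow>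
        (\<exists>y\<in>carrier M. \<forall>K\<in>J. y \<ominus>\<^bsub>M\<^esub> c K \<in> K))"

lemma (in left_module) coset_eq_iff:
  assumes U: "abelian_subgroup U M" and xy: "x \<in> carrier M" "y \<in> carrier M"
  shows "U +>\<^bsub>M\<^esub> x = U +>\<^bsub>M\<^esub> y \<longleftrightarrow> x \<ominus>\<^bsub>M\<^esub> y \<in> U"
proof -
  interpret U: abelian_subgroup U M by (rule U)
  show ?thesis
  proof
    assume "U +>\<^bsub>M\<^esub> x = U +>\<^bsub>M\<^esub> y"
    then have "x \<in> U +>\<^bsub>M\<^esub> y" using U.a_rcos_self[OF xy(1)] by simp
    then obtain u where u: "u \<in> U" "x = u \<oplus>\<^bsub>M\<^esub> y" unfolding mem_a_r_coset by blast
    then have "x \<ominus>\<^bsub>M\<^esub> y = u"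
      using U.a_subset xy(2) by (auto simp: a_minus_def M.a_assoc M.r_neg)
    then show "x \<ominus>\<^bsub>M\<^esub> y \<in> U" using u(1) by simp
  next
    assume "x \<ominus>\<^bsub>M\<^esub> y \<in> U"
    moreover have "x = (x \<ominus>\<^bsub>M\<^esub> y) \<oplus>\<^bsub>M\<^esub> y" using xy by (simp add: a_minus_def M.a_assoc M.l_neg)
    ultimately have "x \<in> U +>\<^bsub>M\<^esub> y" unfolding mem_a_r_coset by blast
    from M.a_repr_independence[OF this xy(2) U.a_subgroup]
    show "U +>\<^bsub>M\<^esub> x = U +>\<^bsub>M\<^esub> y" by (rule sym)
  qed
qed

text \<open>The kernels of the projections form the base: the limit topology makes them small, injectivity
  of the map into the limit separates points, and surjectivity onto it gives completeness.\<close>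

lemma discrete_limit_complete_base:
  assumes tm: "topological_module R TR M TM"
    and sys: "discrete_system R TR I leq N f"
    and lim: "is_discrete_limit R M TM I leq N f p"
  shows "complete_base R M TM ((\<lambda>i. a_kernel M (N i) (p i)) ` I)"
    and "Hausdorff_space TM"
proof -
  interpret left_module R M using tm by (rule topological_module_left_module)
  define J where "J = (\<lambda>i. a_kernel M (N i) (p i)) ` I"
  have tM: "topspace TM = carrier M"
    using tm by (auto simp: topological_module_def topological_abelian_group_def)
  let ?le = "\<lambda>U V. V \<subseteq> U" and ?cm = "\<lambda>U V. coset_map M U (\<lambda>x. x)"
  note can = discrete_limit_canonical[OF assms, folded J_def]
  have Js: "submodule U R M" "openin TM U" if "U \<in> J" for U
    using can(1) that by (auto simp: open_submodules_def)
  have Ja: "abelian_subgroup U M" if "U \<in> J" for U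
    using submodule_abelian_subgroup[OF Js(1)[OF that]] .
  note q = quot_module_facts[OF Js(1)]
  let ?L = "inv_lim J ?le (\<lambda>U. discrete_topology (carrier (quot_module M U))) ?cm"
  let ?P = "\<lambda>x. \<lambda>U\<in>J. U +>\<^bsub>M\<^esub> x"
  have hom: "homeomorphic_map TM ?L ?P" using can(3) by (simp add: is_discrete_limit_def)
  show "Hausdorff_space TM"
    by (rule homeomorphic_map_imp_Hausdorff[OF hom Hausdorff_inv_lim_discrete])
  have dir: "directed_on J ?le" using can(2) by (simp add: discrete_system_def)
  have inj: "inj_on ?P (carrier M)" and img: "?P ` carrier M = topspace ?L"
    using homeomorphic_imp_injective_map[OF hom] homeomorphic_imp_surjective_map[OF hom] tM by auto
  have idh: "(\<lambda>x. x) \<in> hom (add_monoid M) (add_monoid M)" by (auto simp: hom_def)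
  have cm: "coset_map M U (\<lambda>x. x) (V +>\<^bsub>M\<^esub> x) = U +>\<^bsub>M\<^esub> x"
    if "U \<in> J" "V \<in> J" "V \<subseteq> U" "x \<in> carrier M" for U V x
    using coset_map_coset[OF Ja[OF that(2)] Ja[OF that(1)] idh _ that(4)] that(3) by simp
  have in_iff: "U +>\<^bsub>M\<^esub> x = U +>\<^bsub>M\<^esub> \<zero>\<^bsub>M\<^esub> \<longleftrightarrow> x \<in> U" if "U \<in> J" "x \<in> carrier M" for U x
    using coset_eq_iff[OF Ja[OF that(1)] that(2) M.zero_closed] that(2) by simp
  show "complete_base R M TM ((\<lambda>i. a_kernel M (N i) (p i)) ` I)"
    unfolding complete_base_def J_def[symmetric]
  proof (intro conjI allI ballI impI)
    show "J \<subseteq> open_submodules R M TM" by (rule can(1))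
  next
    fix V assume V: "openin TM V \<and> \<zero>\<^bsub>M\<^esub> \<in> V"
    have "openin ?L (?P ` V)"
      using hom V homeomorphic_imp_open_map open_map_def by blast
    then obtain K where K: "K \<in> J"
      "\<And>z. z \<in> topspace ?L \<Longrightarrow> z K = ?P \<zero>\<^bsub>M\<^esub> K \<Longrightarrow> z \<in> ?P ` V"
      by (rule inv_lim_discrete_nbhd[OF dir _ imageI[OF conjunct2[OF V]]]) (rule that)
    have "K \<subseteq> V"
    proof
      fix x assume x: "x \<in> K"
      then have xM: "x \<in> carrier M" using submoduleD_left(1)[OF Js(1)[OF K(1)]] by blast
      have "?P x \<in> ?P ` V" using K img in_iff[OF K(1) xM] x xM by (intro K(2)) auto
      then obtain v where v: "v \<in> V" "?P x = ?P v" by blast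
      have "v \<in> carrier M" using openin_subset[OF conjunct1[OF V]] v(1) tM by blast
      then show "x \<in> V" using inj_onD[OF inj v(2) xM] v(1) by simp
    qed
    then show "\<exists>K\<in>J. K \<subseteq> V" using K(1) by blast
  next
    fix y assume y: "y \<in> carrier M" "\<forall>K\<in>J. y \<in> K"
    have "?P y = ?P \<zero>\<^bsub>M\<^esub>" using in_iff y by (intro restrict_ext) blast
    then show "y = \<zero>\<^bsub>M\<^esub>" using inj_onD[OF inj _ y(1) M.zero_closed] by blast
  next
    fix c assume c: "(\<forall>K\<in>J. c K \<in> carrier M) \<and> (\<forall>K\<in>J. \<forall>L\<in>J. L \<subseteq> K \<longrightarrow> c L \<ominus>\<^bsub>M\<^esub> c K \<in> K)"
    have "(\<lambda>U\<in>J. U +>\<^bsub>M\<^esub> c U) \<in> topspace ?L"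
      unfolding inv_lim_iff
    proof (intro conjI ballI impI)
      show "(\<lambda>U\<in>J. U +>\<^bsub>M\<^esub> c U) \<in> (\<Pi>\<^sub>E i\<in>J. topspace (discrete_topology (carrier (quot_module M i))))"
        using c q(2) by auto
      fix U V assume UV: "U \<in> J" "V \<in> J" "V \<subseteq> U"
      then show "coset_map M U (\<lambda>x. x) ((\<lambda>U\<in>J. U +>\<^bsub>M\<^esub> c U) V) = (\<lambda>U\<in>J. U +>\<^bsub>M\<^esub> c U) U"
        using cm[OF UV] coset_eq_iff[OF Ja[OF UV(1)]] c by auto
    qed
    then obtain y where y: "y \<in> carrier M" "?P y = (\<lambda>U\<in>J. U +>\<^bsub>M\<^esub> c U)" unfolding img[symmetric] by force
    have "y \<ominus>\<^bsub>M\<^esub> c K \<in> K" if K: "K \<in> J" for K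
      using fun_cong[OF y(2), of K] coset_eq_iff[OF Ja[OF K] y(1)] c K by auto
    then show "\<exists>y\<in>carrier M. \<forall>K\<in>J. y \<ominus>\<^bsub>M\<^esub> c K \<in> K" using y(1) by blast
  qed
qed

text \<open>As \<open>p\<close> may fail to be surjective, the quotient by its kernel is only a submodule of \<open>N\<close> up to
  isomorphism; finite length passes to submodules.\<close>

lemma finite_length_quot_kernel:
  assumes "left_module R M" "left_module R N" and hp: "p \<in> module_homs R M N" and "finite_length R N"
  shows "finite_length R (quot_module M (a_kernel M N p))"
proof -
  interpret left_module R M by fact
  let ?K = "a_kernel M N p"
  have Ks: "submodule ?K R M" by (rule kernel_submodule[OF assms(2) hp])
  note q = quot_module_facts[OF Ks]
  interpret Q: left_module R "quot_module M ?K" by (rule q(1))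
  interpret K: abelian_subgroup ?K M using submodule_abelian_subgroup[OF Ks] .
  define g where "g c = p (SOME x. x \<in> carrier M \<and> c = ?K +>\<^bsub>M\<^esub> x)" for c
  have g: "g (?K +>\<^bsub>M\<^esub> x) = p x" if x: "x \<in> carrier M" for x
  proof -
    let ?s = "SOME y. y \<in> carrier M \<and> ?K +>\<^bsub>M\<^esub> x = ?K +>\<^bsub>M\<^esub> y"
    have s: "?s \<in> carrier M \<and> ?K +>\<^bsub>M\<^esub> x = ?K +>\<^bsub>M\<^esub> ?s" by (rule someI[of _ x]) (simp add: x)
    have "p x = p ?s"
      using coset_eq_kernel_iff(1)[OF assms(2) hp x conjunct1[OF s]] conjunct2[OF s] by (rule iffD1)
    then show ?thesis unfolding g_def by (rule sym)
  qed
  show ?thesis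
  proof (rule Q.finite_length_pullback[OF assms(2) _ _ assms(4)])
    show "g \<in> module_homs R (quot_module M ?K) N"
      unfolding module_homs_def hom_def
      using homD[OF hp] by (auto simp: q(2,3,4) g lsmult_closed)
    fix c assume "c \<in> carrier (quot_module M ?K)" and z: "g c = \<zero>\<^bsub>N\<^esub>"
    then obtain x where x: "x \<in> carrier M" "c = ?K +>\<^bsub>M\<^esub> x" unfolding q(2) by blast
    have "p x = p \<zero>\<^bsub>M\<^esub>" using z g[OF x(1)] x(2) hom_zero[OF assms(2) hp] by simp
    then have "c = ?K +>\<^bsub>M\<^esub> \<zero>\<^bsub>M\<^esub>"
      using coset_eq_kernel_iff(1)[OF assms(2) hp x(1) M.zero_closed] x(2) by simp
    then show "c = \<zero>\<^bsub>quot_module M ?K\<^esub>" using K.a_subset by (simp add: q(5))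
  qed
qed

lemma pseudocompact_complete_base:
  fixes M :: "('r, 'm, 'y) module_scheme"
  assumes "pseudocompact R TR M TM"
  obtains J where "complete_base R M TM J" "\<And>K. K \<in> J \<Longrightarrow> finite_length R (quot_module M K)"
    "Hausdorff_space TM" "topological_module R TR M TM"
proof -
  obtain I :: "'m set set" and leq and N :: "'m set \<Rightarrow> ('r, 'm set) module" and f p where
    *: "topological_module R TR M TM" "discrete_system R TR I leq N f"
    "\<forall>i\<in>I. finite_length R (N i)" "is_discrete_limit R M TM I leq N f p"
    using assms unfolding pseudocompact_def by (elim conjE exE) (rule that)
  note cb = discrete_limit_complete_base[OF *(1,2,4)]
  show thesis
  proof (rule that[OF cb(1) _ cb(2) *(1)])
    fix K assume "K \<in> (\<lambda>i. a_kernel M (N i) (p i)) ` I"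
    then obtain i where i: "i \<in> I" "K = a_kernel M (N i) (p i)" by blast
    show "finite_length R (quot_module M K)"
      unfolding i(2) using * i(1)
      by (intro finite_length_quot_kernel topological_module_left_module[OF *(1)])
        (auto simp: discrete_system_def topological_module_def is_discrete_limit_def)
  qed
qed

section \<open>Extending maps to completions\<close>

lemma complete_baseD:
  assumes "complete_base R M TM J"
  shows "J \<subseteq> open_submodules R M TM"
    and "openin TM V \<Longrightarrow> \<zero>\<^bsub>M\<^esub> \<in> V \<Longrightarrow> \<exists>K\<in>J. K \<subseteq> V"
    and "y \<in> carrier M \<Longrightarrow> (\<And>K. K \<in> J \<Longrightarrow> y \<in> K) \<Longrightarrow> y = \<zero>\<^bsub>M\<^esub>"
    and "(\<And>K. K \<in> J \<Longrightarrow> c K \<in> carrier M) \<Longrightarrow>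
      (\<And>K L. K \<in> J \<Longrightarrow> L \<in> J \<Longrightarrow> L \<subseteq> K \<Longrightarrow> c L \<ominus>\<^bsub>M\<^esub> c K \<in> K) \<Longrightarrow>
      \<exists>y\<in>carrier M. \<forall>K\<in>J. y \<ominus>\<^bsub>M\<^esub> c K \<in> K"
proof -
  note cb = assms[unfolded complete_base_def]
  show "J \<subseteq> open_submodules R M TM" using cb by (rule conjunct1)
  show "openin TM V \<Longrightarrow> \<zero>\<^bsub>M\<^esub> \<in> V \<Longrightarrow> \<exists>K\<in>J. K \<subseteq> V" using conjunct1[OF conjunct2[OF cb]] by blast
  show "y \<in> carrier M \<Longrightarrow> (\<And>K. K \<in> J \<Longrightarrow> y \<in> K) \<Longrightarrow> y = \<zero>\<^bsub>M\<^esub>"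
    using conjunct1[OF conjunct2[OF conjunct2[OF cb]]] by blast
  show "(\<And>K. K \<in> J \<Longrightarrow> c K \<in> carrier M) \<Longrightarrow>
      (\<And>K L. K \<in> J \<Longrightarrow> L \<in> J \<Longrightarrow> L \<subseteq> K \<Longrightarrow> c L \<ominus>\<^bsub>M\<^esub> c K \<in> K) \<Longrightarrow>
      \<exists>y\<in>carrier M. \<forall>K\<in>J. y \<ominus>\<^bsub>M\<^esub> c K \<in> K"
    by (rule spec[OF conjunct2[OF conjunct2[OF conjunct2[OF cb]]], THEN mp]) simp
qed

lemma (in abelian_group) diff_simps:
  assumes "x \<in> carrier G" "y \<in> carrier G"
  shows "\<ominus> (x \<ominus> y) = y \<ominus> x" "(x \<ominus> y) \<oplus> y = x" "(x \<oplus> y) \<ominus> y = x" "(x \<oplus> y) \<ominus> x = y"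
    "x \<oplus> (y \<ominus> x) = y"
proof -
  have 4: "(x \<ominus> y) \<oplus> y = x" if "x \<in> carrier G" "y \<in> carrier G" for x y
    using that by (simp add: minus_eq a_assoc l_neg)
  have 5: "(x \<oplus> y) \<ominus> y = x" if "x \<in> carrier G" "y \<in> carrier G" for x y
    using that by (simp add: minus_eq a_assoc r_neg)
  show "\<ominus> (x \<ominus> y) = y \<ominus> x" using assms by (simp add: minus_eq minus_add a_comm)
  show "(x \<ominus> y) \<oplus> y = x" "(x \<oplus> y) \<ominus> y = x" by (rule 4[OF assms] 5[OF assms])+
  show "(x \<oplus> y) \<ominus> x = y" using 5[OF assms(2,1)] a_comm assms by simp
  show "x \<oplus> (y \<ominus> x) = y" using 4[OF assms(2,1)] a_comm assms by simp
qed

lemma (in abelian_group) diff_chain: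
  assumes "x \<in> carrier G" "y \<in> carrier G" "z \<in> carrier G"
  shows "(x \<ominus> y) \<oplus> (y \<ominus> z) = x \<ominus> z" "(x \<ominus> y) \<ominus> (x \<ominus> z) = z \<ominus> y"
proof -
  have 1: "(x \<ominus> y) \<oplus> (y \<ominus> z) = x \<ominus> z" if "x \<in> carrier G" "y \<in> carrier G" "z \<in> carrier G" for x y z
    using that by (simp add: minus_eq a_assoc r_neg1)
  show "(x \<ominus> y) \<oplus> (y \<ominus> z) = x \<ominus> z" by (rule 1[OF assms])
  show "(x \<ominus> y) \<ominus> (x \<ominus> z) = z \<ominus> y"
    unfolding minus_eq[of "x \<ominus> y"] diff_simps(1)[OF assms(1,3)]
    using 1[OF assms(3,1,2)] a_comm[of "x \<ominus> y" "z \<ominus> x"] assms by simp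
qed

lemma (in abelian_group) diff_add_add:
  assumes "x \<in> carrier G" "x' \<in> carrier G" "y \<in> carrier G" "y' \<in> carrier G"
  shows "(x \<oplus> x') \<ominus> (y \<oplus> y') = (x \<ominus> y) \<oplus> (x' \<ominus> y')"
  using assms by (simp add: minus_eq minus_add a_ac)

text \<open>A subgroup that contains a neighbourhood of zero is a union of translates of it.\<close>

lemma subgroup_open:
  assumes T: "topological_abelian_group G T" and C: "subgroup C (add_monoid G)"
    and V: "openin T V" "\<zero>\<^bsub>G\<^esub> \<in> V" "V \<subseteq> C"
  shows "open_subgroup G T C"
proof -
  note t = topological_abelian_groupD[OF T] and c = add_subgroupD[OF C]
  interpret abelian_group G by (rule t(1))
  have "openin T C"
  proof (subst openin_subopen, intro ballI)
    fix x assume x: "x \<in> C"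
    then have xG: "x \<in> carrier G" using c(1) by blast
    let ?T = "{y \<in> carrier G. y \<ominus>\<^bsub>G\<^esub> x \<in> V}"
    have "?T \<subseteq> C"
    proof
      fix y assume y: "y \<in> ?T"
      then have "(y \<ominus>\<^bsub>G\<^esub> x) \<oplus>\<^bsub>G\<^esub> x \<in> C" using V(3) c(3) x by blast
      then show "y \<in> C" using y xG by (simp add: diff_simps(2))
    qed
    moreover have "x \<in> ?T" using xG V(2) by (simp add: a_minus_def r_neg)
    ultimately show "\<exists>T'. openin T T' \<and> x \<in> T' \<and> T' \<subseteq> C"
      using openin_translate(2)[OF T V(1) xG] by blast
  qed
  then show ?thesis using C by (simp add: open_subgroup_def)
qed

lemma complete_base_mem:
  assumes "topological_module R TR Y TY" "complete_base R Y TY J" "K \<in> J"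
  shows "submodule K R Y" "openin TY K" "open_subgroup Y TY K" "\<zero>\<^bsub>Y\<^esub> \<in> K"
    "\<And>x y. x \<in> K \<Longrightarrow> y \<in> K \<Longrightarrow> x \<oplus>\<^bsub>Y\<^esub> y \<in> K" "\<And>x y. x \<in> K \<Longrightarrow> y \<in> K \<Longrightarrow> x \<ominus>\<^bsub>Y\<^esub> y \<in> K"
    "\<And>a x. a \<in> carrier R \<Longrightarrow> x \<in> K \<Longrightarrow> a \<odot>\<^bsub>Y\<^esub> x \<in> K"
proof -
  interpret left_module R Y using assms(1) by (rule topological_module_left_module)
  show s: "submodule K R Y" "openin TY K"
    using complete_baseD(1)[OF assms(2)] assms(3) by (auto simp: open_submodules_def)
  note k = submoduleD_left[OF s(1)]
  show d: "\<And>x y. x \<in> K \<Longrightarrow> y \<in> K \<Longrightarrow> x \<ominus>\<^bsub>Y\<^esub> y \<in> K" using k(3,5) by (simp add: a_minus_def)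
  show "\<zero>\<^bsub>Y\<^esub> \<in> K" "\<And>x y. x \<in> K \<Longrightarrow> y \<in> K \<Longrightarrow> x \<oplus>\<^bsub>Y\<^esub> y \<in> K"
    "\<And>a x. a \<in> carrier R \<Longrightarrow> x \<in> K \<Longrightarrow> a \<odot>\<^bsub>Y\<^esub> x \<in> K" by (fact k)+
  show "open_subgroup Y TY K"
    using M.add_subgroupI[OF k(1,2) d] s(2) by (simp add: open_subgroup_def)
qed

text \<open>A continuous additive map into a pro-discrete module is the same as a compatible family of
  continuous maps into its discrete quotients. Compatibility need not be checked by hand if the
  values on a set of topological generators lift to \<open>Y\<close>: the elements at which two members of the
  family agree form an open, hence closed, subgroup.\<close>

lemma complete_base_lift:
  fixes E :: "('e, 'u) ring_scheme" and Y :: "('r, 'q, 'v) module_scheme"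
  assumes E: "topological_abelian_group E TE" "topologically_generates E TE (e ` I)"
    and Y: "topological_module R TR Y TY" "complete_base R Y TY J"
    and g: "\<And>i. i \<in> I \<Longrightarrow> g i \<in> carrier Y"
    and quot: "\<And>K. K \<in> J \<Longrightarrow> \<exists>k\<in>hom (add_monoid E) (add_monoid (quot_module Y K)).
      openin TE {x \<in> carrier E. k x = K} \<and> (\<forall>i\<in>I. k (e i) = K +>\<^bsub>Y\<^esub> g i)"
  obtains h where "h \<in> hom (add_monoid E) (add_monoid Y)" "continuous_map TE TY h"
    "\<And>i. i \<in> I \<Longrightarrow> h (e i) = g i"
proof -
  interpret E: abelian_group E by (rule topological_abelian_groupD(1)[OF E(1)])
  interpret Y: left_module R Y using Y(1) by (rule topological_module_left_module)
  have Yt: "topological_abelian_group Y TY" using Y(1) by (simp add: topological_module_def)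
  have "\<exists>k. \<forall>K\<in>J. k K \<in> hom (add_monoid E) (add_monoid (quot_module Y K)) \<and>
      openin TE {x \<in> carrier E. k K x = K} \<and> (\<forall>i\<in>I. k K (e i) = K +>\<^bsub>Y\<^esub> g i)"
    by (rule bchoice) (use quot in blast)
  then obtain k where k: "\<And>K. K \<in> J \<Longrightarrow> k K \<in> hom (add_monoid E) (add_monoid (quot_module Y K))"
    "\<And>K. K \<in> J \<Longrightarrow> openin TE {x \<in> carrier E. k K x = K}"
    "\<And>K i. K \<in> J \<Longrightarrow> i \<in> I \<Longrightarrow> k K (e i) = K +>\<^bsub>Y\<^esub> g i"
    by blast
  have J: "submodule K R Y" "abelian_subgroup K Y" if "K \<in> J" for K
    using complete_baseD(1)[OF Y(2)] that Y.submodule_abelian_subgroup by (auto simp: open_submodules_def)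
  note q = Y.quot_module_facts[OF J(1)] and js = Y.submoduleD_left[OF J(1)]
  note ceq = Y.coset_eq_iff[OF J(2)]
  have K0: "K +>\<^bsub>Y\<^esub> \<zero>\<^bsub>Y\<^esub> = K" if "K \<in> J" for K
    using js(1)[OF that] by (simp add: Y.M.a_coset_add_zero)
  have ka: "k K (x \<oplus>\<^bsub>E\<^esub> x') = K +>\<^bsub>Y\<^esub> (y \<oplus>\<^bsub>Y\<^esub> y')" "k K (x \<ominus>\<^bsub>E\<^esub> x') = K +>\<^bsub>Y\<^esub> (y \<ominus>\<^bsub>Y\<^esub> y')"
    if "K \<in> J" "x \<in> carrier E" "x' \<in> carrier E" "y \<in> carrier Y" "y' \<in> carrier Y"
      "k K x = K +>\<^bsub>Y\<^esub> y" "k K x' = K +>\<^bsub>Y\<^esub> y'" for K x x' y y'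
  proof -
    interpret Z: left_module R "quot_module Y K" by (rule q(1)[OF that(1)])
    show "k K (x \<oplus>\<^bsub>E\<^esub> x') = K +>\<^bsub>Y\<^esub> (y \<oplus>\<^bsub>Y\<^esub> y')"
      using additive_homD(2)[OF k(1)[OF that(1)] that(2,3)] that(6,7) q(3)[OF that(1,4,5)] by simp
    have qY: "(\<lambda>y. K +>\<^bsub>Y\<^esub> y) \<in> hom (add_monoid Y) (add_monoid (quot_module Y K))"
      using that(1) by (auto simp: hom_def q(2,3))
    show "k K (x \<ominus>\<^bsub>E\<^esub> x') = K +>\<^bsub>Y\<^esub> (y \<ominus>\<^bsub>Y\<^esub> y')"
      unfolding additive_hom_diff(3)[OF E.abelian_group_axioms Z.M.abelian_group_axioms k(1)[OF that(1)] that(2,3)]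
        additive_hom_diff(3)[OF Y.M.abelian_group_axioms Z.M.abelian_group_axioms qY that(4,5)] that(6,7) ..
  qed
  have k0: "k K \<zero>\<^bsub>E\<^esub> = K" if "K \<in> J" for K
    using additive_hom_diff(1)[OF E.abelian_group_axioms _ k(1)[OF that]] q(1,5)[OF that]
    by (simp add: left_module_def)
  have common: "\<exists>y\<in>carrier Y. k L x = L +>\<^bsub>Y\<^esub> y \<and> k K x = K +>\<^bsub>Y\<^esub> y"
    if KL: "K \<in> J" "L \<in> J" and x: "x \<in> carrier E" for K L x
  proof -
    let ?C = "{x \<in> carrier E. \<exists>y\<in>carrier Y. k L x = L +>\<^bsub>Y\<^esub> y \<and> k K x = K +>\<^bsub>Y\<^esub> y}"
    let ?V = "{x \<in> carrier E. k K x = K} \<inter> {x \<in> carrier E. k L x = L}"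
    have V: "?V \<subseteq> ?C"
    proof
      fix x assume "x \<in> ?V"
      then have "x \<in> carrier E" "k L x = L +>\<^bsub>Y\<^esub> \<zero>\<^bsub>Y\<^esub>" "k K x = K +>\<^bsub>Y\<^esub> \<zero>\<^bsub>Y\<^esub>" using K0 KL by auto
      then show "x \<in> ?C" using Y.M.zero_closed by blast
    qed
    have C: "subgroup ?C (add_monoid E)"
    proof (rule E.add_subgroupI)
      show "\<zero>\<^bsub>E\<^esub> \<in> ?C" by (rule subsetD[OF V]) (use k0 KL in simp)
      fix x x' assume "x \<in> ?C" "x' \<in> ?C"
      then obtain y y' where y: "x \<in> carrier E" "x' \<in> carrier E" "y \<in> carrier Y" "y' \<in> carrier Y"
        "k L x = L +>\<^bsub>Y\<^esub> y" "k L x' = L +>\<^bsub>Y\<^esub> y'" "k K x = K +>\<^bsub>Y\<^esub> y" "k K x' = K +>\<^bsub>Y\<^esub> y'" by blast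
      show "x \<ominus>\<^bsub>E\<^esub> x' \<in> ?C"
        using ka(2)[OF KL(2) y(1-4) y(5,6)] ka(2)[OF KL(1) y(1-4) y(7,8)] y(1-4) by blast
    qed blast
    have "openin TE ?V" by (rule openin_Int[OF k(2)[OF KL(1)] k(2)[OF KL(2)]])
    moreover have "\<zero>\<^bsub>E\<^esub> \<in> ?V" using k0 KL by simp
    ultimately have "closedin TE ?C"
      using V by (intro open_subgroup_closed[OF E(1) subgroup_open[OF E(1) C]])
    moreover have "e ` I \<subseteq> ?C"
      using E(2) g k(3) KL unfolding topologically_generates_def by blast
    ultimately have "?C = carrier E" using C E(2) unfolding topologically_generates_def by blast
    then show ?thesis using x by blast
  qed
  have ex: "\<exists>y\<in>carrier Y. \<forall>K\<in>J. k K x = K +>\<^bsub>Y\<^esub> y" if x: "x \<in> carrier E" for x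
  proof -
    have "\<forall>K\<in>J. \<exists>c. c \<in> carrier Y \<and> k K x = K +>\<^bsub>Y\<^esub> c" using common[OF _ _ x] by blast
    then obtain c where c: "\<And>K. K \<in> J \<Longrightarrow> c K \<in> carrier Y" "\<And>K. K \<in> J \<Longrightarrow> k K x = K +>\<^bsub>Y\<^esub> c K"
      using bchoice[of J "\<lambda>K c. c \<in> carrier Y \<and> k K x = K +>\<^bsub>Y\<^esub> c"] by blast
    have compat: "c L \<ominus>\<^bsub>Y\<^esub> c K \<in> K" if KL: "K \<in> J" "L \<in> J" "L \<subseteq> K" for K L
    proof -
      obtain y where y: "y \<in> carrier Y" "k L x = L +>\<^bsub>Y\<^esub> y" "k K x = K +>\<^bsub>Y\<^esub> y"
        using common[OF KL(1,2) x] by blast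
      have "c L \<ominus>\<^bsub>Y\<^esub> y \<in> L" using ceq[OF KL(2) c(1)[OF KL(2)] y(1)] c(2)[OF KL(2)] y(2) by simp
      moreover have "y \<ominus>\<^bsub>Y\<^esub> c K \<in> K" using ceq[OF KL(1) y(1) c(1)[OF KL(1)]] c(2)[OF KL(1)] y(3) by simp
      ultimately have "(c L \<ominus>\<^bsub>Y\<^esub> y) \<oplus>\<^bsub>Y\<^esub> (y \<ominus>\<^bsub>Y\<^esub> c K) \<in> K" using js(3)[OF KL(1)] KL(3) by blast
      then show ?thesis using y(1) c(1) KL by (simp add: Y.M.diff_chain(1))
    qed
    obtain y where y: "y \<in> carrier Y" "\<forall>K\<in>J. y \<ominus>\<^bsub>Y\<^esub> c K \<in> K"
      using complete_baseD(4)[OF Y(2), of c] c(1) compat by blast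
    have "k K x = K +>\<^bsub>Y\<^esub> y" if "K \<in> J" for K
      using ceq[OF that y(1) c(1)[OF that]] y(2) that c(2)[OF that] by simp
    then show ?thesis using y(1) by blast
  qed
  have uniq: "y = y'" if yy: "y \<in> carrier Y" "y' \<in> carrier Y" "\<And>K. K \<in> J \<Longrightarrow> K +>\<^bsub>Y\<^esub> y = K +>\<^bsub>Y\<^esub> y'" for y y'
  proof -
    have "y \<ominus>\<^bsub>Y\<^esub> y' = \<zero>\<^bsub>Y\<^esub>"
      by (rule complete_baseD(3)[OF Y(2)]) (use ceq yy in auto)
    then show ?thesis using Y.M.diff_simps(2)[OF yy(1,2)] yy(2) by simp
  qed
  obtain h where h: "\<And>x. x \<in> carrier E \<Longrightarrow> h x \<in> carrier Y"
    "\<And>x K. x \<in> carrier E \<Longrightarrow> K \<in> J \<Longrightarrow> k K x = K +>\<^bsub>Y\<^esub> h x"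
    using bchoice[of "carrier E" "\<lambda>x y. y \<in> carrier Y \<and> (\<forall>K\<in>J. k K x = K +>\<^bsub>Y\<^esub> y)"] ex by blast
  have hom: "h \<in> hom (add_monoid E) (add_monoid Y)"
  proof (rule homI)
    fix x x' assume "x \<in> carrier (add_monoid E)" "x' \<in> carrier (add_monoid E)"
    then have x: "x \<in> carrier E" "x' \<in> carrier E" by auto
    have "h (x \<oplus>\<^bsub>E\<^esub> x') = h x \<oplus>\<^bsub>Y\<^esub> h x'"
    proof (rule uniq)
      fix K assume K: "K \<in> J"
      show "K +>\<^bsub>Y\<^esub> h (x \<oplus>\<^bsub>E\<^esub> x') = K +>\<^bsub>Y\<^esub> (h x \<oplus>\<^bsub>Y\<^esub> h x')"
        using ka(1)[OF K x h(1)[OF x(1)] h(1)[OF x(2)] h(2)[OF x(1) K] h(2)[OF x(2) K]]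
          h(2)[of "x \<oplus>\<^bsub>E\<^esub> x'" K] x K by simp
    qed (use x h(1) in simp_all)
    then show "h (x \<otimes>\<^bsub>add_monoid E\<^esub> x') = h x \<otimes>\<^bsub>add_monoid Y\<^esub> h x'" by simp
  qed (use h(1) in simp)
  have val: "h (e i) = g i" if i: "i \<in> I" for i
  proof (rule uniq)
    have eE: "e i \<in> carrier E" using E(2) i unfolding topologically_generates_def by blast
    show "h (e i) \<in> carrier Y" by (rule h(1)[OF eE])
    show "g i \<in> carrier Y" by (rule g[OF i])
    show "K +>\<^bsub>Y\<^esub> h (e i) = K +>\<^bsub>Y\<^esub> g i" if "K \<in> J" for K using h(2)[OF eE that] k(3)[OF that i] by simp
  qed
  have "continuous_map TE TY h"
  proof (rule additive_continuousI[OF E(1) Yt hom])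
    fix V assume "openin TY V" "\<zero>\<^bsub>Y\<^esub> \<in> V"
    then obtain K where K: "K \<in> J" "K \<subseteq> V" using complete_baseD(2)[OF Y(2)] by blast
    have "h x \<in> K" if x: "x \<in> carrier E" "k K x = K" for x
      using ceq[OF K(1) h(1)[OF x(1)] Y.M.zero_closed] h(2)[OF x(1) K(1)] x(2) K0[OF K(1)] h(1)[OF x(1)] by simp
    then have "h ` {x \<in> carrier E. k K x = K} \<subseteq> V" using K(2) by blast
    moreover have "\<zero>\<^bsub>E\<^esub> \<in> {x \<in> carrier E. k K x = K}" using k0[OF K(1)] by simp
    ultimately show "\<exists>U. openin TE U \<and> \<zero>\<^bsub>E\<^esub> \<in> U \<and> h ` U \<subseteq> V" using k(2)[OF K(1)] by blast
  qed
  then show thesis using that hom val by blast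
qed

section \<open>Modules of finite length\<close>

definition has_composition_series ::
  "('r, 'z) ring_scheme \<Rightarrow> ('r, 'm, 'y) module_scheme \<Rightarrow> 'm set \<Rightarrow> bool" where
  "has_composition_series R M K \<longleftrightarrow>
    (\<exists>(C :: nat \<Rightarrow> 'm set) n. C 0 = {\<zero>\<^bsub>M\<^esub>} \<and> C n = K \<and>
       (\<forall>i\<le>n. submodule (C i) R M) \<and>
       (\<forall>i<n. C i \<subset> C (Suc i) \<and> \<not> (\<exists>L. submodule L R M \<and> C i \<subset> L \<and> L \<subset> C (Suc i))))"

lemma finite_length_iff: "finite_length R M \<longleftrightarrow> has_composition_series R M (carrier M)"
  by (simp add: finite_length_def has_composition_series_def)

lemma finite_lengthE:
  assumes "finite_length R M"
  obtains C n where "C 0 = {\<zero>\<^bsub>M\<^esub>}" "C n = carrier M" "\<And>i. i \<le> n \<Longrightarrow> submodule (C i) R M"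
    "\<And>i. i < n \<Longrightarrow> C i \<subset> C (Suc i)"
    "\<And>i K. i < n \<Longrightarrow> submodule K R M \<Longrightarrow> C i \<subset> K \<Longrightarrow> K \<subset> C (Suc i) \<Longrightarrow> False"
proof -
  obtain C n where *: "C 0 = {\<zero>\<^bsub>M\<^esub>} \<and> C n = carrier M \<and>
       (\<forall>i\<le>n. submodule (C i) R M) \<and>
       (\<forall>i<n. C i \<subset> C (Suc i) \<and> \<not> (\<exists>K. submodule K R M \<and> C i \<subset> K \<and> K \<subset> C (Suc i)))"
    using assms unfolding finite_length_def by (elim exE) (rule that)
  note ** = conjunct1[OF *] conjunct1[OF conjunct2[OF *]] conjunct1[OF conjunct2[OF conjunct2[OF *]]]
    conjunct2[OF conjunct2[OF conjunct2[OF *]]]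
  show thesis
    by (rule that[of C n, OF **(1,2)]) (use **(3,4) in blast)+
qed

lemma (in left_module) submodule_sum_image:
  assumes K: "submodule K R M" and N: "left_module R N" and L: "submodule L R N"
    and f: "f \<in> module_homs R N M"
  shows "submodule {k \<oplus>\<^bsub>M\<^esub> f c | k c. k \<in> K \<and> c \<in> L} R M" (is "submodule ?S R M")
    and "K \<subseteq> {k \<oplus>\<^bsub>M\<^esub> f c | k c. k \<in> K \<and> c \<in> L}" "f ` L \<subseteq> {k \<oplus>\<^bsub>M\<^esub> f c | k c. k \<in> K \<and> c \<in> L}"
proof -
  interpret N: left_module R N by fact
  note k = submoduleD_left[OF K] and l = N.submoduleD_left[OF L] and F = N.homD[OF f]
  have f0: "f \<zero>\<^bsub>N\<^esub> = \<zero>\<^bsub>M\<^esub>" by (rule N.hom_zero[OF _ f]) (rule left_module_axioms)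
  have I: "k \<oplus>\<^bsub>M\<^esub> f c \<in> ?S" if "k \<in> K" "c \<in> L" for k c using that by blast
  have kc: "x \<in> carrier M" if "x \<in> K" for x using that k(1) by blast
  have lc: "x \<in> carrier N" "f x \<in> carrier M" if "x \<in> L" for x using that l(1) F(1) by auto
  show "K \<subseteq> ?S"
  proof
    fix x assume "x \<in> K"
    then show "x \<in> ?S" using I[OF _ l(2), of x] f0 kc by simp
  qed
  show "f ` L \<subseteq> ?S"
  proof
    fix x assume "x \<in> f ` L"
    then obtain c where c: "c \<in> L" "x = f c" by blast
    show "x \<in> ?S" using I[OF k(2) c(1)] lc(2)[OF c(1)] c(2) by simp
  qed
  show "submodule ?S R M"
  proof (rule submoduleI_left)
    show "?S \<subseteq> carrier M" using kc lc by auto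
    show "\<zero>\<^bsub>M\<^esub> \<in> ?S" using \<open>K \<subseteq> ?S\<close> k(2) by blast
    fix x assume "x \<in> ?S"
    then obtain u c where x: "u \<in> K" "c \<in> L" "x = u \<oplus>\<^bsub>M\<^esub> f c" by blast
    { fix y assume "y \<in> ?S"
      then obtain v d where y: "v \<in> K" "d \<in> L" "y = v \<oplus>\<^bsub>M\<^esub> f d" by blast
      have "x \<oplus>\<^bsub>M\<^esub> y = (u \<oplus>\<^bsub>M\<^esub> v) \<oplus>\<^bsub>M\<^esub> (f c \<oplus>\<^bsub>M\<^esub> f d)"
        using x y kc lc by (simp add: M.a_ac)
      also have "f c \<oplus>\<^bsub>M\<^esub> f d = f (c \<oplus>\<^bsub>N\<^esub> d)" using F(2) lc x y by simp
      finally show "x \<oplus>\<^bsub>M\<^esub> y \<in> ?S" using I[OF k(3)[OF x(1) y(1)] l(3)[OF x(2) y(2)]] by simp }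
    fix a assume a: "a \<in> carrier R"
    have "a \<odot>\<^bsub>M\<^esub> x = a \<odot>\<^bsub>M\<^esub> u \<oplus>\<^bsub>M\<^esub> f (a \<odot>\<^bsub>N\<^esub> c)"
      using a x kc lc F(3) by (simp add: lsmult_r_distr)
    then show "a \<odot>\<^bsub>M\<^esub> x \<in> ?S" using I[OF k(4)[OF a x(1)] l(4)[OF a x(2)]] by simp
  qed
qed

text \<open>Adding to \<open>K\<close> the images of the terms of a composition series of \<open>N\<close> gives a chain whose
  consecutive terms are equal or have nothing strictly in between.\<close>

lemma (in left_module) composition_series_add_image:
  assumes K: "submodule K R M" "has_composition_series R M K"
    and N: "left_module R N" "finite_length R N" and f: "f \<in> module_homs R N M"
  shows "has_composition_series R M {k \<oplus>\<^bsub>M\<^esub> f c | k c. k \<in> K \<and> c \<in> carrier N}"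
proof -
  interpret N: left_module R N by fact
  obtain C n where C: "C 0 = {\<zero>\<^bsub>N\<^esub>}" "C n = carrier N" "\<And>i. i \<le> n \<Longrightarrow> submodule (C i) R N"
    "\<And>i. i < n \<Longrightarrow> C i \<subset> C (Suc i)"
    "\<And>i L. i < n \<Longrightarrow> submodule L R N \<Longrightarrow> C i \<subset> L \<Longrightarrow> L \<subset> C (Suc i) \<Longrightarrow> False"
    by (rule finite_lengthE[OF N(2)]) (rule that)
  obtain D m where Dm: "D 0 = {\<zero>\<^bsub>M\<^esub>} \<and> D m = K \<and> (\<forall>i\<le>m. submodule (D i) R M) \<and>
       (\<forall>i<m. D i \<subset> D (Suc i) \<and> \<not> (\<exists>L. submodule L R M \<and> D i \<subset> L \<and> L \<subset> D (Suc i)))"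
    using K(2) unfolding has_composition_series_def by (elim exE) (rule that)
  note D = conjunct1[OF Dm] conjunct1[OF conjunct2[OF Dm]] conjunct1[OF conjunct2[OF conjunct2[OF Dm]]]
    conjunct2[OF conjunct2[OF conjunct2[OF Dm]]]
  let ?S = "\<lambda>L. {k \<oplus>\<^bsub>M\<^esub> f c | k c. k \<in> K \<and> c \<in> L}"
  note S = submodule_sum_image[OF K(1) N(1) _ f]
  have f0: "f \<zero>\<^bsub>N\<^esub> = \<zero>\<^bsub>M\<^esub>" by (rule N.hom_zero[OF _ f]) (rule left_module_axioms)
  note k = submoduleD_left[OF K(1)] and F = N.homD[OF f]
  have S0: "?S (C 0) = K"
    using k(1) f0 by (force simp: C(1))
  define E where "E i = (if i \<le> m then D i else ?S (C (i - m)))" for i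
  have E: "E i = D i" if "i \<le> m" for i using that by (simp add: E_def)
  have E': "E (m + i) = ?S (C i)" for i
    using S0 D(2) by (cases "i = 0") (auto simp: E_def)
  have "\<exists>(D :: nat \<Rightarrow> 'm set) l. D 0 = {\<zero>\<^bsub>M\<^esub>} \<and> D l = E (m + n) \<and> (\<forall>i\<le>l. submodule (D i) R M) \<and>
    (\<forall>i<l. D i \<subset> D (Suc i) \<and> \<not> (\<exists>L. submodule L R M \<and> D i \<subset> L \<and> L \<subset> D (Suc i)))"
  proof (rule finite_length_weak)
    show "E 0 = {\<zero>\<^bsub>M\<^esub>}" using E[of 0] D(1) by simp
    show "submodule (E i) R M" if i: "i \<le> m + n" for i
    proof (cases "i \<le> m")
      case True
      then show ?thesis using E D(3) by simp
    next
      case False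
      then obtain j where "i = m + j" "j \<le> n" using i by (metis add_le_cancel_left le_Suc_ex nat_le_linear)
      then show ?thesis using E' S(1)[OF C(3)] by simp
    qed
    show "E i \<subseteq> E (Suc i)" if i: "i < m + n" for i
    proof (cases "i < m")
      case True
      then show ?thesis using E[of i] E[of "Suc i"] D(4) by auto
    next
      case False
      then obtain j where j: "i = m + j" "j < n" using i by (metis add_less_cancel_left le_Suc_ex not_less)
      have "?S (C j) \<subseteq> ?S (C (Suc j))" using C(4)[OF j(2)] by blast
      then show ?thesis using E'[of j] E'[of "Suc j"] j(1) by simp
    qed
    show False if i: "i < m + n" and L: "submodule L R M" "E i \<subset> L" "L \<subset> E (Suc i)" for i L
    proof (cases "i < m")
      case True
      then show ?thesis using E[of i] E[of "Suc i"] D(4) L by auto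
    next
      case False
      then obtain j where j: "i = m + j" "j < n" using i by (metis add_less_cancel_left le_Suc_ex not_less)
      have L': "?S (C j) \<subset> L" "L \<subset> ?S (C (Suc j))" using L E'[of j] E'[of "Suc j"] j(1) by auto
      have Cj: "submodule (C j) R N" "submodule (C (Suc j)) R N" using C(3) j(2) by auto
      note l = submoduleD_left[OF L(1)] and c = N.submoduleD_left[OF Cj(1)] and c' = N.submoduleD_left[OF Cj(2)]
      let ?J = "{x \<in> C (Suc j). f x \<in> L}"
      have "submodule ?J R N"
      proof (rule N.submoduleI_left)
        show "?J \<subseteq> carrier N" using c'(1) by blast
        show "\<zero>\<^bsub>N\<^esub> \<in> ?J" using c'(2) l(2) f0 by simp
        show "x \<oplus>\<^bsub>N\<^esub> y \<in> ?J" if "x \<in> ?J" "y \<in> ?J" for x y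
          using that c'(3) l(3) F(2) c'(1) by (auto simp: subset_iff)
        show "a \<odot>\<^bsub>N\<^esub> x \<in> ?J" if "a \<in> carrier R" "x \<in> ?J" for a x
          using that c'(4) l(4) F(3) c'(1) by (auto simp: subset_iff)
      qed
      moreover have CJ: "C j \<subseteq> ?J" using C(4)[OF j(2)] S(3)[OF Cj(1)] L'(1) by blast
      moreover have "?J \<subseteq> C (Suc j)" by blast
      ultimately consider "?J = C j" | "?J = C (Suc j)" using C(5)[OF j(2), of ?J] by blast
      then show False
      proof cases
        case 1
        have "L \<subseteq> ?S (C j)"
        proof
          fix x assume x: "x \<in> L"
          then obtain u d where u: "u \<in> K" "d \<in> C (Suc j)" "x = u \<oplus>\<^bsub>M\<^esub> f d" using L'(2) by blast
          have car: "u \<in> carrier M" "f d \<in> carrier M" using k(1) u F(1) c'(1) by auto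
          have uL: "u \<in> L" using S(2)[OF Cj(1)] u(1) L'(1) by blast
          have "\<ominus>\<^bsub>M\<^esub> u \<oplus>\<^bsub>M\<^esub> x \<in> L" using l(3)[OF l(5)[OF uL] x] .
          moreover have "\<ominus>\<^bsub>M\<^esub> u \<oplus>\<^bsub>M\<^esub> x = f d" using car by (simp add: u(3) M.r_neg1)
          ultimately have "d \<in> C j" using u(2) 1 by auto
          then show "x \<in> ?S (C j)" using u by blast
        qed
        then show False using L'(1) by blast
      next
        case 2
        have "?S (C (Suc j)) \<subseteq> L"
        proof
          fix x assume "x \<in> ?S (C (Suc j))"
          then obtain u d where u: "u \<in> K" "d \<in> C (Suc j)" "x = u \<oplus>\<^bsub>M\<^esub> f d" by blast
          have "u \<in> L" using S(2)[OF Cj(1)] u(1) L'(1) by blast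
          moreover have "f d \<in> L" using u(2) 2 by auto
          ultimately show "x \<in> L" using l(3) u(3) by simp
        qed
        then show False using L'(2) by blast
      qed
    qed
  qed
  then show ?thesis unfolding has_composition_series_def E' C(2) .
qed

text \<open>Adjoining the images one after the other keeps a composition series at each stage. One image
  gives the case of a quotient of \<open>N\<close>, several give a quotient of a finite power of \<open>N\<close>.\<close>

lemma (in left_module) finite_length_generated_by_images:
  assumes I: "finite I" and N: "left_module R N" "finite_length R N"
    and f: "\<And>i. i \<in> I \<Longrightarrow> f i \<in> module_homs R N M"
    and gen: "\<And>K. submodule K R M \<Longrightarrow> (\<And>i. i \<in> I \<Longrightarrow> f i ` carrier N \<subseteq> K) \<Longrightarrow> K = carrier M"
  shows "finite_length R M"
proof -
  interpret N: left_module R N by fact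
  have N': "submodule (carrier N) R N" by (rule N.submoduleI_left) (auto intro: N.lsmult_closed)
  have "\<exists>K. submodule K R M \<and> has_composition_series R M K \<and> (\<forall>i\<in>I. f i ` carrier N \<subseteq> K)"
    using I f
  proof (induction I)
    case empty
    have z: "submodule {\<zero>\<^bsub>M\<^esub>} R M" by (rule submoduleI_left) (auto simp: lsmult_zero)
    moreover have "has_composition_series R M {\<zero>\<^bsub>M\<^esub>}"
      unfolding has_composition_series_def
      by (intro exI[of _ "\<lambda>_. {\<zero>\<^bsub>M\<^esub>}"] exI[of _ 0]) (simp add: z)
    ultimately show ?case by blast
  next
    case (insert i I)
    obtain K where K: "submodule K R M" "has_composition_series R M K" "\<And>j. j \<in> I \<Longrightarrow> f j ` carrier N \<subseteq> K"
      using insert.IH insert.prems by auto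
    have fi: "f i \<in> module_homs R N M" using insert.prems by simp
    note S = submodule_sum_image[OF K(1) N(1) N' fi]
    let ?S = "{k \<oplus>\<^bsub>M\<^esub> f i c | k c. k \<in> K \<and> c \<in> carrier N}"
    have "\<forall>j\<in>insert i I. f j ` carrier N \<subseteq> ?S"
      using S(2,3) K(3) by (metis (no_types, lifting) insertE order_trans)
    then show ?case using S(1) composition_series_add_image[OF K(1,2) N fi] by blast
  qed
  then show ?thesis using gen unfolding finite_length_iff by metis
qed

text \<open>One element from each step of a composition series suffices: a submodule containing them contains
  the terms of the series one after the other, as there is nothing strictly between two of them.\<close>

lemma (in left_module) finite_length_imp_finitely_generated:
  assumes "finite_length R M"
  obtains F where "finite F" "F \<subseteq> carrier M" "\<And>K. submodule K R M \<Longrightarrow> F \<subseteq> K \<Longrightarrow> K = carrier M"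
proof -
  obtain C n where C: "C 0 = {\<zero>\<^bsub>M\<^esub>}" "C n = carrier M" "\<And>i. i \<le> n \<Longrightarrow> submodule (C i) R M"
    "\<And>i. i < n \<Longrightarrow> C i \<subset> C (Suc i)"
    "\<And>i L. i < n \<Longrightarrow> submodule L R M \<Longrightarrow> C i \<subset> L \<Longrightarrow> L \<subset> C (Suc i) \<Longrightarrow> False"
    by (rule finite_lengthE[OF assms]) (rule that)
  have "\<forall>i\<in>{..<n}. \<exists>x. x \<in> C (Suc i) - C i" using C(4) by blast
  then obtain x where x: "\<And>i. i < n \<Longrightarrow> x i \<in> C (Suc i) - C i" by (metis lessThan_iff)
  have sub: "C i \<subseteq> carrier M" if "i \<le> n" for i using submoduleD_left(1)[OF C(3)[OF that]] .
  show thesis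
  proof (rule that)
    show "finite (x ` {..<n})" by simp
    show "x ` {..<n} \<subseteq> carrier M"
    proof
      fix y assume "y \<in> x ` {..<n}"
      then obtain i where i: "i < n" "y = x i" by blast
      then show "y \<in> carrier M" using x[OF i(1)] sub[of "Suc i"] by auto
    qed
    fix K assume K: "submodule K R M" "x ` {..<n} \<subseteq> K"
    note k = submoduleD_left[OF K(1)]
    have "C i \<subseteq> K" if "i \<le> n" for i
      using that
    proof (induction i)
      case 0
      then show ?case using C(1) k(2) by simp
    next
      case (Suc i)
      then have i: "i < n" and Ci: "C i \<subseteq> K" by auto
      note c = submoduleD_left[OF C(3)[OF Suc.prems]]
      have "submodule (K \<inter> C (Suc i)) R M"
        by (rule submoduleI_left) (use k c in auto)
      moreover have "C i \<subset> K \<inter> C (Suc i)" using Ci C(4)[OF i] x[OF i] K(2) i by blast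
      ultimately show ?case using C(5)[OF i, of "K \<inter> C (Suc i)"] by blast
    qed
    then show "K = carrier M" using C(2) k(1) by blast
  qed
qed

section \<open>Recognising limits\<close>

text \<open>All module axioms and continuity statements can be checked after projection to the discrete
  modules, because the projections are jointly injective and determine the topology.\<close>

lemma discrete_limit_topological_module:
  assumes R: "topological_ring R TR" and sys: "discrete_system R TR I leq N f"
    and top: "topspace TE = carrier E"
    and hom: "homeomorphic_map TE (inv_lim I leq (\<lambda>i. discrete_topology (carrier (N i))) f) (\<lambda>x. \<lambda>i\<in>I. p i x)"
    and zero: "\<zero>\<^bsub>E\<^esub> \<in> carrier E" "\<And>i. i \<in> I \<Longrightarrow> p i \<zero>\<^bsub>E\<^esub> = \<zero>\<^bsub>N i\<^esub>"
    and add: "\<And>x y. x \<in> carrier E \<Longrightarrow> y \<in> carrier E \<Longrightarrow> x \<oplus>\<^bsub>E\<^esub> y \<in> carrier E"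
      "\<And>i x y. i \<in> I \<Longrightarrow> x \<in> carrier E \<Longrightarrow> y \<in> carrier E \<Longrightarrow> p i (x \<oplus>\<^bsub>E\<^esub> y) = p i x \<oplus>\<^bsub>N i\<^esub> p i y"
    and smult: "\<And>r x. r \<in> carrier R \<Longrightarrow> x \<in> carrier E \<Longrightarrow> r \<odot>\<^bsub>E\<^esub> x \<in> carrier E"
      "\<And>i r x. i \<in> I \<Longrightarrow> r \<in> carrier R \<Longrightarrow> x \<in> carrier E \<Longrightarrow> p i (r \<odot>\<^bsub>E\<^esub> x) = r \<odot>\<^bsub>N i\<^esub> p i x"
  shows "topological_module R TR E TE" and "is_discrete_limit R E TE I leq N f p"
proof -
  let ?L = "inv_lim I leq (\<lambda>i. discrete_topology (carrier (N i))) f"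
  let ?P = "\<lambda>x. \<lambda>i\<in>I. p i x"
  have rR: "ring R" using R by (simp add: topological_ring_def)
  interpret R: ring R by (rule rR)
  have tN: "topological_module R TR (N i) (discrete_topology (carrier (N i)))" if "i \<in> I" for i
    using sys that by (auto simp: discrete_system_def)
  have lN: "left_module R (N i)" if "i \<in> I" for i using tN[OF that] by (simp add: topological_module_def)
  have gN: "topological_abelian_group (N i) (discrete_topology (carrier (N i)))" if "i \<in> I" for i
    using tN[OF that] by (simp add: topological_module_def)
  have inj: "x = y" if "x \<in> carrier E" "y \<in> carrier E" "\<And>i. i \<in> I \<Longrightarrow> p i x = p i y" for x y
  proof -
    have "?P x = ?P y" using that(3) by (intro restrict_ext) blast
    then show ?thesis using homeomorphic_imp_injective_map[OF hom] that top by (metis inj_onD)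
  qed
  have cp: "continuous_map TE (discrete_topology (carrier (N i))) (p i)" if "i \<in> I" for i
    using continuous_map_compose[OF homeomorphic_imp_continuous_map[OF hom] inv_lim_proj[OF that]] that
    by (simp add: o_def)
  have pc: "p i x \<in> carrier (N i)" if "i \<in> I" "x \<in> carrier E" for i x
    using cp[OF that(1)] that(2) top by (auto simp: continuous_map_def)
  have into: "continuous_map S TE g"
    if g: "\<And>z. z \<in> topspace S \<Longrightarrow> g z \<in> carrier E"
      and c: "\<And>i. i \<in> I \<Longrightarrow> continuous_map S (discrete_topology (carrier (N i))) (\<lambda>z. p i (g z))"
    for S and g :: "'s \<Rightarrow> _"
  proof -
    obtain h where h: "homeomorphic_maps TE ?L ?P h" using hom homeomorphic_map_maps by blast
    have "continuous_map S ?L (\<lambda>z. ?P (g z))"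
    proof (rule continuous_map_inv_limI)
      show "continuous_map S (discrete_topology (carrier (N i))) (\<lambda>z. ?P (g z) i)" if "i \<in> I" for i
        using c[OF that] that by simp
      fix z i j assume "z \<in> topspace S" and ij: "i \<in> I" "j \<in> I" "leq i j"
      then have "?P (g z) \<in> topspace ?L"
        using homeomorphic_imp_surjective_map[OF hom] g top by blast
      then show "f i j (?P (g z) j) = ?P (g z) i" using ij unfolding inv_lim_iff by blast
    qed simp
    moreover have "continuous_map ?L TE h" using h by (simp add: homeomorphic_maps_def)
    ultimately have "continuous_map S TE (h \<circ> (\<lambda>z. ?P (g z)))" by (rule continuous_map_compose)
    moreover have "(h \<circ> (\<lambda>z. ?P (g z))) z = g z" if "z \<in> topspace S" for z
      using h g[OF that] top by (simp add: homeomorphic_maps_def)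
    ultimately show ?thesis by (rule continuous_map_eq)
  qed
  have add_mod: "p i (x \<oplus>\<^bsub>E\<^esub> y) = p i x \<oplus>\<^bsub>N i\<^esub> p i y" "p i x \<oplus>\<^bsub>N i\<^esub> p i y \<in> carrier (N i)"
    if "i \<in> I" "x \<in> carrier E" "y \<in> carrier E" for i x y
  proof -
    interpret Ni: left_module R "N i" by (rule lN[OF that(1)])
    show "p i (x \<oplus>\<^bsub>E\<^esub> y) = p i x \<oplus>\<^bsub>N i\<^esub> p i y" "p i x \<oplus>\<^bsub>N i\<^esub> p i y \<in> carrier (N i)"
      using add(2)[OF that] pc that by auto
  qed
  have inv: "(\<ominus>\<^bsub>R\<^esub> \<one>\<^bsub>R\<^esub>) \<odot>\<^bsub>E\<^esub> x \<oplus>\<^bsub>E\<^esub> x = \<zero>\<^bsub>E\<^esub>" "(\<ominus>\<^bsub>R\<^esub> \<one>\<^bsub>R\<^esub>) \<odot>\<^bsub>E\<^esub> x \<in> carrier E" if x: "x \<in> carrier E" for x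
  proof -
    show 1: "(\<ominus>\<^bsub>R\<^esub> \<one>\<^bsub>R\<^esub>) \<odot>\<^bsub>E\<^esub> x \<in> carrier E" by (rule smult(1)) (use x in auto)
    show "(\<ominus>\<^bsub>R\<^esub> \<one>\<^bsub>R\<^esub>) \<odot>\<^bsub>E\<^esub> x \<oplus>\<^bsub>E\<^esub> x = \<zero>\<^bsub>E\<^esub>"
    proof (rule inj)
      fix i assume i: "i \<in> I"
      interpret Ni: left_module R "N i" by (rule lN[OF i])
      have px: "p i x \<in> carrier (N i)" by (rule pc[OF i x])
      have "p i ((\<ominus>\<^bsub>R\<^esub> \<one>\<^bsub>R\<^esub>) \<odot>\<^bsub>E\<^esub> x \<oplus>\<^bsub>E\<^esub> x) = \<ominus>\<^bsub>N i\<^esub> p i x \<oplus>\<^bsub>N i\<^esub> p i x"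
        unfolding add(2)[OF i 1 x] by (subst smult(2)[OF i _ x]) (simp_all add: Ni.lsmult_minus_one px)
      also have "\<dots> = \<zero>\<^bsub>N i\<^esub>" using px by (rule Ni.M.l_neg)
      finally show "p i ((\<ominus>\<^bsub>R\<^esub> \<one>\<^bsub>R\<^esub>) \<odot>\<^bsub>E\<^esub> x \<oplus>\<^bsub>E\<^esub> x) = p i \<zero>\<^bsub>E\<^esub>" using zero(2)[OF i] by simp
    qed (use add(1)[OF 1 x] zero in simp_all)
  qed
  have ab: "abelian_group E"
  proof (rule abelian_groupI)
    show "x \<oplus>\<^bsub>E\<^esub> y \<oplus>\<^bsub>E\<^esub> z = x \<oplus>\<^bsub>E\<^esub> (y \<oplus>\<^bsub>E\<^esub> z)"
      if xyz: "x \<in> carrier E" "y \<in> carrier E" "z \<in> carrier E" for x y z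
    proof (rule inj)
      fix i assume i: "i \<in> I"
      interpret Ni: left_module R "N i" by (rule lN[OF i])
      show "p i (x \<oplus>\<^bsub>E\<^esub> y \<oplus>\<^bsub>E\<^esub> z) = p i (x \<oplus>\<^bsub>E\<^esub> (y \<oplus>\<^bsub>E\<^esub> z))"
        using i xyz add(1) by (simp add: add(2) pc Ni.M.a_assoc)
    qed (use xyz add(1) in simp_all)
    show "x \<oplus>\<^bsub>E\<^esub> y = y \<oplus>\<^bsub>E\<^esub> x" if xy: "x \<in> carrier E" "y \<in> carrier E" for x y
    proof (rule inj)
      fix i assume i: "i \<in> I"
      interpret Ni: left_module R "N i" by (rule lN[OF i])
      show "p i (x \<oplus>\<^bsub>E\<^esub> y) = p i (y \<oplus>\<^bsub>E\<^esub> x)"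
        unfolding add(2)[OF i xy] add(2)[OF i xy(2,1)] by (rule Ni.M.a_comm[OF pc[OF i xy(1)] pc[OF i xy(2)]])
    qed (use xy add(1) in simp_all)
    show "\<zero>\<^bsub>E\<^esub> \<oplus>\<^bsub>E\<^esub> x = x" if x: "x \<in> carrier E" for x
    proof (rule inj)
      fix i assume i: "i \<in> I"
      interpret Ni: left_module R "N i" by (rule lN[OF i])
      show "p i (\<zero>\<^bsub>E\<^esub> \<oplus>\<^bsub>E\<^esub> x) = p i x"
        unfolding add(2)[OF i zero(1) x] zero(2)[OF i] by (rule Ni.M.l_zero[OF pc[OF i x]])
    qed (use x zero add(1) in simp_all)
    show "\<exists>y\<in>carrier E. y \<oplus>\<^bsub>E\<^esub> x = \<zero>\<^bsub>E\<^esub>" if x: "x \<in> carrier E" for x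
      using inv[OF x] by blast
  qed (use zero add(1) in auto)
  then interpret E: abelian_group E .
  have lm: "left_module R E"
  proof (intro left_module.intro left_module_axioms.intro)
    show "ring R" by (rule rR)
    show "abelian_group E" by (rule ab)
    show "a \<odot>\<^bsub>E\<^esub> x \<in> carrier E" if "a \<in> carrier R" "x \<in> carrier E" for a x using smult(1) that .
    show "(a \<oplus>\<^bsub>R\<^esub> b) \<odot>\<^bsub>E\<^esub> x = a \<odot>\<^bsub>E\<^esub> x \<oplus>\<^bsub>E\<^esub> b \<odot>\<^bsub>E\<^esub> x"
      if h: "a \<in> carrier R" "b \<in> carrier R" "x \<in> carrier E" for a b x
    proof (rule inj)
      fix i assume i: "i \<in> I"
      interpret Ni: left_module R "N i" by (rule lN[OF i])
      show "p i ((a \<oplus>\<^bsub>R\<^esub> b) \<odot>\<^bsub>E\<^esub> x) = p i (a \<odot>\<^bsub>E\<^esub> x \<oplus>\<^bsub>E\<^esub> b \<odot>\<^bsub>E\<^esub> x)"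
        using i h smult(1) by (simp add: smult(2) add(2) pc Ni.lsmult_l_distr)
    qed (use h smult(1) in simp_all)
    show "a \<odot>\<^bsub>E\<^esub> (x \<oplus>\<^bsub>E\<^esub> y) = a \<odot>\<^bsub>E\<^esub> x \<oplus>\<^bsub>E\<^esub> a \<odot>\<^bsub>E\<^esub> y"
      if h: "a \<in> carrier R" "x \<in> carrier E" "y \<in> carrier E" for a x y
    proof (rule inj)
      fix i assume i: "i \<in> I"
      interpret Ni: left_module R "N i" by (rule lN[OF i])
      show "p i (a \<odot>\<^bsub>E\<^esub> (x \<oplus>\<^bsub>E\<^esub> y)) = p i (a \<odot>\<^bsub>E\<^esub> x \<oplus>\<^bsub>E\<^esub> a \<odot>\<^bsub>E\<^esub> y)"
        using i h smult(1) by (simp add: smult(2) add(2) pc Ni.lsmult_r_distr)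
    qed (use h smult(1) in simp_all)
    show "(a \<otimes>\<^bsub>R\<^esub> b) \<odot>\<^bsub>E\<^esub> x = a \<odot>\<^bsub>E\<^esub> (b \<odot>\<^bsub>E\<^esub> x)"
      if h: "a \<in> carrier R" "b \<in> carrier R" "x \<in> carrier E" for a b x
    proof (rule inj)
      fix i assume i: "i \<in> I"
      interpret Ni: left_module R "N i" by (rule lN[OF i])
      show "p i ((a \<otimes>\<^bsub>R\<^esub> b) \<odot>\<^bsub>E\<^esub> x) = p i (a \<odot>\<^bsub>E\<^esub> (b \<odot>\<^bsub>E\<^esub> x))"
        using i h smult(1) by (simp add: smult(2) pc Ni.lsmult_assoc)
    qed (use h smult(1) in simp_all)
    show "\<one>\<^bsub>R\<^esub> \<odot>\<^bsub>E\<^esub> x = x" if h: "x \<in> carrier E" for x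
    proof (rule inj)
      fix i assume i: "i \<in> I"
      interpret Ni: left_module R "N i" by (rule lN[OF i])
      show "p i (\<one>\<^bsub>R\<^esub> \<odot>\<^bsub>E\<^esub> x) = p i x"
        using i h by (simp add: smult(2) pc Ni.lsmult_one)
    qed (use h smult(1) in simp_all)
  qed
  then interpret E: left_module R E .
  have neg: "p i (\<ominus>\<^bsub>E\<^esub> x) = \<ominus>\<^bsub>N i\<^esub> p i x" if "i \<in> I" "x \<in> carrier E" for i x
  proof -
    interpret Ni: left_module R "N i" by (rule lN[OF that(1)])
    show ?thesis unfolding E.lsmult_minus_one[OF that(2), symmetric]
      by (subst smult(2)[OF that(1) _ that(2)]) (simp_all add: Ni.lsmult_minus_one pc that)
  qed
  have tag: "topological_abelian_group E TE"
    unfolding topological_abelian_group_def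
  proof (intro conjI ab top into)
    fix i assume i: "i \<in> I"
    note t = topological_abelian_groupD[OF gN[OF i]]
    have 1: "continuous_map (prod_topology TE TE) (discrete_topology (carrier (N i))) (\<lambda>z. p i (fst z))"
      "continuous_map (prod_topology TE TE) (discrete_topology (carrier (N i))) (\<lambda>z. p i (snd z))"
      using continuous_map_compose[OF continuous_map_fst cp[OF i]]
        continuous_map_compose[OF continuous_map_snd cp[OF i]] by (simp_all add: o_def)
    show "continuous_map (prod_topology TE TE) (discrete_topology (carrier (N i)))
        (\<lambda>z. p i (case z of (x, y) \<Rightarrow> x \<oplus>\<^bsub>E\<^esub> y))"
      by (rule continuous_map_eq[OF t(3)[OF 1]]) (auto simp: top add(2)[OF i])
    show "continuous_map TE (discrete_topology (carrier (N i))) (\<lambda>z. p i (\<ominus>\<^bsub>E\<^esub> z))"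
      by (rule continuous_map_eq[OF t(4)[OF cp[OF i]]]) (simp add: top neg[OF i])
  qed (auto simp: top add(1))
  have tR: "topspace TR = carrier R" using R by (simp add: topological_ring_def topological_abelian_group_def)
  have "continuous_map (prod_topology TR TE) TE (\<lambda>(r, x). r \<odot>\<^bsub>E\<^esub> x)"
  proof (rule into)
    fix i assume i: "i \<in> I"
    have c: "continuous_map (prod_topology TR (discrete_topology (carrier (N i)))) (discrete_topology (carrier (N i)))
      (\<lambda>(r, x). r \<odot>\<^bsub>N i\<^esub> x)" using tN[OF i] by (simp add: topological_module_def)
    have "continuous_map (prod_topology TR TE) (prod_topology TR (discrete_topology (carrier (N i))))
      (\<lambda>z. (fst z, p i (snd z)))"
      using continuous_map_compose[OF continuous_map_snd cp[OF i]]
      by (intro continuous_map_pairedI continuous_map_fst) (simp add: o_def)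
    from continuous_map_compose[OF this c]
    show "continuous_map (prod_topology TR TE) (discrete_topology (carrier (N i)))
        (\<lambda>z. p i (case z of (r, x) \<Rightarrow> r \<odot>\<^bsub>E\<^esub> x))"
      by (rule continuous_map_eq) (auto simp: top tR smult(2)[OF i])
  qed (auto simp: top tR smult(1))
  then show "topological_module R TR E TE" using R lm tag by (simp add: topological_module_def)
  have "p i \<in> module_homs R E (N i)" if "i \<in> I" for i
    using that pc add(2) smult(2) by (auto simp: module_homs_def hom_def)
  then show "is_discrete_limit R E TE I leq N f p" using hom by (simp add: is_discrete_limit_def)
qed

section \<open>Quotients of modules and bimodules\<close>

lemma right_module_simps [simp]:
  "carrier (right_module P) = carrier P" "\<zero>\<^bsub>right_module P\<^esub> = \<zero>\<^bsub>P\<^esub>"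
  "x \<oplus>\<^bsub>right_module P\<^esub> y = x \<oplus>\<^bsub>P\<^esub> y" "a \<odot>\<^bsub>right_module P\<^esub> x = rsmult P x a"
  by (simp_all add: right_module_def)

lemma a_r_coset_right_module [simp]: "U +>\<^bsub>right_module P\<^esub> x = U +>\<^bsub>P\<^esub> x"
  by (simp add: a_r_coset_def r_coset_def)

lemma a_inv_right_module [simp]: "\<ominus>\<^bsub>right_module P\<^esub> x = \<ominus>\<^bsub>P\<^esub> x" "x \<ominus>\<^bsub>right_module P\<^esub> y = x \<ominus>\<^bsub>P\<^esub> y"
  by (simp_all add: a_inv_def a_minus_def m_inv_def)

lemma quot_module_hom:
  assumes K: "left_module R K" "submodule V R K" and M: "left_module R M" "submodule U R M"
    and f: "f \<in> module_homs R K M" "f ` V \<subseteq> U"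
  shows "coset_map M U f \<in> module_homs R (quot_module K V) (quot_module M U)"
    and "x \<in> carrier K \<Longrightarrow> coset_map M U f (V +>\<^bsub>K\<^esub> x) = U +>\<^bsub>M\<^esub> f x"
proof -
  interpret K: left_module R K by (rule K(1))
  interpret M: left_module R M by (rule M(1))
  note F = K.homD[OF f(1)]
  have fh: "f \<in> hom (add_monoid K) (add_monoid M)" using f(1) by (simp add: module_homs_def)
  show cm: "coset_map M U f (V +>\<^bsub>K\<^esub> x) = U +>\<^bsub>M\<^esub> f x" if "x \<in> carrier K" for x
    by (rule coset_map_coset[OF K.submodule_abelian_subgroup[OF K(2)] M.submodule_abelian_subgroup[OF M(2)] fh f(2) that])
  note qK = K.quot_module_facts[OF K(2)] and qM = M.quot_module_facts[OF M(2)]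
  have add: "coset_map M U f (x \<oplus>\<^bsub>quot_module K V\<^esub> y) = coset_map M U f x \<oplus>\<^bsub>quot_module M U\<^esub> coset_map M U f y"
    if "x \<in> carrier (quot_module K V)" "y \<in> carrier (quot_module K V)" for x y
    using that F by (auto simp: qK(2,3) qM(3) cm)
  have sm: "coset_map M U f (a \<odot>\<^bsub>quot_module K V\<^esub> x) = a \<odot>\<^bsub>quot_module M U\<^esub> coset_map M U f x"
    if "a \<in> carrier R" "x \<in> carrier (quot_module K V)" for a x
    using that F by (auto simp: qK(2,4) qM(4) cm K.lsmult_closed)
  have cl: "coset_map M U f x \<in> carrier (quot_module M U)" if "x \<in> carrier (quot_module K V)" for x
    using that F by (auto simp: qK(2) qM(2) cm)
  show "coset_map M U f \<in> module_homs R (quot_module K V) (quot_module M U)"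
    using add sm cl by (auto simp: module_homs_def hom_def)
qed

lemma module_homs_id: "left_module R M \<Longrightarrow> (\<lambda>C. C) \<in> module_homs R M M"
  by (auto simp: module_homs_def hom_def)

lemma open_submodules_Int:
  assumes "left_module R M" "U \<in> open_submodules R M TM" "V \<in> open_submodules R M TM"
  shows "U \<inter> V \<in> open_submodules R M TM"
proof -
  interpret left_module R M by fact
  have s: "submodule U R M" "submodule V R M" "openin TM U" "openin TM V"
    using assms by (auto simp: open_submodules_def)
  have "submodule (U \<inter> V) R M"
    using submoduleD_left[OF s(1)] submoduleD_left[OF s(2)] by (intro submoduleI_left) auto
  then show ?thesis using s by (auto simp: open_submodules_def)
qed

lemma carrier_open_submodule:
  assumes "topological_module R TR M TM"
  shows "carrier M \<in> open_submodules R M TM"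
proof -
  interpret left_module R M using assms by (rule topological_module_left_module)
  have "submodule (carrier M) R M" by (rule submoduleI_left) (auto simp: lsmult_closed)
  moreover have "topspace TM = carrier M"
    using assms by (simp add: topological_module_def topological_abelian_group_def)
  ultimately show ?thesis using openin_topspace[of TM] by (simp add: open_submodules_def)
qed

text \<open>The preimage of a set under the action is a union of slices over the points of the discrete
  module.\<close>

lemma discrete_topological_moduleI:
  assumes R: "topological_ring R TR" and M: "left_module R M"
    and c: "\<And>x. x \<in> carrier M \<Longrightarrow> continuous_map TR (discrete_topology (carrier M)) (\<lambda>r. r \<odot>\<^bsub>M\<^esub> x)"
  shows "topological_module R TR M (discrete_topology (carrier M))"
proof -
  interpret left_module R M by (rule M)
  let ?D = "discrete_topology (carrier M)"
  have tR: "topspace TR = carrier R" using R by (simp add: topological_ring_def topological_abelian_group_def)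
  have "continuous_map (prod_topology TR ?D) ?D (\<lambda>(r, x). r \<odot>\<^bsub>M\<^esub> x)"
    unfolding continuous_map_def
  proof (intro conjI allI impI)
    show "(\<lambda>(r, x). r \<odot>\<^bsub>M\<^esub> x) \<in> topspace (prod_topology TR ?D) \<rightarrow> topspace ?D"
      by (auto simp: tR lsmult_closed)
    fix S assume S: "openin ?D S"
    have "{z \<in> topspace (prod_topology TR ?D). (case z of (r, x) \<Rightarrow> r \<odot>\<^bsub>M\<^esub> x) \<in> S} =
        (\<Union>x\<in>carrier M. {r \<in> topspace TR. r \<odot>\<^bsub>M\<^esub> x \<in> S} \<times> {x})"
      by (auto simp: tR)
    moreover have "openin (prod_topology TR ?D) (\<Union>x\<in>carrier M. {r \<in> topspace TR. r \<odot>\<^bsub>M\<^esub> x \<in> S} \<times> {x})"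
      using openin_continuous_map_preimage[OF c S]
      by (intro openin_Union) (auto simp: openin_prod_Times_iff)
    ultimately show "openin (prod_topology TR ?D)
      {z \<in> topspace (prod_topology TR ?D). (case z of (r, x) \<Rightarrow> r \<odot>\<^bsub>M\<^esub> x) \<in> S}" by simp
  qed
  moreover have "topological_abelian_group M ?D"
    by (auto simp: topological_abelian_group_def M.abelian_group_axioms
        prod_topology_discrete_topology[symmetric])
  ultimately show ?thesis using R M by (simp add: topological_module_def)
qed

section \<open>Completed tensor products of pseudocompact modules\<close>

text \<open>The last two assumptions are the finiteness conditions under which the completed tensor product is
  pseudocompact over \<open>B\<close>: finite colength of small open subbimodules, and finite generation over \<open>A\<close>
  of the discrete quotients of \<open>N\<close>, phrased by submodules of \<open>N\<close> that contain \<open>V\<close>.\<close>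

locale completed_tensor =
  fixes A :: "('a, 'z) ring_scheme" and TA :: "'a topology"
    and B :: "('b, 'x) ring_scheme" and TB :: "'b topology"
    and P :: "('b, 'a, 'p, 'y) bimodule_scheme" and TP :: "'p topology"
    and N :: "('a, 'n, 'w) module_scheme" and TN :: "'n topology"
  assumes PB: "topological_module B TB P TP"
    and PA: "topological_module (op_ring A) TA (right_module P) TP"
    and bimodule: "\<And>b a p. b \<in> carrier B \<Longrightarrow> a \<in> carrier A \<Longrightarrow> p \<in> carrier P \<Longrightarrow>
      rsmult P (b \<odot>\<^bsub>P\<^esub> p) a = b \<odot>\<^bsub>P\<^esub> rsmult P p a"
    and NA: "topological_module A TA N TN"
    and small: "\<And>U. U \<in> open_submodules (op_ring A) (right_module P) TP \<Longrightarrow>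
      \<exists>W\<in>open_submodules (op_ring A) (right_module P) TP.
        W \<subseteq> U \<and> submodule W B P \<and> finite_length B (quot_module P W)"
    and finitely_generated: "\<And>V. V \<in> open_submodules A N TN \<Longrightarrow>
      \<exists>F. finite F \<and> F \<subseteq> carrier N \<and> (\<forall>K. submodule K A N \<longrightarrow> F \<subseteq> K \<longrightarrow> V \<subseteq> K \<longrightarrow> K = carrier N)"
begin

abbreviation "Q \<equiv> right_module P"
abbreviation "UU \<equiv> open_submodules (op_ring A) Q TP"
abbreviation "VV \<equiv> open_submodules A N TN"
abbreviation "WW \<equiv> {W \<in> UU. submodule W B P \<and> finite_length B (quot_module P W)}"
abbreviation "T U V \<equiv> tensor A (quot_module Q U) (quot_module N V)"
abbreviation "el U V p n \<equiv> tensor_elem A (quot_module Q U) (quot_module N V) (U +>\<^bsub>P\<^esub> p) (V +>\<^bsub>N\<^esub> n)"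
abbreviation "E \<equiv> ctensor A P TP N TN"
abbreviation "TE \<equiv> ctensor_top A Q TP N TN"
abbreviation "ce p n \<equiv> ctensor_elem A Q TP N TN p n"

sublocale P: left_module B P using PB by (rule topological_module_left_module)
sublocale Q: left_module "op_ring A" Q using PA by (rule topological_module_left_module)
sublocale N: left_module A N using NA by (rule topological_module_left_module)

lemma UUD:
  assumes "U \<in> UU"
  shows "submodule U (op_ring A) Q" "openin TP U" "U \<subseteq> carrier P"
    "\<And>a p. a \<in> carrier A \<Longrightarrow> p \<in> U \<Longrightarrow> rsmult P p a \<in> U"
    "\<zero>\<^bsub>P\<^esub> \<in> U" "\<And>p q. p \<in> U \<Longrightarrow> q \<in> U \<Longrightarrow> p \<oplus>\<^bsub>P\<^esub> q \<in> U"
proof -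
  show 1: "submodule U (op_ring A) Q" and "openin TP U" using assms by (auto simp: open_submodules_def)
  note s = Q.submoduleD_left[OF 1]
  show "U \<subseteq> carrier P" "\<zero>\<^bsub>P\<^esub> \<in> U" using s(1,2) by auto
  show "\<And>p q. p \<in> U \<Longrightarrow> q \<in> U \<Longrightarrow> p \<oplus>\<^bsub>P\<^esub> q \<in> U" using s(3) by auto
  show "\<And>a p. a \<in> carrier A \<Longrightarrow> p \<in> U \<Longrightarrow> rsmult P p a \<in> U" using s(4) by auto
qed

lemma VVD:
  assumes "V \<in> VV"
  shows "submodule V A N" "openin TN V"
  using assms by (auto simp: open_submodules_def)

lemma rsmult_closed [simp]: "a \<in> carrier A \<Longrightarrow> p \<in> carrier P \<Longrightarrow> rsmult P p a \<in> carrier P"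
  using Q.lsmult_closed[of a p] by simp

lemma factors: "U \<in> UU \<Longrightarrow> V \<in> VV \<Longrightarrow> tensor_factors A (quot_module Q U) (quot_module N V)"
  unfolding tensor_factors_def
  using Q.quot_module_facts(1)[OF UUD(1)] N.quot_module_facts(1)[OF VVD(1)] by blast

lemma T_comm_group: "U \<in> UU \<Longrightarrow> V \<in> VV \<Longrightarrow> comm_group (T U V)"
  by (rule tensor_factors.tensor_comm_group[OF factors])

lemma quotQ:
  assumes "U \<in> UU"
  shows "carrier (quot_module Q U) = (\<lambda>x. U +>\<^bsub>P\<^esub> x) ` carrier P"
    and "\<And>x y. x \<in> carrier P \<Longrightarrow> y \<in> carrier P \<Longrightarrow>
      (U +>\<^bsub>P\<^esub> x) \<oplus>\<^bsub>quot_module Q U\<^esub> (U +>\<^bsub>P\<^esub> y) = U +>\<^bsub>P\<^esub> (x \<oplus>\<^bsub>P\<^esub> y)"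
    and "\<And>a x. a \<in> carrier A \<Longrightarrow> x \<in> carrier P \<Longrightarrow>
      a \<odot>\<^bsub>quot_module Q U\<^esub> (U +>\<^bsub>P\<^esub> x) = U +>\<^bsub>P\<^esub> rsmult P x a"
  using Q.quot_module_facts(2-4)[OF UUD(1)[OF assms]] by simp_all

lemma quotN:
  assumes "V \<in> VV"
  shows "carrier (quot_module N V) = (\<lambda>x. V +>\<^bsub>N\<^esub> x) ` carrier N"
    and "\<And>x y. x \<in> carrier N \<Longrightarrow> y \<in> carrier N \<Longrightarrow>
      (V +>\<^bsub>N\<^esub> x) \<oplus>\<^bsub>quot_module N V\<^esub> (V +>\<^bsub>N\<^esub> y) = V +>\<^bsub>N\<^esub> (x \<oplus>\<^bsub>N\<^esub> y)"
    and "\<And>a x. a \<in> carrier A \<Longrightarrow> x \<in> carrier N \<Longrightarrow>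
      a \<odot>\<^bsub>quot_module N V\<^esub> (V +>\<^bsub>N\<^esub> x) = V +>\<^bsub>N\<^esub> (a \<odot>\<^bsub>N\<^esub> x)"
  using N.quot_module_facts(2-4)[OF VVD(1)[OF assms]] by simp_all

lemma coset_eqP: "U \<in> UU \<Longrightarrow> x \<in> carrier P \<Longrightarrow> y \<in> carrier P \<Longrightarrow>
    U +>\<^bsub>P\<^esub> x = U +>\<^bsub>P\<^esub> y \<longleftrightarrow> x \<ominus>\<^bsub>P\<^esub> y \<in> U"
  using Q.coset_eq_iff[OF Q.submodule_abelian_subgroup[OF UUD(1)], of U x y] by simp

lemma coset_eqN: "V \<in> VV \<Longrightarrow> x \<in> carrier N \<Longrightarrow> y \<in> carrier N \<Longrightarrow>
    V +>\<^bsub>N\<^esub> x = V +>\<^bsub>N\<^esub> y \<longleftrightarrow> x \<ominus>\<^bsub>N\<^esub> y \<in> V"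
  by (rule N.coset_eq_iff[OF N.submodule_abelian_subgroup[OF VVD(1)]])

lemma el_props:
  assumes "U \<in> UU" "V \<in> VV"
  shows "\<And>p n. p \<in> carrier P \<Longrightarrow> n \<in> carrier N \<Longrightarrow> el U V p n \<in> carrier (T U V)"
    and "\<And>p q n. p \<in> carrier P \<Longrightarrow> q \<in> carrier P \<Longrightarrow> n \<in> carrier N \<Longrightarrow>
      el U V (p \<oplus>\<^bsub>P\<^esub> q) n = el U V p n \<otimes>\<^bsub>T U V\<^esub> el U V q n"
    and "\<And>p m n. p \<in> carrier P \<Longrightarrow> m \<in> carrier N \<Longrightarrow> n \<in> carrier N \<Longrightarrow>
      el U V p (m \<oplus>\<^bsub>N\<^esub> n) = el U V p m \<otimes>\<^bsub>T U V\<^esub> el U V p n"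
    and "\<And>a p n. a \<in> carrier A \<Longrightarrow> p \<in> carrier P \<Longrightarrow> n \<in> carrier N \<Longrightarrow>
      el U V (rsmult P p a) n = el U V p (a \<odot>\<^bsub>N\<^esub> n)"
    and "\<And>p n. p \<in> U \<Longrightarrow> n \<in> carrier N \<Longrightarrow> el U V p n = \<one>\<^bsub>T U V\<^esub>"
    and "\<And>p n. p \<in> carrier P \<Longrightarrow> n \<in> V \<Longrightarrow> el U V p n = \<one>\<^bsub>T U V\<^esub>"
proof -
  interpret F: tensor_factors A "quot_module Q U" "quot_module N V" by (rule factors[OF assms])
  have c: "U +>\<^bsub>P\<^esub> p \<in> carrier (quot_module Q U)" if "p \<in> carrier P" for p
    using that quotQ(1)[OF assms(1)] by simp
  have d: "V +>\<^bsub>N\<^esub> n \<in> carrier (quot_module N V)" if "n \<in> carrier N" for n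
    using that quotN(1)[OF assms(2)] by simp
  show cl: "el U V p n \<in> carrier (T U V)" if "p \<in> carrier P" "n \<in> carrier N" for p n
    using F.elem_closed[OF c d] that .
  show l: "el U V (p \<oplus>\<^bsub>P\<^esub> q) n = el U V p n \<otimes>\<^bsub>T U V\<^esub> el U V q n"
    if "p \<in> carrier P" "q \<in> carrier P" "n \<in> carrier N" for p q n
    using F.elem_add_left[OF c[OF that(1)] c[OF that(2)] d[OF that(3)]] quotQ(2)[OF assms(1) that(1,2)] by simp
  show r: "el U V p (m \<oplus>\<^bsub>N\<^esub> n) = el U V p m \<otimes>\<^bsub>T U V\<^esub> el U V p n"
    if "p \<in> carrier P" "m \<in> carrier N" "n \<in> carrier N" for p m n
    using F.elem_add_right[OF c[OF that(1)] d[OF that(2)] d[OF that(3)]] quotN(2)[OF assms(2) that(2,3)] by simp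
  show "el U V (rsmult P p a) n = el U V p (a \<odot>\<^bsub>N\<^esub> n)"
    if "a \<in> carrier A" "p \<in> carrier P" "n \<in> carrier N" for a p n
    using F.elem_balanced[OF that(1) c[OF that(2)] d[OF that(3)]]
      quotQ(3)[OF assms(1) that(1,2)] quotN(3)[OF assms(2) that(1,3)] by simp
  have idem: "x = \<one>\<^bsub>T U V\<^esub>" if "x \<in> carrier (T U V)" "x \<otimes>\<^bsub>T U V\<^esub> x = x" for x
    using that by (metis F.T.l_cancel_one)
  show "el U V p n = \<one>\<^bsub>T U V\<^esub>" if p: "p \<in> U" and n: "n \<in> carrier N" for p n
  proof -
    have pc: "p \<in> carrier P" using UUD(3)[OF assms(1)] p by blast
    have "U +>\<^bsub>P\<^esub> p = U +>\<^bsub>P\<^esub> \<zero>\<^bsub>P\<^esub>" using coset_eqP[OF assms(1) pc P.M.zero_closed] p pc by simp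
    moreover have "el U V \<zero>\<^bsub>P\<^esub> n = \<one>\<^bsub>T U V\<^esub>"
      by (rule idem) (use cl l[of "\<zero>\<^bsub>P\<^esub>" "\<zero>\<^bsub>P\<^esub>" n] n in simp_all)
    ultimately show ?thesis by simp
  qed
  show "el U V p n = \<one>\<^bsub>T U V\<^esub>" if p: "p \<in> carrier P" and n: "n \<in> V" for p n
  proof -
    have nc: "n \<in> carrier N" using N.submoduleD_left(1)[OF VVD(1)[OF assms(2)]] n by blast
    have "V +>\<^bsub>N\<^esub> n = V +>\<^bsub>N\<^esub> \<zero>\<^bsub>N\<^esub>" using coset_eqN[OF assms(2) nc N.M.zero_closed] n nc by simp
    moreover have "el U V p \<zero>\<^bsub>N\<^esub> = \<one>\<^bsub>T U V\<^esub>"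
      by (rule idem) (use cl r[of p "\<zero>\<^bsub>N\<^esub>" "\<zero>\<^bsub>N\<^esub>"] p in simp_all)
    ultimately show ?thesis by simp
  qed
qed

lemma T_induct [consumes 3, case_names el one diff]:
  assumes "U \<in> UU" "V \<in> VV" "x \<in> carrier (T U V)"
    and "\<And>p n. p \<in> carrier P \<Longrightarrow> n \<in> carrier N \<Longrightarrow> R (el U V p n)"
    and "R \<one>\<^bsub>T U V\<^esub>"
    and "\<And>x y. x \<in> carrier (T U V) \<Longrightarrow> y \<in> carrier (T U V) \<Longrightarrow> R x \<Longrightarrow> R y \<Longrightarrow> R (x \<otimes>\<^bsub>T U V\<^esub> inv\<^bsub>T U V\<^esub> y)"
  shows "R x"
proof (rule tensor_factors.tensor_induct[OF factors[OF assms(1,2)] assms(3)])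
  fix c d assume "c \<in> carrier (quot_module Q U)" "d \<in> carrier (quot_module N V)"
  then show "R (tensor_elem A (quot_module Q U) (quot_module N V) c d)"
    using assms(4) by (auto simp: quotQ(1)[OF assms(1)] quotN(1)[OF assms(2)])
qed (use assms in blast)+

text \<open>A homomorphism between two of the groups \<open>T U V\<close> that sends the class of \<open>p \<otimes> n\<close> to that of
  \<open>f p \<otimes> n\<close>. Such a homomorphism is unique, so all identities between the transition maps and the
  action of \<open>B\<close> are identities between the functions \<open>f\<close>.\<close>

definition covers :: "('p \<Rightarrow> 'p) \<Rightarrow> 'p set \<Rightarrow> 'n set \<Rightarrow> 'p set \<Rightarrow> 'n set \<Rightarrow> _" where
  "covers f U' V' U V h \<longleftrightarrow> h \<in> hom (T U' V') (T U V) \<and>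
     (\<forall>p\<in>carrier P. \<forall>n\<in>carrier N. h (el U' V' p n) = el U V (f p) n)"

lemma covers_hom:
  assumes "covers f U' V' U V h" "U \<in> UU" "V \<in> VV" "U' \<in> UU" "V' \<in> VV"
  shows "x \<in> carrier (T U' V') \<Longrightarrow> h x \<in> carrier (T U V)"
    and "x \<in> carrier (T U' V') \<Longrightarrow> y \<in> carrier (T U' V') \<Longrightarrow> h (x \<otimes>\<^bsub>T U' V'\<^esub> y) = h x \<otimes>\<^bsub>T U V\<^esub> h y"
    and "h \<one>\<^bsub>T U' V'\<^esub> = \<one>\<^bsub>T U V\<^esub>"
    and "x \<in> carrier (T U' V') \<Longrightarrow> h (inv\<^bsub>T U' V'\<^esub> x) = inv\<^bsub>T U V\<^esub> h x"
    and "p \<in> carrier P \<Longrightarrow> n \<in> carrier N \<Longrightarrow> h (el U' V' p n) = el U V (f p) n"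
proof -
  interpret S: comm_group "T U' V'" by (rule T_comm_group[OF assms(4,5)])
  interpret S': comm_group "T U V" by (rule T_comm_group[OF assms(2,3)])
  interpret h: group_hom "T U' V'" "T U V" h
    using assms(1) by (simp add: covers_def group_hom_def group_hom_axioms_def S.is_group S'.is_group)
  show "x \<in> carrier (T U' V') \<Longrightarrow> h x \<in> carrier (T U V)" by simp
  show "x \<in> carrier (T U' V') \<Longrightarrow> y \<in> carrier (T U' V') \<Longrightarrow> h (x \<otimes>\<^bsub>T U' V'\<^esub> y) = h x \<otimes>\<^bsub>T U V\<^esub> h y" by simp
  show "h \<one>\<^bsub>T U' V'\<^esub> = \<one>\<^bsub>T U V\<^esub>" by simp
  show "x \<in> carrier (T U' V') \<Longrightarrow> h (inv\<^bsub>T U' V'\<^esub> x) = inv\<^bsub>T U V\<^esub> h x" by simp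
  show "p \<in> carrier P \<Longrightarrow> n \<in> carrier N \<Longrightarrow> h (el U' V' p n) = el U V (f p) n"
    using assms(1) by (simp add: covers_def)
qed

lemma covers_unique:
  assumes "covers f U' V' U V h" "covers g U' V' U V h'" "U \<in> UU" "V \<in> VV" "U' \<in> UU" "V' \<in> VV"
    and "x \<in> carrier (T U' V')" and "\<And>p. p \<in> carrier P \<Longrightarrow> f p = g p"
  shows "h x = h' x"
  using assms(5,6,7)
proof (induction rule: T_induct)
  case (el p n)
  then show ?case using covers_hom(5)[OF assms(1,3-6)] covers_hom(5)[OF assms(2,3-6)] assms(8) by simp
qed (simp_all add: covers_hom[OF assms(1,3-6)] covers_hom[OF assms(2,3-6)] 
      group.inv_closed[OF comm_group.axioms(2)[OF T_comm_group[OF assms(5,6)]]])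

lemma covers_comp:
  assumes h: "covers f U'' V'' U' V' h" and h': "covers g U' V' U V h'" and f: "\<And>p. p \<in> carrier P \<Longrightarrow> f p \<in> carrier P"
    and "U \<in> UU" "V \<in> VV" "U' \<in> UU" "V' \<in> VV" "U'' \<in> UU" "V'' \<in> VV"
  shows "covers (\<lambda>p. g (f p)) U'' V'' U V (\<lambda>x. h' (h x))"
proof -
  note c = covers_hom[OF h assms(6-9)] and c' = covers_hom[OF h' assms(4-7)]
  have "(\<lambda>x. h' (h x)) \<in> hom (T U'' V'') (T U V)"
    by (rule homI) (simp_all add: c c')
  then show ?thesis unfolding covers_def by (simp add: c c' f)
qed

lemma covers_tensor_map:
  assumes "U \<in> UU" "V \<in> VV" "U' \<in> UU" "V' \<in> VV"
    and f: "f \<in> module_homs (op_ring A) (quot_module Q U') (quot_module Q U)"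
      "\<And>p. p \<in> carrier P \<Longrightarrow> f (U' +>\<^bsub>P\<^esub> p) = U +>\<^bsub>P\<^esub> f' p"
    and g: "g \<in> module_homs A (quot_module N V') (quot_module N V)"
      "\<And>n. n \<in> carrier N \<Longrightarrow> g (V' +>\<^bsub>N\<^esub> n) = V +>\<^bsub>N\<^esub> n"
  shows "covers f' U' V' U V (tensor_map A (quot_module Q U) (quot_module N V) f g)"
  unfolding covers_def
  using tensor_map_hom[OF factors[OF assms(3,4)] factors[OF assms(1,2)] f(1) g(1)]
  by (auto simp: quotQ(1)[OF assms(3)] quotN(1)[OF assms(4)] f(2) g(2))

abbreviation "tr U V \<equiv> tensor_map A (quot_module Q U) (quot_module N V)
  (coset_map Q U (\<lambda>y. y)) (coset_map N V (\<lambda>y. y))"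

lemma covers_transition:
  assumes "U \<in> UU" "V \<in> VV" "U' \<in> UU" "V' \<in> VV"
  shows "U' \<subseteq> U \<Longrightarrow> V' \<subseteq> V \<Longrightarrow> covers (\<lambda>p. p) U' V' U V (tr U V)"
    and "V' \<subseteq> V \<Longrightarrow> covers (\<lambda>p. p) U V' U V
      (tensor_map A (quot_module Q U) (quot_module N V) (\<lambda>C. C) (coset_map N V (\<lambda>y. y)))"
    and "U' \<subseteq> U \<Longrightarrow> covers (\<lambda>p. p) U' V U V
      (tensor_map A (quot_module Q U) (quot_module N V) (coset_map Q U (\<lambda>y. y)) (\<lambda>C. C))"
    and "b \<in> carrier B \<Longrightarrow> (\<And>p. p \<in> U' \<Longrightarrow> b \<odot>\<^bsub>P\<^esub> p \<in> U) \<Longrightarrow> covers (\<lambda>p. b \<odot>\<^bsub>P\<^esub> p) U' V U V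
      (tensor_map A (quot_module Q U) (quot_module N V) (coset_map Q U (\<lambda>p. b \<odot>\<^bsub>P\<^esub> p)) (\<lambda>C. C))"
proof -
  note u = UUD(1)[OF assms(1)] UUD(1)[OF assms(3)] and v = VVD(1)[OF assms(2)] VVD(1)[OF assms(4)]
  note lQ = Q.left_module_axioms and lN = N.left_module_axioms
  note hQ = quot_module_hom[OF lQ u(2) lQ u(1) module_homs_id[OF lQ]]
  note hN = quot_module_hom[OF lN v(2) lN v(1) module_homs_id[OF lN]]
  note iQ = module_homs_id[OF Q.quot_module_facts(1)[OF u(1)]]
  note iN = module_homs_id[OF N.quot_module_facts(1)[OF v(1)]]
  show "covers (\<lambda>p. p) U' V' U V (tr U V)" if "U' \<subseteq> U" "V' \<subseteq> V"
    using hQ hN that by (intro covers_tensor_map assms) auto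
  show "covers (\<lambda>p. p) U V' U V
      (tensor_map A (quot_module Q U) (quot_module N V) (\<lambda>C. C) (coset_map N V (\<lambda>y. y)))" if "V' \<subseteq> V"
    using hN iQ that by (intro covers_tensor_map assms) auto
  show "covers (\<lambda>p. p) U' V U V
      (tensor_map A (quot_module Q U) (quot_module N V) (coset_map Q U (\<lambda>y. y)) (\<lambda>C. C))" if "U' \<subseteq> U"
    using hQ iN that by (intro covers_tensor_map assms) auto
  show "covers (\<lambda>p. b \<odot>\<^bsub>P\<^esub> p) U' V U V
      (tensor_map A (quot_module Q U) (quot_module N V) (coset_map Q U (\<lambda>p. b \<odot>\<^bsub>P\<^esub> p)) (\<lambda>C. C))"
    if b: "b \<in> carrier B" and bU: "\<And>p. p \<in> U' \<Longrightarrow> b \<odot>\<^bsub>P\<^esub> p \<in> U"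
  proof -
    have "(\<lambda>p. b \<odot>\<^bsub>P\<^esub> p) \<in> module_homs (op_ring A) Q Q"
      using b by (auto simp: module_homs_def hom_def P.lsmult_closed P.lsmult_r_distr bimodule)
    from quot_module_hom[OF lQ u(2) lQ u(1) this]
    show ?thesis using iN bU by (intro covers_tensor_map assms) auto
  qed
qed

text \<open>The transition maps of the inner and of the outer limit compose to the maps \<open>tr U V\<close>, so the points
  of the iterated limit are the families that are compatible over pairs of submodules.\<close>

lemma mem_ctensor_iff:
  "x \<in> topspace TE \<longleftrightarrow> x \<in> extensional UU \<and> (\<forall>U\<in>UU. x U \<in> extensional VV) \<and>
     (\<forall>U\<in>UU. \<forall>V\<in>VV. x U V \<in> carrier (T U V)) \<and>
     (\<forall>U\<in>UU. \<forall>V\<in>VV. \<forall>U'\<in>UU. \<forall>V'\<in>VV. U' \<subseteq> U \<longrightarrow> V' \<subseteq> V \<longrightarrow> tr U V (x U' V') = x U V)"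
  (is "?l \<longleftrightarrow> ?e \<and> ?e' \<and> ?c \<and> ?t")
proof -
  let ?m1 = "\<lambda>U V. tensor_map A (quot_module Q U) (quot_module N V) (\<lambda>C. C) (coset_map N V (\<lambda>y. y))"
  let ?m2 = "\<lambda>U V. tensor_map A (quot_module Q U) (quot_module N V) (coset_map Q U (\<lambda>y. y)) (\<lambda>C. C)"
  have l: "?l \<longleftrightarrow> ?e \<and> ?e' \<and> ?c \<and> (\<forall>U\<in>UU. \<forall>V\<in>VV. \<forall>V'\<in>VV. V' \<subseteq> V \<longrightarrow> ?m1 U V (x U V') = x U V) \<and>
     (\<forall>U\<in>UU. \<forall>U'\<in>UU. U' \<subseteq> U \<longrightarrow> (\<lambda>V\<in>VV. ?m2 U V (x U' V)) = x U)"
    unfolding ctensor_top_def inv_lim_iff PiE_iff topspace_discrete_topology by blast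
  show ?thesis
  proof
    assume ?l
    note L1 = this[unfolded l]
    note L2 = conjunct2[OF L1]
    note L3 = conjunct2[OF L2]
    note L4 = conjunct2[OF L3]
    note h = conjunct1[OF L1] conjunct1[OF L2] conjunct1[OF L3]
    note h1 = conjunct1[OF L4] and h2 = conjunct2[OF L4]
    have "tr U V (x U' V') = x U V" if a: "U \<in> UU" "V \<in> VV" "U' \<in> UU" "V' \<in> VV" "U' \<subseteq> U" "V' \<subseteq> V" for U V U' V'
    proof -
      have "tr U V (x U' V') = ?m2 U V (?m1 U' V (x U' V'))"
        by (rule covers_unique[OF covers_transition(1)[OF a] covers_comp[OF covers_transition(2)[OF a(3,2,3,4,6)]
                covers_transition(3)[OF a(1,2,3,2,5)]]])
          (use a h(3) in simp_all)
      also have "\<dots> = ?m2 U V (x U' V)" using h1[rule_format, OF a(3,2,4,6)] by simp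
      also have "\<dots> = x U V" using fun_cong[OF h2[rule_format, OF a(1,3,5)], of V] a(2) by simp
      finally show ?thesis .
    qed
    then show "?e \<and> ?e' \<and> ?c \<and> ?t" by (intro conjI ballI impI h)
  next
    assume r: "?e \<and> ?e' \<and> ?c \<and> ?t"
    have 1: "?m1 U V (x U V') = x U V" if a: "U \<in> UU" "V \<in> VV" "V' \<in> VV" "V' \<subseteq> V" for U V V'
    proof -
      have "?m1 U V (x U V') = tr U V (x U V')"
        by (rule covers_unique[OF covers_transition(2)[OF a(1,2,1,3,4)] covers_transition(1)[OF a(1,2,1,3) order_refl a(4)]])
          (use a r in simp_all)
      then show ?thesis using r a by (metis order_refl)
    qed
    have 2: "?m2 U V (x U' V) = x U V" if a: "U \<in> UU" "V \<in> VV" "U' \<in> UU" "U' \<subseteq> U" for U V U'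
    proof -
      have "?m2 U V (x U' V) = tr U V (x U' V)"
        by (rule covers_unique[OF covers_transition(3)[OF a(1,2,3,2,4)] covers_transition(1)[OF a(1,2,3,2,4) order_refl]])
          (use a r in simp_all)
      then show ?thesis using r a by (metis order_refl)
    qed
    have 3: "(\<lambda>V\<in>VV. ?m2 U V (x U' V)) = x U" if a: "U \<in> UU" "U' \<in> UU" "U' \<subseteq> U" for U U'
    proof (rule extensionalityI)
      show "x U \<in> extensional VV" using r a(1) by blast
    qed (use 2 a in simp_all)
    show ?l unfolding l by (intro conjI ballI impI 1 3) (use r in blast)+
  qed
qed

text \<open>For a general open right submodule \<open>U\<close> there is no action of \<open>B\<close> on \<open>P/U \<otimes> N/V\<close>, but for a
  subbimodule \<open>W\<close> there is. Module records extend ring records, whence the undefined multiplication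
  and unit.\<close>

definition tensor_module :: "'p set \<Rightarrow> 'n set \<Rightarrow> ('b, (('p set \<times> 'n set) \<Rightarrow>\<^sub>0 int) set) module" where
  "tensor_module W V = \<lparr>carrier = carrier (T W V), mult = undefined, one = undefined,
     ring.zero = \<one>\<^bsub>T W V\<^esub>, add = mult (T W V),
     smult = (\<lambda>b. tensor_map A (quot_module Q W) (quot_module N V) (coset_map Q W (\<lambda>p. b \<odot>\<^bsub>P\<^esub> p)) (\<lambda>C. C))\<rparr>"

lemma tensor_module_simps [simp]:
  "carrier (tensor_module W V) = carrier (T W V)" "\<zero>\<^bsub>tensor_module W V\<^esub> = \<one>\<^bsub>T W V\<^esub>"
  "x \<oplus>\<^bsub>tensor_module W V\<^esub> y = x \<otimes>\<^bsub>T W V\<^esub> y" "\<ominus>\<^bsub>tensor_module W V\<^esub> x = inv\<^bsub>T W V\<^esub> x"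
  by (simp_all add: tensor_module_def a_inv_def m_inv_def)

lemma WWD:
  assumes "W \<in> WW"
  shows "W \<in> UU" "submodule W B P" "finite_length B (quot_module P W)"
    "\<And>b p. b \<in> carrier B \<Longrightarrow> p \<in> W \<Longrightarrow> b \<odot>\<^bsub>P\<^esub> p \<in> W"
  using assms P.submoduleD_left(4) by auto

lemma covers_act:
  assumes "W \<in> WW" "V \<in> VV" "b \<in> carrier B"
  shows "covers (\<lambda>p. b \<odot>\<^bsub>P\<^esub> p) W V W V (\<lambda>x. b \<odot>\<^bsub>tensor_module W V\<^esub> x)"
  using covers_transition(4)[OF WWD(1)[OF assms(1)] assms(2) WWD(1)[OF assms(1)] assms(2,3)]
    WWD(4)[OF assms(1,3)] by (simp add: tensor_module_def)

lemma act_el: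
  assumes "W \<in> WW" "V \<in> VV" "b \<in> carrier B" "p \<in> carrier P" "n \<in> carrier N"
  shows "b \<odot>\<^bsub>tensor_module W V\<^esub> el W V p n = el W V (b \<odot>\<^bsub>P\<^esub> p) n"
  using covers_hom(5)[OF covers_act[OF assms(1-3)]] WWD(1)[OF assms(1)] assms by blast

lemma tensor_module_left_module:
  assumes W: "W \<in> WW" and V: "V \<in> VV"
  shows "left_module B (tensor_module W V)"
proof -
  have U: "W \<in> UU" by (rule WWD(1)[OF W])
  interpret G: comm_group "T W V" by (rule T_comm_group[OF U V])
  note c = covers_hom[OF covers_act[OF W V] U V U V]
  have ab: "abelian_group (tensor_module W V)"
  proof (rule abelian_groupI)
    fix x assume "x \<in> carrier (tensor_module W V)"
    then show "\<exists>y\<in>carrier (tensor_module W V). y \<oplus>\<^bsub>tensor_module W V\<^esub> x = \<zero>\<^bsub>tensor_module W V\<^esub>"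
      by (intro bexI[of _ "inv\<^bsub>T W V\<^esub> x"]) auto
  qed (auto simp: G.m_ac)
  show ?thesis
  proof (intro left_module.intro left_module_axioms.intro)
    show "ring B" by (rule P.ring_axioms)
    show "abelian_group (tensor_module W V)" by (rule ab)
    fix a b x y
    assume a: "a \<in> carrier B" and x: "x \<in> carrier (tensor_module W V)"
    show "a \<odot>\<^bsub>tensor_module W V\<^esub> x \<in> carrier (tensor_module W V)" using c(1)[OF a] x by simp
    { assume "y \<in> carrier (tensor_module W V)"
      then show "a \<odot>\<^bsub>tensor_module W V\<^esub> (x \<oplus>\<^bsub>tensor_module W V\<^esub> y) =
          a \<odot>\<^bsub>tensor_module W V\<^esub> x \<oplus>\<^bsub>tensor_module W V\<^esub> a \<odot>\<^bsub>tensor_module W V\<^esub> y"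
        using c(2)[OF a] x by simp }
    assume b: "b \<in> carrier B"
    have xc: "x \<in> carrier (T W V)" using x by simp
    have "covers (\<lambda>p. a \<odot>\<^bsub>P\<^esub> (b \<odot>\<^bsub>P\<^esub> p)) W V W V (\<lambda>x. a \<odot>\<^bsub>tensor_module W V\<^esub> (b \<odot>\<^bsub>tensor_module W V\<^esub> x))"
      by (rule covers_comp[OF covers_act[OF W V b] covers_act[OF W V a] _ U V U V U V])
        (use b in \<open>auto simp: P.lsmult_closed\<close>)
    from covers_unique[OF covers_act[OF W V, of "a \<otimes>\<^bsub>B\<^esub> b"] this U V U V xc]
    show "(a \<otimes>\<^bsub>B\<^esub> b) \<odot>\<^bsub>tensor_module W V\<^esub> x = a \<odot>\<^bsub>tensor_module W V\<^esub> (b \<odot>\<^bsub>tensor_module W V\<^esub> x)"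
      using a b by (simp add: P.lsmult_assoc)
    show "(a \<oplus>\<^bsub>B\<^esub> b) \<odot>\<^bsub>tensor_module W V\<^esub> x =
        a \<odot>\<^bsub>tensor_module W V\<^esub> x \<oplus>\<^bsub>tensor_module W V\<^esub> b \<odot>\<^bsub>tensor_module W V\<^esub> x"
      using U V xc
    proof (induction rule: T_induct)
      case (el p n)
      then show ?case
        using a b el_props(2)[OF U V] by (simp add: act_el[OF W V] P.lsmult_l_distr P.lsmult_closed)
    next
      case one
      then show ?case using a b by (simp add: c(3))
    next
      case (diff x y)
      then show ?case using a b by (simp add: c(1,2,4) G.inv_mult G.m_ac)
    qed
  next
    fix x assume x: "x \<in> carrier (tensor_module W V)"
    have xc: "x \<in> carrier (T W V)" using x by simp
    have "covers (\<lambda>p. p) W V W V (\<lambda>x. x)" by (auto simp: covers_def hom_def)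
    from covers_unique[OF covers_act[OF W V, of "\<one>\<^bsub>B\<^esub>"] this U V U V xc]
    show "\<one>\<^bsub>B\<^esub> \<odot>\<^bsub>tensor_module W V\<^esub> x = x" by (simp add: P.lsmult_one)
  qed
qed

lemma TB_ring: "topological_ring B TB" and TP_group: "topological_abelian_group P TP"
  and smult_cont: "continuous_map (prod_topology TB TP) TP (\<lambda>(b, p). b \<odot>\<^bsub>P\<^esub> p)"
  and space_TB: "topspace TB = carrier B" and space_TP: "topspace TP = carrier P"
  and space_TN: "topspace TN = carrier N"
  using PB NA by (auto simp: topological_module_def topological_ring_def topological_abelian_group_def)

lemma left_smult_cont:
  assumes "b \<in> carrier B"
  shows "continuous_map TP TP (\<lambda>p. b \<odot>\<^bsub>P\<^esub> p)"
proof -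
  have "continuous_map TP (prod_topology TB TP) (\<lambda>p. (b, p))"
    using assms space_TB by (intro continuous_map_pairedI) auto
  from continuous_map_compose[OF this smult_cont] show ?thesis by (simp add: o_def)
qed

text \<open>On \<open>p \<otimes> n\<close> the action of \<open>B\<close> factors through the discrete module \<open>P/W\<close>; these elements generate.\<close>

lemma tensor_module_discrete:
  assumes W: "W \<in> WW" and V: "V \<in> VV"
  shows "topological_module B TB (tensor_module W V) (discrete_topology (carrier (tensor_module W V)))"
proof (rule discrete_topological_moduleI[OF TB_ring tensor_module_left_module[OF W V]])
  fix x assume "x \<in> carrier (tensor_module W V)"
  then have x: "x \<in> carrier (T W V)" by simp
  have U: "W \<in> UU" by (rule WWD(1)[OF W])
  interpret M: left_module B "tensor_module W V" by (rule tensor_module_left_module[OF W V])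
  interpret G: comm_group "T W V" by (rule T_comm_group[OF U V])
  have D: "topological_abelian_group (tensor_module W V) (discrete_topology (carrier (tensor_module W V)))"
    by (auto simp: topological_abelian_group_def M.M.abelian_group_axioms
        prod_topology_discrete_topology[symmetric])
  note d = topological_abelian_groupD[OF D]
  note c = covers_hom[OF covers_act[OF W V] U V U V]
  show "continuous_map TB (discrete_topology (carrier (tensor_module W V))) (\<lambda>b. b \<odot>\<^bsub>tensor_module W V\<^esub> x)"
    using U V x
  proof (induction rule: T_induct)
    case (el p n)
    note qd = quot_discrete[OF PB WWD(2)[OF W] UUD(2)[OF U]]
    note qf = P.quot_module_facts[OF WWD(2)[OF W]]
    have cp: "continuous_map TB (discrete_topology (carrier (quot_module P W))) (\<lambda>b. b \<odot>\<^bsub>quot_module P W\<^esub> (W +>\<^bsub>P\<^esub> p))"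
    proof -
      have "continuous_map TB (prod_topology TB (discrete_topology (carrier (quot_module P W)))) (\<lambda>b. (b, W +>\<^bsub>P\<^esub> p))"
        using el qf(2) by (intro continuous_map_pairedI) auto
      moreover have "continuous_map (prod_topology TB (discrete_topology (carrier (quot_module P W))))
          (discrete_topology (carrier (quot_module P W))) (\<lambda>(r, x). r \<odot>\<^bsub>quot_module P W\<^esub> x)"
        using qd by (simp add: topological_module_def)
      ultimately show ?thesis using continuous_map_compose by (fastforce simp: o_def)
    qed
    let ?e = "\<lambda>C. tensor_elem A (quot_module Q W) (quot_module N V) C (V +>\<^bsub>N\<^esub> n)"
    have "continuous_map (discrete_topology (carrier (quot_module P W))) (discrete_topology (carrier (tensor_module W V))) ?e"
      using el_props(1)[OF U V] el by (auto simp: qf(2))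
    from continuous_map_compose[OF cp this]
    show ?case
      by (rule continuous_map_eq) (use el in \<open>auto simp: space_TB qf(4) act_el[OF W V]\<close>)
  next
    case one
    have "continuous_map TB (discrete_topology (carrier (tensor_module W V))) (\<lambda>b. \<one>\<^bsub>T W V\<^esub>)" by simp
    then show ?case by (rule continuous_map_eq) (simp add: c(3) space_TB)
  next
    case (diff x y)
    show ?case
      by (rule continuous_map_eq[OF d(5)[OF diff(3,4)]]) (use diff(1,2) c in \<open>simp add: a_minus_def space_TB\<close>)
  qed
qed

text \<open>If the elements of \<open>F\<close> generate \<open>N/V\<close> over \<open>A\<close>, then the images of the maps \<open>P/W \<rightarrow> P/W \<otimes> N/V\<close>,
  \<open>c \<mapsto> c \<otimes> n\<close>, with \<open>n\<close> in \<open>F\<close> generate \<open>P/W \<otimes> N/V\<close> over \<open>B\<close>, as \<open>p \<otimes> a n = p a \<otimes> n\<close>.\<close>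

lemma tensor_module_finite_length:
  assumes W: "W \<in> WW" and V: "V \<in> VV"
  shows "finite_length B (tensor_module W V)"
proof -
  have U: "W \<in> UU" by (rule WWD(1)[OF W])
  interpret M: left_module B "tensor_module W V" by (rule tensor_module_left_module[OF W V])
  obtain F where F: "finite F" "F \<subseteq> carrier N"
    "\<And>K. submodule K A N \<Longrightarrow> F \<subseteq> K \<Longrightarrow> V \<subseteq> K \<Longrightarrow> K = carrier N"
    using finitely_generated[OF V] by blast
  note qf = P.quot_module_facts[OF WWD(2)[OF W]]
  note e = el_props[OF U V]
  let ?f = "\<lambda>n C. tensor_elem A (quot_module Q W) (quot_module N V) C (V +>\<^bsub>N\<^esub> n)"
  show ?thesis
  proof (rule M.finite_length_generated_by_images[OF F(1) qf(1) WWD(3)[OF W]])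
    fix n assume "n \<in> F"
    then have n: "n \<in> carrier N" using F(2) by blast
    show "?f n \<in> module_homs B (quot_module P W) (tensor_module W V)"
      using n e(1,2) by (auto simp: module_homs_def hom_def qf(2-4) act_el[OF W V])
  next
    fix K assume K: "submodule K B (tensor_module W V)" and fK: "\<And>n. n \<in> F \<Longrightarrow> ?f n ` carrier (quot_module P W) \<subseteq> K"
    note k = M.submoduleD_left[OF K]
    let ?L = "{n \<in> carrier N. \<forall>p\<in>carrier P. el W V p n \<in> K}"
    have "submodule ?L A N"
    proof (rule N.submoduleI_left)
      show "\<zero>\<^bsub>N\<^esub> \<in> ?L" using e(6) N.submoduleD_left(2)[OF VVD(1)[OF V]] k(2) by simp
      show "x \<oplus>\<^bsub>N\<^esub> y \<in> ?L" if "x \<in> ?L" "y \<in> ?L" for x y using that e(3) k(3) by simp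
      show "a \<odot>\<^bsub>N\<^esub> x \<in> ?L" if "a \<in> carrier A" "x \<in> ?L" for a x
        using that e(4)[OF that(1), symmetric] by (simp add: N.lsmult_closed)
    qed auto
    moreover have "F \<subseteq> ?L" using fK F(2) by (auto simp: qf(2))
    moreover have "V \<subseteq> ?L" using e(6) k(2) N.submoduleD_left(1)[OF VVD(1)[OF V]] by auto
    ultimately have L: "?L = carrier N" by (rule F(3))
    have "x \<in> K" if "x \<in> carrier (T W V)" for x
      using U V that
    proof (induction rule: T_induct)
      case (el p n)
      then show ?case using L by blast
    next
      case (diff x y)
      then show ?case using k(3)[OF diff(3) k(5)[OF diff(4)]] by simp
    qed (use k(2) in simp)
    then show "K = carrier (tensor_module W V)" using k(1) by auto
  qed
qed

lemma ctensor_simps: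
  "carrier E = topspace TE" "\<zero>\<^bsub>E\<^esub> = (\<lambda>U\<in>UU. \<lambda>V\<in>VV. \<one>\<^bsub>T U V\<^esub>)"
  "x \<oplus>\<^bsub>E\<^esub> y = (\<lambda>U\<in>UU. \<lambda>V\<in>VV. x U V \<otimes>\<^bsub>T U V\<^esub> y U V)"
  "b \<odot>\<^bsub>E\<^esub> x = (\<lambda>U\<in>UU. \<lambda>V\<in>VV.
     tensor_map A (quot_module Q U) (quot_module N V) (coset_map Q U (\<lambda>p. b \<odot>\<^bsub>P\<^esub> p)) (\<lambda>C. C)
       (x {p \<in> carrier P. b \<odot>\<^bsub>P\<^esub> p \<in> U} V))"
  by (simp_all add: ctensor_def Let_def)

lemma memD:
  assumes "x \<in> carrier E"
  shows "U \<in> UU \<Longrightarrow> V \<in> VV \<Longrightarrow> x U V \<in> carrier (T U V)"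
    and "U \<in> UU \<Longrightarrow> V \<in> VV \<Longrightarrow> U' \<in> UU \<Longrightarrow> V' \<in> VV \<Longrightarrow> U' \<subseteq> U \<Longrightarrow> V' \<subseteq> V \<Longrightarrow> tr U V (x U' V') = x U V"
    and "x \<in> extensional UU" "U \<in> UU \<Longrightarrow> x U \<in> extensional VV"
proof -
  note m = assms[unfolded ctensor_simps(1) mem_ctensor_iff]
  note m1 = conjunct2[OF m]
  note m2 = conjunct2[OF m1]
  show "x \<in> extensional UU" by (rule conjunct1[OF m])
  show "U \<in> UU \<Longrightarrow> x U \<in> extensional VV" by (rule bspec[OF conjunct1[OF m1]])
  show "U \<in> UU \<Longrightarrow> V \<in> VV \<Longrightarrow> x U V \<in> carrier (T U V)"
    by (rule bspec[OF bspec[OF conjunct1[OF m2]]])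
  show "U \<in> UU \<Longrightarrow> V \<in> VV \<Longrightarrow> U' \<in> UU \<Longrightarrow> V' \<in> VV \<Longrightarrow> U' \<subseteq> U \<Longrightarrow> V' \<subseteq> V \<Longrightarrow> tr U V (x U' V') = x U V"
    by (rule conjunct2[OF m2, rule_format])
qed

lemma memI:
  assumes "\<And>U V. U \<in> UU \<Longrightarrow> V \<in> VV \<Longrightarrow> x U V \<in> carrier (T U V)"
    and "\<And>U V U' V'. U \<in> UU \<Longrightarrow> V \<in> VV \<Longrightarrow> U' \<in> UU \<Longrightarrow> V' \<in> VV \<Longrightarrow> U' \<subseteq> U \<Longrightarrow> V' \<subseteq> V \<Longrightarrow>
      tr U V (x U' V') = x U V"
  shows "(\<lambda>U\<in>UU. \<lambda>V\<in>VV. x U V) \<in> carrier E"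
  unfolding ctensor_simps(1) mem_ctensor_iff
  by (intro conjI ballI impI) (simp_all add: assms)

lemma mem_eqI:
  assumes "x \<in> carrier E" "y \<in> carrier E" "\<And>U V. U \<in> UU \<Longrightarrow> V \<in> VV \<Longrightarrow> x U V = y U V"
  shows "x = y"
proof (rule extensionalityI[OF memD(3)[OF assms(1)] memD(3)[OF assms(2)]])
  fix U assume U: "U \<in> UU"
  show "x U = y U"
    by (rule extensionalityI[OF memD(4)[OF assms(1) U] memD(4)[OF assms(2) U]]) (rule assms(3)[OF U])
qed

lemma preimage_UU:
  assumes "b \<in> carrier B" "U \<in> UU"
  shows "{p \<in> carrier P. b \<odot>\<^bsub>P\<^esub> p \<in> U} \<in> UU"
proof -
  note u = UUD[OF assms(2)]
  have "openin TP {p \<in> carrier P. b \<odot>\<^bsub>P\<^esub> p \<in> U}"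
    using openin_continuous_map_preimage[OF left_smult_cont[OF assms(1)] u(2)] space_TP by simp
  moreover have "submodule {p \<in> carrier P. b \<odot>\<^bsub>P\<^esub> p \<in> U} (op_ring A) Q"
    by (rule Q.submoduleI_left)
      (use assms(1) u(4-6) in \<open>auto simp: P.lsmult_zero P.lsmult_r_distr bimodule[symmetric]\<close>)
  ultimately show ?thesis by (simp add: open_submodules_def)
qed

lemma ctensor_closed:
  shows "\<zero>\<^bsub>E\<^esub> \<in> carrier E"
    and "x \<in> carrier E \<Longrightarrow> y \<in> carrier E \<Longrightarrow> x \<oplus>\<^bsub>E\<^esub> y \<in> carrier E"
    and "b \<in> carrier B \<Longrightarrow> x \<in> carrier E \<Longrightarrow> b \<odot>\<^bsub>E\<^esub> x \<in> carrier E"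
proof -
  note g = T_comm_group[THEN comm_group.axioms(2), THEN group.is_monoid]
  note t = covers_hom[OF covers_transition(1)]
  show "\<zero>\<^bsub>E\<^esub> \<in> carrier E"
    unfolding ctensor_simps(2)
    by (rule memI) (auto simp: t(3) intro: monoid.one_closed[OF g])
  show "x \<oplus>\<^bsub>E\<^esub> y \<in> carrier E" if xy: "x \<in> carrier E" "y \<in> carrier E"
    unfolding ctensor_simps(3)
  proof (rule memI)
    show "x U V \<otimes>\<^bsub>T U V\<^esub> y U V \<in> carrier (T U V)" if "U \<in> UU" "V \<in> VV" for U V
      by (rule monoid.m_closed[OF g[OF that] memD(1)[OF xy(1) that] memD(1)[OF xy(2) that]])
    fix U V U' V' assume h: "U \<in> UU" "V \<in> VV" "U' \<in> UU" "V' \<in> VV" "U' \<subseteq> U" "V' \<subseteq> V"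
    show "tr U V (x U' V' \<otimes>\<^bsub>T U' V'\<^esub> y U' V') = x U V \<otimes>\<^bsub>T U V\<^esub> y U V"
      using t(2)[OF h h(1-4) memD(1)[OF xy(1) h(3,4)] memD(1)[OF xy(2) h(3,4)]]
        memD(2)[OF xy(1) h] memD(2)[OF xy(2) h] by simp
  qed
  show "b \<odot>\<^bsub>E\<^esub> x \<in> carrier E" if b: "b \<in> carrier B" and x: "x \<in> carrier E"
    unfolding ctensor_simps(4)
  proof (rule memI)
    let ?pre = "\<lambda>U. {p \<in> carrier P. b \<odot>\<^bsub>P\<^esub> p \<in> U}"
    let ?s = "\<lambda>U V. tensor_map A (quot_module Q U) (quot_module N V) (coset_map Q U (\<lambda>p. b \<odot>\<^bsub>P\<^esub> p)) (\<lambda>C. C)"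
    have s: "covers (\<lambda>p. b \<odot>\<^bsub>P\<^esub> p) (?pre U) V U V (?s U V)" if "U \<in> UU" "V \<in> VV" for U V
      by (rule covers_transition(4)[OF that preimage_UU[OF b that(1)] that(2) b]) simp
    show "?s U V (x (?pre U) V) \<in> carrier (T U V)" if h: "U \<in> UU" "V \<in> VV" for U V
      by (rule covers_hom(1)[OF s[OF h] h preimage_UU[OF b h(1)] h(2) memD(1)[OF x preimage_UU[OF b h(1)] h(2)]])
    fix U V U' V' assume h: "U \<in> UU" "V \<in> VV" "U' \<in> UU" "V' \<in> VV" "U' \<subseteq> U" "V' \<subseteq> V"
    note p = preimage_UU[OF b h(1)] and p' = preimage_UU[OF b h(3)]
    have pp: "?pre U' \<subseteq> ?pre U" using h(5) by blast
    have "tr U V (?s U' V' (x (?pre U') V')) = ?s U V (tr (?pre U) V (x (?pre U') V'))"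
    proof -
      have c1: "covers (\<lambda>p. b \<odot>\<^bsub>P\<^esub> p) (?pre U') V' U V (\<lambda>y. tr U V (?s U' V' y))"
        by (rule covers_comp[OF s[OF h(3,4)] covers_transition(1)[OF h] _ h(1-4) p' h(4)])
          (use b in \<open>auto simp: P.lsmult_closed\<close>)
      have c2: "covers (\<lambda>p. b \<odot>\<^bsub>P\<^esub> p) (?pre U') V' U V (\<lambda>y. ?s U V (tr (?pre U) V y))"
        by (rule covers_comp[OF covers_transition(1)[OF p h(2) p' h(4) pp h(6)] s[OF h(1,2)] _ h(1,2) p h(2) p' h(4)])
      show ?thesis by (rule covers_unique[OF c1 c2]) (use h p' memD(1)[OF x p' h(4)] in simp_all)
    qed
    then show "tr U V (?s U' V' (x (?pre U') V')) = ?s U V (x (?pre U) V)"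
      using memD(2)[OF x p h(2) p' h(4) pp h(6)] by simp
  qed
qed

text \<open>The component at \<open>U\<close> of \<open>b x\<close> is computed from the component of \<open>x\<close> at the preimage of \<open>U\<close> under \<open>b\<close>.
  That preimage contains \<open>U\<close> if \<open>U\<close> is a left submodule, and the action becomes componentwise.\<close>

lemma smult_component:
  assumes "b \<in> carrier B" "x \<in> carrier E" "W \<in> WW" "V \<in> VV"
  shows "(b \<odot>\<^bsub>E\<^esub> x) W V = b \<odot>\<^bsub>tensor_module W V\<^esub> x W V"
proof -
  let ?pre = "{p \<in> carrier P. b \<odot>\<^bsub>P\<^esub> p \<in> W}"
  let ?s = "tensor_map A (quot_module Q W) (quot_module N V) (coset_map Q W (\<lambda>p. b \<odot>\<^bsub>P\<^esub> p)) (\<lambda>C. C)"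
  have U: "W \<in> UU" by (rule WWD(1)[OF assms(3)])
  note pre = preimage_UU[OF assms(1) U]
  have sub: "W \<subseteq> ?pre" using WWD(4)[OF assms(3,1)] UUD(3)[OF U] by blast
  have s: "covers (\<lambda>p. b \<odot>\<^bsub>P\<^esub> p) ?pre V W V ?s"
    by (rule covers_transition(4)[OF U assms(4) pre assms(4,1)]) simp
  have "?s (tr ?pre V (x W V)) = b \<odot>\<^bsub>tensor_module W V\<^esub> x W V"
  proof -
    have c1: "covers (\<lambda>p. b \<odot>\<^bsub>P\<^esub> p) W V W V (\<lambda>y. ?s (tr ?pre V y))"
      by (rule covers_comp[OF covers_transition(1)[OF pre assms(4) U assms(4) sub order_refl] s _ U assms(4) pre assms(4) U assms(4)])
    have c2: "covers (\<lambda>p. b \<odot>\<^bsub>P\<^esub> p) W V W V (\<lambda>y. b \<odot>\<^bsub>tensor_module W V\<^esub> y)"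
      by (rule covers_act[OF assms(3,4,1)])
    show ?thesis by (rule covers_unique[OF c1 c2]) (use U assms memD(1)[OF assms(2) U assms(4)] in simp_all)
  qed
  then show ?thesis
    using memD(2)[OF assms(2) pre assms(4) U assms(4) sub order_refl] U assms(4)
    by (simp add: ctensor_simps(4))
qed

abbreviation "II \<equiv> WW \<times> VV"
abbreviation "leI i j \<equiv> fst j \<subseteq> fst i \<and> snd j \<subseteq> snd i"
abbreviation "MI i \<equiv> tensor_module (fst i) (snd i)"
abbreviation "trI i j \<equiv> tr (fst i) (snd i)"

lemma small_WW: "U \<in> UU \<Longrightarrow> \<exists>W\<in>WW. W \<subseteq> U"
  using small by blast

lemma tensor_system: "discrete_system B TB II leI MI trI"
  unfolding discrete_system_def
proof (intro conjI ballI impI)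
  show "directed_on II leI"
    unfolding directed_on_def
  proof (intro conjI ballI impI)
    have "carrier P \<in> UU" using carrier_open_submodule[OF PA] by simp
    then show "II \<noteq> {}" using small_WW carrier_open_submodule[OF NA] by blast
    fix i j assume i: "i \<in> II" and j: "j \<in> II"
    have "fst i \<inter> fst j \<in> UU" using i j by (intro open_submodules_Int[OF Q.left_module_axioms]) auto
    then obtain W where W: "W \<in> WW" "W \<subseteq> fst i \<inter> fst j" using small_WW by blast
    have V: "snd i \<inter> snd j \<in> VV" using i j by (intro open_submodules_Int[OF N.left_module_axioms]) auto
    show "\<exists>k\<in>II. leI i k \<and> leI j k"
      by (rule bexI[of _ "(W, snd i \<inter> snd j)"]) (use W V in auto)
  qed auto
  fix i assume i: "i \<in> II"
  then have I: "fst i \<in> WW" "snd i \<in> VV" "fst i \<in> UU" by auto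
  show "topological_module B TB (MI i) (discrete_topology (carrier (MI i)))"
    by (rule tensor_module_discrete[OF I(1,2)])
  { fix x assume "x \<in> carrier (MI i)"
    then have x: "x \<in> carrier (T (fst i) (snd i))" by simp
    have "covers (\<lambda>p. p) (fst i) (snd i) (fst i) (snd i) (\<lambda>x. x)" by (auto simp: covers_def hom_def)
    from covers_unique[OF covers_transition(1)[OF I(3,2,3,2)] this I(3,2,3,2) x]
    show "trI i i x = x" by simp }
  fix j assume j: "j \<in> II"
  then have J: "fst j \<in> WW" "snd j \<in> VV" "fst j \<in> UU" by auto
  { assume le: "leI i j"
    note c = covers_transition(1)[OF I(3,2) J(3,2) conjunct1[OF le] conjunct2[OF le]]
    note h = covers_hom[OF c I(3,2) J(3,2)]
    have "trI i j (b \<odot>\<^bsub>MI j\<^esub> x) = b \<odot>\<^bsub>MI i\<^esub> trI i j x" if b: "b \<in> carrier B" and x: "x \<in> carrier (T (fst j) (snd j))" for b x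
    proof -
      have c1: "covers (\<lambda>p. b \<odot>\<^bsub>P\<^esub> p) (fst j) (snd j) (fst i) (snd i) (\<lambda>x. trI i j (b \<odot>\<^bsub>MI j\<^esub> x))"
        by (rule covers_comp[OF covers_act[OF J(1,2) b] c _ I(3,2) J(3,2) J(3,2)]) (use b in \<open>simp add: P.lsmult_closed\<close>)
      have c2: "covers (\<lambda>p. b \<odot>\<^bsub>P\<^esub> p) (fst j) (snd j) (fst i) (snd i) (\<lambda>x. b \<odot>\<^bsub>MI i\<^esub> trI i j x)"
        by (rule covers_comp[OF c covers_act[OF I(1,2) b] _ I(3,2) I(3,2) J(3,2)])
      show ?thesis by (rule covers_unique[OF c1 c2]) (use I J x in simp_all)
    qed
    then show "trI i j \<in> module_homs B (MI j) (MI i)" using h by (auto simp: module_homs_def hom_def) }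
  fix k x assume k: "k \<in> II" and le: "leI i j" "leI j k" and "x \<in> carrier (MI k)"
  then have K: "fst k \<in> UU" "snd k \<in> VV" and x: "x \<in> carrier (T (fst k) (snd k))" by auto
  have le': "fst k \<subseteq> fst i" "snd k \<subseteq> snd i" using le by auto
  show "trI i j (trI j k x) = trI i k x"
  proof -
    have c1: "covers (\<lambda>p. p) (fst k) (snd k) (fst i) (snd i) (\<lambda>x. trI i j (trI j k x))"
      by (rule covers_comp[OF covers_transition(1)[OF J(3,2) K conjunct1[OF le(2)] conjunct2[OF le(2)]]
            covers_transition(1)[OF I(3,2) J(3,2) conjunct1[OF le(1)] conjunct2[OF le(1)]] _ I(3,2) J(3,2) K])
    have c2: "covers (\<lambda>p. p) (fst k) (snd k) (fst i) (snd i) (trI i k)"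
      by (rule covers_transition(1)[OF I(3,2) K le'])
    show ?thesis by (rule covers_unique[OF c1 c2]) (use I K x in simp_all)
  qed
qed

text \<open>The subbimodules are cofinal among the open right submodules, so the iterated limit is also the
  limit over \<^term>\<open>II\<close>. The inverse map fills in the component at \<open>(U, V)\<close> from any \<open>W \<subseteq> U\<close>.\<close>

lemma ctensor_homeomorphic:
  "homeomorphic_map TE (inv_lim II leI (\<lambda>i. discrete_topology (carrier (MI i))) trI)
     (\<lambda>x. \<lambda>i\<in>II. x (fst i) (snd i))"
proof -
  let ?L = "inv_lim II leI (\<lambda>i. discrete_topology (carrier (MI i))) trI"
  let ?P = "\<lambda>x. \<lambda>i\<in>II. x (fst i) (snd i)"
  define w where "w U = (SOME W. W \<in> WW \<and> W \<subseteq> U)" for U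
  have ww: "w U \<in> WW \<and> w U \<subseteq> U" if "U \<in> UU" for U
    unfolding w_def by (rule someI_ex) (use small_WW[OF that] in blast)
  have w: "\<And>U. U \<in> UU \<Longrightarrow> w U \<in> WW" "\<And>U. U \<in> UU \<Longrightarrow> w U \<subseteq> U"
    using ww by blast+
  have wU: "w U \<in> UU" if "U \<in> UU" for U using w(1)[OF that] by (rule WWD(1))
  let ?g = "\<lambda>y. \<lambda>U\<in>UU. \<lambda>V\<in>VV. tr U V (y (w U, V))"
  have yc: "y (W, V) \<in> carrier (T W V)" if "y \<in> topspace ?L" "W \<in> WW" "V \<in> VV" for y W V
    using PiE_mem[OF conjunct1[OF that(1)[unfolded inv_lim_iff]], OF SigmaI[OF that(2,3)]] by simp
  have yt: "tr W V (y (W', V')) = y (W, V)"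
    if "y \<in> topspace ?L" "W \<in> WW" "V \<in> VV" "W' \<in> WW" "V' \<in> VV" "W' \<subseteq> W" "V' \<subseteq> V" for y W V W' V'
  proof -
    have "trI (W, V) (W', V') (y (W', V')) = y (W, V)"
      by (rule conjunct2[OF that(1)[unfolded inv_lim_iff], THEN bspec, THEN bspec, THEN mp,
            OF SigmaI[OF that(2,3)] SigmaI[OF that(4,5)]]) (use that(6,7) in simp)
    then show ?thesis by simp
  qed
  have trans: "tr U V (tr U' V' x) = tr U V x"
    if "U \<in> UU" "V \<in> VV" "U' \<in> UU" "V' \<in> VV" "U'' \<in> UU" "V'' \<in> VV" "U' \<subseteq> U" "V' \<subseteq> V" "U'' \<subseteq> U'" "V'' \<subseteq> V'"
      "x \<in> carrier (T U'' V'')" for U V U' V' U'' V'' x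
    by (rule covers_unique[OF covers_comp[OF covers_transition(1)[OF that(3-6,9,10)] covers_transition(1)[OF that(1-4,7,8)] _ that(1-6)]
          covers_transition(1)[OF that(1,2,5,6) order_trans[OF that(9,7)] order_trans[OF that(10,8)]] that(1,2,5,6,11)])
      simp_all
  \<comment> \<open>independence of the choice of \<open>W\<close>: compare with a common refinement\<close>
  have indep: "tr U V (y (W, V')) = tr U V (y (W', V''))"
    if y: "y \<in> topspace ?L" and h: "U \<in> UU" "V \<in> VV" "W \<in> WW" "W' \<in> WW" "V' \<in> VV" "V'' \<in> VV"
      "W \<subseteq> U" "W' \<subseteq> U" "V' \<subseteq> V" "V'' \<subseteq> V" for y U V W W' V' V''
  proof -
    have hU: "W \<in> UU" "W' \<in> UU" using h by auto
    have "W \<inter> W' \<in> UU" by (rule open_submodules_Int[OF Q.left_module_axioms hU])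
    then obtain Z where Z: "Z \<in> WW" "Z \<subseteq> W \<inter> W'" using small_WW by blast
    have ZU: "Z \<in> UU" and Zs: "Z \<subseteq> W" "Z \<subseteq> W'" using Z by auto
    have V0: "V' \<inter> V'' \<in> VV" by (rule open_submodules_Int[OF N.left_module_axioms h(5,6)])
    have Vs: "V' \<inter> V'' \<subseteq> V'" "V' \<inter> V'' \<subseteq> V''" by auto
    note yZ = yc[OF y Z(1) V0]
    have "tr U V (y (W, V')) = tr U V (y (Z, V' \<inter> V''))"
      using trans[OF h(1,2) hU(1) h(5) ZU V0 h(7,9) Zs(1) Vs(1) yZ] yt[OF y h(3,5) Z(1) V0 Zs(1) Vs(1)] by simp
    moreover have "tr U V (y (W', V'')) = tr U V (y (Z, V' \<inter> V''))"
      using trans[OF h(1,2) hU(2) h(6) ZU V0 h(8,10) Zs(2) Vs(2) yZ] yt[OF y h(4,6) Z(1) V0 Zs(2) Vs(2)] by simp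
    ultimately show ?thesis by simp
  qed
  have gE: "?g y \<in> topspace TE" if y: "y \<in> topspace ?L" for y
    unfolding ctensor_simps(1)[symmetric]
  proof (rule memI)
    show "tr U V (y (w U, V)) \<in> carrier (T U V)" if h: "U \<in> UU" "V \<in> VV" for U V
      by (rule covers_hom(1)[OF covers_transition(1)[OF h wU[OF h(1)] h(2) w(2)[OF h(1)] order_refl] h wU[OF h(1)] h(2)
            yc[OF y w(1)[OF h(1)] h(2)]])
    fix U V U' V' assume h: "U \<in> UU" "V \<in> VV" "U' \<in> UU" "V' \<in> VV" "U' \<subseteq> U" "V' \<subseteq> V"
    have "tr U V (tr U' V' (y (w U', V'))) = tr U V (y (w U', V'))"
      by (rule trans[OF h(1-4) wU[OF h(3)] h(4-6) w(2)[OF h(3)] order_refl yc[OF y w(1)[OF h(3)] h(4)]])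
    also have "\<dots> = tr U V (y (w U, V))"
      by (rule indep[OF y h(1,2) w(1)[OF h(3)] w(1)[OF h(1)] h(4,2) order_trans[OF w(2)[OF h(3)] h(5)] w(2)[OF h(1)] h(6) order_refl])
    finally show "tr U V (tr U' V' (y (w U', V'))) = tr U V (y (w U, V))" .
  qed
  have proj: "continuous_map TE (discrete_topology (carrier (T U V))) (\<lambda>x. x U V)" if "U \<in> UU" "V \<in> VV" for U V
    using continuous_map_compose[OF inv_lim_proj[OF that(1)] inv_lim_proj[OF that(2)]]
    unfolding ctensor_top_def o_def .
  have "homeomorphic_maps TE ?L ?P ?g"
    unfolding homeomorphic_maps_def
  proof (intro conjI ballI)
    show cP: "continuous_map TE ?L ?P"
    proof (rule continuous_map_inv_limI)
      fix i assume i: "i \<in> II"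
      then have I: "fst i \<in> UU" "snd i \<in> VV" by auto
      show "continuous_map TE (discrete_topology (carrier (MI i))) (\<lambda>x. ?P x i)"
        unfolding restrict_apply'[OF i] tensor_module_simps(1) by (rule proj[OF I])
    next
      fix x i j assume x: "x \<in> topspace TE" and i: "i \<in> II" and j: "j \<in> II" and le: "leI i j"
      have xE: "x \<in> carrier E" using x by (simp only: ctensor_simps(1))
      have I: "fst i \<in> UU" "snd i \<in> VV" "fst j \<in> UU" "snd j \<in> VV" using i j by auto
      show "trI i j (?P x j) = ?P x i"
        unfolding restrict_apply'[OF i] restrict_apply'[OF j]
        by (rule memD(2)[OF xE I conjunct1[OF le] conjunct2[OF le]])
    qed simp
    have comp: "continuous_map ?L (discrete_topology (carrier (T U V))) (\<lambda>y. tr U V (y (w U, V)))"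
      if h: "U \<in> UU" "V \<in> VV" for U V
    proof -
      have "(w U, V) \<in> II" using w(1)[OF h(1)] h(2) by (rule SigmaI)
      note pr = inv_lim_proj[OF this, of leI "\<lambda>i. discrete_topology (carrier (MI i))" trI]
      have "continuous_map (discrete_topology (carrier (MI (w U, V)))) (discrete_topology (carrier (T U V))) (tr U V)"
        unfolding continuous_map_from_discrete_topology topspace_discrete_topology tensor_module_simps(1) fst_conv snd_conv
        using covers_hom(1)[OF covers_transition(1)[OF h wU[OF h(1)] h(2) w(2)[OF h(1)] order_refl] h wU[OF h(1)] h(2)]
        by (rule Pi_I)
      from continuous_map_compose[OF pr this] show ?thesis by (simp add: o_def)
    qed
    let ?m1 = "\<lambda>U V. tensor_map A (quot_module Q U) (quot_module N V) (\<lambda>C. C) (coset_map N V (\<lambda>y. y))"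
    let ?m2 = "\<lambda>U V. tensor_map A (quot_module Q U) (quot_module N V) (coset_map Q U (\<lambda>y. y)) (\<lambda>C. C)"
    have ge: "?m1 U V (?g z U V') = ?g z U V" if z: "z \<in> topspace ?L" and a: "U \<in> UU" "V \<in> VV" "V' \<in> VV" "V' \<subseteq> V" for z U V V'
    proof -
      have gz: "?g z \<in> carrier E" using gE[OF z] by (simp only: ctensor_simps(1))
      have "?m1 U V (?g z U V') = tr U V (?g z U V')"
        by (rule covers_unique[OF covers_transition(2)[OF a(1,2,1,3,4)] covers_transition(1)[OF a(1,2,1,3) order_refl a(4)]
             a(1,2,1,3) memD(1)[OF gz a(1,3)] refl])
      also have "\<dots> = ?g z U V" by (rule memD(2)[OF gz a(1,2,1,3) order_refl a(4)])
      finally show ?thesis .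
    qed
    have ge2: "?m2 U V (?g z U' V) = ?g z U V" if z: "z \<in> topspace ?L" and a: "U \<in> UU" "V \<in> VV" "U' \<in> UU" "U' \<subseteq> U" for z U V U'
    proof -
      have gz: "?g z \<in> carrier E" using gE[OF z] by (simp only: ctensor_simps(1))
      have "?m2 U V (?g z U' V) = tr U V (?g z U' V)"
        by (rule covers_unique[OF covers_transition(3)[OF a(1,2,3,2,4)] covers_transition(1)[OF a(1,2,3,2,4) order_refl]
             a(1,2,3,2) memD(1)[OF gz a(3,2)] refl])
      also have "\<dots> = ?g z U V" by (rule memD(2)[OF gz a(1,2,3,2,4) order_refl])
      finally show ?thesis .
    qed
    show "continuous_map ?L TE ?g"
      unfolding ctensor_top_def
    proof (rule continuous_map_inv_limI)
      fix U assume U: "U \<in> UU"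
      show "continuous_map ?L (inv_lim VV (\<lambda>V V'. V' \<subseteq> V) (\<lambda>V. discrete_topology (carrier (T U V))) (\<lambda>V V'. ?m1 U V)) (\<lambda>y. ?g y U)"
      proof (rule continuous_map_inv_limI)
        show "continuous_map ?L (discrete_topology (carrier (T U V))) (\<lambda>y. ?g y U V)" if V: "V \<in> VV" for V
          using comp[OF U V] U V by simp
        show "?g y U \<in> extensional VV" for y using U by simp
        show "?m1 U V (?g z U V') = ?g z U V" if "z \<in> topspace ?L" "V \<in> VV" "V' \<in> VV" "V' \<subseteq> V" for z V V'
          by (rule ge[OF that(1) U that(2-4)])
      qed
    next
      fix z U U' assume z: "z \<in> topspace ?L" and U: "U \<in> UU" "U' \<in> UU" "U' \<subseteq> U"
      show "(\<lambda>V\<in>VV. ?m2 U V (?g z U' V)) = ?g z U"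
      proof (rule extensionalityI[where A = VV])
        show "?g z U \<in> extensional VV" using U by simp
        show "(\<lambda>V\<in>VV. ?m2 U V (?g z U' V)) V = ?g z U V" if "V \<in> VV" for V
          using ge2[OF z U(1) that U(2,3)] that by simp
      qed simp
    qed simp
    show "?g (?P x) = x" if x: "x \<in> topspace TE" for x
    proof (rule mem_eqI)
      show xE: "x \<in> carrier E" using x by (simp only: ctensor_simps(1))
      have "?P x \<in> topspace ?L" by (rule funcset_mem[OF continuous_map_funspace[OF cP] x])
      then show "?g (?P x) \<in> carrier E" using gE by (simp only: ctensor_simps(1))
      fix U V assume h: "U \<in> UU" "V \<in> VV"
      have "?g (?P x) U V = tr U V (x (w U) V)"
        using h restrict_apply'[OF SigmaI[OF w(1)[OF h(1)] h(2)], of "\<lambda>i. x (fst i) (snd i)"]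
        by (simp only: restrict_apply' fst_conv snd_conv)
      also have "\<dots> = x U V" by (rule memD(2)[OF xE h wU[OF h(1)] h(2) w(2)[OF h(1)] order_refl])
      finally show "?g (?P x) U V = x U V" .
    qed
    show "?P (?g y) = y" if y: "y \<in> topspace ?L" for y
    proof (rule extensionalityI[where A = II])
      show "y \<in> extensional II" using conjunct1[OF y[unfolded inv_lim_iff]] by (simp only: PiE_iff)
      show "?P (?g y) i = y i" if i: "i \<in> II" for i
      proof -
        obtain W V where WV: "i = (W, V)" "W \<in> WW" "V \<in> VV" "W \<in> UU" using i by auto
        have "tr W V (y (w W, V)) = y (W, V)"
          by (rule yt[OF y WV(2,3) w(1)[OF WV(4)] WV(3) w(2)[OF WV(4)] order_refl])
        then show ?thesis
          unfolding restrict_apply'[OF i] unfolding WV(1) fst_conv snd_conv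
            restrict_apply'[OF WV(4)] restrict_apply'[OF WV(3)] .
      qed
    qed (rule restrict_extensional)
  qed
  then show ?thesis using homeomorphic_map_maps by blast
qed

theorem ctensor_pseudocompact: "pseudocompact B TB E TE"
  and ctensor_limit: "is_discrete_limit B E TE II leI MI trI (\<lambda>i x. x (fst i) (snd i))"
proof -
  let ?p = "\<lambda>i x. x (fst i) (snd i)"
  have I: "fst i \<in> WW" "fst i \<in> UU" "snd i \<in> VV" if "i \<in> II" for i using that by auto
  have zero: "?p i \<zero>\<^bsub>E\<^esub> = \<zero>\<^bsub>MI i\<^esub>" if "i \<in> II" for i
    using I(2,3)[OF that] by (simp add: ctensor_simps(2))
  have add: "?p i (x \<oplus>\<^bsub>E\<^esub> y) = ?p i x \<oplus>\<^bsub>MI i\<^esub> ?p i y" if "i \<in> II" "x \<in> carrier E" "y \<in> carrier E" for i x y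
    using I(2,3)[OF that(1)] by (simp add: ctensor_simps(3))
  have smult: "?p i (b \<odot>\<^bsub>E\<^esub> x) = b \<odot>\<^bsub>MI i\<^esub> ?p i x" if "i \<in> II" "b \<in> carrier B" "x \<in> carrier E" for i b x
    by (rule smult_component[OF that(2,3) I(1,3)[OF that(1)]])
  have *: "topological_module B TB E TE \<and> is_discrete_limit B E TE II leI MI trI ?p"
    by (intro conjI discrete_limit_topological_module[where p = ?p and I = II and leq = leI and N = MI and f = trI, OF TB_ring tensor_system ctensor_simps(1)[symmetric]
          ctensor_homeomorphic ctensor_closed(1) zero ctensor_closed(2) add ctensor_closed(3) smult])
  then show "is_discrete_limit B E TE II leI MI trI (\<lambda>i x. x (fst i) (snd i))" by blast
  show "pseudocompact B TB E TE"
    by (rule pseudocompactI[OF conjunct1[OF *] tensor_system _ conjunct2[OF *]])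
      (use tensor_module_finite_length in auto)
qed

sublocale E: left_module B E
  using ctensor_pseudocompact unfolding pseudocompact_def topological_module_def by blast

lemma E_topological: "topological_module B TB E TE"
  using ctensor_pseudocompact unfolding pseudocompact_def by blast

lemma E_group: "topological_abelian_group E TE"
  using E_topological unfolding topological_module_def by blast

lemma ce_component: "U \<in> UU \<Longrightarrow> V \<in> VV \<Longrightarrow> ce p n U V = el U V p n"
  by (simp add: ctensor_elem_def)

lemma ce_closed [simp]:
  assumes "p \<in> carrier P" "n \<in> carrier N"
  shows "ce p n \<in> carrier E"
  unfolding ctensor_elem_def a_r_coset_right_module
proof (rule memI)
  show "el U V p n \<in> carrier (T U V)" if "U \<in> UU" "V \<in> VV" for U V
    by (rule el_props(1)[OF that assms])
  show "tr U V (el U' V' p n) = el U V p n"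
    if h: "U \<in> UU" "V \<in> VV" "U' \<in> UU" "V' \<in> VV" "U' \<subseteq> U" "V' \<subseteq> V" for U V U' V'
    by (rule covers_hom(5)[OF covers_transition(1)[OF h] h(1-4) assms])
qed

lemma component_hom:
  assumes "U \<in> UU" "V \<in> VV"
  shows "(\<lambda>x. x U V) \<in> hom (add_monoid E) (T U V)"
    and "\<zero>\<^bsub>E\<^esub> U V = \<one>\<^bsub>T U V\<^esub>"
    and "x \<in> carrier E \<Longrightarrow> y \<in> carrier E \<Longrightarrow> (x \<ominus>\<^bsub>E\<^esub> y) U V = x U V \<otimes>\<^bsub>T U V\<^esub> inv\<^bsub>T U V\<^esub> (y U V)"
proof -
  interpret G: comm_group "T U V" by (rule T_comm_group[OF assms])
  show h: "(\<lambda>x. x U V) \<in> hom (add_monoid E) (T U V)"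
    using memD(1)[OF _ assms] assms by (auto simp: hom_def ctensor_simps(3))
  show "\<zero>\<^bsub>E\<^esub> U V = \<one>\<^bsub>T U V\<^esub>" using assms by (simp add: ctensor_simps(2))
  interpret h: group_hom "add_monoid E" "T U V" "\<lambda>x. x U V"
    using h by (simp add: group_hom_def group_hom_axioms_def E.M.a_group G.is_group)
  show "(x \<ominus>\<^bsub>E\<^esub> y) U V = x U V \<otimes>\<^bsub>T U V\<^esub> inv\<^bsub>T U V\<^esub> (y U V)" if "x \<in> carrier E" "y \<in> carrier E"
    using h.hom_mult[of x "\<ominus>\<^bsub>E\<^esub> y"] h.hom_inv[of y] that
    by (simp add: a_minus_def) (simp add: a_inv_def)
qed

lemma ce_add_left:
  assumes "p \<in> carrier P" "q \<in> carrier P" "n \<in> carrier N"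
  shows "ce (p \<oplus>\<^bsub>P\<^esub> q) n = ce p n \<oplus>\<^bsub>E\<^esub> ce q n"
proof (rule mem_eqI)
  show "ce (p \<oplus>\<^bsub>P\<^esub> q) n U V = (ce p n \<oplus>\<^bsub>E\<^esub> ce q n) U V" if "U \<in> UU" "V \<in> VV" for U V
    using el_props(2)[OF that assms] that by (simp add: ctensor_simps(3) ce_component)
qed (use assms in simp_all)

lemma ce_add_right:
  assumes "p \<in> carrier P" "m \<in> carrier N" "n \<in> carrier N"
  shows "ce p (m \<oplus>\<^bsub>N\<^esub> n) = ce p m \<oplus>\<^bsub>E\<^esub> ce p n"
proof (rule mem_eqI)
  show "ce p (m \<oplus>\<^bsub>N\<^esub> n) U V = (ce p m \<oplus>\<^bsub>E\<^esub> ce p n) U V" if "U \<in> UU" "V \<in> VV" for U V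
    using el_props(3)[OF that assms] that by (simp add: ctensor_simps(3) ce_component)
qed (use assms in simp_all)

lemma ce_balanced:
  assumes "a \<in> carrier A" "p \<in> carrier P" "n \<in> carrier N"
  shows "ce (rsmult P p a) n = ce p (a \<odot>\<^bsub>N\<^esub> n)"
proof (rule mem_eqI)
  show "ce (rsmult P p a) n U V = ce p (a \<odot>\<^bsub>N\<^esub> n) U V" if "U \<in> UU" "V \<in> VV" for U V
    using el_props(4)[OF that assms] that by (simp add: ce_component)
qed (use assms in \<open>simp_all add: N.lsmult_closed\<close>)

lemma ce_smult:
  assumes "b \<in> carrier B" "p \<in> carrier P" "n \<in> carrier N"
  shows "b \<odot>\<^bsub>E\<^esub> ce p n = ce (b \<odot>\<^bsub>P\<^esub> p) n"
proof (rule mem_eqI)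
  fix U V assume UV: "U \<in> UU" "V \<in> VV"
  note pre = preimage_UU[OF assms(1) UV(1)]
  note c = covers_transition(4)[OF UV pre UV(2) assms(1)]
  have "(b \<odot>\<^bsub>E\<^esub> ce p n) U V =
     tensor_map A (quot_module Q U) (quot_module N V) (coset_map Q U (\<lambda>p. b \<odot>\<^bsub>P\<^esub> p)) (\<lambda>C. C)
       (el {p \<in> carrier P. b \<odot>\<^bsub>P\<^esub> p \<in> U} V p n)"
    using UV pre by (simp add: ctensor_simps(4) ce_component)
  also have "\<dots> = el U V (b \<odot>\<^bsub>P\<^esub> p) n"
    by (rule covers_hom(5)[OF c UV pre UV(2) assms(2,3)]) simp
  finally show "(b \<odot>\<^bsub>E\<^esub> ce p n) U V = ce (b \<odot>\<^bsub>P\<^esub> p) n U V" using UV by (simp add: ce_component)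
qed (use assms in \<open>simp_all add: P.lsmult_closed E.lsmult_closed\<close>)

lemma nbhd_component:
  assumes "openin TE O'" "\<zero>\<^bsub>E\<^esub> \<in> O'"
  obtains U V where "U \<in> UU" "V \<in> VV" "\<And>x. x \<in> carrier E \<Longrightarrow> x U V = \<one>\<^bsub>T U V\<^esub> \<Longrightarrow> x \<in> O'"
proof -
  note cb = discrete_limit_complete_base(1)[OF E_topological tensor_system ctensor_limit]
  obtain K where K: "K \<in> (\<lambda>i. a_kernel E (MI i) (\<lambda>x. x (fst i) (snd i))) ` II" "K \<subseteq> O'"
    using complete_baseD(2)[OF cb assms] by blast
  then obtain i where i: "i \<in> II" "K = a_kernel E (MI i) (\<lambda>x. x (fst i) (snd i))" by blast
  have I: "fst i \<in> UU" "snd i \<in> VV" using i(1) by auto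
  show thesis
  proof (rule that[OF I])
    fix x assume "x \<in> carrier E" "x (fst i) (snd i) = \<one>\<^bsub>T (fst i) (snd i)\<^esub>"
    then have "x \<in> K" unfolding i(2) a_kernel_def kernel_def by simp
    then show "x \<in> O'" using K(2) by blast
  qed
qed

lemma ce_small:
  assumes "openin TE O'" "\<zero>\<^bsub>E\<^esub> \<in> O'"
  obtains U V where "U \<in> UU" "V \<in> VV" "\<And>p n. p \<in> U \<Longrightarrow> n \<in> carrier N \<Longrightarrow> ce p n \<in> O'"
    "\<And>p n. p \<in> carrier P \<Longrightarrow> n \<in> V \<Longrightarrow> ce p n \<in> O'"
proof -
  obtain U V where UV: "U \<in> UU" "V \<in> VV" "\<And>x. x \<in> carrier E \<Longrightarrow> x U V = \<one>\<^bsub>T U V\<^esub> \<Longrightarrow> x \<in> O'"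
    by (rule nbhd_component[OF assms]) (rule that)
  note e = el_props(5,6)[OF UV(1,2)]
  show thesis
  proof (rule that[OF UV(1,2)])
    show "ce p n \<in> O'" if "p \<in> U" "n \<in> carrier N" for p n
      by (rule UV(3)) (use that UUD(3)[OF UV(1)] e(1) in \<open>auto simp: ce_component[OF UV(1,2)]\<close>)
    show "ce p n \<in> O'" if "p \<in> carrier P" "n \<in> V" for p n
      by (rule UV(3)) (use that N.submoduleD_left(1)[OF VVD(1)[OF UV(2)]] e(2) in \<open>auto simp: ce_component[OF UV(1,2)]\<close>)
  qed
qed

text \<open>A neighbourhood of \<open>x\<close> contains all points whose component at a suitable pair \<open>(U, V)\<close> is that of
  \<open>x\<close>, and this component is a combination of classes of elements \<open>p \<otimes> n\<close>.\<close>

lemma ce_generates: "topologically_generates E TE {ce p n | p n. p \<in> carrier P \<and> n \<in> carrier N}"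
  unfolding topologically_generates_def
proof (intro conjI allI impI)
  show "{ce p n | p n. p \<in> carrier P \<and> n \<in> carrier N} \<subseteq> carrier E" by auto
  fix C assume C: "subgroup C (add_monoid E) \<and> closedin TE C \<and>
    {ce p n | p n. p \<in> carrier P \<and> n \<in> carrier N} \<subseteq> C"
  note c = add_subgroupD[OF conjunct1[OF C]]
  have ceC: "ce p n \<in> C" if "p \<in> carrier P" "n \<in> carrier N" for p n using C that by blast
  have "x \<in> C" if x: "x \<in> carrier E" for x
  proof (rule ccontr)
    assume "x \<notin> C"
    have "openin TE (carrier E - C)" using C by (simp add: closedin_def ctensor_simps(1))
    from openin_translate(1)[OF E_group this x]
    have "openin TE {y \<in> carrier E. y \<oplus>\<^bsub>E\<^esub> x \<in> carrier E - C}" .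
    moreover have "\<zero>\<^bsub>E\<^esub> \<in> {y \<in> carrier E. y \<oplus>\<^bsub>E\<^esub> x \<in> carrier E - C}" using x \<open>x \<notin> C\<close> by simp
    ultimately obtain U V where UV: "U \<in> UU" "V \<in> VV"
      "\<And>y. y \<in> carrier E \<Longrightarrow> y U V = \<one>\<^bsub>T U V\<^esub> \<Longrightarrow> y \<in> {y \<in> carrier E. y \<oplus>\<^bsub>E\<^esub> x \<in> carrier E - C}"
      by (rule nbhd_component) (rule that)
    interpret G: comm_group "T U V" by (rule T_comm_group[OF UV(1,2)])
    have "\<exists>c\<in>C. c U V = \<tau>" if "\<tau> \<in> carrier (T U V)" for \<tau>
      using UV(1,2) that
    proof (induction rule: T_induct)
      case (el p n)
      show ?case by (rule bexI[OF _ ceC[OF el]]) (rule ce_component[OF UV(1,2)])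
    next
      case one
      show ?case by (rule bexI[OF _ c(2)]) (rule component_hom(2)[OF UV(1,2)])
    next
      case (diff s t)
      then obtain u v where uv: "u \<in> C" "u U V = s" "v \<in> C" "v U V = t" by blast
      have "(u \<ominus>\<^bsub>E\<^esub> v) U V = s \<otimes>\<^bsub>T U V\<^esub> inv\<^bsub>T U V\<^esub> t"
        using component_hom(3)[OF UV(1,2), of u v] uv c(1) by auto
      then show ?case using c(5)[OF uv(1,3)] by blast
    qed
    then obtain u where u: "u \<in> C" "u U V = x U V" using memD(1)[OF x UV(1,2)] by blast
    have uE: "u \<in> carrier E" using c(1) u(1) by blast
    have "(u \<ominus>\<^bsub>E\<^esub> x) U V = \<one>\<^bsub>T U V\<^esub>"
      using component_hom(3)[OF UV(1,2) uE x] u(2) memD(1)[OF x UV(1,2)] by simp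
    then have "(u \<ominus>\<^bsub>E\<^esub> x) \<oplus>\<^bsub>E\<^esub> x \<in> carrier E - C" using UV(3)[of "u \<ominus>\<^bsub>E\<^esub> x"] uE x by simp
    then show False using u(1) uE x by (simp add: E.M.diff_simps(2))
  qed
  then show "C = carrier E" using c(1) by blast
qed

lemma ce_continuous:
  shows "n \<in> carrier N \<Longrightarrow> (\<lambda>p. ce p n) \<in> hom (add_monoid P) (add_monoid E)"
    and "n \<in> carrier N \<Longrightarrow> continuous_map TP TE (\<lambda>p. ce p n)"
    and "p \<in> carrier P \<Longrightarrow> (\<lambda>n. ce p n) \<in> hom (add_monoid N) (add_monoid E)"
    and "p \<in> carrier P \<Longrightarrow> continuous_map TN TE (\<lambda>n. ce p n)"
proof -
  have N_group: "topological_abelian_group N TN" using NA by (simp add: topological_module_def)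
  show 1: "(\<lambda>p. ce p n) \<in> hom (add_monoid P) (add_monoid E)" if "n \<in> carrier N" for n
    using that by (auto simp: hom_def ce_add_left)
  show 2: "(\<lambda>n. ce p n) \<in> hom (add_monoid N) (add_monoid E)" if "p \<in> carrier P" for p
    using that by (auto simp: hom_def ce_add_right)
  show "continuous_map TP TE (\<lambda>p. ce p n)" if n: "n \<in> carrier N"
  proof (rule additive_continuousI[OF TP_group E_group 1[OF n]])
    fix O' assume "openin TE O'" "\<zero>\<^bsub>E\<^esub> \<in> O'"
    then obtain U V where "U \<in> UU" "V \<in> VV" "\<And>p n. p \<in> U \<Longrightarrow> n \<in> carrier N \<Longrightarrow> ce p n \<in> O'"
      by (rule ce_small) (rule that)
    then show "\<exists>U. openin TP U \<and> \<zero>\<^bsub>P\<^esub> \<in> U \<and> (\<lambda>p. ce p n) ` U \<subseteq> O'"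
      using UUD(2,5) n by (intro exI[of _ U]) auto
  qed
  show "continuous_map TN TE (\<lambda>n. ce p n)" if p: "p \<in> carrier P"
  proof (rule additive_continuousI[OF N_group E_group 2[OF p]])
    fix O' assume "openin TE O'" "\<zero>\<^bsub>E\<^esub> \<in> O'"
    then obtain U V where "U \<in> UU" "V \<in> VV" "\<And>p n. p \<in> U \<Longrightarrow> n \<in> carrier N \<Longrightarrow> ce p n \<in> O'"
      "\<And>p n. p \<in> carrier P \<Longrightarrow> n \<in> V \<Longrightarrow> ce p n \<in> O'"
      by (rule ce_small) (rule that)
    then show "\<exists>U. openin TN U \<and> \<zero>\<^bsub>N\<^esub> \<in> U \<and> (\<lambda>n. ce p n) ` U \<subseteq> O'"
      using VVD N.submoduleD_left(2) p by (intro exI[of _ V]) auto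
  qed
qed

text \<open>Modulo an open submodule \<open>K\<close> of the target, a balanced biadditive map that sends \<open>U \<times> N\<close> and
  \<open>P \<times> V\<close> into \<open>K\<close> factors through \<open>P/U \<otimes> N/V\<close>, hence through a component of the completed tensor
  product. The factorisations for the various \<open>K\<close> are then glued.\<close>

lemma ctensor_universal:
  fixes \<phi> :: "'p \<Rightarrow> 'n \<Rightarrow> 'q" and Y :: "('r, 'q, 'v) module_scheme"
  assumes Y: "topological_module R TR Y TY" "complete_base R Y TY J"
    and cl: "\<And>p n. p \<in> carrier P \<Longrightarrow> n \<in> carrier N \<Longrightarrow> \<phi> p n \<in> carrier Y"
    and l: "\<And>p q n. p \<in> carrier P \<Longrightarrow> q \<in> carrier P \<Longrightarrow> n \<in> carrier N \<Longrightarrow>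
      \<phi> (p \<oplus>\<^bsub>P\<^esub> q) n = \<phi> p n \<oplus>\<^bsub>Y\<^esub> \<phi> q n"
    and r: "\<And>p m n. p \<in> carrier P \<Longrightarrow> m \<in> carrier N \<Longrightarrow> n \<in> carrier N \<Longrightarrow>
      \<phi> p (m \<oplus>\<^bsub>N\<^esub> n) = \<phi> p m \<oplus>\<^bsub>Y\<^esub> \<phi> p n"
    and b: "\<And>a p n. a \<in> carrier A \<Longrightarrow> p \<in> carrier P \<Longrightarrow> n \<in> carrier N \<Longrightarrow>
      \<phi> (rsmult P p a) n = \<phi> p (a \<odot>\<^bsub>N\<^esub> n)"
    and c: "\<And>K. K \<in> J \<Longrightarrow> \<exists>U\<in>UU. \<forall>p\<in>U. \<forall>n\<in>carrier N. \<phi> p n \<in> K"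
      "\<And>K. K \<in> J \<Longrightarrow> \<exists>V\<in>VV. \<forall>p\<in>carrier P. \<forall>n\<in>V. \<phi> p n \<in> K"
  obtains h where "h \<in> hom (add_monoid E) (add_monoid Y)" "continuous_map TE TY h"
    "\<And>p n. p \<in> carrier P \<Longrightarrow> n \<in> carrier N \<Longrightarrow> h (ce p n) = \<phi> p n"
proof -
  interpret Y: left_module R Y using Y(1) by (rule topological_module_left_module)
  have J: "submodule K R Y" "abelian_subgroup K Y" if "K \<in> J" for K
    using complete_baseD(1)[OF Y(2)] that Y.submodule_abelian_subgroup by (auto simp: open_submodules_def)
  have quot: "\<exists>k\<in>hom (add_monoid E) (add_monoid (quot_module Y K)). openin TE {x \<in> carrier E. k x = K} \<and>
      (\<forall>i\<in>carrier P \<times> carrier N. k (case_prod (\<lambda>p n. ce p n) i) = K +>\<^bsub>Y\<^esub> case_prod \<phi> i)" if K: "K \<in> J" for K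
  proof -
    obtain U V where UV: "U \<in> UU" "V \<in> VV" "\<And>p n. p \<in> U \<Longrightarrow> n \<in> carrier N \<Longrightarrow> \<phi> p n \<in> K"
      "\<And>p n. p \<in> carrier P \<Longrightarrow> n \<in> V \<Longrightarrow> \<phi> p n \<in> K"
      using c[OF K] by blast
    note u = UUD[OF UV(1)] and v = N.submoduleD_left[OF VVD(1)[OF UV(2)]]
    note q = Y.quot_module_facts[OF J(1)[OF K]]
    interpret Z: left_module R "quot_module Y K" by (rule q(1))
    have cZ: "comm_group (add_monoid (quot_module Y K))" by (rule Z.M.a_comm_group)
    note k = Y.submoduleD_left[OF J(1)[OF K]]
    interpret TF: tensor_factors A "quot_module Q U" "quot_module N V" by (rule factors[OF UV(1,2)])
    have wd: "K +>\<^bsub>Y\<^esub> \<phi> p n = K +>\<^bsub>Y\<^esub> \<phi> p' n'"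
      if h: "p \<in> carrier P" "p' \<in> carrier P" "n \<in> carrier N" "n' \<in> carrier N"
        "U +>\<^bsub>P\<^esub> p = U +>\<^bsub>P\<^esub> p'" "V +>\<^bsub>N\<^esub> n = V +>\<^bsub>N\<^esub> n'" for p p' n n'
    proof -
      have d: "p \<ominus>\<^bsub>P\<^esub> p' \<in> U" "n \<ominus>\<^bsub>N\<^esub> n' \<in> V"
        using coset_eqP[OF UV(1) h(1,2)] coset_eqN[OF UV(2) h(3,4)] h(5,6) by auto
      have 1: "\<phi> p n = \<phi> (p \<ominus>\<^bsub>P\<^esub> p') n \<oplus>\<^bsub>Y\<^esub> \<phi> p' n"
        using l[of "p \<ominus>\<^bsub>P\<^esub> p'" p' n] h by (simp add: P.M.diff_simps(2))
      have 2: "\<phi> p' n = \<phi> p' (n \<ominus>\<^bsub>N\<^esub> n') \<oplus>\<^bsub>Y\<^esub> \<phi> p' n'"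
        using r[of p' "n \<ominus>\<^bsub>N\<^esub> n'" n'] h by (simp add: N.M.diff_simps(2))
      have m: "\<phi> (p \<ominus>\<^bsub>P\<^esub> p') n \<in> K" "\<phi> p' (n \<ominus>\<^bsub>N\<^esub> n') \<in> K" using UV(3,4) d h by auto
      have car: "\<phi> p n \<in> carrier Y" "\<phi> p' n \<in> carrier Y" "\<phi> p' n' \<in> carrier Y"
        "\<phi> (p \<ominus>\<^bsub>P\<^esub> p') n \<in> carrier Y" "\<phi> p' (n \<ominus>\<^bsub>N\<^esub> n') \<in> carrier Y"
        using cl h by auto
      have "\<phi> p n \<ominus>\<^bsub>Y\<^esub> \<phi> p' n \<in> K" using m(1) car by (simp add: 1 Y.M.diff_simps(3))
      moreover have "\<phi> p' n \<ominus>\<^bsub>Y\<^esub> \<phi> p' n' \<in> K" using m(2) car by (simp add: 2 Y.M.diff_simps(3))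
      ultimately show ?thesis
        using Y.coset_eq_iff[OF J(2)[OF K] car(1,2)] Y.coset_eq_iff[OF J(2)[OF K] car(2,3)] by simp
    qed
    \<comment> \<open>representatives of cosets; by \<open>wd\<close> their choice does not matter\<close>
    define rP where "rP C = (SOME p. p \<in> carrier P \<and> C = U +>\<^bsub>P\<^esub> p)" for C
    define rN where "rN D = (SOME n. n \<in> carrier N \<and> D = V +>\<^bsub>N\<^esub> n)" for D
    have rP: "rP (U +>\<^bsub>P\<^esub> p) \<in> carrier P \<and> U +>\<^bsub>P\<^esub> p = U +>\<^bsub>P\<^esub> rP (U +>\<^bsub>P\<^esub> p)" if "p \<in> carrier P" for p
      unfolding rP_def by (rule someI[of _ p]) (simp add: that)
    have rN: "rN (V +>\<^bsub>N\<^esub> n) \<in> carrier N \<and> V +>\<^bsub>N\<^esub> n = V +>\<^bsub>N\<^esub> rN (V +>\<^bsub>N\<^esub> n)" if "n \<in> carrier N" for n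
      unfolding rN_def by (rule someI[of _ n]) (simp add: that)
    define \<psi> where "\<psi> C D = K +>\<^bsub>Y\<^esub> \<phi> (rP C) (rN D)" for C D
    have \<psi>: "\<psi> (U +>\<^bsub>P\<^esub> p) (V +>\<^bsub>N\<^esub> n) = K +>\<^bsub>Y\<^esub> \<phi> p n" if "p \<in> carrier P" "n \<in> carrier N" for p n
      unfolding \<psi>_def
      by (rule wd[OF conjunct1[OF rP[OF that(1)]] that(1) conjunct1[OF rN[OF that(2)]] that(2)
            conjunct2[OF rP[OF that(1)], symmetric] conjunct2[OF rN[OF that(2)], symmetric]])
    obtain h where h: "h \<in> hom (T U V) (add_monoid (quot_module Y K))"
      "\<And>C D. C \<in> carrier (quot_module Q U) \<Longrightarrow> D \<in> carrier (quot_module N V) \<Longrightarrow>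
        h (tensor_elem A (quot_module Q U) (quot_module N V) C D) = \<psi> C D"
    proof (rule TF.tensor_universal[OF cZ, of \<psi>])
      note qQ = quotQ[OF UV(1)] and qN = quotN[OF UV(2)]
      show "\<psi> C D \<in> carrier (add_monoid (quot_module Y K))"
        if "C \<in> carrier (quot_module Q U)" "D \<in> carrier (quot_module N V)" for C D
        using that unfolding qQ(1) qN(1) by (auto simp: \<psi> q(2) cl)
      show "\<psi> (C \<oplus>\<^bsub>quot_module Q U\<^esub> C') D = \<psi> C D \<otimes>\<^bsub>add_monoid (quot_module Y K)\<^esub> \<psi> C' D"
        if "C \<in> carrier (quot_module Q U)" "C' \<in> carrier (quot_module Q U)" "D \<in> carrier (quot_module N V)" for C C' D
        using that unfolding qQ(1) qN(1) by (auto simp: \<psi> q(3) cl l qQ(2))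
      show "\<psi> C (D \<oplus>\<^bsub>quot_module N V\<^esub> D') = \<psi> C D \<otimes>\<^bsub>add_monoid (quot_module Y K)\<^esub> \<psi> C D'"
        if "C \<in> carrier (quot_module Q U)" "D \<in> carrier (quot_module N V)" "D' \<in> carrier (quot_module N V)" for C D D'
        using that unfolding qQ(1) qN(1) by (auto simp: \<psi> q(3) cl r qN(2))
      show "\<psi> (a \<odot>\<^bsub>quot_module Q U\<^esub> C) D = \<psi> C (a \<odot>\<^bsub>quot_module N V\<^esub> D)"
        if "a \<in> carrier A" "C \<in> carrier (quot_module Q U)" "D \<in> carrier (quot_module N V)" for a C D
        using that unfolding qQ(1) qN(1) by (auto simp: \<psi> b qQ(3) qN(3) N.lsmult_closed)
    qed (rule that)
    interpret h: group_hom "T U V" "add_monoid (quot_module Y K)" h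
      using h(1) by (simp add: group_hom_def group_hom_axioms_def TF.T.is_group Z.M.a_group)
    have hel: "h (el U V p n) = K +>\<^bsub>Y\<^esub> \<phi> p n" if "p \<in> carrier P" "n \<in> carrier N" for p n
      using h(2)[of "U +>\<^bsub>P\<^esub> p" "V +>\<^bsub>N\<^esub> n"] \<psi> that quotQ(1)[OF UV(1)] quotN(1)[OF UV(2)] by simp
    let ?k = "\<lambda>x. h (x U V)"
    have "?k \<in> hom (add_monoid E) (add_monoid (quot_module Y K))"
      using hom_compose[OF component_hom(1)[OF UV(1,2)] h(1)] by (simp add: o_def)
    moreover have "openin TE {x \<in> carrier E. ?k x = K}"
    proof -
      have "continuous_map TE (discrete_topology (carrier (T U V))) (\<lambda>x. x U V)"
        using continuous_map_compose[OF inv_lim_proj[OF UV(1)] inv_lim_proj[OF UV(2)]]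
        unfolding ctensor_top_def o_def .
      from openin_continuous_map_preimage[OF this, of "{\<tau> \<in> carrier (T U V). h \<tau> = K}"]
      have "openin TE {x \<in> carrier E. x U V \<in> {\<tau> \<in> carrier (T U V). h \<tau> = K}}"
        unfolding ctensor_simps(1) by simp
      moreover have "{x \<in> carrier E. x U V \<in> {\<tau> \<in> carrier (T U V). h \<tau> = K}} = {x \<in> carrier E. ?k x = K}"
        using memD(1)[OF _ UV(1,2)] by blast
      ultimately show ?thesis by simp
    qed
    moreover have "\<forall>i\<in>carrier P \<times> carrier N. ?k (case_prod (\<lambda>p n. ce p n) i) = K +>\<^bsub>Y\<^esub> case_prod \<phi> i"
      using hel by (auto simp: ce_component[OF UV(1,2)])
    ultimately show ?thesis by (intro bexI[of _ ?k] conjI)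
  qed
  have gen: "topologically_generates E TE (case_prod (\<lambda>p n. ce p n) ` (carrier P \<times> carrier N))"
  proof -
    have "case_prod (\<lambda>p n. ce p n) ` (carrier P \<times> carrier N) = {ce p n | p n. p \<in> carrier P \<and> n \<in> carrier N}"
      by (auto simp: image_def)
    then show ?thesis using ce_generates by simp
  qed
  obtain h where h: "h \<in> hom (add_monoid E) (add_monoid Y)" "continuous_map TE TY h"
    "\<And>i. i \<in> carrier P \<times> carrier N \<Longrightarrow> h (case_prod (\<lambda>p n. ce p n) i) = case_prod \<phi> i"
  proof (rule complete_base_lift[OF E_group gen Y])
    show "case_prod \<phi> i \<in> carrier Y" if "i \<in> carrier P \<times> carrier N" for i using that cl by auto
    show "\<exists>k\<in>hom (add_monoid E) (add_monoid (quot_module Y K)). openin TE {x \<in> carrier E. k x = K} \<and>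
      (\<forall>i\<in>carrier P \<times> carrier N. k (case_prod (\<lambda>p n. ce p n) i) = K +>\<^bsub>Y\<^esub> case_prod \<phi> i)" if "K \<in> J" for K
      by (rule quot[OF that])
  qed (rule that)
  show thesis
    by (rule that[OF h(1,2)]) (use h(3) in auto)
qed

text \<open>By density it suffices to test linearity over \<open>B\<close> on the elements \<open>p \<otimes> n\<close>.\<close>

lemma ctensor_map_linear:
  assumes Y: "topological_module B TB Y TY" "Hausdorff_space TY"
    and h: "h \<in> hom (add_monoid E) (add_monoid Y)" "continuous_map TE TY h"
    and lin: "\<And>b p n. b \<in> carrier B \<Longrightarrow> p \<in> carrier P \<Longrightarrow> n \<in> carrier N \<Longrightarrow>
      h (ce (b \<odot>\<^bsub>P\<^esub> p) n) = b \<odot>\<^bsub>Y\<^esub> h (ce p n)"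
  shows "h \<in> module_homs B E Y"
proof -
  interpret Y: left_module B Y using Y(1) by (rule topological_module_left_module)
  have Yt: "topological_abelian_group Y TY" using Y(1) by (simp add: topological_module_def)
  have "h (b \<odot>\<^bsub>E\<^esub> x) = b \<odot>\<^bsub>Y\<^esub> h x" if b: "b \<in> carrier B" and x: "x \<in> carrier E" for b x
  proof (rule continuous_additive_eqI[OF E_group ce_generates Yt Y(2) _ _ _ _ _ x])
    have act: "continuous_map TZ TZ (\<lambda>z. b \<odot>\<^bsub>Z\<^esub> z)" if "topological_module B TB Z TZ" for Z :: "('b, 'k, 'l) module_scheme" and TZ
    proof -
      have "continuous_map TZ (prod_topology TB TZ) (\<lambda>p. (b, p))"
        using b space_TB by (intro continuous_map_pairedI) auto
      moreover have "continuous_map (prod_topology TB TZ) TZ (\<lambda>(b, p). b \<odot>\<^bsub>Z\<^esub> p)"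
        using that by (simp add: topological_module_def)
      ultimately have "continuous_map TZ TZ ((\<lambda>(b, p). b \<odot>\<^bsub>Z\<^esub> p) \<circ> (\<lambda>p. (b, p)))"
        by (rule continuous_map_compose)
      then show ?thesis by (simp add: o_def)
    qed
    show "continuous_map TE TY (\<lambda>x. h (b \<odot>\<^bsub>E\<^esub> x))"
      using continuous_map_compose[OF act[OF E_topological] h(2)] by (simp add: o_def)
    show "continuous_map TE TY (\<lambda>x. b \<odot>\<^bsub>Y\<^esub> h x)"
      using continuous_map_compose[OF h(2) act[OF Y(1)]] by (simp add: o_def)
    note H = additive_homD[OF h(1)]
    show "(\<lambda>x. h (b \<odot>\<^bsub>E\<^esub> x)) \<in> hom (add_monoid E) (add_monoid Y)"
      using b by (auto simp: hom_def H E.lsmult_closed E.lsmult_r_distr)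
    show "(\<lambda>x. b \<odot>\<^bsub>Y\<^esub> h x) \<in> hom (add_monoid E) (add_monoid Y)"
      using b by (auto simp: hom_def H Y.lsmult_closed Y.lsmult_r_distr)
    fix s assume "s \<in> {ce p n | p n. p \<in> carrier P \<and> n \<in> carrier N}"
    then show "h (b \<odot>\<^bsub>E\<^esub> s) = b \<odot>\<^bsub>Y\<^esub> h s" using lin b by (auto simp: ce_smult)
  qed
  then show ?thesis using h(1) by (simp add: module_homs_def)
qed

end

section \<open>Skew power series rings\<close>

locale skew_power_series =
  fixes A B :: "'b ring" and TA TB :: "'b topology" and \<sigma> \<delta> :: "'b \<Rightarrow> 'b" and t :: 'b
  assumes skew: "skew_power_series_ring A TA \<sigma> \<delta> B TB t"
begin

lemma A_pseudocompact: "pseudocompact_ring A TA"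
  and \<sigma>_iso: "\<sigma> \<in> ring_iso A A" and \<sigma>_cont: "continuous_map TA TA \<sigma>"
  and \<delta>_derivation: "top_nilpotent_derivation A TA \<sigma> \<delta>"
  and B_pseudocompact: "left_pseudocompact_ring B TB" and t_closed [simp]: "t \<in> carrier B"
  and incl: "(\<lambda>a. a) \<in> ring_hom A B" and TA_eq: "TA = subtopology TB (carrier A)"
  and B_right_pseudocompact: "pseudocompact (op_ring A) TA (right_module (regular_bimodule B)) TB"
  and expansion: "\<exists>\<Phi>. homeomorphic_map (product_topology (\<lambda>_::nat. TA) UNIV) TB \<Phi> \<and>
        (\<forall>a \<in> UNIV \<rightarrow> carrier A.
           limitin TB (\<lambda>n. \<Oplus>\<^bsub>B\<^esub>k\<in>{..<n}. a k \<otimes>\<^bsub>B\<^esub> t [^]\<^bsub>B\<^esub> k) (\<Phi> a) sequentially)"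
  and t_commute: "a \<in> carrier A \<Longrightarrow> t \<otimes>\<^bsub>B\<^esub> a = \<sigma> a \<otimes>\<^bsub>B\<^esub> t \<oplus>\<^bsub>B\<^esub> \<delta> a"
  using skew unfolding skew_power_series_ring_def by (elim conjE; assumption | blast)+

lemma A_top_ring: "topological_ring A TA" and B_top_ring: "topological_ring B TB"
  using A_pseudocompact B_pseudocompact by (auto simp: pseudocompact_ring_def left_pseudocompact_ring_def)

sublocale A: ring A using A_top_ring by (simp add: topological_ring_def)
sublocale B: ring B using B_top_ring by (simp add: topological_ring_def)

lemma B_group: "topological_abelian_group B TB" and A_group: "topological_abelian_group A TA"
  using A_top_ring B_top_ring by (simp_all add: topological_ring_def)

lemma space_TB: "topspace TB = carrier B" and space_TA: "topspace TA = carrier A"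
  using B_group A_group by (simp_all add: topological_abelian_group_def)

lemma
  shows A_closed [simp]: "a \<in> carrier A \<Longrightarrow> a \<in> carrier B"
    and A_add: "a \<in> carrier A \<Longrightarrow> b \<in> carrier A \<Longrightarrow> a \<oplus>\<^bsub>A\<^esub> b = a \<oplus>\<^bsub>B\<^esub> b"
    and A_mult: "a \<in> carrier A \<Longrightarrow> b \<in> carrier A \<Longrightarrow> a \<otimes>\<^bsub>A\<^esub> b = a \<otimes>\<^bsub>B\<^esub> b"
    and A_one: "\<one>\<^bsub>A\<^esub> = \<one>\<^bsub>B\<^esub>" and A_zero: "\<zero>\<^bsub>A\<^esub> = \<zero>\<^bsub>B\<^esub>"
proof -
  show c: "a \<in> carrier A \<Longrightarrow> a \<in> carrier B" for a using ring_hom_closed[OF incl] .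
  show add: "a \<in> carrier A \<Longrightarrow> b \<in> carrier A \<Longrightarrow> a \<oplus>\<^bsub>A\<^esub> b = a \<oplus>\<^bsub>B\<^esub> b" for a b using ring_hom_add[OF incl] .
  show "a \<in> carrier A \<Longrightarrow> b \<in> carrier A \<Longrightarrow> a \<otimes>\<^bsub>A\<^esub> b = a \<otimes>\<^bsub>B\<^esub> b" using ring_hom_mult[OF incl] .
  show "\<one>\<^bsub>A\<^esub> = \<one>\<^bsub>B\<^esub>" using ring_hom_one[OF incl] .
  have "\<zero>\<^bsub>A\<^esub> \<oplus>\<^bsub>B\<^esub> \<zero>\<^bsub>A\<^esub> = \<zero>\<^bsub>A\<^esub>" using add[of "\<zero>\<^bsub>A\<^esub>" "\<zero>\<^bsub>A\<^esub>"] by simp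
  then show "\<zero>\<^bsub>A\<^esub> = \<zero>\<^bsub>B\<^esub>" using c[OF A.zero_closed] by simp
qed

lemma one_in_A [simp]: "\<one>\<^bsub>B\<^esub> \<in> carrier A" using A_one A.one_closed by simp

lemma \<sigma>_hom: "\<sigma> \<in> ring_hom A A" using \<sigma>_iso by (simp add: ring_iso_def)

lemma \<sigma>_closed [simp]: "a \<in> carrier A \<Longrightarrow> \<sigma> a \<in> carrier A"
  using ring_hom_closed[OF \<sigma>_hom] .

lemma \<delta>_closed [simp]: "a \<in> carrier A \<Longrightarrow> \<delta> a \<in> carrier A"
  using \<delta>_derivation by (auto simp: top_nilpotent_derivation_def hom_def)

lemma tpow_closed [simp]: "t [^]\<^bsub>B\<^esub> (n::nat) \<in> carrier B" by simp

lemma mult_cont: "continuous_map (prod_topology TB TB) TB (\<lambda>(x, y). x \<otimes>\<^bsub>B\<^esub> y)"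
  using B_top_ring by (simp add: topological_ring_def)

lemma continuous_mult:
  "continuous_map S TB f \<Longrightarrow> continuous_map S TB g \<Longrightarrow> continuous_map S TB (\<lambda>x. f x \<otimes>\<^bsub>B\<^esub> g x)"
  using continuous_map_compose[OF continuous_map_pairedI mult_cont] by (fastforce simp: o_def)

lemma incl_cont: "continuous_map TA TB (\<lambda>a. a)"
  unfolding TA_eq by (rule continuous_map_from_subtopology) simp

section \<open>Expansions in powers of \<open>t\<close>\<close>

definition psum :: "(nat \<Rightarrow> 'b) \<Rightarrow> nat \<Rightarrow> 'b" where
  "psum a n = (\<Oplus>\<^bsub>B\<^esub>k\<in>{..<n}. a k \<otimes>\<^bsub>B\<^esub> t [^]\<^bsub>B\<^esub> k)"

lemma psum_0 [simp]: "psum a 0 = \<zero>\<^bsub>B\<^esub>" by (simp add: psum_def)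

lemma psum_Suc:
  assumes "a \<in> UNIV \<rightarrow> carrier A"
  shows "psum a (Suc n) = a n \<otimes>\<^bsub>B\<^esub> t [^]\<^bsub>B\<^esub> n \<oplus>\<^bsub>B\<^esub> psum a n" "psum a n \<in> carrier B"
proof -
  have "a k \<in> carrier B" for k by (rule A_closed[OF funcset_mem[OF assms UNIV_I]])
  then show "psum a (Suc n) = a n \<otimes>\<^bsub>B\<^esub> t [^]\<^bsub>B\<^esub> n \<oplus>\<^bsub>B\<^esub> psum a n" "psum a n \<in> carrier B"
    unfolding psum_def lessThan_Suc by (auto intro!: B.finsum_closed simp: B.finsum_insert)
qed

definition expands :: "(nat \<Rightarrow> 'b) \<Rightarrow> 'b \<Rightarrow> bool" where
  "expands a b \<longleftrightarrow> a \<in> UNIV \<rightarrow> carrier A \<and> limitin TB (psum a) b sequentially"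

lemma expands_add:
  assumes "expands a b" "expands a' b'"
  shows "expands (\<lambda>n. a n \<oplus>\<^bsub>A\<^esub> a' n) (b \<oplus>\<^bsub>B\<^esub> b')"
proof -
  have a: "a \<in> UNIV \<rightarrow> carrier A" "a' \<in> UNIV \<rightarrow> carrier A" using assms by (auto simp: expands_def)
  then have c: "(\<lambda>n. a n \<oplus>\<^bsub>A\<^esub> a' n) \<in> UNIV \<rightarrow> carrier A" by auto
  have aA: "a n \<in> carrier A" "a' n \<in> carrier A" for n using a by auto
  note aa = aA A_closed[OF aA(1)] A_closed[OF aA(2)]
  have eq: "psum (\<lambda>n. a n \<oplus>\<^bsub>A\<^esub> a' n) n = psum a n \<oplus>\<^bsub>B\<^esub> psum a' n" for n
  proof (induction n)
    case (Suc n)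
    have "psum (\<lambda>n. a n \<oplus>\<^bsub>A\<^esub> a' n) (Suc n) =
        (a n \<oplus>\<^bsub>A\<^esub> a' n) \<otimes>\<^bsub>B\<^esub> t [^]\<^bsub>B\<^esub> n \<oplus>\<^bsub>B\<^esub> (psum a n \<oplus>\<^bsub>B\<^esub> psum a' n)"
      unfolding psum_Suc(1)[OF c] Suc ..
    also have "\<dots> = psum a (Suc n) \<oplus>\<^bsub>B\<^esub> psum a' (Suc n)"
      unfolding A_add[OF aA] psum_Suc(1)[OF a(1)] psum_Suc(1)[OF a(2)]
      using psum_Suc(2)[OF a(1), of n] psum_Suc(2)[OF a(2), of n] aa by (simp add: B.l_distr B.a_ac)
    finally show ?case .
  qed simp
  have "limitin (prod_topology TB TB) (\<lambda>n. (psum a n, psum a' n)) (b, b') sequentially"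
    using assms by (simp add: limitin_pairwise expands_def o_def)
  from continuous_map_limit[OF _ this, of TB "\<lambda>(x, y). x \<oplus>\<^bsub>B\<^esub> y"]
  have "limitin TB (\<lambda>n. psum a n \<oplus>\<^bsub>B\<^esub> psum a' n) (b \<oplus>\<^bsub>B\<^esub> b') sequentially"
    using B_group by (simp add: o_def topological_abelian_group_def)
  then show ?thesis using c by (simp add: expands_def eq[abs_def])
qed

lemma expands_monomial:
  assumes "a \<in> carrier A"
  shows "expands (\<lambda>n. if n = k then a else \<zero>\<^bsub>A\<^esub>) (a \<otimes>\<^bsub>B\<^esub> t [^]\<^bsub>B\<^esub> k)"
proof -
  let ?a = "\<lambda>n. if n = k then a else \<zero>\<^bsub>A\<^esub>"
  have c: "?a \<in> UNIV \<rightarrow> carrier A" using assms by auto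
  have aB: "a \<in> carrier B" using assms by simp
  have "psum ?a n = (if n > k then a \<otimes>\<^bsub>B\<^esub> t [^]\<^bsub>B\<^esub> k else \<zero>\<^bsub>B\<^esub>)" for n
    by (induction n) (use aB in \<open>auto simp: psum_Suc[OF c] A_zero less_Suc_eq\<close>)
  then have "eventually (\<lambda>n. psum ?a n = a \<otimes>\<^bsub>B\<^esub> t [^]\<^bsub>B\<^esub> k) sequentially"
    by (intro eventually_sequentiallyI[of "Suc k"]) simp
  then show ?thesis
    using c aB unfolding expands_def by (auto intro!: limitin_eventually simp: space_TB)
qed

lemma twisted_bimodule_simps:
  "carrier (twisted_bimodule B \<rho>) = carrier B" "\<zero>\<^bsub>twisted_bimodule B \<rho>\<^esub> = \<zero>\<^bsub>B\<^esub>"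
  "x \<oplus>\<^bsub>twisted_bimodule B \<rho>\<^esub> y = x \<oplus>\<^bsub>B\<^esub> y" "x \<odot>\<^bsub>twisted_bimodule B \<rho>\<^esub> y = x \<otimes>\<^bsub>B\<^esub> y"
  "rsmult (twisted_bimodule B \<rho>) x a = x \<otimes>\<^bsub>B\<^esub> \<rho> a"
  "\<ominus>\<^bsub>twisted_bimodule B \<rho>\<^esub> x = \<ominus>\<^bsub>B\<^esub> x"
  by (simp_all add: twisted_bimodule_def a_inv_def m_inv_def)

lemma TB_Hausdorff: "Hausdorff_space TB"
proof -
  have "pseudocompact B TB (regular_bimodule B) TB"
    using B_pseudocompact by (simp add: left_pseudocompact_ring_def)
  then show ?thesis by (rule pseudocompact_complete_base)
qed

text \<open>The coefficients are the components of the inverse of the homeomorphism from the product of the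
  \<open>A t\<^sup>n\<close> onto \<open>B\<close>. They are additive because expansions add and are unique.\<close>

lemma coefficients:
  obtains coef where "\<And>n. coef n \<in> hom (add_monoid B) (add_monoid A)"
    "\<And>n. continuous_map TB TA (coef n)"
    "\<And>n k a. a \<in> carrier A \<Longrightarrow> coef n (a \<otimes>\<^bsub>B\<^esub> t [^]\<^bsub>B\<^esub> k) = (if n = k then a else \<zero>\<^bsub>A\<^esub>)"
    "\<And>b. b \<in> carrier B \<Longrightarrow> expands (\<lambda>n. coef n b) b"
proof -
  let ?T = "product_topology (\<lambda>_::nat. TA) UNIV"
  obtain \<Phi> where \<Phi>: "homeomorphic_map ?T TB \<Phi>"
    "\<And>a. a \<in> UNIV \<rightarrow> carrier A \<Longrightarrow> limitin TB (psum a) (\<Phi> a) sequentially"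
    using expansion unfolding psum_def[abs_def] by blast
  obtain \<Psi> where \<Psi>: "homeomorphic_maps ?T TB \<Phi> \<Psi>" using \<Phi>(1) homeomorphic_map_maps by blast
  have spT: "topspace ?T = UNIV \<rightarrow> carrier A" by (simp add: space_TA PiE_UNIV_domain)
  have \<Psi>c: "continuous_map TB ?T \<Psi>" using \<Psi> by (simp add: homeomorphic_maps_def)
  have \<Psi>\<Phi>: "\<Psi> (\<Phi> a) = a" if "a \<in> UNIV \<rightarrow> carrier A" for a
    using \<Psi> that spT by (simp add: homeomorphic_maps_def)
  have \<Phi>\<Psi>: "\<Phi> (\<Psi> b) = b" if "b \<in> carrier B" for b
    using \<Psi> that by (simp add: homeomorphic_maps_def space_TB)
  have \<Psi>A: "\<Psi> b \<in> UNIV \<rightarrow> carrier A" if "b \<in> carrier B" for b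
    using funcset_mem[OF continuous_map_funspace[OF \<Psi>c]] that spT space_TB by simp
  have ex: "expands (\<Psi> b) b" if "b \<in> carrier B" for b
    using \<Phi>(2)[OF \<Psi>A[OF that]] \<Phi>\<Psi>[OF that] \<Psi>A[OF that] by (simp add: expands_def)
  have uniq: "a = \<Psi> b" if "expands a b" for a b
  proof -
    have a: "a \<in> UNIV \<rightarrow> carrier A" "limitin TB (psum a) b sequentially" using that by (auto simp: expands_def)
    have "\<Phi> a = b" using limitin_Hausdorff_unique[OF \<Phi>(2)[OF a(1)] a(2) _ TB_Hausdorff] by simp
    then show ?thesis using \<Psi>\<Phi>[OF a(1)] by simp
  qed
  show thesis
  proof (rule that[of "\<lambda>n b. \<Psi> b n"])
    show "expands (\<lambda>n. \<Psi> b n) b" if "b \<in> carrier B" for b using ex[OF that] by simp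
    show "continuous_map TB TA (\<lambda>b. \<Psi> b n)" for n
      using continuous_map_compose[OF \<Psi>c continuous_map_product_projection[of n UNIV]] by (simp add: o_def)
    show "\<Psi> (a \<otimes>\<^bsub>B\<^esub> t [^]\<^bsub>B\<^esub> k) n = (if n = k then a else \<zero>\<^bsub>A\<^esub>)" if "a \<in> carrier A" for n k a
      using fun_cong[OF uniq[OF expands_monomial[OF that, of k]], of n] by (rule sym)
    show "(\<lambda>b. \<Psi> b n) \<in> hom (add_monoid B) (add_monoid A)" for n
    proof (rule homI)
      show "\<Psi> b n \<in> carrier (add_monoid A)" if "b \<in> carrier (add_monoid B)" for b
        using \<Psi>A[of b] that by auto
      fix b b' assume b: "b \<in> carrier (add_monoid B)" "b' \<in> carrier (add_monoid B)"
      have "\<Psi> (b \<oplus>\<^bsub>B\<^esub> b') = (\<lambda>n. \<Psi> b n \<oplus>\<^bsub>A\<^esub> \<Psi> b' n)"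
        using uniq[OF expands_add[OF ex ex], of b b'] b by simp
      then show "\<Psi> (b \<otimes>\<^bsub>add_monoid B\<^esub> b') n = \<Psi> b n \<otimes>\<^bsub>add_monoid A\<^esub> \<Psi> b' n" by simp
    qed
  qed
qed

text \<open>An element is the limit of the partial sums of its expansion.\<close>

lemma monomials_generate: "topologically_generates B TB {a \<otimes>\<^bsub>B\<^esub> t [^]\<^bsub>B\<^esub> (n::nat) | a n. a \<in> carrier A}"
  unfolding topologically_generates_def
proof (intro conjI allI impI)
  show "{a \<otimes>\<^bsub>B\<^esub> t [^]\<^bsub>B\<^esub> (n::nat) | a n. a \<in> carrier A} \<subseteq> carrier B" by auto
  fix C assume C: "subgroup C (add_monoid B) \<and> closedin TB C \<and>
    {a \<otimes>\<^bsub>B\<^esub> t [^]\<^bsub>B\<^esub> (n::nat) | a n. a \<in> carrier A} \<subseteq> C"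
  note c = add_subgroupD[OF conjunct1[OF C]]
  have m: "a \<otimes>\<^bsub>B\<^esub> t [^]\<^bsub>B\<^esub> n \<in> C" if "a \<in> carrier A" for a and n :: nat using C that by blast
  obtain coef where "\<And>b. b \<in> carrier B \<Longrightarrow> expands (\<lambda>n. coef n b) b"
    by (rule coefficients) (rule that)
  note coef = this
  have "b \<in> C" if b: "b \<in> carrier B" for b
  proof -
    let ?a = "\<lambda>n. coef n b"
    have a: "?a \<in> UNIV \<rightarrow> carrier A" and l: "limitin TB (psum ?a) b sequentially"
      using coef[OF b] by (auto simp: expands_def)
    have "psum ?a n \<in> C" for n
    proof (induction n)
      case (Suc n)
      have "coef n b \<in> carrier A" using a by auto
      then show ?case using Suc c(3) m by (simp add: psum_Suc(1)[OF a])
    qed (simp add: c(2))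
    then show ?thesis using limitin_closedin[OF l, of C] C by simp
  qed
  then show "C = carrier B" using c(1) by blast
qed

text \<open>The series \<open>\<Sum> t\<^sup>n\<close> converges, so the differences of consecutive partial sums tend to zero.\<close>

lemma powers_tendsto_zero:
  assumes "openin TB O'" "\<zero>\<^bsub>B\<^esub> \<in> O'"
  shows "\<exists>N. \<forall>n\<ge>N. t [^]\<^bsub>B\<^esub> (n::nat) \<in> O'"
proof -
  let ?a = "\<lambda>_::nat. \<one>\<^bsub>B\<^esub>"
  have a: "?a \<in> UNIV \<rightarrow> carrier A" by simp
  obtain \<Phi> where "\<forall>a \<in> UNIV \<rightarrow> carrier A. limitin TB (psum a) (\<Phi> a) sequentially"
    using expansion unfolding psum_def[abs_def] by blast
  from bspec[OF this a] obtain s where s: "limitin TB (psum ?a) s sequentially" by (rule that)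
  have "limitin (prod_topology TB TB) (\<lambda>n. (psum ?a (n + 1), psum ?a n)) (s, s) sequentially"
    using s limitin_sequentially_offset[OF s, of 1] by (simp add: limitin_pairwise o_def)
  moreover have "continuous_map (prod_topology TB TB) TB (\<lambda>z. fst z \<ominus>\<^bsub>B\<^esub> snd z)"
    by (intro topological_abelian_groupD(5)[OF B_group] continuous_map_fst continuous_map_snd)
  ultimately have "limitin TB ((\<lambda>z. fst z \<ominus>\<^bsub>B\<^esub> snd z) \<circ> (\<lambda>n. (psum ?a (n + 1), psum ?a n))) (s \<ominus>\<^bsub>B\<^esub> s) sequentially"
    using continuous_map_limit by (metis (no_types, lifting) fst_conv snd_conv)
  moreover have "psum ?a (n + 1) \<ominus>\<^bsub>B\<^esub> psum ?a n = t [^]\<^bsub>B\<^esub> n" for n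
    using psum_Suc[OF a, of n] by (simp add: B.diff_simps(3))
  moreover have "s \<in> carrier B" using s by (auto simp: limitin_def space_TB)
  then have "s \<ominus>\<^bsub>B\<^esub> s = \<zero>\<^bsub>B\<^esub>" by (simp add: a_minus_def B.r_neg)
  ultimately have "limitin TB (\<lambda>n. t [^]\<^bsub>B\<^esub> n) \<zero>\<^bsub>B\<^esub> sequentially" by (simp add: o_def)
  then show ?thesis using assms unfolding limitin_sequentially by blast
qed

text \<open>\<open>B\<close> is topologically free over \<open>A\<close> on the powers of \<open>t\<close>, so a null sequence \<open>y\<close> prescribes the values
  of a continuous map on them: modulo an open submodule almost all \<open>y n\<close> vanish, and a partial sum of
  \<open>b \<mapsto> \<Sum> a\<^sub>n y\<^sub>n\<close>, the \<open>a\<^sub>n\<close> being the coefficients of \<open>b\<close>, already is the required map.\<close>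

lemma power_series_extension:
  fixes Y :: "('b, 'q, 'v) module_scheme"
  assumes Y: "topological_module B TB Y TY" "complete_base B Y TY J"
    and y: "\<And>n. y n \<in> carrier Y" and null: "\<And>K. K \<in> J \<Longrightarrow> \<exists>N. \<forall>n\<ge>N. y n \<in> K"
  obtains g where "g \<in> hom (add_monoid B) (add_monoid Y)" "continuous_map TB TY g"
    "\<And>a n. a \<in> carrier A \<Longrightarrow> g (a \<otimes>\<^bsub>B\<^esub> t [^]\<^bsub>B\<^esub> (n::nat)) = a \<odot>\<^bsub>Y\<^esub> y n"
proof -
  interpret Y: left_module B Y using Y(1) by (rule topological_module_left_module)
  have Yt: "topological_abelian_group Y TY" using Y(1) by (simp add: topological_module_def)
  obtain coef where coef: "\<And>n. coef n \<in> hom (add_monoid B) (add_monoid A)"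
    "\<And>n. continuous_map TB TA (coef n)"
    "\<And>n k a. a \<in> carrier A \<Longrightarrow> coef n (a \<otimes>\<^bsub>B\<^esub> t [^]\<^bsub>B\<^esub> k) = (if n = k then a else \<zero>\<^bsub>A\<^esub>)"
    "\<And>b. b \<in> carrier B \<Longrightarrow> expands (\<lambda>n. coef n b) b"
    by (rule coefficients) (rule that)
  note ch = additive_homD[OF coef(1)]
  \<comment> \<open>the partial sums of the required map\<close>
  define G where "G = rec_nat (\<lambda>b. \<zero>\<^bsub>Y\<^esub>) (\<lambda>n f b. f b \<oplus>\<^bsub>Y\<^esub> coef n b \<odot>\<^bsub>Y\<^esub> y n)"
  have G: "G 0 = (\<lambda>b. \<zero>\<^bsub>Y\<^esub>)" "G (Suc n) = (\<lambda>b. G n b \<oplus>\<^bsub>Y\<^esub> coef n b \<odot>\<^bsub>Y\<^esub> y n)" for n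
    by (simp_all add: G_def)
  have zero_smult: "\<zero>\<^bsub>B\<^esub> \<odot>\<^bsub>Y\<^esub> x = \<zero>\<^bsub>Y\<^esub>" if "x \<in> carrier Y" for x
  proof -
    have "\<zero>\<^bsub>B\<^esub> \<odot>\<^bsub>Y\<^esub> x \<oplus>\<^bsub>Y\<^esub> \<zero>\<^bsub>B\<^esub> \<odot>\<^bsub>Y\<^esub> x = \<zero>\<^bsub>B\<^esub> \<odot>\<^bsub>Y\<^esub> x"
      using Y.lsmult_l_distr[of "\<zero>\<^bsub>B\<^esub>" "\<zero>\<^bsub>B\<^esub>" x] that by simp
    then show ?thesis using Y.lsmult_closed[of "\<zero>\<^bsub>B\<^esub>" x] that by simp
  qed
  have hom: "G n \<in> hom (add_monoid B) (add_monoid Y)" for n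
  proof (induction n)
    case 0
    then show ?case by (simp add: G hom_def)
  next
    case (Suc n)
    note H = additive_homD[OF Suc]
    show ?case
    proof (rule homI)
      fix b c assume "b \<in> carrier (add_monoid B)" "c \<in> carrier (add_monoid B)"
      then have b: "b \<in> carrier B" "c \<in> carrier B" by auto
      note cA = ch(1)[OF b(1), of n] ch(1)[OF b(2), of n]
      note cB = cA[THEN A_closed]
      note car = H(1)[OF b(1)] H(1)[OF b(2)] Y.lsmult_closed[OF cB(1) y] Y.lsmult_closed[OF cB(2) y]
      have "coef n (b \<oplus>\<^bsub>B\<^esub> c) \<odot>\<^bsub>Y\<^esub> y n = coef n b \<odot>\<^bsub>Y\<^esub> y n \<oplus>\<^bsub>Y\<^esub> coef n c \<odot>\<^bsub>Y\<^esub> y n"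
        unfolding ch(2)[OF b] A_add[OF cA] by (rule Y.lsmult_l_distr[OF cB y])
      then show "G (Suc n) (b \<otimes>\<^bsub>add_monoid B\<^esub> c) = G (Suc n) b \<otimes>\<^bsub>add_monoid Y\<^esub> G (Suc n) c"
        using H(2)[OF b] car by (simp add: G Y.M.a_ac)
    next
      fix b assume "b \<in> carrier (add_monoid B)"
      then have b: "b \<in> carrier B" by simp
      then show "G (Suc n) b \<in> carrier (add_monoid Y)"
        using H(1)[OF b] Y.lsmult_closed[OF A_closed[OF ch(1)[OF b]] y] by (simp add: G)
    qed
  qed
  have cont: "continuous_map TB TY (G n)" for n
  proof (induction n)
    case 0
    then show ?case using Yt by (simp add: G topological_abelian_group_def)
  next
    case (Suc n)
    have "continuous_map TB (prod_topology TB TY) (\<lambda>b. (coef n b, y n))"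
      using continuous_map_compose[OF coef(2) incl_cont] y Yt
      by (intro continuous_map_pairedI) (simp_all add: o_def topological_abelian_group_def)
    moreover have "continuous_map (prod_topology TB TY) TY (\<lambda>(b, x). b \<odot>\<^bsub>Y\<^esub> x)"
      using Y(1) by (simp add: topological_module_def)
    ultimately have "continuous_map TB TY ((\<lambda>(b, x). b \<odot>\<^bsub>Y\<^esub> x) \<circ> (\<lambda>b. (coef n b, y n)))"
      by (rule continuous_map_compose)
    then have "continuous_map TB TY (\<lambda>b. coef n b \<odot>\<^bsub>Y\<^esub> y n)" by (simp add: o_def)
    from topological_abelian_groupD(3)[OF Yt Suc this] show ?case by (simp add: G)
  qed
  have val: "G N (a \<otimes>\<^bsub>B\<^esub> t [^]\<^bsub>B\<^esub> k) = (if k < N then a \<odot>\<^bsub>Y\<^esub> y k else \<zero>\<^bsub>Y\<^esub>)" if a: "a \<in> carrier A" for N k a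
  proof (induction N)
    case (Suc N)
    then show ?case
      using Y.lsmult_closed[OF A_closed[OF a] y] y by (auto simp: G coef(3)[OF a] A_zero zero_smult less_Suc_eq)
  qed (simp add: G)
  let ?I = "carrier A \<times> (UNIV :: nat set)"
  let ?e = "\<lambda>(a, n). a \<otimes>\<^bsub>B\<^esub> t [^]\<^bsub>B\<^esub> (n::nat)" and ?g = "\<lambda>(a, n). a \<odot>\<^bsub>Y\<^esub> y n"
  have gen: "topologically_generates B TB (?e ` ?I)"
  proof -
    have "?e ` ?I = {a \<otimes>\<^bsub>B\<^esub> t [^]\<^bsub>B\<^esub> (n::nat) | a n. a \<in> carrier A}" by (auto simp: image_def)
    then show ?thesis using monomials_generate by simp
  qed
  obtain h where h: "h \<in> hom (add_monoid B) (add_monoid Y)" "continuous_map TB TY h"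
    "\<And>i. i \<in> ?I \<Longrightarrow> h (?e i) = ?g i"
  proof (rule complete_base_lift[OF B_group gen Y])
    show "?g i \<in> carrier Y" if "i \<in> ?I" for i using that y by (auto simp: Y.lsmult_closed)
    fix K assume K: "K \<in> J"
    then obtain N where N: "\<And>n. n \<ge> N \<Longrightarrow> y n \<in> K" using null by blast
    have Ks: "submodule K B Y" "openin TY K"
      using complete_baseD(1)[OF Y(2)] K by (auto simp: open_submodules_def)
    note q = Y.quot_module_facts[OF Ks(1)] and ks = Y.submoduleD_left[OF Ks(1)]
    note ceq = Y.coset_eq_iff[OF Y.submodule_abelian_subgroup[OF Ks(1)]]
    note GH = additive_homD[OF hom]
    let ?k = "\<lambda>b. K +>\<^bsub>Y\<^esub> G N b"
    have "?k \<in> hom (add_monoid B) (add_monoid (quot_module Y K))"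
      using GH by (auto simp: hom_def q(2,3))
    moreover have "openin TB {b \<in> carrier B. ?k b = K}"
    proof -
      have "?k b = K \<longleftrightarrow> G N b \<in> K" if "b \<in> carrier B" for b
        using ceq[OF GH(1)[OF that] Y.M.zero_closed, of N] GH(1)[OF that, of N] ks(1) by simp
      then have "{b \<in> carrier B. ?k b = K} = {b \<in> topspace TB. G N b \<in> K}" using space_TB by auto
      then show ?thesis using openin_continuous_map_preimage[OF cont Ks(2)] by simp
    qed
    moreover have "\<forall>i\<in>?I. ?k (?e i) = K +>\<^bsub>Y\<^esub> ?g i"
    proof (intro ballI)
      fix i assume "i \<in> ?I"
      then obtain a n where i: "i = (a, n)" "a \<in> carrier A" by auto
      have ay: "a \<odot>\<^bsub>Y\<^esub> y n \<in> carrier Y" by (rule Y.lsmult_closed[OF A_closed[OF i(2)] y])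
      show "?k (?e i) = K +>\<^bsub>Y\<^esub> ?g i"
      proof (cases "n < N")
        case False
        then have "a \<odot>\<^bsub>Y\<^esub> y n \<in> K" using N ks(4)[OF A_closed[OF i(2)]] by simp
        then have "\<zero>\<^bsub>Y\<^esub> \<ominus>\<^bsub>Y\<^esub> (a \<odot>\<^bsub>Y\<^esub> y n) \<in> K" using ks(2,3,5) by (simp add: a_minus_def)
        then show ?thesis using ceq[OF Y.M.zero_closed ay] False by (simp add: i(1) val[OF i(2)])
      qed (simp add: i(1) val[OF i(2)])
    qed
    ultimately show "\<exists>k\<in>hom (add_monoid B) (add_monoid (quot_module Y K)). openin TB {b \<in> carrier B. k b = K} \<and>
        (\<forall>i\<in>?I. k (?e i) = K +>\<^bsub>Y\<^esub> ?g i)"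
      by (intro bexI[of _ ?k] conjI)
  qed (rule that)
  show thesis
    by (rule that[OF h(1,2)]) (use h(3) in auto)
qed

section \<open>Twisted bimodules\<close>

lemma id_ring_hom: "(\<lambda>a. a) \<in> ring_hom R R"
  by (simp add: ring_hom_def)

lemma quot_twisted: "quot_module (twisted_bimodule B \<rho>) W = quot_module (regular_bimodule B) W"
  by (simp add: quot_module_def coset_map_def a_r_coset_def r_coset_def A_RCOSETS_def RCOSETS_def
      set_add_def set_mult_def twisted_bimodule_def fun_eq_iff)

lemma twisted_top_module: "topological_module B TB (twisted_bimodule B \<rho>) TB"
proof -
  have "pseudocompact B TB (regular_bimodule B) TB"
    using B_pseudocompact by (simp add: left_pseudocompact_ring_def)
  then have r: "topological_module B TB (regular_bimodule B) TB" by (simp add: pseudocompact_def)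
  have ab: "abelian_group (twisted_bimodule B \<rho>)"
    by (rule abelian_groupI) (auto simp: twisted_bimodule_simps B.a_ac intro: B.l_neg bexI[of _ "\<ominus>\<^bsub>B\<^esub> x" for x])
  have "left_module B (twisted_bimodule B \<rho>)"
    by (intro left_module.intro left_module_axioms.intro ab B.ring_axioms)
      (auto simp: twisted_bimodule_simps B.l_distr B.r_distr B.m_assoc)
  moreover have "topological_abelian_group (twisted_bimodule B \<rho>) TB"
    using B_group ab by (simp add: topological_abelian_group_def twisted_bimodule_simps)
  ultimately show ?thesis using B_top_ring mult_cont by (simp add: topological_module_def twisted_bimodule_simps)
qed

lemma op_A_ring: "topological_ring (op_ring A) TA"
  using B_right_pseudocompact by (simp add: pseudocompact_def topological_module_def)

lemma twisted_right_module:
  assumes \<rho>: "\<rho> \<in> ring_hom A A" "continuous_map TA TA \<rho>"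
  shows "topological_module (op_ring A) TA (right_module (twisted_bimodule B \<rho>)) TB"
proof -
  let ?Q = "right_module (twisted_bimodule B \<rho>)"
  note r = ring_hom_closed[OF \<rho>(1)] ring_hom_add[OF \<rho>(1)] ring_hom_mult[OF \<rho>(1)] ring_hom_one[OF \<rho>(1)]
  have ab: "abelian_group ?Q"
    by (rule abelian_groupI) (auto simp: twisted_bimodule_simps B.a_ac intro: B.l_neg bexI[of _ "\<ominus>\<^bsub>B\<^esub> x" for x])
  have "left_module (op_ring A) ?Q"
  proof (intro left_module.intro left_module_axioms.intro ab)
    show "ring (op_ring A)" using op_A_ring by (simp add: topological_ring_def)
    show "\<one>\<^bsub>op_ring A\<^esub> \<odot>\<^bsub>?Q\<^esub> x = x" if "x \<in> carrier ?Q" for x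
      using that by (simp add: twisted_bimodule_simps r A_one[symmetric]) (simp add: A_one)
    fix a x assume a: "a \<in> carrier (op_ring A)" and x: "x \<in> carrier ?Q"
    have a': "a \<in> carrier A" "\<rho> a \<in> carrier B" "x \<in> carrier B" using a x r(1) by (auto simp: twisted_bimodule_simps)
    show "a \<odot>\<^bsub>?Q\<^esub> x \<in> carrier ?Q" using a' by (simp add: twisted_bimodule_simps)
    show "a \<odot>\<^bsub>?Q\<^esub> (x \<oplus>\<^bsub>?Q\<^esub> y) = a \<odot>\<^bsub>?Q\<^esub> x \<oplus>\<^bsub>?Q\<^esub> a \<odot>\<^bsub>?Q\<^esub> y" if "y \<in> carrier ?Q" for y
      using that a' by (simp add: twisted_bimodule_simps B.l_distr)
    fix b assume b: "b \<in> carrier (op_ring A)"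
    have b': "b \<in> carrier A" "\<rho> b \<in> carrier B" "\<rho> a \<in> carrier A" "\<rho> b \<in> carrier A" using b a' r(1) by auto
    show "(a \<oplus>\<^bsub>op_ring A\<^esub> b) \<odot>\<^bsub>?Q\<^esub> x = a \<odot>\<^bsub>?Q\<^esub> x \<oplus>\<^bsub>?Q\<^esub> b \<odot>\<^bsub>?Q\<^esub> x"
      using a' b' r(2)[OF a'(1) b'(1)] A_add[OF b'(3,4)] by (simp add: twisted_bimodule_simps B.r_distr)
    show "(a \<otimes>\<^bsub>op_ring A\<^esub> b) \<odot>\<^bsub>?Q\<^esub> x = a \<odot>\<^bsub>?Q\<^esub> (b \<odot>\<^bsub>?Q\<^esub> x)"
      using a' b' r(3)[OF b'(1) a'(1)] A_mult[OF b'(4,3)] by (simp add: twisted_bimodule_simps B.m_assoc)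
  qed
  moreover have "topological_abelian_group ?Q TB"
    using B_group ab by (simp add: topological_abelian_group_def twisted_bimodule_simps)
  moreover have "continuous_map (prod_topology TA TB) TB (\<lambda>(a, x). a \<odot>\<^bsub>?Q\<^esub> x)"
  proof -
    have "continuous_map (prod_topology TA TB) TB (\<lambda>z. \<rho> (fst z))"
      using continuous_map_compose[OF continuous_map_compose[OF continuous_map_fst \<rho>(2)] incl_cont] by (simp add: o_def)
    from continuous_mult[OF continuous_map_snd this]
    show ?thesis by (simp add: twisted_bimodule_simps case_prod_beta')
  qed
  ultimately show ?thesis using op_A_ring by (simp add: topological_module_def)
qed

text \<open>Inside an open left submodule \<open>K\<close>, the elements \<open>b\<close> with \<open>b A \<subseteq> K\<close> form a subbimodule, whatever
  the twist. It is open because it contains every right submodule that lies in \<open>K\<close>, and such open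
  right submodules exist because \<open>B\<close> is pseudocompact on the right. Its quotient is a quotient of
  one of the modules of finite length \<open>B/K\<^sub>1\<close> that belong to the left pseudocompact structure.\<close>

lemma small_subbimodule:
  assumes \<rho>: "\<rho> \<in> ring_hom A A" "continuous_map TA TA \<rho>" and O: "openin TB O'" "\<zero>\<^bsub>B\<^esub> \<in> O'"
  shows "\<exists>W\<in>open_submodules (op_ring A) (right_module (twisted_bimodule B \<rho>)) TB. W \<subseteq> O' \<and>
    submodule W B (twisted_bimodule B \<rho>) \<and> finite_length B (quot_module (twisted_bimodule B \<rho>) W)"
proof -
  let ?P = "twisted_bimodule B \<rho>" and ?R = "regular_bimodule B"
  interpret P: left_module B ?P by (rule topological_module_left_module[OF twisted_top_module])
  interpret R: left_module B ?R by (rule topological_module_left_module[OF twisted_top_module])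
  interpret Q: left_module "op_ring A" "right_module ?P"
    by (rule topological_module_left_module[OF twisted_right_module[OF \<rho>]])
  have idA: "(\<lambda>b. b) \<in> ring_hom A A" by (simp add: ring_hom_def)
  interpret Q0: left_module "op_ring A" "right_module ?R"
    by (rule topological_module_left_module[OF twisted_right_module[OF idA]]) simp
  have "pseudocompact B TB ?R TB" using B_pseudocompact by (simp add: left_pseudocompact_ring_def)
  then obtain J where J: "complete_base B ?R TB J" "\<And>K. K \<in> J \<Longrightarrow> finite_length B (quot_module ?R K)"
    by (rule pseudocompact_complete_base) (rule that)
  obtain J' where J': "complete_base (op_ring A) (right_module ?R) TB J'"
    by (rule pseudocompact_complete_base[OF B_right_pseudocompact]) (rule that)
  obtain K where K: "K \<in> J" "K \<subseteq> O'" using complete_baseD(2)[OF J(1) O(1)] O(2) by (auto simp: twisted_bimodule_simps)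
  have Ks: "submodule K B ?R" "openin TB K"
    using complete_baseD(1)[OF J(1)] K(1) by (auto simp: open_submodules_def)
  note k = R.submoduleD_left[OF Ks(1), unfolded twisted_bimodule_simps]
  obtain L where L: "L \<in> J'" "L \<subseteq> K" using complete_baseD(2)[OF J' Ks(2)] k(2) by (auto simp: twisted_bimodule_simps)
  have Ls: "submodule L (op_ring A) (right_module ?R)" "openin TB L"
    using complete_baseD(1)[OF J'] L(1) by (auto simp: open_submodules_def)
  note l = Q0.submoduleD_left[OF Ls(1), unfolded right_module_simps twisted_bimodule_simps op_ring_simps]
  let ?W = "{b \<in> carrier B. \<forall>a\<in>carrier A. b \<otimes>\<^bsub>B\<^esub> a \<in> K}"
  have LW: "L \<subseteq> ?W" using l(1,4) L(2) by blast
  have WK: "?W \<subseteq> K"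
  proof
    fix b assume "b \<in> ?W"
    then have "b \<otimes>\<^bsub>B\<^esub> \<one>\<^bsub>B\<^esub> \<in> K" "b \<in> carrier B" using one_in_A by blast+
    then show "b \<in> K" by simp
  qed
  have Wl: "submodule ?W B ?P"
    by (rule P.submoduleI_left)
      (use k(2,3,4) in \<open>auto simp: twisted_bimodule_simps B.l_distr B.m_assoc\<close>)
  have Wr: "submodule ?W (op_ring A) (right_module ?P)"
  proof (rule Q.submoduleI_left)
    fix a x assume a: "a \<in> carrier (op_ring A)" and x: "x \<in> ?W"
    have ra: "\<rho> a \<in> carrier A" using ring_hom_closed[OF \<rho>(1)] a by simp
    have "x \<otimes>\<^bsub>B\<^esub> \<rho> a \<otimes>\<^bsub>B\<^esub> c \<in> K" if c: "c \<in> carrier A" for c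
    proof -
      have "x \<otimes>\<^bsub>B\<^esub> (\<rho> a \<otimes>\<^bsub>A\<^esub> c) \<in> K" using x ra c A.m_closed by blast
      then show ?thesis using x ra c by (simp add: A_mult B.m_assoc)
    qed
    then show "a \<odot>\<^bsub>right_module ?P\<^esub> x \<in> ?W" using x ra by (simp add: twisted_bimodule_simps)
  qed (use k(2,3) in \<open>auto simp: twisted_bimodule_simps B.l_distr\<close>)
  have Wo: "openin TB ?W"
  proof -
    have "subgroup ?W (add_monoid B)"
      by (rule B.add_subgroupI) (use k(2,3,5) in \<open>auto simp: a_minus_def B.l_distr B.l_minus\<close>)
    from subgroup_open[OF B_group this Ls(2) _ LW] l(2) show ?thesis by (simp add: open_subgroup_def)
  qed
  obtain K1 where K1: "K1 \<in> J" "K1 \<subseteq> ?W"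
    using complete_baseD(2)[OF J(1) Wo, unfolded twisted_bimodule_simps, OF subsetD[OF LW l(2)]] by blast
  have K1s: "submodule K1 B ?R" using complete_baseD(1)[OF J(1)] K1(1) by (auto simp: open_submodules_def)
  have Wl0: "submodule ?W B ?R"
    by (rule R.submoduleI_left)
      (use k(2,3,4) in \<open>auto simp: twisted_bimodule_simps B.l_distr B.m_assoc\<close>)
  have "finite_length B (quot_module ?R ?W)"
  proof -
    note qK = R.quot_module_facts[OF K1s] and qW = R.quot_module_facts[OF Wl0]
    interpret Z: left_module B "quot_module ?R ?W" by (rule qW(1))
    note c = quot_module_hom[OF R.left_module_axioms K1s R.left_module_axioms Wl0 module_homs_id[OF R.left_module_axioms]]
    have img: "(\<lambda>x. x) ` K1 \<subseteq> ?W" using K1(2) by simp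
    show ?thesis
    proof (rule Z.finite_length_generated_by_images[where I = "{()}" and f = "\<lambda>_. coset_map ?R ?W (\<lambda>x. x)",
          OF _ qK(1) J(2)[OF K1(1)]])
      show "finite {()}" by simp
      show "coset_map ?R ?W (\<lambda>x. x) \<in> module_homs B (quot_module ?R K1) (quot_module ?R ?W)" by (rule c(1)[OF img])
      fix H assume H: "submodule H B (quot_module ?R ?W)" "\<And>i. i \<in> {()} \<Longrightarrow> coset_map ?R ?W (\<lambda>x. x) ` carrier (quot_module ?R K1) \<subseteq> H"
      note H' = H(2)[OF singletonI]
      have "?W +>\<^bsub>?R\<^esub> x \<in> H" if x: "x \<in> carrier ?R" for x
      proof -
        have "K1 +>\<^bsub>?R\<^esub> x \<in> carrier (quot_module ?R K1)" unfolding qK(2) using x by (rule imageI)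
        from subsetD[OF H' imageI[OF this]] show ?thesis unfolding c(2)[OF img x] .
      qed
      then have "carrier (quot_module ?R ?W) \<subseteq> H" unfolding qW(2) by (rule image_subsetI)
      then show "H = carrier (quot_module ?R ?W)" using Z.submoduleD_left(1)[OF H(1)] by (rule subset_antisym[rotated])
    qed
  qed
  then have "finite_length B (quot_module ?P ?W)" unfolding quot_twisted[of \<rho>] .
  moreover have "?W \<in> open_submodules (op_ring A) (right_module ?P) TB"
    unfolding open_submodules_def by (intro CollectI conjI Wr Wo)
  ultimately show ?thesis by (intro bexI[of _ ?W] conjI Wl order_trans[OF WK K(2)])
qed

end

section \<open>Pseudocompact modules over a skew power series ring\<close>

locale skew_power_series_module = skew_power_series A B TA TB \<sigma> \<delta> t
  for A B :: "'b ring" and TA TB :: "'b topology" and \<sigma> \<delta> :: "'b \<Rightarrow> 'b" and t :: 'b +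
  fixes M :: "('b, 'm) module" and TM :: "'m topology"
  assumes M_pseudocompact: "pseudocompact B TB M TM"
begin

lemma M_topological: "topological_module B TB M TM"
  using M_pseudocompact by (simp add: pseudocompact_def)

sublocale M: left_module B M by (rule topological_module_left_module[OF M_topological])

lemma M_group: "topological_abelian_group M TM" and space_TM: "topspace TM = carrier M"
  using M_topological by (auto simp: topological_module_def topological_abelian_group_def)

lemma smult_continuous:
  assumes "continuous_map S TB f" "continuous_map S TM g"
  shows "continuous_map S TM (\<lambda>x. f x \<odot>\<^bsub>M\<^esub> g x)"
proof -
  have "continuous_map (prod_topology TB TM) TM (\<lambda>(b, x). b \<odot>\<^bsub>M\<^esub> x)"
    using M_topological by (simp add: topological_module_def)
  from continuous_map_compose[OF continuous_map_pairedI[OF assms] this] show ?thesis by (simp add: o_def)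
qed

lemma smult_left_hom: "x \<in> carrier M \<Longrightarrow> (\<lambda>b. b \<odot>\<^bsub>M\<^esub> x) \<in> hom (add_monoid B) (add_monoid M)"
  by (auto simp: hom_def M.lsmult_closed M.lsmult_l_distr)

lemma smult_left_cont: "x \<in> carrier M \<Longrightarrow> continuous_map TB TM (\<lambda>b. b \<odot>\<^bsub>M\<^esub> x)"
  by (rule smult_continuous) (auto simp: space_TM)

lemma M_left_module_A: "left_module A M"
  by (intro left_module.intro left_module_axioms.intro A.ring_axioms M.M.abelian_group_axioms)
    (auto simp: A_add A_mult A_one M.lsmult_closed M.lsmult_l_distr M.lsmult_r_distr M.lsmult_assoc M.lsmult_one)

lemma M_topological_A: "topological_module A TA M TM"
proof -
  have "continuous_map (prod_topology TA TM) TM (\<lambda>z. fst z \<odot>\<^bsub>M\<^esub> snd z)"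
    using continuous_map_compose[OF continuous_map_fst incl_cont]
    by (intro smult_continuous continuous_map_snd) (simp add: o_def)
  then show ?thesis
    using A_top_ring M_left_module_A M_group by (simp add: topological_module_def case_prod_beta')
qed

lemma small_submodule:
  assumes "openin TM O'" "\<zero>\<^bsub>M\<^esub> \<in> O'"
  obtains V where "V \<in> open_submodules A M TM" "submodule V B M" "V \<subseteq> O'" "finite_length B (quot_module M V)"
proof -
  interpret MA: left_module A M by (rule M_left_module_A)
  obtain J where J: "complete_base B M TM J" "\<And>K. K \<in> J \<Longrightarrow> finite_length B (quot_module M K)"
    by (rule pseudocompact_complete_base[OF M_pseudocompact]) (rule that)
  obtain V where V: "V \<in> J" "V \<subseteq> O'" using complete_baseD(2)[OF J(1) assms] by blast
  have s: "submodule V B M" "openin TM V" using complete_baseD(1)[OF J(1)] V(1) by (auto simp: open_submodules_def)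
  have "submodule V A M"
    by (rule MA.submoduleI_left) (use M.submoduleD_left[OF s(1)] in auto)
  then show thesis using that s V J(2) by (auto simp: open_submodules_def)
qed

text \<open>A quotient of \<open>M\<close> of finite length over \<open>B\<close> is finitely generated over \<open>A\<close>: if the \<open>x\<close> generate
  it over \<open>B\<close>, then the \<open>t\<^sup>k x\<close> generate it over \<open>A\<close>, and all but finitely many of them vanish.\<close>

lemma M_finitely_generated:
  assumes V: "V \<in> open_submodules A M TM"
  shows "\<exists>F. finite F \<and> F \<subseteq> carrier M \<and> (\<forall>K. submodule K A M \<longrightarrow> F \<subseteq> K \<longrightarrow> V \<subseteq> K \<longrightarrow> K = carrier M)"
proof -
  interpret MA: left_module A M by (rule M_left_module_A)
  have Vs: "submodule V A M" "openin TM V" using V by (auto simp: open_submodules_def)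
  obtain V0 where V0: "V0 \<in> open_submodules A M TM" "submodule V0 B M" "V0 \<subseteq> V" "finite_length B (quot_module M V0)"
    by (rule small_submodule[OF Vs(2) MA.submoduleD_left(2)[OF Vs(1)]]) (rule that)
  have V0o: "openin TM V0" using V0(1) by (simp add: open_submodules_def)
  note v = M.submoduleD_left[OF V0(2)]
  note q = M.quot_module_facts[OF V0(2)]
  interpret Z: left_module B "quot_module M V0" by (rule q(1))
  obtain C where C: "finite C" "C \<subseteq> carrier (quot_module M V0)"
    "\<And>K. submodule K B (quot_module M V0) \<Longrightarrow> C \<subseteq> K \<Longrightarrow> K = carrier (quot_module M V0)"
    by (rule Z.finite_length_imp_finitely_generated[OF V0(4)]) (rule that)
  have "C \<subseteq> (\<lambda>x. V0 +>\<^bsub>M\<^esub> x) ` carrier M" using C(2) unfolding q(2) .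
  from finite_subset_image[OF C(1) this]
  obtain G where G: "finite G" "G \<subseteq> carrier M" "C = (\<lambda>x. V0 +>\<^bsub>M\<^esub> x) ` G" by auto
  have "\<exists>n. \<forall>k\<ge>n. t [^]\<^bsub>B\<^esub> (k::nat) \<odot>\<^bsub>M\<^esub> x \<in> V0" if "x \<in> G" for x
  proof -
    have x: "x \<in> carrier M" using G(2) that by blast
    have "openin TB {b \<in> carrier B. b \<odot>\<^bsub>M\<^esub> x \<in> V0}"
      using openin_continuous_map_preimage[OF smult_left_cont[OF x] V0o] space_TB by simp
    from powers_tendsto_zero[OF this]
    show ?thesis
      using additive_hom_diff(1)[OF B.abelian_group_axioms M.M.abelian_group_axioms smult_left_hom[OF x]] v(2) by auto
  qed
  then have "\<forall>x\<in>G. \<exists>n. \<forall>k\<ge>n. t [^]\<^bsub>B\<^esub> (k::nat) \<odot>\<^bsub>M\<^esub> x \<in> V0" by blast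
  from bchoice[OF this] obtain r where r: "\<forall>x\<in>G. \<forall>k\<ge>r x. t [^]\<^bsub>B\<^esub> (k::nat) \<odot>\<^bsub>M\<^esub> x \<in> V0" ..
  let ?F = "\<Union>x\<in>G. (\<lambda>k. t [^]\<^bsub>B\<^esub> (k::nat) \<odot>\<^bsub>M\<^esub> x) ` {..<r x}"
  have "K = carrier M" if K: "submodule K A M" "?F \<subseteq> K" "V \<subseteq> K" for K
  proof -
    note k = MA.submoduleD_left[OF K(1)]
    have V0K: "V0 \<subseteq> K" using V0(3) K(3) by blast
    have Ksub: "subgroup K (add_monoid M)"
      by (rule M.M.add_subgroupI) (use k in \<open>auto simp: a_minus_def\<close>)
    have Ko: "open_subgroup M TM K" by (rule subgroup_open[OF M_group Ksub V0o v(2) V0K])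
    have BG: "b \<odot>\<^bsub>M\<^esub> x \<in> K" if x: "x \<in> G" and b: "b \<in> carrier B" for x b
    proof -
      have xM: "x \<in> carrier M" using G(2) x by blast
      show ?thesis
      proof (rule continuous_additive_mem_open_subgroup[OF B_group monomials_generate M_group Ko
            smult_left_hom[OF xM] smult_left_cont[OF xM] _ b])
        fix s assume "s \<in> {a \<otimes>\<^bsub>B\<^esub> t [^]\<^bsub>B\<^esub> (n::nat) | a n. a \<in> carrier A}"
        then obtain a n where s: "s = a \<otimes>\<^bsub>B\<^esub> t [^]\<^bsub>B\<^esub> (n::nat)" "a \<in> carrier A" by blast
        have "t [^]\<^bsub>B\<^esub> n \<odot>\<^bsub>M\<^esub> x \<in> K"
        proof (cases "n < r x")
          case True
          then show ?thesis using K(2) x by blast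
        next
          case False
          then show ?thesis using bspec[OF r x] V0K by auto
        qed
        then show "s \<odot>\<^bsub>M\<^esub> x \<in> K" using k(4)[OF s(2)] s xM by (simp add: M.lsmult_assoc)
      qed
    qed
    \<comment> \<open>the largest \<open>B\<close>-submodule of \<open>K\<close>, seen modulo \<open>V0\<close>\<close>
    let ?L = "{y \<in> carrier M. \<forall>b\<in>carrier B. b \<odot>\<^bsub>M\<^esub> y \<in> K}"
    have L: "submodule ?L B M"
    proof (rule M.submoduleI_left)
      show "?L \<subseteq> carrier M" by blast
      show "\<zero>\<^bsub>M\<^esub> \<in> ?L" using k(2) by (simp add: M.lsmult_zero)
      show "x \<oplus>\<^bsub>M\<^esub> y \<in> ?L" if "x \<in> ?L" "y \<in> ?L" for x y
        using that k(3) by (simp add: M.lsmult_r_distr)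
      show "a \<odot>\<^bsub>M\<^esub> x \<in> ?L" if "a \<in> carrier B" "x \<in> ?L" for a x
        using that by (simp add: M.lsmult_closed M.lsmult_assoc[symmetric])
    qed
    note l = M.submoduleD_left[OF L]
    have V0L: "V0 \<subseteq> ?L" using v(1,4) V0K by blast
    let ?H = "(\<lambda>x. V0 +>\<^bsub>M\<^esub> x) ` ?L"
    have "submodule ?H B (quot_module M V0)"
    proof (rule Z.submoduleI_left)
      show "?H \<subseteq> carrier (quot_module M V0)" unfolding q(2) by blast
      show "\<zero>\<^bsub>quot_module M V0\<^esub> \<in> ?H"
        unfolding q(5) by (rule image_eqI[OF _ l(2)]) (use v(1) in simp)
      show "x \<oplus>\<^bsub>quot_module M V0\<^esub> y \<in> ?H" if xy: "x \<in> ?H" "y \<in> ?H" for x y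
      proof -
        obtain u w where u: "u \<in> ?L" "x = V0 +>\<^bsub>M\<^esub> u" "w \<in> ?L" "y = V0 +>\<^bsub>M\<^esub> w" using xy by blast
        then show ?thesis using l(3)[OF u(1,3)] q(3)[of u w] by auto
      qed
      show "a \<odot>\<^bsub>quot_module M V0\<^esub> x \<in> ?H" if a: "a \<in> carrier B" and x: "x \<in> ?H" for a x
      proof -
        obtain u where u: "u \<in> ?L" "x = V0 +>\<^bsub>M\<^esub> u" using x by blast
        then show ?thesis using l(4)[OF a u(1)] q(4)[OF a, of u] by auto
      qed
    qed
    moreover have "C \<subseteq> ?H" unfolding G(3) using BG G(2) by blast
    ultimately have H: "?H = carrier (quot_module M V0)" by (rule C(3))
    have "x \<in> K" if x: "x \<in> carrier M" for x
    proof -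
      have "V0 +>\<^bsub>M\<^esub> x \<in> ?H" unfolding H q(2) using x by blast
      then obtain y where y: "y \<in> ?L" "V0 +>\<^bsub>M\<^esub> x = V0 +>\<^bsub>M\<^esub> y" by blast
      have yM: "y \<in> carrier M" and yK: "y \<in> K"
        using y(1) bspec[OF conjunct2[OF CollectD[OF y(1)]] B.one_closed] by (simp_all add: M.lsmult_one)
      have "x \<ominus>\<^bsub>M\<^esub> y \<in> K"
        using M.coset_eq_iff[OF M.submodule_abelian_subgroup[OF V0(2)] x yM] y(2) V0K by blast
      then have "(x \<ominus>\<^bsub>M\<^esub> y) \<oplus>\<^bsub>M\<^esub> y \<in> K" using k(3) yK by blast
      then show ?thesis using M.M.diff_simps(2)[OF x yM] by simp
    qed
    then show ?thesis using k(1) by blast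
  qed
  moreover have "finite ?F" using G(1) by blast
  moreover have "?F \<subseteq> carrier M" using G(2) by (auto intro!: M.lsmult_closed)
  ultimately show ?thesis by (intro exI[of _ ?F] conjI allI impI)
qed

lemma completed_tensor_twisted:
  assumes \<rho>: "\<rho> \<in> ring_hom A A" "continuous_map TA TA \<rho>"
  shows "completed_tensor A TA B TB (twisted_bimodule B \<rho>) TB M TM"
proof
  show "topological_module B TB (twisted_bimodule B \<rho>) TB" by (rule twisted_top_module)
  show tQ: "topological_module (op_ring A) TA (right_module (twisted_bimodule B \<rho>)) TB"
    by (rule twisted_right_module[OF \<rho>])
  show "topological_module A TA M TM" by (rule M_topological_A)
  show "rsmult (twisted_bimodule B \<rho>) (b \<odot>\<^bsub>twisted_bimodule B \<rho>\<^esub> p) a = b \<odot>\<^bsub>twisted_bimodule B \<rho>\<^esub> rsmult (twisted_bimodule B \<rho>) p a"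
    if "b \<in> carrier B" "a \<in> carrier A" "p \<in> carrier (twisted_bimodule B \<rho>)" for b a p
    using that ring_hom_closed[OF \<rho>(1)] by (simp add: twisted_bimodule_simps B.m_assoc)
  fix U assume U: "U \<in> open_submodules (op_ring A) (right_module (twisted_bimodule B \<rho>)) TB"
  interpret Q: left_module "op_ring A" "right_module (twisted_bimodule B \<rho>)"
    by (rule topological_module_left_module[OF tQ])
  have "openin TB U" "\<zero>\<^bsub>B\<^esub> \<in> U"
    using U Q.submoduleD_left(2)[of U] by (auto simp: open_submodules_def twisted_bimodule_simps)
  then show "\<exists>W\<in>open_submodules (op_ring A) (right_module (twisted_bimodule B \<rho>)) TB. W \<subseteq> U \<and>
      submodule W B (twisted_bimodule B \<rho>) \<and> finite_length B (quot_module (twisted_bimodule B \<rho>) W)"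
    by (rule small_subbimodule[OF \<rho>])
qed (rule M_finitely_generated)

section \<open>The maps of the sequence\<close>

text \<open>\<open>I\<close> and \<open>S\<close> refer to the twists by the identity and by \<open>\<sigma>\<close>, that is to the second and the first
  term of the sequence.\<close>

sublocale I: completed_tensor A TA B TB "regular_bimodule B" TB M TM
  by (rule completed_tensor_twisted[OF id_ring_hom]) simp

sublocale S: completed_tensor A TA B TB "twisted_bimodule B \<sigma>" TB M TM
  by (rule completed_tensor_twisted[OF \<sigma>_hom \<sigma>_cont])

lemmas Ice_closed = I.ce_closed[unfolded twisted_bimodule_simps]
  and Ice_add_left = I.ce_add_left[unfolded twisted_bimodule_simps]
  and Ice_add_right = I.ce_add_right[unfolded twisted_bimodule_simps]
  and Ice_balanced = I.ce_balanced[unfolded twisted_bimodule_simps]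
  and Ice_smult = I.ce_smult[unfolded twisted_bimodule_simps]
  and Sce_closed = S.ce_closed[unfolded twisted_bimodule_simps]
  and Sce_add_left = S.ce_add_left[unfolded twisted_bimodule_simps]
  and Sce_add_right = S.ce_add_right[unfolded twisted_bimodule_simps]
  and Sce_balanced = S.ce_balanced[unfolded twisted_bimodule_simps]
  and Sce_smult = S.ce_smult[unfolded twisted_bimodule_simps]

lemma right_mult_maps: "(\<lambda>b. b \<otimes>\<^bsub>B\<^esub> c) \<in> hom (add_monoid B) (add_monoid B)" "continuous_map TB TB (\<lambda>b. b \<otimes>\<^bsub>B\<^esub> c)"
  if "c \<in> carrier B"
  using that by (auto simp: hom_def B.l_distr space_TB intro!: continuous_mult)

lemma small_open:
  assumes "U \<in> I.UU"
  shows "openin TB U" "\<zero>\<^bsub>B\<^esub> \<in> U" "\<And>b a. b \<in> U \<Longrightarrow> a \<in> carrier A \<Longrightarrow> b \<otimes>\<^bsub>B\<^esub> a \<in> U"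
  using I.UUD[OF assms] by (auto simp: twisted_bimodule_simps)

lemma I_small: "openin TB O' \<Longrightarrow> \<zero>\<^bsub>B\<^esub> \<in> O' \<Longrightarrow> \<exists>U\<in>I.UU. U \<subseteq> O'"
  using small_subbimodule[OF id_ring_hom, of O'] by auto

lemma S_small: "openin TB O' \<Longrightarrow> \<zero>\<^bsub>B\<^esub> \<in> O' \<Longrightarrow> \<exists>U\<in>S.UU. U \<subseteq> O'"
  using small_subbimodule[OF \<sigma>_hom \<sigma>_cont, of O'] by auto

lemma VV_open: "V \<in> I.VV \<Longrightarrow> openin TM V \<and> \<zero>\<^bsub>M\<^esub> \<in> V"
  using I.VVD[of V] I.N.submoduleD_left(2)[of V] by blast

text \<open>Balancedness is where the twist is needed: by \<open>t a = \<sigma>(a) t + \<delta>(a)\<close>, passing \<open>a\<close> through \<open>t\<close> adds the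
  same term \<open>b \<delta>(a) \<otimes> m\<close> to \<open>b t \<otimes> a m\<close> and to \<open>b \<otimes> t a m\<close>, and in their difference only \<open>\<sigma>(a)\<close>
  remains.\<close>

lemma kappa_exists:
  "\<exists>\<kappa>. \<kappa> \<in> module_homs B S.E I.E \<and> continuous_map S.TE I.TE \<kappa> \<and>
    (\<forall>b\<in>carrier B. \<forall>m\<in>carrier M. \<kappa> (S.ce b m) = I.ce (b \<otimes>\<^bsub>B\<^esub> t) m \<ominus>\<^bsub>I.E\<^esub> I.ce b (t \<odot>\<^bsub>M\<^esub> m))"
proof -
  obtain J where J: "complete_base B I.E I.TE J" "Hausdorff_space I.TE"
    by (rule pseudocompact_complete_base[OF I.ctensor_pseudocompact]) (rule that)
  note Jm = complete_base_mem[OF I.E_topological J(1)]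
  let ?\<phi> = "\<lambda>b m. I.ce (b \<otimes>\<^bsub>B\<^esub> t) m \<ominus>\<^bsub>I.E\<^esub> I.ce b (t \<odot>\<^bsub>M\<^esub> m)"
  have cl: "?\<phi> b m \<in> carrier I.E" if "b \<in> carrier B" "m \<in> carrier M" for b m
    using that by (simp add: Ice_closed M.lsmult_closed)
  have l: "?\<phi> (b \<oplus>\<^bsub>B\<^esub> c) m = ?\<phi> b m \<oplus>\<^bsub>I.E\<^esub> ?\<phi> c m"
    if "b \<in> carrier B" "c \<in> carrier B" "m \<in> carrier M" for b c m
    using that by (simp add: B.l_distr Ice_add_left Ice_closed M.lsmult_closed I.E.M.diff_add_add)
  have r: "?\<phi> b (m \<oplus>\<^bsub>M\<^esub> n) = ?\<phi> b m \<oplus>\<^bsub>I.E\<^esub> ?\<phi> b n"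
    if "b \<in> carrier B" "m \<in> carrier M" "n \<in> carrier M" for b m n
    using that by (simp add: M.lsmult_r_distr Ice_add_right Ice_closed M.lsmult_closed I.E.M.diff_add_add)
  have bal: "?\<phi> (b \<otimes>\<^bsub>B\<^esub> \<sigma> a) m = ?\<phi> b (a \<odot>\<^bsub>M\<^esub> m)"
    if b: "b \<in> carrier B" and a: "a \<in> carrier A" and m: "m \<in> carrier M" for b a m
  proof -
    have sa: "\<sigma> a \<in> carrier A" "\<delta> a \<in> carrier A" using a by auto
    note aB = A_closed[OF a] A_closed[OF sa(1)] A_closed[OF sa(2)]
    have tm: "t \<odot>\<^bsub>M\<^esub> m \<in> carrier M" "a \<odot>\<^bsub>M\<^esub> m \<in> carrier M" "\<sigma> a \<odot>\<^bsub>M\<^esub> (t \<odot>\<^bsub>M\<^esub> m) \<in> carrier M" "\<delta> a \<odot>\<^bsub>M\<^esub> m \<in> carrier M"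
      using m aB by (auto intro!: M.lsmult_closed)
    let ?x = "I.ce (b \<otimes>\<^bsub>B\<^esub> \<sigma> a \<otimes>\<^bsub>B\<^esub> t) m" and ?d = "I.ce (b \<otimes>\<^bsub>B\<^esub> \<delta> a) m" and ?y = "I.ce (b \<otimes>\<^bsub>B\<^esub> \<sigma> a) (t \<odot>\<^bsub>M\<^esub> m)"
    have car: "?x \<in> carrier I.E" "?d \<in> carrier I.E" "?y \<in> carrier I.E" using b m aB tm by (simp_all add: Ice_closed)
    have "I.ce (b \<otimes>\<^bsub>B\<^esub> t) (a \<odot>\<^bsub>M\<^esub> m) = I.ce (b \<otimes>\<^bsub>B\<^esub> t \<otimes>\<^bsub>B\<^esub> a) m"
      using Ice_balanced[of a "b \<otimes>\<^bsub>B\<^esub> t" m] b a m by simp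
    also have "b \<otimes>\<^bsub>B\<^esub> t \<otimes>\<^bsub>B\<^esub> a = b \<otimes>\<^bsub>B\<^esub> \<sigma> a \<otimes>\<^bsub>B\<^esub> t \<oplus>\<^bsub>B\<^esub> b \<otimes>\<^bsub>B\<^esub> \<delta> a"
      using b aB by (simp add: B.m_assoc t_commute[OF a] B.r_distr)
    also have "I.ce \<dots> m = ?x \<oplus>\<^bsub>I.E\<^esub> ?d" using b m aB by (simp add: Ice_add_left)
    finally have 1: "I.ce (b \<otimes>\<^bsub>B\<^esub> t) (a \<odot>\<^bsub>M\<^esub> m) = ?x \<oplus>\<^bsub>I.E\<^esub> ?d" .
    have "t \<odot>\<^bsub>M\<^esub> (a \<odot>\<^bsub>M\<^esub> m) = \<sigma> a \<odot>\<^bsub>M\<^esub> (t \<odot>\<^bsub>M\<^esub> m) \<oplus>\<^bsub>M\<^esub> \<delta> a \<odot>\<^bsub>M\<^esub> m"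
      using m aB by (simp add: M.lsmult_assoc[symmetric] t_commute[OF a] M.lsmult_l_distr)
    then have 2: "I.ce b (t \<odot>\<^bsub>M\<^esub> (a \<odot>\<^bsub>M\<^esub> m)) = ?y \<oplus>\<^bsub>I.E\<^esub> ?d"
      using b m tm sa Ice_balanced[of "\<sigma> a" b "t \<odot>\<^bsub>M\<^esub> m"] Ice_balanced[of "\<delta> a" b m] by (simp add: Ice_add_right)
    show ?thesis unfolding 1 2 using car by (simp add: I.E.M.diff_add_add I.E.M.r_neg a_minus_def[of _ ?d])
  qed
  have c1: "\<exists>U\<in>S.UU. \<forall>b\<in>U. \<forall>m\<in>carrier M. ?\<phi> b m \<in> K" if K: "K \<in> J" for K
  proof -
    obtain U V where UV: "U \<in> I.UU" "V \<in> I.VV" "\<And>b m. b \<in> U \<Longrightarrow> m \<in> carrier M \<Longrightarrow> I.ce b m \<in> K"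
      by (rule I.ce_small[OF Jm(2,4)[OF K]]) (rule that)
    note u = small_open[OF UV(1)]
    have "openin TB ({b \<in> topspace TB. b \<otimes>\<^bsub>B\<^esub> t \<in> U} \<inter> U)"
      by (intro openin_Int openin_continuous_map_preimage[OF right_mult_maps(2)[OF t_closed] u(1)] u(1))
    moreover have "\<zero>\<^bsub>B\<^esub> \<in> {b \<in> topspace TB. b \<otimes>\<^bsub>B\<^esub> t \<in> U} \<inter> U" using u(2) by (simp add: space_TB)
    ultimately obtain W where W: "W \<in> S.UU" "W \<subseteq> {b \<in> topspace TB. b \<otimes>\<^bsub>B\<^esub> t \<in> U} \<inter> U"
      using S_small by meson
    have "?\<phi> b m \<in> K" if "b \<in> W" "m \<in> carrier M" for b m
      using that W(2) by (intro Jm(6)[OF K] UV(3)) (auto simp: M.lsmult_closed)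
    then show ?thesis using W(1) by blast
  qed
  have c2: "\<exists>V\<in>I.VV. \<forall>b\<in>carrier B. \<forall>m\<in>V. ?\<phi> b m \<in> K" if K: "K \<in> J" for K
  proof -
    obtain U V where UV: "U \<in> I.UU" "V \<in> I.VV" "\<And>b m. b \<in> carrier (regular_bimodule B) \<Longrightarrow> m \<in> V \<Longrightarrow> I.ce b m \<in> K"
      by (rule I.ce_small[OF Jm(2,4)[OF K]]) (rule that)
    obtain V0 where V0: "V0 \<in> I.VV" "submodule V0 B M" "V0 \<subseteq> V"
      by (rule small_submodule[of V]) (use VV_open[OF UV(2)] in \<open>auto intro: that\<close>)
    have "?\<phi> b m \<in> K" if "b \<in> carrier B" "m \<in> V0" for b m
      using that V0(3) M.submoduleD_left(4)[OF V0(2), of t m]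
      by (intro Jm(6)[OF K] UV(3)) (auto simp: twisted_bimodule_simps)
    then show ?thesis using V0(1) by blast
  qed
  obtain \<kappa> where \<kappa>: "\<kappa> \<in> hom (add_monoid S.E) (add_monoid I.E)" "continuous_map S.TE I.TE \<kappa>"
    "\<And>b m. b \<in> carrier (twisted_bimodule B \<sigma>) \<Longrightarrow> m \<in> carrier M \<Longrightarrow> \<kappa> (S.ce b m) = ?\<phi> b m"
  proof (rule S.ctensor_universal[OF I.E_topological J(1), of ?\<phi>], unfold twisted_bimodule_simps)
    show "\<And>b m. b \<in> carrier B \<Longrightarrow> m \<in> carrier M \<Longrightarrow> ?\<phi> b m \<in> carrier I.E" by (rule cl)
    show "\<And>b c m. b \<in> carrier B \<Longrightarrow> c \<in> carrier B \<Longrightarrow> m \<in> carrier M \<Longrightarrow> ?\<phi> (b \<oplus>\<^bsub>B\<^esub> c) m = ?\<phi> b m \<oplus>\<^bsub>I.E\<^esub> ?\<phi> c m" by (rule l)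
    show "\<And>b m n. b \<in> carrier B \<Longrightarrow> m \<in> carrier M \<Longrightarrow> n \<in> carrier M \<Longrightarrow> ?\<phi> b (m \<oplus>\<^bsub>M\<^esub> n) = ?\<phi> b m \<oplus>\<^bsub>I.E\<^esub> ?\<phi> b n" by (rule r)
    show "\<And>a b m. a \<in> carrier A \<Longrightarrow> b \<in> carrier B \<Longrightarrow> m \<in> carrier M \<Longrightarrow> ?\<phi> (b \<otimes>\<^bsub>B\<^esub> \<sigma> a) m = ?\<phi> b (a \<odot>\<^bsub>M\<^esub> m)" by (rule bal)
    show "\<And>K. K \<in> J \<Longrightarrow> \<exists>U\<in>S.UU. \<forall>b\<in>U. \<forall>m\<in>carrier M. ?\<phi> b m \<in> K" by (rule c1)
    show "\<And>K. K \<in> J \<Longrightarrow> \<exists>V\<in>I.VV. \<forall>b\<in>carrier B. \<forall>m\<in>V. ?\<phi> b m \<in> K" by (rule c2)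
  qed (rule that, unfold twisted_bimodule_simps)
  note \<kappa>3 = \<kappa>(3)[unfolded twisted_bimodule_simps]
  have "\<kappa> \<in> module_homs B S.E I.E"
  proof (rule S.ctensor_map_linear[OF I.E_topological J(2) \<kappa>(1,2)], unfold twisted_bimodule_simps)
    fix c b m assume c: "c \<in> carrier B" and b: "b \<in> carrier B" and m: "m \<in> carrier M"
    have car: "I.ce (b \<otimes>\<^bsub>B\<^esub> t) m \<in> carrier I.E" "I.ce b (t \<odot>\<^bsub>M\<^esub> m) \<in> carrier I.E"
      using b m by (simp_all add: Ice_closed M.lsmult_closed)
    have "c \<odot>\<^bsub>I.E\<^esub> ?\<phi> b m = c \<odot>\<^bsub>I.E\<^esub> I.ce (b \<otimes>\<^bsub>B\<^esub> t) m \<ominus>\<^bsub>I.E\<^esub> c \<odot>\<^bsub>I.E\<^esub> I.ce b (t \<odot>\<^bsub>M\<^esub> m)"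
      by (rule additive_hom_diff(3)[OF I.E.M.abelian_group_axioms I.E.M.abelian_group_axioms I.E.smult_hom[OF c] car])
    also have "\<dots> = ?\<phi> (c \<otimes>\<^bsub>B\<^esub> b) m" using c b m by (simp add: Ice_smult M.lsmult_closed B.m_assoc)
    finally show "\<kappa> (S.ce (c \<otimes>\<^bsub>B\<^esub> b) m) = c \<odot>\<^bsub>I.E\<^esub> \<kappa> (S.ce b m)" using \<kappa>3 c b m by simp
  qed
  then show ?thesis using \<kappa>(2) \<kappa>3 by blast
qed

text \<open>For \<open>b m\<close> to be small uniformly in \<open>m\<close> it suffices that \<open>b\<close> maps finitely many generators of \<open>M/K\<close>
  over \<open>A\<close> into \<open>K\<close>, if \<open>b\<close> ranges over a right submodule: then \<open>b (a x) = (b a) x\<close> is small as well.\<close>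

lemma mu_exists:
  "\<exists>\<mu>. \<mu> \<in> module_homs B I.E M \<and> continuous_map I.TE TM \<mu> \<and>
    (\<forall>b\<in>carrier B. \<forall>m\<in>carrier M. \<mu> (I.ce b m) = b \<odot>\<^bsub>M\<^esub> m)"
proof -
  obtain J where J: "complete_base B M TM J" "Hausdorff_space TM"
    by (rule pseudocompact_complete_base[OF M_pseudocompact]) (rule that)
  note Jm = complete_base_mem[OF M_topological J(1)]
  have KV: "K \<in> I.VV" if K: "K \<in> J" for K
    using Jm(2)[OF K] I.N.submoduleI_left[of K] M.submoduleD_left[OF Jm(1)[OF K]]
    by (auto simp: open_submodules_def)
  have c1: "\<exists>U\<in>I.UU. \<forall>b\<in>U. \<forall>m\<in>carrier M. b \<odot>\<^bsub>M\<^esub> m \<in> K" if K: "K \<in> J" for K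
  proof -
    note k = M.submoduleD_left[OF Jm(1)[OF K]]
    obtain F where F: "finite F" "F \<subseteq> carrier M" "\<And>L. submodule L A M \<Longrightarrow> F \<subseteq> L \<Longrightarrow> K \<subseteq> L \<Longrightarrow> L = carrier M"
      using M_finitely_generated[OF KV[OF K]] by blast
    let ?O = "topspace TB \<inter> (\<Inter>x\<in>F. {b \<in> topspace TB. b \<odot>\<^bsub>M\<^esub> x \<in> K})"
    have "openin TB ?O"
    proof (rule openin_Int_Inter)
      show "finite ((\<lambda>x. {b \<in> topspace TB. b \<odot>\<^bsub>M\<^esub> x \<in> K}) ` F)" using F(1) by simp
      fix Z assume "Z \<in> (\<lambda>x. {b \<in> topspace TB. b \<odot>\<^bsub>M\<^esub> x \<in> K}) ` F"
      then obtain x where x: "x \<in> F" "Z = {b \<in> topspace TB. b \<odot>\<^bsub>M\<^esub> x \<in> K}" by blast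
      show "openin TB Z"
        unfolding x(2) by (rule openin_continuous_map_preimage[OF smult_left_cont Jm(2)[OF K]]) (use F(2) x(1) in blast)
    qed simp
    moreover have "\<zero>\<^bsub>B\<^esub> \<in> ?O"
      using additive_hom_diff(1)[OF B.abelian_group_axioms M.M.abelian_group_axioms smult_left_hom] F(2) k(2)
      by (auto simp: space_TB subset_iff)
    ultimately obtain U where U: "U \<in> I.UU" "U \<subseteq> ?O" using I_small by meson
    note u = small_open[OF U(1)]
    have UB: "b \<in> carrier B" if "b \<in> U" for b using U(2) that space_TB by auto
    let ?L = "{m \<in> carrier M. \<forall>b\<in>U. b \<odot>\<^bsub>M\<^esub> m \<in> K}"
    have "?L = carrier M"
    proof (rule F(3))
      show "submodule ?L A M"
      proof (rule I.N.submoduleI_left)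
        show "\<zero>\<^bsub>M\<^esub> \<in> ?L" using k(2) UB by (simp add: M.lsmult_zero)
        show "x \<oplus>\<^bsub>M\<^esub> y \<in> ?L" if "x \<in> ?L" "y \<in> ?L" for x y
          using that k(3) UB by (simp add: M.lsmult_r_distr)
        show "a \<odot>\<^bsub>M\<^esub> x \<in> ?L" if a: "a \<in> carrier A" and x: "x \<in> ?L" for a x
        proof -
          have "b \<odot>\<^bsub>M\<^esub> (a \<odot>\<^bsub>M\<^esub> x) \<in> K" if b: "b \<in> U" for b
          proof -
            have "b \<odot>\<^bsub>M\<^esub> (a \<odot>\<^bsub>M\<^esub> x) = (b \<otimes>\<^bsub>B\<^esub> a) \<odot>\<^bsub>M\<^esub> x"
              using UB[OF b] a x by (simp add: M.lsmult_assoc)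
            then show ?thesis using u(3)[OF b a] x by simp
          qed
          then show ?thesis using a x by (simp add: M.lsmult_closed)
        qed
      qed blast
      show "F \<subseteq> ?L" using F(2) U(2) by blast
      show "K \<subseteq> ?L" using k(1,4) UB by blast
    qed
    then show ?thesis using U(1) by blast
  qed
  have c2: "\<exists>V\<in>I.VV. \<forall>b\<in>carrier B. \<forall>m\<in>V. b \<odot>\<^bsub>M\<^esub> m \<in> K" if K: "K \<in> J" for K
    by (rule bexI[OF _ KV[OF K]]) (intro ballI Jm(7)[OF K])
  obtain \<mu> where \<mu>: "\<mu> \<in> hom (add_monoid I.E) (add_monoid M)" "continuous_map I.TE TM \<mu>"
    "\<And>b m. b \<in> carrier (regular_bimodule B) \<Longrightarrow> m \<in> carrier M \<Longrightarrow> \<mu> (I.ce b m) = b \<odot>\<^bsub>M\<^esub> m"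
    by (rule I.ctensor_universal[OF M_topological J(1), of "\<lambda>b m. b \<odot>\<^bsub>M\<^esub> m"], unfold twisted_bimodule_simps)
      (erule c1 | erule c2 | rule that | simp add: M.lsmult_closed M.lsmult_l_distr M.lsmult_r_distr M.lsmult_assoc twisted_bimodule_simps)+
  have "\<mu> \<in> module_homs B I.E M"
    by (rule I.ctensor_map_linear[OF M_topological J(2) \<mu>(1,2)])
      (simp add: \<mu>(3) twisted_bimodule_simps M.lsmult_assoc)
  then show ?thesis using \<mu>(2) \<mu>(3)[unfolded twisted_bimodule_simps] by blast
qed

section \<open>The derivation and the retraction\<close>

text \<open>The value \<open>D(t\<^sup>n) m\<close>, that is \<open>\<Sum> t\<^sup>i \<otimes> t\<^sup>j m\<close> over \<open>i + j = n - 1\<close>. Splitting off the term with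
  \<open>j = 0\<close> mirrors \<open>D(t\<^sup>n t) = D(t\<^sup>n) t + t\<^sup>n \<otimes> 1\<close>.\<close>

primrec qsum :: "nat \<Rightarrow> 'm \<Rightarrow> 'b set \<Rightarrow> 'm set \<Rightarrow> (('b set \<times> 'm set) \<Rightarrow>\<^sub>0 int) set" where
  "qsum 0 = (\<lambda>m. \<zero>\<^bsub>S.E\<^esub>)"
| "qsum (Suc n) = (\<lambda>m. qsum n (t \<odot>\<^bsub>M\<^esub> m) \<oplus>\<^bsub>S.E\<^esub> S.ce (t [^]\<^bsub>B\<^esub> n) m)"

lemma t_smult_closed [simp]: "m \<in> carrier M \<Longrightarrow> t \<odot>\<^bsub>M\<^esub> m \<in> carrier M"
  by (simp add: M.lsmult_closed)

lemma qsum_closed [simp]: "m \<in> carrier M \<Longrightarrow> qsum n m \<in> carrier S.E"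
  by (induction n arbitrary: m) (simp_all add: Sce_closed)

lemma qsum_add:
  "m \<in> carrier M \<Longrightarrow> m' \<in> carrier M \<Longrightarrow> qsum n (m \<oplus>\<^bsub>M\<^esub> m') = qsum n m \<oplus>\<^bsub>S.E\<^esub> qsum n m'"
proof (induction n arbitrary: m m')
  case (Suc n)
  have "S.ce (t [^]\<^bsub>B\<^esub> n) (m \<oplus>\<^bsub>M\<^esub> m') = S.ce (t [^]\<^bsub>B\<^esub> n) m \<oplus>\<^bsub>S.E\<^esub> S.ce (t [^]\<^bsub>B\<^esub> n) m'"
    by (rule Sce_add_right) (use Suc.prems in simp_all)
  then show ?case
    using Suc.prems by (simp add: M.lsmult_r_distr Suc.IH Sce_closed S.E.M.a_ac)
qed simp

lemma t_pow_smult: "m \<in> carrier M \<Longrightarrow> t [^]\<^bsub>B\<^esub> (Suc j) \<odot>\<^bsub>M\<^esub> m = t [^]\<^bsub>B\<^esub> j \<odot>\<^bsub>M\<^esub> (t \<odot>\<^bsub>M\<^esub> m)"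
  by (simp add: M.lsmult_assoc)

lemma S_E_top: "topological_module B TB S.E S.TE" and S_E_group: "topological_abelian_group S.E S.TE"
  by (rule S.E_topological S.E_group)+

lemma qsum_small:
  assumes K: "openin S.TE K" "subgroup K (add_monoid S.E)"
    and V: "\<And>j. t [^]\<^bsub>B\<^esub> (j::nat) \<odot>\<^bsub>M\<^esub> m \<in> V" "\<And>b v. b \<in> carrier B \<Longrightarrow> v \<in> V \<Longrightarrow> S.ce b v \<in> K" and m: "m \<in> carrier M"
  shows "qsum n m \<in> K"
  using V(1) m
proof (induction n arbitrary: m)
  case 0
  then show ?case using add_subgroupD(2)[OF K(2)] by simp
next
  case (Suc n)
  have "t [^]\<^bsub>B\<^esub> (j::nat) \<odot>\<^bsub>M\<^esub> (t \<odot>\<^bsub>M\<^esub> m) \<in> V" for j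
    using Suc.prems(1)[of "Suc j"] t_pow_smult[OF Suc.prems(2), of j] by simp
  then have "qsum n (t \<odot>\<^bsub>M\<^esub> m) \<in> K" using Suc.IH Suc.prems(2) by simp
  moreover have "S.ce (t [^]\<^bsub>B\<^esub> n) m \<in> K"
    using Suc.prems(1)[of 0] Suc.prems(2) by (intro V(2)) (simp_all add: M.lsmult_one)
  ultimately show ?case using add_subgroupD(3)[OF K(2)] by simp
qed

text \<open>The factors \<open>t\<^sup>i\<close> and \<open>t\<^sup>j m\<close> are small as soon as \<open>i\<close>, respectively \<open>j\<close>, is large.\<close>

lemma qsum_null:
  assumes K: "openin S.TE K" "subgroup K (add_monoid S.E)" and m: "m \<in> carrier M"
  shows "\<exists>N. \<forall>n\<ge>N. qsum n m \<in> K"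
proof -
  note k = add_subgroupD[OF K(2)]
  obtain U V where UV: "U \<in> S.UU" "V \<in> S.VV"
    "\<And>b m. b \<in> U \<Longrightarrow> m \<in> carrier M \<Longrightarrow> S.ce b m \<in> K"
    "\<And>b m. b \<in> carrier (twisted_bimodule B \<sigma>) \<Longrightarrow> m \<in> V \<Longrightarrow> S.ce b m \<in> K"
    by (rule S.ce_small[OF K(1) k(2)]) (rule that)
  note UV4 = UV(4)[unfolded twisted_bimodule_simps]
  have U: "openin TB U" "\<zero>\<^bsub>B\<^esub> \<in> U" using S.UUD(2,5)[OF UV(1)] by (simp_all add: twisted_bimodule_simps)
  obtain p where p: "\<And>n. n \<ge> p \<Longrightarrow> t [^]\<^bsub>B\<^esub> (n::nat) \<in> U" using powers_tendsto_zero[OF U] by blast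
  have V: "openin TM V" "\<zero>\<^bsub>M\<^esub> \<in> V" using VV_open[OF UV(2)] by auto
  have "\<exists>q. \<forall>j\<ge>q. t [^]\<^bsub>B\<^esub> (j::nat) \<odot>\<^bsub>M\<^esub> m \<in> V"
  proof -
    have "openin TB {b \<in> topspace TB. b \<odot>\<^bsub>M\<^esub> m \<in> V}"
      by (rule openin_continuous_map_preimage[OF smult_left_cont[OF m] V(1)])
    from powers_tendsto_zero[OF this] show ?thesis
      using additive_hom_diff(1)[OF B.abelian_group_axioms M.M.abelian_group_axioms smult_left_hom[OF m]] V(2)
      by (auto simp: space_TB)
  qed
  then obtain q where q: "\<forall>j\<ge>q. t [^]\<^bsub>B\<^esub> (j::nat) \<odot>\<^bsub>M\<^esub> m \<in> V" ..
  \<comment> \<open>replacing \<open>m\<close> by \<open>t m\<close> lowers \<open>q\<close> by one and splits off the term \<open>t\<^sup>n \<otimes> m\<close>, small as \<open>n \<ge> p\<close>\<close>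
  have "\<forall>n\<ge>p + q. qsum n m \<in> K"
    using q m
  proof (induction q arbitrary: m)
    case 0
    then show ?case using qsum_small[OF K _ UV4, of m V] by simp
  next
    case (Suc q)
    show ?case
    proof (intro allI impI)
      fix n assume n: "n \<ge> p + Suc q"
      then obtain n' where n': "n = Suc n'" "n' \<ge> p + q" by (metis Suc_le_D add_Suc_right Suc_le_mono)
      have "\<forall>j\<ge>q. t [^]\<^bsub>B\<^esub> (j::nat) \<odot>\<^bsub>M\<^esub> (t \<odot>\<^bsub>M\<^esub> m) \<in> V"
        using Suc.prems(1) t_pow_smult[OF Suc.prems(2)] by (metis Suc_le_mono)
      then have "qsum n' (t \<odot>\<^bsub>M\<^esub> m) \<in> K" using Suc.IH Suc.prems(2) n'(2) by simp
      moreover have "S.ce (t [^]\<^bsub>B\<^esub> n') m \<in> K" using UV(3) p n'(2) Suc.prems(2) by simp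
      ultimately show "qsum n m \<in> K" using k(3) by (simp add: n'(1))
    qed
  qed
  then show ?thesis by blast
qed

text \<open>For fixed \<open>m\<close>, the map \<open>b \<mapsto> D(b) m\<close>, where \<open>D\<close> is the derivation from \<open>B\<close> to
  \<open>B\<^sup>\<sigma> \<otimes> B\<close> that vanishes on \<open>A\<close> and sends \<open>t\<close> to \<open>1 \<otimes> 1\<close>.\<close>

definition is_derivative :: "'m \<Rightarrow> ('b \<Rightarrow> 'b set \<Rightarrow> 'm set \<Rightarrow> (('b set \<times> 'm set) \<Rightarrow>\<^sub>0 int) set) \<Rightarrow> bool" where
  "is_derivative m d \<longleftrightarrow> d \<in> hom (add_monoid B) (add_monoid S.E) \<and> continuous_map TB S.TE d \<and>
     (\<forall>a\<in>carrier A. \<forall>n::nat. d (a \<otimes>\<^bsub>B\<^esub> t [^]\<^bsub>B\<^esub> n) = a \<odot>\<^bsub>S.E\<^esub> qsum n m)"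

lemma derivative_exists:
  obtains D where "\<forall>m\<in>carrier M. is_derivative m (D m)"
proof -
  obtain J where J: "complete_base B S.E S.TE J"
    by (rule pseudocompact_complete_base[OF S.ctensor_pseudocompact]) (rule that)
  note Jm = complete_base_mem[OF S_E_top J]
  have "\<forall>m\<in>carrier M. \<exists>d. is_derivative m d"
  proof
    fix m assume m: "m \<in> carrier M"
    obtain d where "d \<in> hom (add_monoid B) (add_monoid S.E)" "continuous_map TB S.TE d"
      "\<And>a n. a \<in> carrier A \<Longrightarrow> d (a \<otimes>\<^bsub>B\<^esub> t [^]\<^bsub>B\<^esub> (n::nat)) = a \<odot>\<^bsub>S.E\<^esub> qsum n m"
    proof (rule power_series_extension[OF S_E_top J])
      show "qsum n m \<in> carrier S.E" for n using m by simp
      show "\<exists>N. \<forall>n\<ge>N. qsum n m \<in> K" if "K \<in> J" for K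
        using qsum_null[OF Jm(2)[OF that] _ m] Jm(3)[OF that] by (simp add: open_subgroup_def)
    qed (rule that)
    then show "\<exists>d. is_derivative m d" unfolding is_derivative_def by blast
  qed
  from bchoice[OF this] show thesis using that by blast
qed

lemma derivative_eqI:
  assumes "f \<in> hom (add_monoid B) (add_monoid S.E)" "continuous_map TB S.TE f"
    and "g \<in> hom (add_monoid B) (add_monoid S.E)" "continuous_map TB S.TE g"
    and "\<And>a n. a \<in> carrier A \<Longrightarrow> f (a \<otimes>\<^bsub>B\<^esub> t [^]\<^bsub>B\<^esub> (n::nat)) = g (a \<otimes>\<^bsub>B\<^esub> t [^]\<^bsub>B\<^esub> n)"
    and "b \<in> carrier B"
  shows "f b = g b"
proof -
  have H: "Hausdorff_space S.TE"
    by (rule pseudocompact_complete_base[OF S.ctensor_pseudocompact])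
  show ?thesis
    by (rule continuous_additive_eqI[OF B_group monomials_generate S_E_group H assms(1-4) _ assms(6)])
      (use assms(5) in blast)
qed

context
  fixes D
  assumes D: "\<forall>m\<in>carrier M. is_derivative m (D m)"
begin

lemma D_hom: "m \<in> carrier M \<Longrightarrow> D m \<in> hom (add_monoid B) (add_monoid S.E)"
  and D_cont: "m \<in> carrier M \<Longrightarrow> continuous_map TB S.TE (D m)"
  and D_monomial: "m \<in> carrier M \<Longrightarrow> a \<in> carrier A \<Longrightarrow> D m (a \<otimes>\<^bsub>B\<^esub> t [^]\<^bsub>B\<^esub> (n::nat)) = a \<odot>\<^bsub>S.E\<^esub> qsum n m"
  using bspec[OF D, of m] by (auto simp: is_derivative_def)

lemma D_closed [simp]: "m \<in> carrier M \<Longrightarrow> b \<in> carrier B \<Longrightarrow> D m b \<in> carrier S.E"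
  using additive_homD(1)[OF D_hom] by blast

lemma D_add_left: "m \<in> carrier M \<Longrightarrow> b \<in> carrier B \<Longrightarrow> c \<in> carrier B \<Longrightarrow> D m (b \<oplus>\<^bsub>B\<^esub> c) = D m b \<oplus>\<^bsub>S.E\<^esub> D m c"
  using additive_homD(2)[OF D_hom] by blast

lemma D_add_right:
  assumes "m \<in> carrier M" "m' \<in> carrier M" "b \<in> carrier B"
  shows "D (m \<oplus>\<^bsub>M\<^esub> m') b = D m b \<oplus>\<^bsub>S.E\<^esub> D m' b"
proof (rule derivative_eqI[OF _ _ _ _ _ assms(3)])
  have mm: "m \<oplus>\<^bsub>M\<^esub> m' \<in> carrier M" using assms by simp
  show "D (m \<oplus>\<^bsub>M\<^esub> m') \<in> hom (add_monoid B) (add_monoid S.E)" "continuous_map TB S.TE (D (m \<oplus>\<^bsub>M\<^esub> m'))"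
    using D_hom[OF mm] D_cont[OF mm] .
  show "(\<lambda>b. D m b \<oplus>\<^bsub>S.E\<^esub> D m' b) \<in> hom (add_monoid B) (add_monoid S.E)"
    using hom_add_maps[OF B.abelian_group_axioms S.E.M.abelian_group_axioms D_hom[OF assms(1)] D_hom[OF assms(2)]] .
  show "continuous_map TB S.TE (\<lambda>b. D m b \<oplus>\<^bsub>S.E\<^esub> D m' b)"
    using topological_abelian_groupD(3)[OF S_E_group D_cont[OF assms(1)] D_cont[OF assms(2)]] .
  show "D (m \<oplus>\<^bsub>M\<^esub> m') (a \<otimes>\<^bsub>B\<^esub> t [^]\<^bsub>B\<^esub> (n::nat)) = D m (a \<otimes>\<^bsub>B\<^esub> t [^]\<^bsub>B\<^esub> n) \<oplus>\<^bsub>S.E\<^esub> D m' (a \<otimes>\<^bsub>B\<^esub> t [^]\<^bsub>B\<^esub> n)"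
    if "a \<in> carrier A" for a n
    using assms that mm by (simp add: D_monomial qsum_add S.E.lsmult_r_distr)
qed

lemma Sce_left_maps:
  assumes "m \<in> carrier M"
  shows "(\<lambda>b. S.ce b m) \<in> hom (add_monoid B) (add_monoid S.E)" "continuous_map TB S.TE (\<lambda>b. S.ce b m)"
proof -
  show "(\<lambda>b. S.ce b m) \<in> hom (add_monoid B) (add_monoid S.E)"
    using assms by (auto simp: hom_def Sce_closed Sce_add_left)
  show "continuous_map TB S.TE (\<lambda>b. S.ce b m)" by (rule S.ce_continuous(2)[OF assms])
qed

text \<open>Leibniz' rule with one factor equal to \<open>t\<close>. Both sides are continuous in \<open>b\<close>, and on monomials this
  is the recursion for \<^const>\<open>qsum\<close>.\<close>

lemma D_mult_t:
  assumes m: "m \<in> carrier M" and b: "b \<in> carrier B"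
  shows "D m (b \<otimes>\<^bsub>B\<^esub> t) = D (t \<odot>\<^bsub>M\<^esub> m) b \<oplus>\<^bsub>S.E\<^esub> S.ce b m"
proof (rule derivative_eqI[OF _ _ _ _ _ b])
  have tm: "t \<odot>\<^bsub>M\<^esub> m \<in> carrier M" using m by simp
  show "(\<lambda>b. D m (b \<otimes>\<^bsub>B\<^esub> t)) \<in> hom (add_monoid B) (add_monoid S.E)"
    by (rule homI) (use m in \<open>simp_all add: B.l_distr D_add_left\<close>)
  show "continuous_map TB S.TE (\<lambda>b. D m (b \<otimes>\<^bsub>B\<^esub> t))"
    using continuous_map_compose[OF right_mult_maps(2)[OF t_closed] D_cont[OF m]] by (simp add: o_def)
  show "(\<lambda>b. D (t \<odot>\<^bsub>M\<^esub> m) b \<oplus>\<^bsub>S.E\<^esub> S.ce b m) \<in> hom (add_monoid B) (add_monoid S.E)"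
    using hom_add_maps[OF B.abelian_group_axioms S.E.M.abelian_group_axioms D_hom[OF tm] Sce_left_maps(1)[OF m]] .
  show "continuous_map TB S.TE (\<lambda>b. D (t \<odot>\<^bsub>M\<^esub> m) b \<oplus>\<^bsub>S.E\<^esub> S.ce b m)"
    using topological_abelian_groupD(3)[OF S_E_group D_cont[OF tm] Sce_left_maps(2)[OF m]] .
  fix a n assume a: "a \<in> carrier A"
  have "D m (a \<otimes>\<^bsub>B\<^esub> t [^]\<^bsub>B\<^esub> (n::nat) \<otimes>\<^bsub>B\<^esub> t) = a \<odot>\<^bsub>S.E\<^esub> qsum (Suc n) m"
    using D_monomial[OF m a, of "Suc n"] a by (simp add: B.m_assoc del: qsum.simps)
  also have "\<dots> = a \<odot>\<^bsub>S.E\<^esub> qsum n (t \<odot>\<^bsub>M\<^esub> m) \<oplus>\<^bsub>S.E\<^esub> a \<odot>\<^bsub>S.E\<^esub> S.ce (t [^]\<^bsub>B\<^esub> n) m"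
    using a m tm by (simp add: S.E.lsmult_r_distr Sce_closed)
  also have "\<dots> = D (t \<odot>\<^bsub>M\<^esub> m) (a \<otimes>\<^bsub>B\<^esub> t [^]\<^bsub>B\<^esub> n) \<oplus>\<^bsub>S.E\<^esub> S.ce (a \<otimes>\<^bsub>B\<^esub> t [^]\<^bsub>B\<^esub> n) m"
    using a m tm by (simp add: D_monomial Sce_smult)
  finally show "D m (a \<otimes>\<^bsub>B\<^esub> t [^]\<^bsub>B\<^esub> n \<otimes>\<^bsub>B\<^esub> t) =
      D (t \<odot>\<^bsub>M\<^esub> m) (a \<otimes>\<^bsub>B\<^esub> t [^]\<^bsub>B\<^esub> n) \<oplus>\<^bsub>S.E\<^esub> S.ce (a \<otimes>\<^bsub>B\<^esub> t [^]\<^bsub>B\<^esub> n) m" .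
qed

text \<open>\<open>D(b a) = D(b) a\<close>, since \<open>D\<close> vanishes on \<open>A\<close>. The relation \<open>t a = \<sigma>(a) t + \<delta>(a)\<close> enters
  here together with the twist in \<open>B\<^sup>\<sigma>\<close>: both sides agree for \<open>b = t\<close> because
  \<open>D(\<sigma>(a) t) = \<sigma>(a) \<otimes> 1 = 1 \<otimes> a\<close>.\<close>

lemma D_balanced:
  assumes m: "m \<in> carrier M" and b: "b \<in> carrier B" and a: "a \<in> carrier A"
  shows "D m (b \<otimes>\<^bsub>B\<^esub> a) = D (a \<odot>\<^bsub>M\<^esub> m) b"
proof (rule derivative_eqI[OF _ _ _ _ _ b])
  have aB: "a \<in> carrier B" using a by simp
  have am: "a \<odot>\<^bsub>M\<^esub> m \<in> carrier M" using m aB by (simp add: M.lsmult_closed)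
  show "(\<lambda>b. D m (b \<otimes>\<^bsub>B\<^esub> a)) \<in> hom (add_monoid B) (add_monoid S.E)"
    by (rule homI) (use m aB in \<open>simp_all add: B.l_distr D_add_left\<close>)
  show "continuous_map TB S.TE (\<lambda>b. D m (b \<otimes>\<^bsub>B\<^esub> a))"
    using continuous_map_compose[OF right_mult_maps(2)[OF aB] D_cont[OF m]] by (simp add: o_def)
  show "D (a \<odot>\<^bsub>M\<^esub> m) \<in> hom (add_monoid B) (add_monoid S.E)" "continuous_map TB S.TE (D (a \<odot>\<^bsub>M\<^esub> m))"
    using D_hom[OF am] D_cont[OF am] .
  fix c and n :: nat assume c: "c \<in> carrier A"
  have "D m (c \<otimes>\<^bsub>B\<^esub> t [^]\<^bsub>B\<^esub> n \<otimes>\<^bsub>B\<^esub> a) = c \<odot>\<^bsub>S.E\<^esub> qsum n (a \<odot>\<^bsub>M\<^esub> m)"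
    using m a
  proof (induction n arbitrary: m a)
    case 0
    have "D m (c \<otimes>\<^bsub>A\<^esub> a \<otimes>\<^bsub>B\<^esub> t [^]\<^bsub>B\<^esub> (0::nat)) = (c \<otimes>\<^bsub>A\<^esub> a) \<odot>\<^bsub>S.E\<^esub> qsum 0 m"
      by (rule D_monomial) (use 0 c in auto)
    then show ?case using 0 c by (simp add: A_mult S.E.lsmult_zero)
  next
    case (Suc n)
    note m = Suc.prems(1) and a = Suc.prems(2)
    have s: "\<sigma> a \<in> carrier A" "\<delta> a \<in> carrier A" using a by auto
    note aB = A_closed[OF a] A_closed[OF s(1)] A_closed[OF s(2)] A_closed[OF c]
    let ?u = "c \<otimes>\<^bsub>B\<^esub> t [^]\<^bsub>B\<^esub> n"
    have u: "?u \<in> carrier B" using aB by simp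
    have tm: "t \<odot>\<^bsub>M\<^esub> m \<in> carrier M" "a \<odot>\<^bsub>M\<^esub> m \<in> carrier M" "\<sigma> a \<odot>\<^bsub>M\<^esub> (t \<odot>\<^bsub>M\<^esub> m) \<in> carrier M" "\<delta> a \<odot>\<^bsub>M\<^esub> m \<in> carrier M"
      using m aB by (auto intro!: M.lsmult_closed)
    have "c \<otimes>\<^bsub>B\<^esub> t [^]\<^bsub>B\<^esub> Suc n \<otimes>\<^bsub>B\<^esub> a = ?u \<otimes>\<^bsub>B\<^esub> (t \<otimes>\<^bsub>B\<^esub> a)" using aB by (simp add: B.m_assoc)
    also have "\<dots> = ?u \<otimes>\<^bsub>B\<^esub> \<sigma> a \<otimes>\<^bsub>B\<^esub> t \<oplus>\<^bsub>B\<^esub> ?u \<otimes>\<^bsub>B\<^esub> \<delta> a"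
      unfolding t_commute[OF a] using u aB by (simp add: B.r_distr B.m_assoc)
    finally have "D m (c \<otimes>\<^bsub>B\<^esub> t [^]\<^bsub>B\<^esub> Suc n \<otimes>\<^bsub>B\<^esub> a) = D m (?u \<otimes>\<^bsub>B\<^esub> \<sigma> a \<otimes>\<^bsub>B\<^esub> t) \<oplus>\<^bsub>S.E\<^esub> D m (?u \<otimes>\<^bsub>B\<^esub> \<delta> a)"
      using m u aB by (simp add: D_add_left)
    also have "D m (?u \<otimes>\<^bsub>B\<^esub> \<sigma> a \<otimes>\<^bsub>B\<^esub> t) = D (t \<odot>\<^bsub>M\<^esub> m) (?u \<otimes>\<^bsub>B\<^esub> \<sigma> a) \<oplus>\<^bsub>S.E\<^esub> S.ce (?u \<otimes>\<^bsub>B\<^esub> \<sigma> a) m"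
      by (rule D_mult_t[OF m]) (use u aB in simp)
    also have "D (t \<odot>\<^bsub>M\<^esub> m) (?u \<otimes>\<^bsub>B\<^esub> \<sigma> a) = c \<odot>\<^bsub>S.E\<^esub> qsum n (\<sigma> a \<odot>\<^bsub>M\<^esub> (t \<odot>\<^bsub>M\<^esub> m))"
      by (rule Suc.IH[OF tm(1) s(1)])
    also have "S.ce (?u \<otimes>\<^bsub>B\<^esub> \<sigma> a) m = c \<odot>\<^bsub>S.E\<^esub> S.ce (t [^]\<^bsub>B\<^esub> n) (a \<odot>\<^bsub>M\<^esub> m)"
      using Sce_balanced[OF a u m] Sce_smult[OF aB(4) tpow_closed tm(2)] by simp
    also have "D m (?u \<otimes>\<^bsub>B\<^esub> \<delta> a) = c \<odot>\<^bsub>S.E\<^esub> qsum n (\<delta> a \<odot>\<^bsub>M\<^esub> m)"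
      by (rule Suc.IH[OF m s(2)])
    finally have "D m (c \<otimes>\<^bsub>B\<^esub> t [^]\<^bsub>B\<^esub> Suc n \<otimes>\<^bsub>B\<^esub> a) =
        c \<odot>\<^bsub>S.E\<^esub> ((qsum n (\<sigma> a \<odot>\<^bsub>M\<^esub> (t \<odot>\<^bsub>M\<^esub> m)) \<oplus>\<^bsub>S.E\<^esub> qsum n (\<delta> a \<odot>\<^bsub>M\<^esub> m)) \<oplus>\<^bsub>S.E\<^esub> S.ce (t [^]\<^bsub>B\<^esub> n) (a \<odot>\<^bsub>M\<^esub> m))"
      using aB tm by (simp add: S.E.lsmult_r_distr S.E.lsmult_closed Sce_closed S.E.M.a_ac)
    moreover have "t \<odot>\<^bsub>M\<^esub> (a \<odot>\<^bsub>M\<^esub> m) = \<sigma> a \<odot>\<^bsub>M\<^esub> (t \<odot>\<^bsub>M\<^esub> m) \<oplus>\<^bsub>M\<^esub> \<delta> a \<odot>\<^bsub>M\<^esub> m"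
      using m aB by (simp add: M.lsmult_assoc[symmetric] t_commute[OF a] M.lsmult_l_distr)
    ultimately show ?case using qsum_add[OF tm(3,4)] by simp
  qed
  then show "D m (c \<otimes>\<^bsub>B\<^esub> t [^]\<^bsub>B\<^esub> n \<otimes>\<^bsub>B\<^esub> a) = D (a \<odot>\<^bsub>M\<^esub> m) (c \<otimes>\<^bsub>B\<^esub> t [^]\<^bsub>B\<^esub> n)"
    using D_monomial[OF am c] by simp
qed

text \<open>The map \<open>(b, m) \<mapsto> D(b) m\<close> is small in \<open>m\<close> uniformly in \<open>b\<close>: if \<open>m\<close> lies in a small \<open>B\<close>-submodule, then so
  do all \<open>t\<^sup>j m\<close>. It is small in \<open>b\<close> uniformly in \<open>m\<close> because it is so for finitely many generators of a
  discrete quotient of \<open>M\<close> over \<open>A\<close>, and \<open>D(b) (a m) = D(b a) m\<close>.\<close>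

lemma retraction_exists:
  "\<exists>s. s \<in> hom (add_monoid I.E) (add_monoid S.E) \<and> continuous_map I.TE S.TE s \<and>
    (\<forall>b\<in>carrier B. \<forall>m\<in>carrier M. s (I.ce b m) = D m b)"
proof -
  obtain J where J: "complete_base B S.E S.TE J"
    by (rule pseudocompact_complete_base[OF S.ctensor_pseudocompact]) (rule that)
  note Jm = complete_base_mem[OF S_E_top J]
  have c2: "\<exists>V\<in>I.VV. \<forall>b\<in>carrier B. \<forall>m\<in>V. D m b \<in> K" if K: "K \<in> J" for K
  proof -
    have Ks: "subgroup K (add_monoid S.E)" using Jm(3)[OF K] by (simp add: open_subgroup_def)
    obtain U V where UV: "U \<in> S.UU" "V \<in> S.VV" "\<And>b m. b \<in> carrier (twisted_bimodule B \<sigma>) \<Longrightarrow> m \<in> V \<Longrightarrow> S.ce b m \<in> K"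
      by (rule S.ce_small[OF Jm(2,4)[OF K]]) (rule that)
    obtain V0 where V0: "V0 \<in> I.VV" "submodule V0 B M" "V0 \<subseteq> V"
      by (rule small_submodule[of V]) (use VV_open[OF UV(2)] in \<open>auto intro: that\<close>)
    note v = M.submoduleD_left[OF V0(2)]
    have "D m b \<in> K" if m: "m \<in> V0" and b: "b \<in> carrier B" for m b
    proof -
      have mM: "m \<in> carrier M" using v(1) m by blast
      have q: "qsum n m \<in> K" for n
      proof (rule qsum_small[OF Jm(2)[OF K] Ks])
        show "t [^]\<^bsub>B\<^esub> (j::nat) \<odot>\<^bsub>M\<^esub> m \<in> V0" for j by (rule v(4)[OF _ m]) simp
        show "S.ce b v \<in> K" if "b \<in> carrier B" "v \<in> V0" for b v
          using UV(3) V0(3) that by (auto simp: twisted_bimodule_simps)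
      qed (rule mM)
      show ?thesis
      proof (rule continuous_additive_mem_open_subgroup[OF B_group monomials_generate S_E_group Jm(3)[OF K] D_hom[OF mM] D_cont[OF mM] _ b])
        fix x assume "x \<in> {a \<otimes>\<^bsub>B\<^esub> t [^]\<^bsub>B\<^esub> (n::nat) | a n. a \<in> carrier A}"
        then obtain a n where x: "x = a \<otimes>\<^bsub>B\<^esub> t [^]\<^bsub>B\<^esub> (n::nat)" "a \<in> carrier A" by blast
        show "D m x \<in> K" unfolding x(1) D_monomial[OF mM x(2)] by (rule Jm(7)[OF K A_closed[OF x(2)] q])
      qed
    qed
    then show ?thesis using V0(1) by blast
  qed
  have c1: "\<exists>U\<in>I.UU. \<forall>b\<in>U. \<forall>m\<in>carrier M. D m b \<in> K" if K: "K \<in> J" for K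
  proof -
    obtain V where V: "V \<in> I.VV" "\<And>b m. b \<in> carrier B \<Longrightarrow> m \<in> V \<Longrightarrow> D m b \<in> K" using c2[OF K] by blast
    have VM: "V \<subseteq> carrier M" using I.N.submoduleD_left(1)[OF I.VVD(1)[OF V(1)]] .
    obtain F where F: "finite F" "F \<subseteq> carrier M" "\<And>L. submodule L A M \<Longrightarrow> F \<subseteq> L \<Longrightarrow> V \<subseteq> L \<Longrightarrow> L = carrier M"
      using M_finitely_generated[OF V(1)] by blast
    let ?O = "topspace TB \<inter> (\<Inter>x\<in>F. {b \<in> topspace TB. D x b \<in> K})"
    have "openin TB ?O"
    proof (rule openin_Int_Inter)
      show "finite ((\<lambda>x. {b \<in> topspace TB. D x b \<in> K}) ` F)" using F(1) by simp
      fix Z assume "Z \<in> (\<lambda>x. {b \<in> topspace TB. D x b \<in> K}) ` F"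
      then obtain x where x: "x \<in> F" "Z = {b \<in> topspace TB. D x b \<in> K}" by blast
      show "openin TB Z"
        unfolding x(2) by (rule openin_continuous_map_preimage[OF D_cont Jm(2)[OF K]]) (use F(2) x(1) in blast)
    qed simp
    moreover have "\<zero>\<^bsub>B\<^esub> \<in> ?O"
      using additive_hom_diff(1)[OF B.abelian_group_axioms S.E.M.abelian_group_axioms D_hom] F(2) Jm(4)[OF K]
      by (auto simp: space_TB subset_iff)
    ultimately obtain U where U: "U \<in> I.UU" "U \<subseteq> ?O" using I_small by meson
    note u = small_open[OF U(1)]
    have UB: "b \<in> carrier B" if "b \<in> U" for b using U(2) that space_TB by auto
    let ?L = "{m \<in> carrier M. \<forall>b\<in>U. D m b \<in> K}"
    have "?L = carrier M"
    proof (rule F(3))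
      show "submodule ?L A M"
      proof (rule I.N.submoduleI_left)
        show "\<zero>\<^bsub>M\<^esub> \<in> ?L" using V(2) UB VV_open[OF V(1)] by simp
        show "x \<oplus>\<^bsub>M\<^esub> y \<in> ?L" if "x \<in> ?L" "y \<in> ?L" for x y
          using that Jm(5)[OF K] UB by (simp add: D_add_right)
        show "a \<odot>\<^bsub>M\<^esub> x \<in> ?L" if a: "a \<in> carrier A" and x: "x \<in> ?L" for a x
        proof -
          have "D (a \<odot>\<^bsub>M\<^esub> x) b \<in> K" if b: "b \<in> U" for b
          proof -
            have "D x (b \<otimes>\<^bsub>B\<^esub> a) \<in> K" using x u(3)[OF b a] by blast
            then show ?thesis using D_balanced[OF _ UB[OF b] a, of x] x by simp
          qed
          then show ?thesis using a x by (simp add: M.lsmult_closed)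
        qed
      qed blast
      show "F \<subseteq> ?L" using F(2) U(2) by blast
      show "V \<subseteq> ?L" using V(2) UB VM by blast
    qed
    then show ?thesis using U(1) by blast
  qed
  obtain s where "s \<in> hom (add_monoid I.E) (add_monoid S.E)" "continuous_map I.TE S.TE s"
    "\<And>b m. b \<in> carrier (regular_bimodule B) \<Longrightarrow> m \<in> carrier M \<Longrightarrow> s (I.ce b m) = D m b"
  proof (rule I.ctensor_universal[OF S_E_top J, of "\<lambda>b m. D m b"], unfold twisted_bimodule_simps)
    show "\<And>b m. b \<in> carrier B \<Longrightarrow> m \<in> carrier M \<Longrightarrow> D m b \<in> carrier S.E" by simp
    show "\<And>b c m. b \<in> carrier B \<Longrightarrow> c \<in> carrier B \<Longrightarrow> m \<in> carrier M \<Longrightarrow> D m (b \<oplus>\<^bsub>B\<^esub> c) = D m b \<oplus>\<^bsub>S.E\<^esub> D m c"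
      by (rule D_add_left)
    show "\<And>b m n. b \<in> carrier B \<Longrightarrow> m \<in> carrier M \<Longrightarrow> n \<in> carrier M \<Longrightarrow> D (m \<oplus>\<^bsub>M\<^esub> n) b = D m b \<oplus>\<^bsub>S.E\<^esub> D n b"
      by (rule D_add_right)
    show "\<And>a b m. a \<in> carrier A \<Longrightarrow> b \<in> carrier B \<Longrightarrow> m \<in> carrier M \<Longrightarrow> D m (b \<otimes>\<^bsub>B\<^esub> a) = D (a \<odot>\<^bsub>M\<^esub> m) b"
      by (rule D_balanced)
    show "\<And>K. K \<in> J \<Longrightarrow> \<exists>U\<in>I.UU. \<forall>b\<in>U. \<forall>m\<in>carrier M. D m b \<in> K" by (rule c1)
    show "\<And>K. K \<in> J \<Longrightarrow> \<exists>V\<in>I.VV. \<forall>b\<in>carrier B. \<forall>m\<in>V. D m b \<in> K" by (rule c2)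
  qed (rule that, unfold twisted_bimodule_simps)
  then show ?thesis unfolding twisted_bimodule_simps by blast
qed

end

section \<open>Exactness\<close>

text \<open>The maps of the sequence, together with the retraction \<open>s\<close> of \<open>\<kappa>\<close> and the section
  \<open>m \<mapsto> 1 \<otimes> m\<close> of \<open>\<mu>\<close>, form a contracting homotopy. All identities are checked on the
  topological generators \<open>b \<otimes> m\<close>, the homotopy identity even for \<open>b = a t\<^sup>n\<close> only.\<close>

theorem short_exact:
  "\<exists>\<kappa> \<mu>. pseudocompact_short_exact B TB S.E S.TE \<kappa> I.E I.TE \<mu> M TM \<and>
    (\<forall>b\<in>carrier B. \<forall>m\<in>carrier M.
      \<kappa> (S.ce b m) = I.ce (b \<otimes>\<^bsub>B\<^esub> t) m \<ominus>\<^bsub>I.E\<^esub> I.ce b (t \<odot>\<^bsub>M\<^esub> m)) \<and>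
    (\<forall>b\<in>carrier B. \<forall>m\<in>carrier M. \<mu> (I.ce b m) = b \<odot>\<^bsub>M\<^esub> m)"
proof -
  obtain D where D: "\<forall>m\<in>carrier M. is_derivative m (D m)"
    by (rule derivative_exists) (rule that)
  obtain s where s: "s \<in> hom (add_monoid I.E) (add_monoid S.E)" "continuous_map I.TE S.TE s"
    "\<And>b m. b \<in> carrier B \<Longrightarrow> m \<in> carrier M \<Longrightarrow> s (I.ce b m) = D m b"
    using retraction_exists[OF D] by blast
  obtain \<kappa> where \<kappa>: "\<kappa> \<in> module_homs B S.E I.E" "continuous_map S.TE I.TE \<kappa>"
    "\<And>b m. b \<in> carrier B \<Longrightarrow> m \<in> carrier M \<Longrightarrow> \<kappa> (S.ce b m) = I.ce (b \<otimes>\<^bsub>B\<^esub> t) m \<ominus>\<^bsub>I.E\<^esub> I.ce b (t \<odot>\<^bsub>M\<^esub> m)"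
    using kappa_exists by blast
  obtain \<mu> where \<mu>: "\<mu> \<in> module_homs B I.E M" "continuous_map I.TE TM \<mu>"
    "\<And>b m. b \<in> carrier B \<Longrightarrow> m \<in> carrier M \<Longrightarrow> \<mu> (I.ce b m) = b \<odot>\<^bsub>M\<^esub> m"
    using mu_exists by blast
  note K = S.E.homD[OF \<kappa>(1)] and Mu = I.E.homD[OF \<mu>(1)] and Sh = additive_homD[OF s(1)]
  have \<kappa>h: "\<kappa> \<in> hom (add_monoid S.E) (add_monoid I.E)" and \<mu>h: "\<mu> \<in> hom (add_monoid I.E) (add_monoid M)"
    using \<kappa>(1) \<mu>(1) by (auto simp: module_homs_def)
  have HS: "Hausdorff_space S.TE" by (rule pseudocompact_complete_base[OF S.ctensor_pseudocompact])
  have HI: "Hausdorff_space I.TE" by (rule pseudocompact_complete_base[OF I.ctensor_pseudocompact])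
  have HM: "Hausdorff_space TM" by (rule pseudocompact_complete_base[OF M_pseudocompact])
  note Sgen = S.ce_generates[unfolded twisted_bimodule_simps] and Igen = I.ce_generates[unfolded twisted_bimodule_simps]
  have retraction: "s (\<kappa> x) = x" if x: "x \<in> carrier S.E" for x
  proof (rule continuous_additive_eqI[OF S_E_group Sgen S_E_group HS _ _ _ _ _ x])
    show "(\<lambda>x. s (\<kappa> x)) \<in> hom (add_monoid S.E) (add_monoid S.E)"
      using hom_compose[OF \<kappa>h s(1)] by (simp add: o_def)
    show "continuous_map S.TE S.TE (\<lambda>x. s (\<kappa> x))"
      using continuous_map_compose[OF \<kappa>(2) s(2)] by (simp add: o_def)
    show "(\<lambda>x. x) \<in> hom (add_monoid S.E) (add_monoid S.E)" by (simp add: hom_def)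
    show "continuous_map S.TE S.TE (\<lambda>x. x)" by simp
    fix y assume "y \<in> {S.ce b m | b m. b \<in> carrier B \<and> m \<in> carrier M}"
    then obtain b m where y: "y = S.ce b m" and b: "b \<in> carrier B" and m: "m \<in> carrier M" by blast
    have tm: "t \<odot>\<^bsub>M\<^esub> m \<in> carrier M" and bt: "b \<otimes>\<^bsub>B\<^esub> t \<in> carrier B" using b m by auto
    have "s (\<kappa> y) = D m (b \<otimes>\<^bsub>B\<^esub> t) \<ominus>\<^bsub>S.E\<^esub> D (t \<odot>\<^bsub>M\<^esub> m) b"
      unfolding y \<kappa>(3)[OF b m]
      using additive_hom_diff(3)[OF I.E.M.abelian_group_axioms S.E.M.abelian_group_axioms s(1)
          Ice_closed[OF bt m] Ice_closed[OF b tm]] s(3)[OF bt m] s(3)[OF b tm] by simp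
    also have "\<dots> = S.ce b m"
      unfolding D_mult_t[OF D m b] by (rule S.E.M.diff_simps(4)[OF D_closed[OF D tm b] Sce_closed[OF b m]])
    finally show "s (\<kappa> y) = y" by (simp only: y)
  qed
  have complex: "\<mu> (\<kappa> x) = \<zero>\<^bsub>M\<^esub>" if x: "x \<in> carrier S.E" for x
  proof (rule continuous_additive_eqI[OF S_E_group Sgen M_group HM _ _ _ _ _ x])
    show "(\<lambda>x. \<mu> (\<kappa> x)) \<in> hom (add_monoid S.E) (add_monoid M)"
      using hom_compose[OF \<kappa>h \<mu>h] by (simp add: o_def)
    show "continuous_map S.TE TM (\<lambda>x. \<mu> (\<kappa> x))"
      using continuous_map_compose[OF \<kappa>(2) \<mu>(2)] by (simp add: o_def)
    show "(\<lambda>x. \<zero>\<^bsub>M\<^esub>) \<in> hom (add_monoid S.E) (add_monoid M)" by (simp add: hom_def)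
    show "continuous_map S.TE TM (\<lambda>x. \<zero>\<^bsub>M\<^esub>)" by (simp add: space_TM)
    fix y assume "y \<in> {S.ce b m | b m. b \<in> carrier B \<and> m \<in> carrier M}"
    then obtain b m where y: "y = S.ce b m" and b: "b \<in> carrier B" and m: "m \<in> carrier M" by blast
    have tm: "t \<odot>\<^bsub>M\<^esub> m \<in> carrier M" and bt: "b \<otimes>\<^bsub>B\<^esub> t \<in> carrier B" using b m by auto
    have "\<mu> (\<kappa> y) = (b \<otimes>\<^bsub>B\<^esub> t) \<odot>\<^bsub>M\<^esub> m \<ominus>\<^bsub>M\<^esub> b \<odot>\<^bsub>M\<^esub> (t \<odot>\<^bsub>M\<^esub> m)"
      unfolding y \<kappa>(3)[OF b m]
      using additive_hom_diff(3)[OF I.E.M.abelian_group_axioms M.M.abelian_group_axioms \<mu>h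
          Ice_closed[OF bt m] Ice_closed[OF b tm]] \<mu>(3)[OF bt m] \<mu>(3)[OF b tm] by simp
    also have "\<dots> = \<zero>\<^bsub>M\<^esub>"
      using b m by (simp add: M.lsmult_assoc M.lsmult_closed a_minus_def M.M.r_neg)
    finally show "\<mu> (\<kappa> y) = \<zero>\<^bsub>M\<^esub>" .
  qed
  have sect: "(\<lambda>m. I.ce \<one>\<^bsub>B\<^esub> m) \<in> hom (add_monoid M) (add_monoid I.E)" "continuous_map TM I.TE (\<lambda>m. I.ce \<one>\<^bsub>B\<^esub> m)"
    by (rule I.ce_continuous(3,4)[unfolded twisted_bimodule_simps, OF B.one_closed])+
  \<comment> \<open>the sum telescopes: \<open>\<kappa>\<close> sends \<open>t\<^sup>i \<otimes> t\<^sup>j m\<close> to \<open>t\<^sup>i\<^sup>+\<^sup>1 \<otimes> t\<^sup>j m - t\<^sup>i \<otimes> t\<^sup>j\<^sup>+\<^sup>1 m\<close>\<close>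
  have base: "\<kappa> (qsum n m) \<oplus>\<^bsub>I.E\<^esub> I.ce \<one>\<^bsub>B\<^esub> (t [^]\<^bsub>B\<^esub> n \<odot>\<^bsub>M\<^esub> m) = I.ce (t [^]\<^bsub>B\<^esub> n) m" if "m \<in> carrier M" for n m
    using that
  proof (induction n arbitrary: m)
    case 0
    then show ?case
      using additive_hom_diff(1)[OF S.E.M.abelian_group_axioms I.E.M.abelian_group_axioms \<kappa>h]
      by (simp add: M.lsmult_one Ice_closed)
  next
    case (Suc n)
    note m = Suc.prems
    have tm: "t \<odot>\<^bsub>M\<^esub> m \<in> carrier M" using m by simp
    let ?p = "t [^]\<^bsub>B\<^esub> n"
    have p: "?p \<in> carrier B" "?p \<otimes>\<^bsub>B\<^esub> t \<in> carrier B" by simp_all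
    have car: "\<kappa> (qsum n (t \<odot>\<^bsub>M\<^esub> m)) \<in> carrier I.E" "I.ce \<one>\<^bsub>B\<^esub> (?p \<odot>\<^bsub>M\<^esub> (t \<odot>\<^bsub>M\<^esub> m)) \<in> carrier I.E"
      "I.ce (?p \<otimes>\<^bsub>B\<^esub> t) m \<in> carrier I.E" "I.ce ?p (t \<odot>\<^bsub>M\<^esub> m) \<in> carrier I.E"
      using K(1) tm p m by (simp_all add: Ice_closed M.lsmult_closed)
    have "\<kappa> (qsum (Suc n) m) = \<kappa> (qsum n (t \<odot>\<^bsub>M\<^esub> m)) \<oplus>\<^bsub>I.E\<^esub> (I.ce (?p \<otimes>\<^bsub>B\<^esub> t) m \<ominus>\<^bsub>I.E\<^esub> I.ce ?p (t \<odot>\<^bsub>M\<^esub> m))"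
      using K(2)[OF qsum_closed[OF tm, of n] Sce_closed[OF p(1) m]] \<kappa>(3)[OF p(1) m] by simp
    then have "\<kappa> (qsum (Suc n) m) \<oplus>\<^bsub>I.E\<^esub> I.ce \<one>\<^bsub>B\<^esub> (t [^]\<^bsub>B\<^esub> Suc n \<odot>\<^bsub>M\<^esub> m) =
        (\<kappa> (qsum n (t \<odot>\<^bsub>M\<^esub> m)) \<oplus>\<^bsub>I.E\<^esub> I.ce \<one>\<^bsub>B\<^esub> (?p \<odot>\<^bsub>M\<^esub> (t \<odot>\<^bsub>M\<^esub> m))) \<oplus>\<^bsub>I.E\<^esub>
          (I.ce (?p \<otimes>\<^bsub>B\<^esub> t) m \<ominus>\<^bsub>I.E\<^esub> I.ce ?p (t \<odot>\<^bsub>M\<^esub> m))"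
      unfolding t_pow_smult[OF m] using car by (simp add: I.E.M.a_ac)
    also have "\<dots> = I.ce ?p (t \<odot>\<^bsub>M\<^esub> m) \<oplus>\<^bsub>I.E\<^esub> (I.ce (?p \<otimes>\<^bsub>B\<^esub> t) m \<ominus>\<^bsub>I.E\<^esub> I.ce ?p (t \<odot>\<^bsub>M\<^esub> m))"
      unfolding Suc.IH[OF tm] ..
    also have "\<dots> = I.ce (?p \<otimes>\<^bsub>B\<^esub> t) m" by (rule I.E.M.diff_simps(5)[OF car(4,3)])
    finally show ?case by simp
  qed
  have homotopy: "\<kappa> (s x) \<oplus>\<^bsub>I.E\<^esub> I.ce \<one>\<^bsub>B\<^esub> (\<mu> x) = x" if x: "x \<in> carrier I.E" for x
  proof (rule continuous_additive_eqI[OF I.E_group Igen I.E_group HI _ _ _ _ _ x])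
    have 1: "(\<lambda>x. \<kappa> (s x)) \<in> hom (add_monoid I.E) (add_monoid I.E)" "(\<lambda>x. I.ce \<one>\<^bsub>B\<^esub> (\<mu> x)) \<in> hom (add_monoid I.E) (add_monoid I.E)"
      using hom_compose[OF s(1) \<kappa>h] hom_compose[OF \<mu>h sect(1)] by (simp_all add: o_def)
    have 2: "continuous_map I.TE I.TE (\<lambda>x. \<kappa> (s x))" "continuous_map I.TE I.TE (\<lambda>x. I.ce \<one>\<^bsub>B\<^esub> (\<mu> x))"
      using continuous_map_compose[OF s(2) \<kappa>(2)] continuous_map_compose[OF \<mu>(2) sect(2)] by (simp_all add: o_def)
    show "(\<lambda>x. \<kappa> (s x) \<oplus>\<^bsub>I.E\<^esub> I.ce \<one>\<^bsub>B\<^esub> (\<mu> x)) \<in> hom (add_monoid I.E) (add_monoid I.E)"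
      by (rule hom_add_maps[OF I.E.M.abelian_group_axioms I.E.M.abelian_group_axioms 1])
    show "continuous_map I.TE I.TE (\<lambda>x. \<kappa> (s x) \<oplus>\<^bsub>I.E\<^esub> I.ce \<one>\<^bsub>B\<^esub> (\<mu> x))"
      by (rule topological_abelian_groupD(3)[OF I.E_group 2])
    show "(\<lambda>x. x) \<in> hom (add_monoid I.E) (add_monoid I.E)" by (simp add: hom_def)
    show "continuous_map I.TE I.TE (\<lambda>x. x)" by simp
    fix y assume "y \<in> {I.ce b m | b m. b \<in> carrier B \<and> m \<in> carrier M}"
    then obtain b m where y: "y = I.ce b m" and b: "b \<in> carrier B" and m: "m \<in> carrier M" by blast
    have "\<kappa> (D m b) \<oplus>\<^bsub>I.E\<^esub> I.ce \<one>\<^bsub>B\<^esub> (b \<odot>\<^bsub>M\<^esub> m) = I.ce b m"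
    proof (rule continuous_additive_eqI[OF B_group monomials_generate I.E_group HI _ _ _ _ _ b])
      have 1: "(\<lambda>b. \<kappa> (D m b)) \<in> hom (add_monoid B) (add_monoid I.E)"
        "(\<lambda>b. I.ce \<one>\<^bsub>B\<^esub> (b \<odot>\<^bsub>M\<^esub> m)) \<in> hom (add_monoid B) (add_monoid I.E)"
        using hom_compose[OF D_hom[OF D m] \<kappa>h] hom_compose[OF smult_left_hom[OF m] sect(1)] by (simp_all add: o_def)
      have 2: "continuous_map TB I.TE (\<lambda>b. \<kappa> (D m b))" "continuous_map TB I.TE (\<lambda>b. I.ce \<one>\<^bsub>B\<^esub> (b \<odot>\<^bsub>M\<^esub> m))"
        using continuous_map_compose[OF D_cont[OF D m] \<kappa>(2)]
          continuous_map_compose[OF smult_left_cont[OF m] sect(2)] by (simp_all add: o_def)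
      show "(\<lambda>b. \<kappa> (D m b) \<oplus>\<^bsub>I.E\<^esub> I.ce \<one>\<^bsub>B\<^esub> (b \<odot>\<^bsub>M\<^esub> m)) \<in> hom (add_monoid B) (add_monoid I.E)"
        by (rule hom_add_maps[OF B.abelian_group_axioms I.E.M.abelian_group_axioms 1])
      show "continuous_map TB I.TE (\<lambda>b. \<kappa> (D m b) \<oplus>\<^bsub>I.E\<^esub> I.ce \<one>\<^bsub>B\<^esub> (b \<odot>\<^bsub>M\<^esub> m))"
        by (rule topological_abelian_groupD(3)[OF I.E_group 2])
      show "(\<lambda>b. I.ce b m) \<in> hom (add_monoid B) (add_monoid I.E)"
        using m by (auto simp: hom_def Ice_closed Ice_add_left)
      show "continuous_map TB I.TE (\<lambda>b. I.ce b m)" by (rule I.ce_continuous(2)[OF m])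
      fix c assume "c \<in> {a \<otimes>\<^bsub>B\<^esub> t [^]\<^bsub>B\<^esub> (n::nat) | a n. a \<in> carrier A}"
      then obtain a n where c: "c = a \<otimes>\<^bsub>B\<^esub> t [^]\<^bsub>B\<^esub> (n::nat)" and a: "a \<in> carrier A" by blast
      have aB: "a \<in> carrier B" using a by simp
      let ?p = "t [^]\<^bsub>B\<^esub> n"
      have pm: "?p \<odot>\<^bsub>M\<^esub> m \<in> carrier M" using m by (simp add: M.lsmult_closed)
      have "I.ce \<one>\<^bsub>B\<^esub> (c \<odot>\<^bsub>M\<^esub> m) = I.ce \<one>\<^bsub>B\<^esub> (a \<odot>\<^bsub>M\<^esub> (?p \<odot>\<^bsub>M\<^esub> m))"
        unfolding c using aB m by (simp add: M.lsmult_assoc)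
      also have "\<dots> = I.ce a (?p \<odot>\<^bsub>M\<^esub> m)"
        using Ice_balanced[OF a B.one_closed pm] aB by simp
      also have "\<dots> = a \<odot>\<^bsub>I.E\<^esub> I.ce \<one>\<^bsub>B\<^esub> (?p \<odot>\<^bsub>M\<^esub> m)" using Ice_smult[OF aB B.one_closed pm] aB by simp
      finally have 3: "I.ce \<one>\<^bsub>B\<^esub> (c \<odot>\<^bsub>M\<^esub> m) = a \<odot>\<^bsub>I.E\<^esub> I.ce \<one>\<^bsub>B\<^esub> (?p \<odot>\<^bsub>M\<^esub> m)" .
      have 4: "\<kappa> (D m c) = a \<odot>\<^bsub>I.E\<^esub> \<kappa> (qsum n m)"
        unfolding c D_monomial[OF D m a] by (rule K(3)[OF aB qsum_closed[OF m]])
      show "\<kappa> (D m c) \<oplus>\<^bsub>I.E\<^esub> I.ce \<one>\<^bsub>B\<^esub> (c \<odot>\<^bsub>M\<^esub> m) = I.ce c m"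
        unfolding 3 4 using I.E.lsmult_r_distr[OF aB K(1)[OF qsum_closed[OF m, of n]] Ice_closed[OF B.one_closed pm]]
          base[OF m, of n] Ice_smult[OF aB tpow_closed m, of n] by (simp add: c)
    qed
    then show "\<kappa> (s y) \<oplus>\<^bsub>I.E\<^esub> I.ce \<one>\<^bsub>B\<^esub> (\<mu> y) = y" unfolding y s(3)[OF b m] \<mu>(3)[OF b m] .
  qed
  have "pseudocompact_short_exact B TB S.E S.TE \<kappa> I.E I.TE \<mu> M TM"
    unfolding pseudocompact_short_exact_def
  proof (intro conjI S.ctensor_pseudocompact I.ctensor_pseudocompact M_pseudocompact \<kappa>(1,2) \<mu>(1,2))
    show "inj_on \<kappa> (carrier S.E)" by (rule inj_on_inverseI[of _ s]) (rule retraction)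
    show "\<kappa> ` carrier S.E = a_kernel I.E M \<mu>"
    proof (intro subset_antisym subsetI)
      fix y assume "y \<in> \<kappa> ` carrier S.E"
      then show "y \<in> a_kernel I.E M \<mu>" using K(1) complex by (auto simp: a_kernel_def kernel_def)
    next
      fix y assume "y \<in> a_kernel I.E M \<mu>"
      then have y: "y \<in> carrier I.E" "\<mu> y = \<zero>\<^bsub>M\<^esub>" by (simp_all add: a_kernel_def kernel_def)
      have "I.ce \<one>\<^bsub>B\<^esub> \<zero>\<^bsub>M\<^esub> = \<zero>\<^bsub>I.E\<^esub>"
        by (rule additive_hom_diff(1)[OF M.M.abelian_group_axioms I.E.M.abelian_group_axioms sect(1)])
      then have "\<kappa> (s y) = y" using homotopy[OF y(1)] y K(1)[OF Sh(1)[OF y(1)]] by simp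
      then show "y \<in> \<kappa> ` carrier S.E" using Sh(1)[OF y(1)] by (metis imageI)
    qed
    show "\<mu> ` carrier I.E = carrier M"
    proof (intro subset_antisym subsetI)
      fix m assume m: "m \<in> carrier M"
      have "\<mu> (I.ce \<one>\<^bsub>B\<^esub> m) = m" using \<mu>(3)[OF B.one_closed m] m by (simp add: M.lsmult_one)
      then show "m \<in> \<mu> ` carrier I.E" using Ice_closed[OF B.one_closed m] by (metis imageI)
    qed (use Mu(1) in blast)
  qed
  then show ?thesis using \<kappa>(3) \<mu>(3) by (intro exI[of _ \<kappa>] exI[of _ \<mu>] conjI ballI)
qed

end

theorem proposition2p4:
  fixes A B :: "'b ring" and TA TB :: "'b topology"
    and \<sigma> \<delta> :: "'b \<Rightarrow> 'b" and t :: 'b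
    and M :: "('b, 'm) module" and TM :: "'m topology"
  assumes "skew_power_series_ring A TA \<sigma> \<delta> B TB t"
    and "pseudocompact B TB M TM"
  shows "\<exists>\<kappa> \<mu>.
    pseudocompact_short_exact B TB
      (ctensor A (twisted_bimodule B \<sigma>) TB M TM)
      (ctensor_top A (right_module (twisted_bimodule B \<sigma>)) TB M TM)
      \<kappa>
      (ctensor A (regular_bimodule B) TB M TM)
      (ctensor_top A (right_module (regular_bimodule B)) TB M TM)
      \<mu>
      M TM \<and>
    (\<forall>b\<in>carrier B. \<forall>m\<in>carrier M.
      \<kappa> (ctensor_elem A (right_module (twisted_bimodule B \<sigma>)) TB M TM b m) =
        ctensor_elem A (right_module (regular_bimodule B)) TB M TM (b \<otimes>\<^bsub>B\<^esub> t) m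
        \<ominus>\<^bsub>ctensor A (regular_bimodule B) TB M TM\<^esub>
        ctensor_elem A (right_module (regular_bimodule B)) TB M TM b (t \<odot>\<^bsub>M\<^esub> m)) \<and>
    (\<forall>b\<in>carrier B. \<forall>m\<in>carrier M.
      \<mu> (ctensor_elem A (right_module (regular_bimodule B)) TB M TM b m) = b \<odot>\<^bsub>M\<^esub> m)"
proof -
  interpret skew_power_series_module A B TA TB \<sigma> \<delta> t M TM
    using assms by (intro skew_power_series_module.intro skew_power_series.intro skew_power_series_module_axioms.intro)
  show ?thesis by (rule short_exact)
qed

end
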